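(* Let $M$ be a compact connected complex manifold of complex dimension $n\geq 2$ with a Hermitian metric $\omega_0$, and let $(E,h)$ be a Hermitian holomorphic vector bundle over $M$. Let $K$ be the mean curvature form of $(E,h)$ with respect to $\omega_0$, and for $x\in M$ let $\gamma(x)$ be the greatest eigenvalue of $K$ at $x$ (with respect to $h$). If $\omega_0$ is Gauduchon, the function $\gamma$ is smooth, and $$\int_M\gamma\,\omega_0^n<0,$$ then $E$ admits no nontrivial holomorphic sections.
   Context: A Hermitian metric on $M$ is identified with its associated positive $(1,1)$-form, $\omega_0=\sqrt{-1}\,g_{i\bar j}\,dz^i\wedge d\bar z^j$ (summation convention), $(g^{i\bar j})=(g_{i\bar j})^{-1}$. It is Gauduchon if $\partial\bar\partial\omega_0^{n-1}=0$. Let $\nabla$ be the Chern connection of $(E,h)$ and $R=\nabla^2$ its curvature; in a local frame $\{s_1,\dots,s_r\}$ of $E$ (with dual frame $\{s_\alpha^*\}$) write $R=R^{\beta}_{i\bar j\alpha}\,dz^i\wedge d\bar z^j\otimes s_\alpha^*\otimes s_\beta$ and $h_{\alpha\bar\beta}=h(s_\alpha,s_\beta)$. The mean curvature form of $(E,h)$ with respect to $\omega_0$ is the Hermitian form $K(\xi,\eta)=K_{\alpha\bar\beta}\xi^\alpha\overline{\eta^\beta}$ on $E$, where $$K_{\alpha\bar\beta}=h_{\gamma\bar\beta}\,g^{i\bar j}R^{\gamma}_{i\bar j\alpha};$$ it is independent of the choice of local frame and coordinates. Its eigenvalues at $x$ are taken with respect to $h$, i.e. they are the eigenvalues of the matrix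 $(K_{\alpha\bar\beta})$ relative to $(h_{\alpha\bar\beta})$ (equivalently, of $(K_{\alpha\bar\beta})$ in an $h$-unitary frame). The function $\gamma$ is always continuous but need not be smooth in general. *)

theory Defs
  imports "HOL-Analysis.Analysis"
begin

section \<open>Functions of several complex variables\<close>

text \<open>All predicates below that mention a set \<open>S\<close> are meant for open \<open>S\<close>.\<close>

primrec Ck_on :: "nat \<Rightarrow> 'a::real_normed_vector set \<Rightarrow> ('a \<Rightarrow> 'b::real_normed_vector) \<Rightarrow> bool" where
  "Ck_on 0 S f \<longleftrightarrow> continuous_on S f"
| "Ck_on (Suc k) S f \<longleftrightarrow> (\<forall>z\<in>S. f differentiable (at z)) \<and>
     (\<forall>v. Ck_on k S (\<lambda>z. frechet_derivative f (at z) v))"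

definition smooth_on :: "'a::real_normed_vector set \<Rightarrow> ('a \<Rightarrow> 'b::real_normed_vector) \<Rightarrow> bool" where
  "smooth_on S f \<longleftrightarrow> (\<forall>k. Ck_on k S f)"

definition holo_on :: "(complex^'n) set \<Rightarrow> (complex^'n \<Rightarrow> complex) \<Rightarrow> bool" where
  "holo_on S f \<longleftrightarrow>
     (\<forall>z\<in>S. \<exists>D. (f has_derivative D) (at z) \<and> (\<forall>c v. D (c *s v) = c * D v))"

text \<open>The Wirtinger derivatives \<open>\<partial>/\<partial>z\<^sup>i = (\<partial>/\<partial>x\<^sup>i - \<i> \<partial>/\<partial>y\<^sup>i)/2\<close> and
  \<open>\<partial>/\<partial>\<bar>z\<^sup>i = (\<partial>/\<partial>x\<^sup>i + \<i> \<partial>/\<partial>y\<^sup>i)/2\<close>.\<close>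

definition dz :: "'n::finite \<Rightarrow> (complex^'n \<Rightarrow> complex) \<Rightarrow> complex^'n \<Rightarrow> complex" where
  "dz i f z = (frechet_derivative f (at z) (axis i 1)
               - \<i> * frechet_derivative f (at z) (axis i \<i>)) / 2"

definition dzbar :: "'n::finite \<Rightarrow> (complex^'n \<Rightarrow> complex) \<Rightarrow> complex^'n \<Rightarrow> complex" where
  "dzbar i f z = (frechet_derivative f (at z) (axis i 1)
                  + \<i> * frechet_derivative f (at z) (axis i \<i>)) / 2"


section \<open>Complex differential forms in coordinates\<close>

text \<open>The index \<open>Inl i\<close> stands for \<open>dz\<^sup>i\<close> and \<open>Inr i\<close> for \<open>d\<bar>z\<^sup>i\<close>. A form (possibly of mixed
  degree) maps a point \<open>z\<close> and a set \<open>S\<close> of indices to the coefficient at \<open>z\<close> of the product of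
  the generators in \<open>S\<close>, taken in the order \<open>dz\<^sup>1, \<dots>, dz\<^sup>n, d\<bar>z\<^sup>1, \<dots>, d\<bar>z\<^sup>n\<close>.\<close>

type_synonym 'n form = "complex^'n \<Rightarrow> ('n + 'n) set \<Rightarrow> complex"

fun gen_less :: "'n::linorder + 'n \<Rightarrow> 'n + 'n \<Rightarrow> bool" where
  "gen_less (Inl i) (Inl j) \<longleftrightarrow> i < j"
| "gen_less (Inl i) (Inr j) \<longleftrightarrow> True"
| "gen_less (Inr i) (Inl j) \<longleftrightarrow> False"
| "gen_less (Inr i) (Inr j) \<longleftrightarrow> i < j"

text \<open>The sign that sorts the product of the generators in \<open>S\<close> followed by those in \<open>T\<close>.\<close>

definition shuffle_sign :: "('n::linorder + 'n) set \<Rightarrow> ('n + 'n) set \<Rightarrow> complex" where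
  "shuffle_sign S T = (-1) ^ card {(a, b). a \<in> S \<and> b \<in> T \<and> gen_less b a}"

definition wedge :: "'n::{finite,linorder} form \<Rightarrow> 'n form \<Rightarrow> 'n form" where
  "wedge \<alpha> \<beta> = (\<lambda>z S. \<Sum>T\<in>Pow S. shuffle_sign T (S - T) * \<alpha> z T * \<beta> z (S - T))"

definition zero_form :: "(complex^'n \<Rightarrow> complex) \<Rightarrow> 'n form" where
  "zero_form f = (\<lambda>z S. if S = {} then f z else 0)"

definition gen :: "'n + 'n \<Rightarrow> 'n form" where
  "gen a = (\<lambda>z S. if S = {a} then 1 else 0)"

primrec wedge_pow :: "'n::{finite,linorder} form \<Rightarrow> nat \<Rightarrow> 'n form" where
  "wedge_pow \<alpha> 0 = zero_form (\<lambda>z. 1)"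
| "wedge_pow \<alpha> (Suc k) = wedge \<alpha> (wedge_pow \<alpha> k)"

definition del :: "'n::{finite,linorder} form \<Rightarrow> 'n form" where
  "del \<alpha> = (\<lambda>z S. \<Sum>i\<in>UNIV. wedge (gen (Inl i)) (\<lambda>z T. dz i (\<lambda>w. \<alpha> w T) z) z S)"

definition delbar :: "'n::{finite,linorder} form \<Rightarrow> 'n form" where
  "delbar \<alpha> = (\<lambda>z S. \<Sum>i\<in>UNIV. wedge (gen (Inr i)) (\<lambda>z T. dzbar i (\<lambda>w. \<alpha> w T) z) z S)"

definition ext_d :: "'n::{finite,linorder} form \<Rightarrow> 'n form" where
  "ext_d \<alpha> = (\<lambda>z S. del \<alpha> z S + delbar \<alpha> z S)"

text \<open>Complex conjugation of a 1-form; in higher degree a sign would be missing.\<close>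

definition conj_1form :: "'n form \<Rightarrow> 'n form" where
  "conj_1form \<alpha> = (\<lambda>z S. cnj (\<alpha> z (case_sum Inr Inl ` S)))"

text \<open>The coefficient of a form of top degree with respect to
  \<open>dx\<^sup>1 \<and> dy\<^sup>1 \<and> \<dots> \<and> dx\<^sup>n \<and> dy\<^sup>n\<close>, which is the complex orientation: sorting
  \<open>dz\<^sup>1 \<and> d\<bar>z\<^sup>1 \<and> \<dots> \<and> dz\<^sup>n \<and> d\<bar>z\<^sup>n\<close> costs the sign \<open>(-1)\<^bsup>n(n-1)/2\<^esup>\<close>, and
  \<open>dz \<and> d\<bar>z = -2\<i> dx \<and> dy\<close>.\<close>

definition top_density :: "'n::finite form \<Rightarrow> complex^'n \<Rightarrow> complex" where
  "top_density \<eta> z =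
     (-1) ^ (CARD('n) * (CARD('n) - 1) div 2) * (- 2 * \<i>) ^ CARD('n) * \<eta> z UNIV"


section \<open>Complex manifolds\<close>

text \<open>The manifold is the whole type \<open>'m\<close>. A chart is a pair of a domain and a map that matters
  only on this domain.\<close>

type_synonym ('m, 'n) chart = "'m set \<times> ('m \<Rightarrow> complex^'n)"

definition chart_inv :: "('m, 'n) chart \<Rightarrow> complex^'n \<Rightarrow> 'm" where
  "chart_inv c = inv_into (fst c) (snd c)"

definition complex_atlas :: "('m::topological_space, 'n::finite) chart set \<Rightarrow> bool" where
  "complex_atlas A \<longleftrightarrow>
     \<Union> (fst ` A) = UNIV \<and>
     (\<forall>c\<in>A. open (fst c) \<and> open (snd c ` fst c) \<and>
        homeomorphism (fst c) (snd c ` fst c) (snd c) (chart_inv c)) \<and>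
     (\<forall>c\<in>A. \<forall>c'\<in>A. \<forall>i.
        holo_on (snd c ` (fst c \<inter> fst c')) (\<lambda>z. snd c' (chart_inv c z) $ i))"

definition compact_connected_complex_manifold ::
    "('m::t2_space, 'n::finite) chart set \<Rightarrow> bool" where
  "compact_connected_complex_manifold A \<longleftrightarrow>
     complex_atlas A \<and> compact (UNIV :: 'm set) \<and> connected (UNIV :: 'm set)"

definition mfd_smooth ::
    "('m, 'n::finite) chart set \<Rightarrow> ('m \<Rightarrow> 'b::real_normed_vector) \<Rightarrow> bool" where
  "mfd_smooth A f \<longleftrightarrow> (\<forall>c\<in>A. smooth_on (snd c ` fst c) (\<lambda>z. f (chart_inv c z)))"

definition mfd_holo_on ::
    "('m, 'n::finite) chart set \<Rightarrow> 'm set \<Rightarrow> ('m \<Rightarrow> complex) \<Rightarrow> bool" where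
  "mfd_holo_on A V f \<longleftrightarrow> (\<forall>c\<in>A. holo_on (snd c ` (fst c \<inter> V)) (\<lambda>z. f (chart_inv c z)))"


subsection \<open>Integration of top-degree forms\<close>

text \<open>A form on the manifold is the family of its expressions in the charts of the atlas. Its
  integral is defined by a finite smooth partition of unity subordinate to the atlas; on a compact
  manifold one exists, and the integral does not depend on it.\<close>

definition partition_of_unity ::
    "('m::topological_space, 'n::finite) chart set \<Rightarrow> ('m, 'n) chart set
     \<Rightarrow> (('m, 'n) chart \<Rightarrow> 'm \<Rightarrow> real) \<Rightarrow> bool" where
  "partition_of_unity A I \<rho> \<longleftrightarrow>
     finite I \<and> I \<subseteq> A \<and>
     (\<forall>c\<in>I. mfd_smooth A (\<rho> c) \<and> (\<forall>x. 0 \<le> \<rho> c x) \<and> closure {x. \<rho> c x \<noteq> 0} \<subseteq> fst c) \<and>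
     (\<forall>x. (\<Sum>c\<in>I. \<rho> c x) = 1)"

definition form_integral ::
    "('m::topological_space, 'n::finite) chart set \<Rightarrow> (('m, 'n) chart \<Rightarrow> 'n form) \<Rightarrow> complex" where
  "form_integral A \<eta> =
     (let (I, \<rho>) = (SOME (I, \<rho>). partition_of_unity A I \<rho>) in
       \<Sum>c\<in>I. LINT z : snd c ` fst c | lborel.
         complex_of_real (\<rho> c (chart_inv c z)) * top_density (\<eta> c) z)"


subsection \<open>Hermitian metrics\<close>

text \<open>\<open>g c z $ i $ j\<close> is the component \<open>g\<^bsub>i\<bar>j\<^esub>\<close> in the chart \<open>c\<close> at the point with coordinates \<open>z\<close>.\<close>

type_synonym ('m, 'n) metric_tensor = "('m, 'n) chart \<Rightarrow> complex^'n \<Rightarrow> complex^'n^'n"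

definition hermitian_metric ::
    "('m, 'n::finite) chart set \<Rightarrow> ('m, 'n) metric_tensor \<Rightarrow> bool" where
  "hermitian_metric A g \<longleftrightarrow>
     (\<forall>c\<in>A. \<forall>i j. smooth_on (snd c ` fst c) (\<lambda>z. g c z $ i $ j)) \<and>
     (\<forall>c\<in>A. \<forall>z\<in>snd c ` fst c.
        (\<forall>i j. g c z $ j $ i = cnj (g c z $ i $ j)) \<and>
        (\<forall>v. v \<noteq> 0 \<longrightarrow> 0 < Re (\<Sum>i\<in>UNIV. \<Sum>j\<in>UNIV. g c z $ i $ j * v $ i * cnj (v $ j)))) \<and>
     (\<forall>c\<in>A. \<forall>c'\<in>A. \<forall>x\<in>fst c \<inter> fst c'. \<forall>i j.
        g c (snd c x) $ i $ j =
          (\<Sum>k\<in>UNIV. \<Sum>l\<in>UNIV. g c' (snd c' x) $ k $ l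
             * dz i (\<lambda>z. snd c' (chart_inv c z) $ k) (snd c x)
             * cnj (dz j (\<lambda>z. snd c' (chart_inv c z) $ l) (snd c x))))"

definition metric_form ::
    "('m, 'n::{finite,linorder}) metric_tensor \<Rightarrow> ('m, 'n) chart \<Rightarrow> 'n form" where
  "metric_form g c = (\<lambda>z S. \<Sum>i\<in>UNIV. \<Sum>j\<in>UNIV.
     \<i> * g c z $ i $ j * wedge (gen (Inl i)) (gen (Inr j)) z S)"

definition gauduchon ::
    "('m, 'n::{finite,linorder}) chart set
     \<Rightarrow> ('m, 'n) metric_tensor \<Rightarrow> bool" where
  "gauduchon A g \<longleftrightarrow>
     (\<forall>c\<in>A. \<forall>z\<in>snd c ` fst c. \<forall>S.
        del (delbar (wedge_pow (metric_form g c) (CARD('n) - 1))) z S = 0)"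


section \<open>Hermitian holomorphic vector bundles\<close>

text \<open>The total space is the whole type \<open>'e\<close>. A local trivialization is a pair \<open>(V, \<tau>)\<close>, where \<open>\<tau>\<close>
  maps each fibre over the open set \<open>V\<close> isomorphically to \<open>\<complex>\<^sup>r\<close>; the topology and the complex
  structure of the total space are those induced by the trivializations.\<close>

record ('m, 'e, 'r::finite) vector_bundle =
  bproj :: "'e \<Rightarrow> 'm"
  badd :: "'e \<Rightarrow> 'e \<Rightarrow> 'e"
  bscale :: "complex \<Rightarrow> 'e \<Rightarrow> 'e"
  triv :: "('m set \<times> ('e \<Rightarrow> complex^'r)) set"

definition fibre :: "('m, 'e, 'r::finite) vector_bundle \<Rightarrow> 'm \<Rightarrow> 'e set" where
  "fibre E x = {e. bproj E e = x}"

definition bzero :: "('m, 'e, 'r::finite) vector_bundle \<Rightarrow> 'm \<Rightarrow> 'e" where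
  "bzero E x = (THE e. e \<in> fibre E x \<and> badd E e e = e)"

text \<open>The local frame \<open>s\<^sub>\<alpha>\<close> that belongs to a trivialization.\<close>

definition frame ::
    "('m, 'e, 'r::finite) vector_bundle \<Rightarrow> 'm set \<times> ('e \<Rightarrow> complex^'r) \<Rightarrow> 'r \<Rightarrow> 'm \<Rightarrow> 'e" where
  "frame E t \<alpha> x = (THE e. e \<in> fibre E x \<and> snd t e = axis \<alpha> 1)"

definition holomorphic_bundle ::
    "('m::topological_space, 'n::finite) chart set \<Rightarrow> ('m, 'e, 'r::finite) vector_bundle \<Rightarrow> bool" where
  "holomorphic_bundle A E \<longleftrightarrow>
     (\<forall>x. \<forall>e\<in>fibre E x. \<forall>c. bscale E c e \<in> fibre E x \<and> (\<forall>e'\<in>fibre E x. badd E e e' \<in> fibre E x)) \<and>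
     \<Union> (fst ` triv E) = UNIV \<and>
     (\<forall>t\<in>triv E. open (fst t) \<and> (\<forall>x\<in>fst t.
        bij_betw (snd t) (fibre E x) UNIV \<and>
        (\<forall>e\<in>fibre E x. \<forall>c. snd t (bscale E c e) = c *s snd t e) \<and>
        (\<forall>e\<in>fibre E x. \<forall>e'\<in>fibre E x. snd t (badd E e e') = snd t e + snd t e'))) \<and>
     (\<forall>t\<in>triv E. \<forall>t'\<in>triv E. \<forall>\<alpha> \<beta>.
        mfd_holo_on A (fst t \<inter> fst t') (\<lambda>x. snd t' (frame E t \<alpha> x) $ \<beta>))"

definition holomorphic_section ::
    "('m, 'n::finite) chart set \<Rightarrow> ('m, 'e, 'r::finite) vector_bundle \<Rightarrow> ('m \<Rightarrow> 'e) \<Rightarrow> bool" where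
  "holomorphic_section A E s \<longleftrightarrow>
     (\<forall>x. s x \<in> fibre E x) \<and>
     (\<forall>t\<in>triv E. \<forall>\<alpha>. mfd_holo_on A (fst t) (\<lambda>x. snd t (s x) $ \<alpha>))"

text \<open>The set of coordinates of the points common to a chart and a trivialization.\<close>

definition common_domain ::
    "('m, 'n) chart \<Rightarrow> 'm set \<times> ('e \<Rightarrow> complex^'r) \<Rightarrow> (complex^'n) set" where
  "common_domain c t = snd c ` (fst c \<inter> fst t)"

text \<open>\<open>h\<^bsub>\<alpha>\<bar>\<beta>\<^esub> = h(s\<^sub>\<alpha>, s\<^sub>\<beta>)\<close> as a function of the coordinates.\<close>

definition h_coeff ::
    "('m, 'e, 'r::finite) vector_bundle \<Rightarrow> ('e \<Rightarrow> 'e \<Rightarrow> complex) \<Rightarrow> ('m, 'n) chart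
     \<Rightarrow> 'm set \<times> ('e \<Rightarrow> complex^'r) \<Rightarrow> 'r \<Rightarrow> 'r \<Rightarrow> complex^'n \<Rightarrow> complex" where
  "h_coeff E h c t \<alpha> \<beta> z = h (frame E t \<alpha> (chart_inv c z)) (frame E t \<beta> (chart_inv c z))"

definition bundle_metric ::
    "('m, 'n::finite) chart set \<Rightarrow> ('m, 'e, 'r::finite) vector_bundle \<Rightarrow> ('e \<Rightarrow> 'e \<Rightarrow> complex) \<Rightarrow> bool" where
  "bundle_metric A E h \<longleftrightarrow>
     (\<forall>x. \<forall>e\<in>fibre E x. \<forall>e'\<in>fibre E x.
        (\<forall>e''\<in>fibre E x. h (badd E e e') e'' = h e e'' + h e' e'') \<and>
        (\<forall>c. h (bscale E c e) e' = c * h e e') \<and>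
        h e' e = cnj (h e e') \<and>
        (e \<noteq> bzero E x \<longrightarrow> 0 < Re (h e e))) \<and>
     (\<forall>c\<in>A. \<forall>t\<in>triv E. \<forall>\<alpha> \<beta>. smooth_on (common_domain c t) (h_coeff E h c t \<alpha> \<beta>))"


subsection \<open>Chern connection, curvature and mean curvature\<close>

text \<open>A connection is given by its 1-forms \<open>\<theta>\<^sub>\<alpha>\<^sup>\<beta> = \<theta> c t \<alpha> \<beta>\<close> in the frames of the trivializations,
  \<open>\<nabla> s\<^sub>\<alpha> = \<theta>\<^sub>\<alpha>\<^sup>\<beta> \<otimes> s\<^sub>\<beta>\<close>. It is the Chern connection if it has (0,1)-part \<open>\<bar>\<partial>\<close>, that is, no
  (0,1)-part in the holomorphic frames \<open>s\<^sub>\<alpha>\<close>, and is compatible with \<open>h\<close>: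
  \<open>d h(s\<^sub>\<alpha>, s\<^sub>\<beta>) = h(\<nabla> s\<^sub>\<alpha>, s\<^sub>\<beta>) + h(s\<^sub>\<alpha>, \<nabla> s\<^sub>\<beta>)\<close>. These conditions determine the \<open>\<theta>\<^sub>\<alpha>\<^sup>\<beta>\<close>, so that the
  transformation laws under changes of chart and frame need not be required.\<close>

type_synonym ('m, 'n, 'e, 'r) connection =
  "('m, 'n) chart \<Rightarrow> 'm set \<times> ('e \<Rightarrow> complex^'r) \<Rightarrow> 'r \<Rightarrow> 'r \<Rightarrow> 'n form"

definition chern_connection ::
    "('m, 'n::{finite,linorder}) chart set \<Rightarrow> ('m, 'e, 'r::finite) vector_bundle
     \<Rightarrow> ('e \<Rightarrow> 'e \<Rightarrow> complex) \<Rightarrow> ('m, 'n, 'e, 'r) connection \<Rightarrow> bool" where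
  "chern_connection A E h \<theta> \<longleftrightarrow>
     (\<forall>c\<in>A. \<forall>t\<in>triv E. \<forall>\<alpha> \<beta>.
        (\<forall>S. smooth_on (common_domain c t) (\<lambda>z. \<theta> c t \<alpha> \<beta> z S)) \<and>
        (\<forall>z\<in>common_domain c t.
           (\<forall>S. card S \<noteq> 1 \<longrightarrow> \<theta> c t \<alpha> \<beta> z S = 0) \<and>
           (\<forall>j. \<theta> c t \<alpha> \<beta> z {Inr j} = 0) \<and>
           (\<forall>S. ext_d (zero_form (h_coeff E h c t \<alpha> \<beta>)) z S =
              (\<Sum>\<gamma>\<in>UNIV. \<theta> c t \<alpha> \<gamma> z S * h_coeff E h c t \<gamma> \<beta> z)
              + (\<Sum>\<gamma>\<in>UNIV. conj_1form (\<theta> c t \<beta> \<gamma>) z S * h_coeff E h c t \<alpha> \<gamma> z))))"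

text \<open>The extension of \<open>\<nabla>\<close> to \<open>E\<close>-valued \<open>p\<close>-forms:
  \<open>\<nabla>(\<eta>\<^sup>\<alpha> \<otimes> s\<^sub>\<alpha>) = (d\<eta>\<^sup>\<beta> + (-1)\<^sup>p \<eta>\<^sup>\<alpha> \<and> \<theta>\<^sub>\<alpha>\<^sup>\<beta>) \<otimes> s\<^sub>\<beta>\<close>.\<close>

definition cov_d ::
    "('r::finite \<Rightarrow> 'r \<Rightarrow> 'n::{finite,linorder} form) \<Rightarrow> nat \<Rightarrow> ('r \<Rightarrow> 'n form) \<Rightarrow> 'r \<Rightarrow> 'n form" where
  "cov_d \<theta> p \<eta> \<beta> =
     (\<lambda>z S. ext_d (\<eta> \<beta>) z S + (-1) ^ p * (\<Sum>\<alpha>\<in>UNIV. wedge (\<eta> \<alpha>) (\<theta> \<alpha> \<beta>) z S))"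

text \<open>\<open>curvature \<theta> \<alpha> \<beta>\<close> is the component along \<open>s\<^sub>\<beta>\<close> of \<open>\<nabla>\<^sup>2 s\<^sub>\<alpha>\<close>.\<close>

definition curvature ::
    "('r::finite \<Rightarrow> 'r \<Rightarrow> 'n::{finite,linorder} form) \<Rightarrow> 'r \<Rightarrow> 'r \<Rightarrow> 'n form" where
  "curvature \<theta> \<alpha> = cov_d \<theta> 1 (cov_d \<theta> 0 (\<lambda>\<beta>. zero_form (\<lambda>z. if \<beta> = \<alpha> then 1 else 0)))"

text \<open>\<open>K\<^bsub>\<alpha>\<bar>\<beta>\<^esub>\<close>. The convention for the inverse is \<open>g\<^bsup>i\<bar>j\<^esup> g\<^bsub>k\<bar>j\<^esub> = \<delta>\<^bsup>i\<^esup>\<^bsub>k\<^esub>\<close>, the one that makes the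
  contraction invariant; hence \<open>g\<^bsup>i\<bar>j\<^esup>\<close> is the entry \<open>(j, i)\<close> of the inverse matrix.\<close>

definition mean_curv_coeff ::
    "('m, 'n::{finite,linorder}) metric_tensor \<Rightarrow> ('m, 'e, 'r::finite) vector_bundle
     \<Rightarrow> ('e \<Rightarrow> 'e \<Rightarrow> complex) \<Rightarrow> ('m, 'n, 'e, 'r) connection \<Rightarrow> ('m, 'n) chart
     \<Rightarrow> 'm set \<times> ('e \<Rightarrow> complex^'r) \<Rightarrow> 'r \<Rightarrow> 'r \<Rightarrow> (complex, 'n) vec \<Rightarrow> complex" where
  "mean_curv_coeff g E h \<theta> c t \<alpha> \<beta> z =
     (\<Sum>\<gamma>\<in>UNIV. \<Sum>i\<in>UNIV. \<Sum>j\<in>UNIV.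
        h_coeff E h c t \<gamma> \<beta> z * matrix_inv (g c z) $ j $ i
        * curvature (\<theta> c t) \<alpha> \<gamma> z {Inl i, Inr j})"

text \<open>\<open>K(\<xi>, \<eta>)\<close> for \<open>\<xi>\<close> and \<open>\<eta>\<close> in the same fibre; it does not depend on the choice of the chart and
  the trivialization.\<close>

definition mean_curvature ::
    "('m, 'n::{finite,linorder}) chart set
     \<Rightarrow> ('m, 'n) metric_tensor \<Rightarrow> ('m, 'e, 'r::finite) vector_bundle
     \<Rightarrow> ('e \<Rightarrow> 'e \<Rightarrow> complex) \<Rightarrow> ('m, 'n, 'e, 'r) connection \<Rightarrow> 'e \<Rightarrow> 'e \<Rightarrow> complex" where
  "mean_curvature A g E h \<theta> \<xi> \<eta> =
     (let x = bproj E \<xi>;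
          (c, t) = (SOME (c, t). c \<in> A \<and> t \<in> triv E \<and> x \<in> fst c \<inter> fst t)
      in \<Sum>\<alpha>\<in>UNIV. \<Sum>\<beta>\<in>UNIV.
           mean_curv_coeff g E h \<theta> c t \<alpha> \<beta> (snd c x) * snd t \<xi> $ \<alpha> * cnj (snd t \<eta> $ \<beta>))"

text \<open>An eigenvalue at \<open>x\<close>, relative to \<open>h\<close>, of a Hermitian form \<open>K\<close> on \<open>E\<close>.\<close>

definition eigenvalue_at ::
    "('m, 'e, 'r::finite) vector_bundle \<Rightarrow> ('e \<Rightarrow> 'e \<Rightarrow> complex) \<Rightarrow> ('e \<Rightarrow> 'e \<Rightarrow> complex) \<Rightarrow> 'm \<Rightarrow> real \<Rightarrow> bool" where
  "eigenvalue_at E h K x l \<longleftrightarrow>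
     (\<exists>\<xi>\<in>fibre E x. \<xi> \<noteq> bzero E x \<and> (\<forall>\<eta>\<in>fibre E x. K \<xi> \<eta> = complex_of_real l * h \<xi> \<eta>))"

definition greatest_eigenvalue ::
    "('m, 'e, 'r::finite) vector_bundle \<Rightarrow> ('e \<Rightarrow> 'e \<Rightarrow> complex) \<Rightarrow> ('e \<Rightarrow> 'e \<Rightarrow> complex) \<Rightarrow> 'm \<Rightarrow> real" where
  "greatest_eigenvalue E h K x = (GREATEST l. eigenvalue_at E h K x l)"

text \<open>\<open>f \<omega>\<^sub>0\<^sup>n\<close> for a real function \<open>f\<close>.\<close>

definition volume_multiple ::
    "('m, 'n::{finite,linorder}) metric_tensor \<Rightarrow> ('m \<Rightarrow> real)
     \<Rightarrow> ('m, 'n) chart \<Rightarrow> 'n form" where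
  "volume_multiple g f c =
     (\<lambda>z S. complex_of_real (f (chart_inv c z)) * wedge_pow (metric_form g c) CARD('n) z S)"

end

theory Submission
  imports Defs "HOL-Complex_Analysis.Conformal_Mappings"
begin

text \<open>Let \<open>s\<close> be a holomorphic section that is not identically zero, \<open>f = h(s, s)\<close> and
  \<open>\<epsilon> > 0\<close>, and let \<open>\<Delta> u\<close> be the trace of \<open>\<partial>\<bar>\<partial>u\<close> with respect to \<open>\<omega>\<^sub>0\<close>. The Bochner formula and the
  Cauchy-Schwarz inequality give \<open>\<Delta> ln (f + \<epsilon>) \<ge> - K(s, s) / (f + \<epsilon>) \<ge> - \<gamma> f / (f + \<epsilon>)\<close>. Two
  integrations by parts move \<open>\<partial>\<bar>\<partial>\<close> onto \<open>\<omega>\<^sub>0\<^sup>n\<^sup>-\<^sup>1\<close>, so for a Gauduchon metric the left-hand side has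
  integral zero against \<open>\<omega>\<^sub>0\<^sup>n\<close>; hence the integral of \<open>\<gamma> f / (f + \<epsilon>)\<close> is nonnegative. The zeros of \<open>s\<close>
  form a null set, since the manifold is connected, and dominated convergence for \<open>\<epsilon> \<rightarrow> 0\<close> shows
  that the integral of \<open>\<gamma>\<close> is nonnegative.\<close>

section \<open>Functions of class \<open>C\<^sup>k\<close>\<close>

text \<open>The zeros of \<open>s\<close> force the parameter: \<open>ln f\<close> is undefined
  there, so \<open>f + \<epsilon>\<close> replaces \<open>f\<close>. Cauchy-Schwarz survives because
  \<open>f\<close> is at most \<open>f + \<epsilon>\<close>, and the price is the factor
  \<open>f / (f + \<epsilon>)\<close>, which tends to 1 off the zeros. The Gauduchon condition
  enters through linear algebra. The coefficients of the power \<open>n - 1\<close> of the metric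
  form are, up to a constant and signs, the minors of \<open>g\<close>, so with the signs they are
  \<open>det g\<close> times the inverse metric. Hence \<open>\<Delta> u * det g\<close> is a
  constant multiple of a sum of terms \<open>C i j * dzbar j (dz i u)\<close>, and the condition
  says that the formal adjoint of this operator annihilates the constant 1. Integrals are sums over
  charts weighted by a partition of unity. These weights do not commute with
  \<open>\<Delta>\<close>, so the function is split by the same partition into pieces with compact
  support in one chart each, and a change of charts then lets the weights add up to 1. This rests on
  the fact that the real Jacobian of a holomorphic map is \<open>|det J|^2\<close>, the factor by
  which \<open>det g\<close> changes.\<close>

lemma frechet_derivative_eqI:
  "(f has_derivative D) (at z) \<Longrightarrow> frechet_derivative f (at z) = D"
  by (metis frechet_derivative_at)

lemma frechet_derivative_cong_open:
  assumes "open S" "z \<in> S" "\<And>x. x \<in> S \<Longrightarrow> f x = g x"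
  shows "frechet_derivative f (at z) = frechet_derivative g (at z)"
proof -
  have "(f has_derivative D) (at z) \<longleftrightarrow> (g has_derivative D) (at z)" for D
    using assms has_derivative_transform_within_open[of _ _ z UNIV S] by metis
  then show ?thesis by (simp add: frechet_derivative_def)
qed

lemma differentiable_cong_open:
  assumes "open S" "z \<in> S" "\<And>x. x \<in> S \<Longrightarrow> f x = g x"
  shows "f differentiable (at z) \<longleftrightarrow> g differentiable (at z)"
proof -
  have "(f has_derivative D) (at z) \<longleftrightarrow> (g has_derivative D) (at z)" for D
    using assms has_derivative_transform_within_open[of _ _ z UNIV S] by metis
  then show ?thesis by (simp add: differentiable_def)
qed

lemma Ck_on_cong:
  assumes "open S" "\<And>x. x \<in> S \<Longrightarrow> f x = g x"
  shows "Ck_on k S f \<longleftrightarrow> Ck_on k S g"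
  using assms(2)
proof (induction k arbitrary: f g)
  case 0
  then show ?case by (simp cong: continuous_on_cong)
next
  case (Suc k)
  have "Ck_on k S (\<lambda>z. frechet_derivative f (at z) v) \<longleftrightarrow> Ck_on k S (\<lambda>z. frechet_derivative g (at z) v)" for v
    by (rule Suc.IH) (use frechet_derivative_cong_open[OF assms(1)] Suc.prems in metis)
  moreover have "(\<forall>z\<in>S. f differentiable (at z)) \<longleftrightarrow> (\<forall>z\<in>S. g differentiable (at z))"
    using differentiable_cong_open[OF assms(1)] Suc.prems by metis
  ultimately show ?case by simp
qed

lemma Ck_on_subset: "Ck_on k S f \<Longrightarrow> T \<subseteq> S \<Longrightarrow> Ck_on k T f"
  by (induction k arbitrary: f) (auto intro: continuous_on_subset)

lemma Ck_on_continuous: "Ck_on k S f \<Longrightarrow> continuous_on S f"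
  by (cases k) (auto simp: differentiable_imp_continuous_within continuous_at_imp_continuous_on)

lemma Ck_on_Suc_D: "Ck_on (Suc k) S f \<Longrightarrow> Ck_on k S f"
proof (induction k arbitrary: f)
  case 0
  then show ?case using Ck_on_continuous by fastforce
next
  case (Suc k)
  then show ?case by (metis Ck_on.simps(2))
qed

text \<open>\<open>Ck_on\<close> takes derivatives at points of the whole space and not within
  \<open>S\<close>, so the class is a local property.\<close>

lemma Ck_on_local:
  assumes "\<And>x. x \<in> S \<Longrightarrow> \<exists>U. open U \<and> x \<in> U \<and> Ck_on k U f"
  shows "Ck_on k S f"
  using assms
proof (induction k arbitrary: f)
  case 0
  have "continuous (at x) f" if "x \<in> S" for x
    using 0[OF that] by (auto simp: continuous_on_eq_continuous_at)
  then show ?case by (simp add: continuous_at_imp_continuous_on)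
next
  case (Suc k)
  then show ?case by (fastforce intro!: Suc.IH)
qed

lemma Ck_on_const [simp]: "Ck_on k S (\<lambda>x. c)"
  by (induction k arbitrary: c) auto

lemma Ck_on_SucI:
  assumes "\<And>z. z \<in> S \<Longrightarrow> (f has_derivative f' z) (at z)" "open S"
    and "\<And>v. Ck_on k S (\<lambda>z. f' z v)"
  shows "Ck_on (Suc k) S f"
proof -
  have "Ck_on k S (\<lambda>z. frechet_derivative f (at z) v)" for v
    using Ck_on_cong[OF assms(2), of "\<lambda>z. frechet_derivative f (at z) v" "\<lambda>z. f' z v" k]
      frechet_derivative_eqI[OF assms(1)] assms(3) by auto
  then show ?thesis using assms(1) by (auto simp: differentiable_def)
qed

lemma Ck_on_SucE:
  assumes "Ck_on (Suc k) S f"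
  shows "\<And>z. z \<in> S \<Longrightarrow> (f has_derivative frechet_derivative f (at z)) (at z)"
    and "\<And>v. Ck_on k S (\<lambda>z. frechet_derivative f (at z) v)"
  using assms by (auto simp: frechet_derivative_works)

lemma Ck_on_bounded_linear_comp:
  assumes "bounded_linear L" "open S" "Ck_on k S f"
  shows "Ck_on k S (\<lambda>x. L (f x))"
  using assms(3)
proof (induction k arbitrary: f)
  case 0
  then show ?case using bounded_linear.continuous_on[OF assms(1)] by auto
next
  case (Suc k)
  note d = Ck_on_SucE[OF Suc.prems]
  show ?case
    by (rule Ck_on_SucI[OF _ assms(2)], rule bounded_linear.has_derivative[OF assms(1)], rule d(1))
       (auto intro: Suc.IH d(2))
qed

lemma Ck_on_id: "open S \<Longrightarrow> Ck_on k S (\<lambda>x. x)"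
  by (cases k) (auto intro!: Ck_on_SucI)

lemma Ck_on_add:
  assumes "open S" "Ck_on k S f" "Ck_on k S g"
  shows "Ck_on k S (\<lambda>x. f x + g x)"
  using assms(2,3)
proof (induction k arbitrary: f g)
  case 0
  then show ?case by (auto intro: continuous_intros)
next
  case (Suc k)
  note d = Ck_on_SucE[OF Suc.prems(1)] Ck_on_SucE[OF Suc.prems(2)]
  show ?case
    by (rule Ck_on_SucI[OF _ assms(1)], rule has_derivative_add[OF d(1) d(3)])
       (auto intro: Suc.IH d)
qed

lemma Ck_on_minus: "open S \<Longrightarrow> Ck_on k S f \<Longrightarrow> Ck_on k S (\<lambda>x. - f x)"
  by (rule Ck_on_bounded_linear_comp) (auto intro: bounded_linear_minus bounded_linear_ident)

lemma Ck_on_diff: "open S \<Longrightarrow> Ck_on k S f \<Longrightarrow> Ck_on k S g \<Longrightarrow> Ck_on k S (\<lambda>x. f x - g x)"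
  using Ck_on_add[of S k f "\<lambda>x. - g x"] Ck_on_minus by auto

lemma Ck_on_sum:
  assumes "open S" "\<And>i. i \<in> I \<Longrightarrow> Ck_on k S (f i)"
  shows "Ck_on k S (\<lambda>x. \<Sum>i\<in>I. f i x)"
  using assms(2)
  by (induction I rule: infinite_finite_induct) (auto intro: Ck_on_add[OF assms(1)])

text \<open>By the product rule the derivative is a sum of two products of the same kind, each with
  one factor weakened by one order. One induction thus serves multiplication, scaling and inner
  products.\<close>

lemma Ck_on_bilinear:
  assumes "bounded_bilinear p" "open S" "Ck_on k S f" "Ck_on k S g"
  shows "Ck_on k S (\<lambda>x. p (f x) (g x))"
  using assms(3,4)
proof (induction k arbitrary: f g)
  case 0
  then show ?case using bounded_bilinear.continuous_on[OF assms(1)] by auto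
next
  case (Suc k)
  note d = Ck_on_SucE[OF Suc.prems(1)] Ck_on_SucE[OF Suc.prems(2)]
  show ?case
    by (rule Ck_on_SucI[OF _ assms(2)], rule bounded_bilinear.FDERIV[OF assms(1) d(1) d(3)])
       (auto intro!: Suc.IH d Ck_on_add assms(2) Ck_on_Suc_D[OF Suc.prems(1)] Ck_on_Suc_D[OF Suc.prems(2)])
qed

lemmas Ck_on_mult = Ck_on_bilinear[OF bounded_bilinear_mult]
lemmas Ck_on_scaleR = Ck_on_bilinear[OF bounded_bilinear_scaleR]

text \<open>\<open>Ck_on\<close> differentiates in fixed directions, but the chain rule inserts a
  direction that moves with the point into the derivative of \<open>f\<close>. Expanding this
  direction in the finite basis of the intermediate space gives a sum of products to which the
  induction hypothesis applies.\<close>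

lemma Ck_on_compose:
  fixes \<phi> :: "'a::real_normed_vector \<Rightarrow> 'b::euclidean_space"
  assumes "open S" "open T" "Ck_on k T f" "Ck_on k S \<phi>" "\<phi> ` S \<subseteq> T"
  shows "Ck_on k S (\<lambda>x. f (\<phi> x))"
  using assms(3,4)
proof (induction k arbitrary: f)
  case 0
  then show ?case using assms(5) by (auto intro: continuous_on_compose2)
next
  case (Suc k)
  note d = Ck_on_SucE[OF Suc.prems(1)] Ck_on_SucE[OF Suc.prems(2)]
  have der: "((\<lambda>x. f (\<phi> x)) has_derivative
      (\<lambda>v. \<Sum>b\<in>Basis. (frechet_derivative \<phi> (at z) v \<bullet> b) *\<^sub>R frechet_derivative f (at (\<phi> z)) b)) (at z)"
    if z: "z \<in> S" for z
  proof -
    have fz: "(f has_derivative frechet_derivative f (at (\<phi> z))) (at (\<phi> z))"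
      using d(1) z assms(5) by blast
    interpret F: linear "frechet_derivative f (at (\<phi> z))"
      using fz has_derivative_linear by blast
    have "(\<Sum>b\<in>Basis. (w \<bullet> b) *\<^sub>R frechet_derivative f (at (\<phi> z)) b) = frechet_derivative f (at (\<phi> z)) w" for w
      by (metis (no_types, lifting) F.scale F.sum euclidean_representation sum.cong)
    then show ?thesis
      using diff_chain_at[OF d(3)[OF z] fz] by (simp add: o_def)
  qed
  show ?case
  proof (rule Ck_on_SucI[OF der assms(1)])
    fix v
    have "Ck_on k S (\<lambda>z. (frechet_derivative \<phi> (at z) v \<bullet> b))" for b
      by (rule Ck_on_bounded_linear_comp[OF bounded_linear_inner_left assms(1) d(4)])
    moreover have "Ck_on k S (\<lambda>z. frechet_derivative f (at (\<phi> z)) b)" for b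
      by (rule Suc.IH[OF d(2) Ck_on_Suc_D[OF Suc.prems(2)]])
    ultimately show "Ck_on k S (\<lambda>z. \<Sum>b\<in>Basis. (frechet_derivative \<phi> (at z) v \<bullet> b) *\<^sub>R frechet_derivative f (at (\<phi> z)) b)"
      by (intro Ck_on_sum Ck_on_scaleR assms(1))
  qed
qed

lemma Ck_on_real_SucI:
  fixes f f' :: "real \<Rightarrow> real"
  assumes "\<And>x. x \<in> S \<Longrightarrow> (f has_real_derivative f' x) (at x)" "open S" "Ck_on k S f'"
  shows "Ck_on (Suc k) S f"
  by (rule Ck_on_SucI[OF _ assms(2)], rule assms(1)[unfolded has_field_derivative_def])
     (auto intro: Ck_on_mult assms)

text \<open>The derivative is \<open>- (inverse x * inverse x)\<close>, so the induction hypothesis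
  yields the next order.\<close>

lemma Ck_on_inverse_real: "Ck_on k {0<..} (inverse :: real \<Rightarrow> real)"
proof (induction k)
  case 0
  then show ?case by (auto intro!: continuous_intros)
next
  case (Suc k)
  show ?case
    by (rule Ck_on_real_SucI[where f' = "\<lambda>x. - (inverse x * inverse x)"])
       (auto intro!: derivative_eq_intros Ck_on_minus Ck_on_mult Suc simp: power2_eq_square)
qed

lemma Ck_on_ln: "Ck_on k {0<..} (ln :: real \<Rightarrow> real)"
proof (cases k)
  case 0
  then show ?thesis by (auto intro!: continuous_intros)
next
  case (Suc k)
  then show ?thesis
    by (auto intro!: Ck_on_real_SucI[where f' = inverse] Ck_on_inverse_real derivative_eq_intros simp del: Ck_on.simps simp: field_simps)
qed

section \<open>Holomorphic functions of several variables\<close>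

lemma norm_vector_smult: "norm (c *s (v :: complex^'n)) = norm c * norm v"
  by (simp add: norm_vec_def norm_mult L2_set_right_distrib)

lemma vector_smult_eq_scaleR: "of_real r *s (v :: complex^'n) = r *\<^sub>R v"
  by (simp add: vec_eq_iff) (simp add: scaleR_conv_of_real)

lemma smult_bounded_linear: "bounded_linear (\<lambda>c. c *s (v :: complex^'n))"
proof (rule bounded_linear_intro[where K="norm v"])
  show "(r *\<^sub>R c) *s v = r *\<^sub>R (c *s v)" for r c
    by (simp add: vec_eq_iff)
qed (simp_all add: norm_vector_smult vec_eq_iff ring_distribs)

lemma smult_bounded_linear': "bounded_linear (\<lambda>v. c *s (v :: complex^'n))"
proof (rule bounded_linear_intro[where K="norm c"])
  show "c *s (r *\<^sub>R v) = r *\<^sub>R (c *s v)" for r and v :: "complex^'n"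
    by (simp add: vec_eq_iff)
qed (simp_all add: norm_vector_smult vec_eq_iff ring_distribs mult.commute)

lemma holo_on_frechet:
  assumes "holo_on S f" "z \<in> S"
  shows "(f has_derivative frechet_derivative f (at z)) (at z)"
    and "frechet_derivative f (at z) (c *s v) = c * frechet_derivative f (at z) v"
  using assms frechet_derivative_eqI unfolding holo_on_def by (metis, metis)

lemma holo_on_line:
  fixes f :: "complex^'n \<Rightarrow> complex"
  assumes "holo_on S f" "z + t *s w \<in> S"
  shows "((\<lambda>u. f (z + u *s w)) has_field_derivative frechet_derivative f (at (z + t *s w)) w) (at t)"
proof -
  have "((\<lambda>u. z + u *s w) has_derivative (\<lambda>u. u *s w)) (at t)"
    by (auto intro!: derivative_eq_intros bounded_linear_imp_has_derivative smult_bounded_linear)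
  from diff_chain_at[OF this holo_on_frechet(1)[OF assms]]
  have "((\<lambda>u. f (z + u *s w)) has_derivative (\<lambda>u. frechet_derivative f (at (z + t *s w)) (u *s w))) (at t)"
    by (simp add: o_def)
  then show ?thesis
    unfolding has_field_derivative_def using holo_on_frechet(2)[OF assms] by (simp add: mult.commute[of _ "frechet_derivative f (at (z + t *s w)) w"])
qed

text \<open>Cauchy's formula for the first derivative of the one-variable function
  \<open>u \<mapsto> f (z + u w)\<close>, with the circle parametrized over the unit interval. The
  right-hand side contains only values of \<open>f\<close>, so regularity of the derivative can be
  read off from the dependence of the integrand on \<open>z\<close>.\<close>

lemma holo_on_cauchy:
  fixes f :: "complex^'n \<Rightarrow> complex"
  assumes f: "holo_on S f" and r: "r > 0" and sub: "\<And>t. norm t \<le> r \<Longrightarrow> z + t *s w \<in> S"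
  shows "frechet_derivative f (at z) w =
    integral {0..1} (\<lambda>t. f (z + (of_real r * exp (2 * of_real pi * \<i> * of_real t)) *s w)
        / (of_real r * exp (2 * of_real pi * \<i> * of_real t)))"
proof -
  let ?g = "\<lambda>u. f (z + u *s w)"
  let ?e = "\<lambda>t. of_real r * exp (2 * of_real pi * \<i> * of_real t) :: complex"
  have d: "(?g has_field_derivative frechet_derivative f (at (z + t *s w)) w) (at t)" if "norm t \<le> r" for t
    using holo_on_line[OF f sub[OF that]] .
  have cont: "continuous_on (cball 0 r) ?g"
  proof (intro continuous_at_imp_continuous_on ballI)
    fix t :: complex assume "t \<in> cball 0 r"
    then have "norm t \<le> r" by simp
    from DERIV_isCont[OF d[OF this]] show "isCont ?g t" .
  qed
  have hol: "?g holomorphic_on ball 0 r"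
  proof (rule holomorphic_onI)
    fix t :: complex assume "t \<in> ball 0 r"
    then have "(?g has_field_derivative frechet_derivative f (at (z + t *s w)) w) (at t within ball 0 r)"
      using has_field_derivative_at_within[OF d] by simp
    then show "?g field_differentiable (at t within ball 0 r)"
      unfolding field_differentiable_def by blast
  qed
  have "((\<lambda>u. ?g u / (u - 0)^2) has_contour_integral (2 * of_real pi * \<i> / fact 1 * (deriv ^^ 1) ?g 0)) (circlepath 0 r)"
    using Cauchy_has_contour_integral_higher_derivative_circlepath[OF cont hol, of 0 1] r by (simp add: numeral_2_eq_2)
  moreover have "deriv ?g 0 = frechet_derivative f (at z) w"
    using d[of 0] r by (intro DERIV_imp_deriv) auto
  ultimately have "((\<lambda>u. ?g u / u^2) has_contour_integral (2 * of_real pi * \<i> * frechet_derivative f (at z) w)) (circlepath 0 r)"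
    by simp
  then have "((\<lambda>t. ?g (?e t) / (?e t)^2 * (2 * of_real pi * \<i> * ?e t)) has_integral (2 * of_real pi * \<i> * frechet_derivative f (at z) w)) {0..1}"
    unfolding has_contour_integral circlepath_def[symmetric] vector_derivative_circlepath
    by (simp add: circlepath mult_ac)
  \<comment> \<open>The velocity of the circle is \<open>2 pi i\<close> times its position, which
    cancels one of the two factors in the denominator.\<close>
  from has_integral_mult_right[OF this, of "1 / (2 * of_real pi * \<i>)"]
  have "((\<lambda>t. ?g (?e t) / ?e t) has_integral frechet_derivative f (at z) w) {0..1}"
    using r by (simp add: field_simps power2_eq_square)
  then show ?thesis by (simp add: integral_unique)
qed

lemma open_smult_room:
  fixes w :: "complex^'n"
  assumes S: "open S" and z0: "z0 \<in> S"
  shows "\<exists>R>0. \<exists>r>0. \<forall>z\<in>ball z0 R. \<forall>t. norm t \<le> r \<longrightarrow> z + t *s w \<in> S"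
proof -
  obtain R where R: "R > 0" "cball z0 R \<subseteq> S" using S z0 open_contains_cball by blast
  \<comment> \<open>The summand 1 keeps the denominator positive for \<open>w = 0\<close>. One half
    of \<open>R\<close> is reserved for the motion of \<open>z\<close>, the other for
    \<open>t w\<close>.\<close>
  define r where "r = R / (2 * (norm w + 1))"
  have pos: "norm w + 1 > 0" by (simp add: add_nonneg_pos)
  have r: "r > 0" using R pos by (simp add: r_def)
  have rw: "norm t * norm w \<le> R / 2" if "norm t \<le> r" for t :: complex
  proof -
    have "norm t * norm w \<le> r * (norm w + 1)"
      using that r by (intro mult_mono) auto
    also have "\<dots> = R / 2" using pos by (simp add: r_def divide_simps)
    finally show ?thesis .
  qed
  have "z + t *s w \<in> S" if "z \<in> ball z0 (R/2)" "norm t \<le> r" for z t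
  proof -
    have "dist z0 (z + t *s w) \<le> dist z0 z + norm (t *s w)"
      using dist_triangle[of z0 "z + t *s w" z] by (simp add: dist_norm)
    then have "dist z0 (z + t *s w) \<le> R" using that rw[OF that(2)] by (simp add: norm_vector_smult)
    then show ?thesis using R by auto
  qed
  then show ?thesis using R r by (intro exI[of _ "R/2"] exI[of _ r] conjI ballI allI impI) auto
qed

text \<open>An integral depends continuously on a parameter. Continuity comes before
  differentiability because the Leibniz rule in \<open>holo_on_deriv\<close> asks for a jointly
  continuous derivative of the integrand.\<close>

lemma holo_on_deriv_continuous:
  fixes f :: "complex^'n \<Rightarrow> complex"
  assumes f: "holo_on S f" and S: "open S"
  shows "continuous_on S (\<lambda>z. frechet_derivative f (at z) w)"
proof -
  have cf: "continuous_on S f"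
    using holo_on_frechet(1)[OF f] has_derivative_continuous by (blast intro: continuous_at_imp_continuous_on)
  have "continuous (at z0) (\<lambda>z. frechet_derivative f (at z) w)" if z0: "z0 \<in> S" for z0
  proof -
    obtain R r where R: "R > 0" and r: "r > 0"
      and in_S: "\<And>z t. z \<in> ball z0 R \<Longrightarrow> norm t \<le> r \<Longrightarrow> z + t *s w \<in> S"
      using open_smult_room[OF S z0, of w] by blast
    let ?e = "\<lambda>t. of_real r * exp (2 * of_real pi * \<i> * of_real t) :: complex"
    have ne: "norm (?e t) = r" for t using r by (simp add: norm_mult)
    have "continuous_on (ball z0 R) (\<lambda>z. integral (cbox 0 1) (\<lambda>t. f (z + ?e t *s w) / ?e t))"
      apply (rule integral_continuous_on_param)
      using r by (auto simp: split_beta intro!: continuous_intros continuous_on_compose2[OF cf] 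
          bounded_linear.continuous_on[OF smult_bounded_linear] in_S simp: ne)
    then have "continuous_on (ball z0 R) (\<lambda>z. frechet_derivative f (at z) w)"
      by (rule continuous_on_eq) (use holo_on_cauchy[OF f r in_S] in auto)
    then show ?thesis using R by (auto simp: continuous_on_eq_continuous_at)
  qed
  then show ?thesis by (intro continuous_at_imp_continuous_on ballI)
qed


text \<open>The Cauchy integral is differentiated under the integral sign; the derivative of its
  integrand is that of \<open>f\<close> at a translated point, continuous by the previous lemma.
  Complex linearity passes through the integral, so the directional derivative is again holomorphic
  and smoothness follows by induction.\<close>

lemma holo_on_deriv:
  fixes f :: "complex^'n \<Rightarrow> complex"
  assumes f: "holo_on S f" and S: "open S"
  shows "holo_on S (\<lambda>z. frechet_derivative f (at z) w)"
  unfolding holo_on_def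
proof
  fix z0 assume z0: "z0 \<in> S"
    obtain R r where R: "R > 0" and r: "r > 0"
      and in_S: "\<And>z t. z \<in> ball z0 R \<Longrightarrow> norm t \<le> r \<Longrightarrow> z + t *s w \<in> S"
      using open_smult_room[OF S z0, of w] by blast
    let ?e = "\<lambda>t. of_real r * exp (2 * of_real pi * \<i> * of_real t) :: complex"
    have ne: "norm (?e t) = r" for t using r by (simp add: norm_mult)
    have ne0: "?e t \<noteq> 0" for t using r by simp
    let ?U = "ball z0 R"
    let ?D = "\<lambda>z t. Blinfun (\<lambda>v. frechet_derivative f (at (z + ?e t *s w)) v / ?e t)"
    have cf: "continuous_on S f"
      using holo_on_frechet(1)[OF f] has_derivative_continuous by (blast intro: continuous_at_imp_continuous_on)
    have bl: "bounded_linear (\<lambda>v. frechet_derivative f (at (z + ?e t *s w)) v / ?e t)" if "z \<in> ?U" for z t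
      using holo_on_frechet(1)[OF f in_S[OF that, of "?e t"]] ne[of t]
      by (intro bounded_linear_divide[THEN bounded_linear_compose] has_derivative_bounded_linear) auto
    have ap: "blinfun_apply (?D z t) v = frechet_derivative f (at (z + ?e t *s w)) v / ?e t" if "z \<in> ?U" for z t v
      using bounded_linear_Blinfun_apply[OF bl[OF that]] by simp
    \<comment> \<open>The Leibniz rule treats derivatives as bounded linear maps with the operator
      norm. In finite dimension continuity in this norm follows from continuity in each
      direction.\<close>
    have cD: "continuous_on (?U \<times> cbox 0 (1::real)) (\<lambda>(z, t). ?D z t)"
    proof (rule continuous_on_blinfun_componentwise)
      fix v :: "complex^'n"
      have "continuous_on (?U \<times> cbox 0 (1::real)) (\<lambda>x. frechet_derivative f (at (fst x + ?e (snd x) *s w)) v / ?e (snd x))"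
      proof (rule continuous_on_divide)
        have ce: "continuous_on (?U \<times> cbox 0 (1::real)) (\<lambda>x. ?e (snd x))"
          by (intro continuous_intros)
        then show "continuous_on (?U \<times> cbox 0 (1::real)) (\<lambda>x. ?e (snd x))" .
        have "continuous_on (?U \<times> cbox 0 (1::real)) (\<lambda>x. fst x + ?e (snd x) *s w)"
          by (intro continuous_on_add continuous_on_fst continuous_on_id 
              bounded_linear.continuous_on[OF smult_bounded_linear ce])
        then show "continuous_on (?U \<times> cbox 0 (1::real)) (\<lambda>x. frechet_derivative f (at (fst x + ?e (snd x) *s w)) v)"
          by (rule continuous_on_compose2[OF holo_on_deriv_continuous[OF f S]])
             (use ne in_S in fastforce)
      qed (use ne0 in blast)
      then show "continuous_on (?U \<times> cbox 0 (1::real)) (\<lambda>x. blinfun_apply (case x of (z, t) \<Rightarrow> ?D z t) v)"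
        by (rule continuous_on_eq) (auto simp: ap)
    qed
    have der: "((\<lambda>z. integral (cbox 0 1) (\<lambda>t. f (z + ?e t *s w) / ?e t)) has_derivative 
       integral (cbox 0 1) (?D z0)) (at z0 within ?U)"
    proof (rule leibniz_rule[OF _ _ cD])
      fix z t assume z: "z \<in> ?U"
      have "((\<lambda>z. z + ?e t *s w) has_derivative (\<lambda>v. v)) (at z)"
        by (auto intro!: derivative_eq_intros)
      from diff_chain_at[OF this holo_on_frechet(1)[OF f in_S[OF z, of "?e t"]]]
      have "((\<lambda>z. f (z + ?e t *s w)) has_derivative (\<lambda>v. frechet_derivative f (at (z + ?e t *s w)) v)) (at z)"
        using ne[of t] by (simp add: o_def)
      from bounded_linear.has_derivative[OF bounded_linear_divide this, of "?e t"]
      show "((\<lambda>z. f (z + ?e t *s w) / ?e t) has_derivative blinfun_apply (?D z t)) (at z within ?U)"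
        using bounded_linear_Blinfun_apply[OF bl[OF z]] by (simp add: has_derivative_at_withinI)
    next
      fix z assume z: "z \<in> ?U"
      show "(\<lambda>t. f (z + ?e t *s w) / ?e t) integrable_on cbox 0 1"
        by (rule integrable_continuous)
         (use z r in \<open>auto simp: ne ne0 simp del: mult_eq_0_iff intro!: continuous_intros continuous_on_compose2[OF cf] 
          bounded_linear.continuous_on[OF smult_bounded_linear] in_S\<close>)
    qed (use R in auto)
    have "((\<lambda>z. frechet_derivative f (at z) w) has_derivative integral (cbox 0 1) (?D z0)) (at z0)"
    proof (rule has_derivative_transform_within_open[of _ _ z0 UNIV ?U])
      show "((\<lambda>z. integral (cbox 0 1) (\<lambda>t. f (z + ?e t *s w) / ?e t)) has_derivative integral (cbox 0 1) (?D z0)) (at z0)"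
        using der R by (simp add: at_within_open[of z0 ?U])
    qed (use R holo_on_cauchy[OF f r in_S] in auto)
    moreover have "blinfun_apply (integral (cbox 0 1) (?D z0)) (c *s v) = c * blinfun_apply (integral (cbox 0 1) (?D z0)) v" for c v
    proof -
      have "Pair z0 ` cbox 0 (1::real) \<subseteq> ?U \<times> cbox 0 1" using R by auto
      then have "continuous_on (cbox 0 1) (?D z0)"
        using continuous_on_compose2[OF cD continuous_on_Pair[OF continuous_on_const[of _ z0] continuous_on_id, of "cbox 0 1"]]
        unfolding split_conv by blast
      then have int: "?D z0 integrable_on cbox 0 1" by (rule integrable_continuous)
      have app: "blinfun_apply (integral (cbox 0 1) (?D z0)) u = integral (cbox 0 1) (\<lambda>t. blinfun_apply (?D z0 t) u)" for u
        using blinfun_apply_integral[OF int] .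
      have st: "blinfun_apply (?D z0 t) (c *s v) = c * blinfun_apply (?D z0 t) v" for t
        using ap[of z0 t] R holo_on_frechet(2)[OF f in_S[of z0 "?e t"]] ne[of t] by simp
      show ?thesis unfolding app st by simp
    qed
    ultimately show "\<exists>D. ((\<lambda>z. frechet_derivative f (at z) w) has_derivative D) (at z0) \<and> (\<forall>c v. D (c *s v) = c * D v)"
      by blast
qed

lemma holo_on_Ck:
  fixes f :: "complex^'n \<Rightarrow> complex"
  assumes "holo_on S f" "open S"
  shows "Ck_on k S f"
  using assms(1)
proof (induction k arbitrary: f)
  case 0
  then show ?case
    using holo_on_frechet(1) has_derivative_continuous by (fastforce intro!: continuous_at_imp_continuous_on)
next
  case (Suc k)
  have "Ck_on k S (\<lambda>z. frechet_derivative f (at z) v)" for v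
    by (rule Suc.IH[OF holo_on_deriv[OF Suc.prems assms(2)]])
  moreover have "f differentiable (at z)" if "z \<in> S" for z
    using holo_on_frechet(1)[OF Suc.prems that] by (auto simp: differentiable_def)
  ultimately show ?case by simp
qed


section \<open>Wirtinger derivatives\<close>

lemma dz_eqI: "(f has_derivative D) (at z) \<Longrightarrow> dz i f z = (D (axis i 1) - \<i> * D (axis i \<i>)) / 2"
  and dzbar_eqI: "(f has_derivative D) (at z) \<Longrightarrow> dzbar i f z = (D (axis i 1) + \<i> * D (axis i \<i>)) / 2"
  by (simp_all add: dz_def dzbar_def frechet_derivative_eqI)

lemma dz_cong_open:
  assumes "open S" "z \<in> S" "\<And>x. x \<in> S \<Longrightarrow> f x = g x"
  shows "dz i f z = dz i g z" "dzbar i f z = dzbar i g z"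
  using frechet_derivative_cong_open[OF assms] by (simp_all add: dz_def dzbar_def)

lemma Ck_on_dz:
  assumes "open S" "Ck_on (Suc k) S f"
  shows "Ck_on k S (dz i f)" "Ck_on k S (dzbar i f)"
proof -
  note d = Ck_on_SucE(2)[OF assms(2)]
  have "Ck_on k S (\<lambda>z. (frechet_derivative f (at z) (axis i 1) - \<i> * frechet_derivative f (at z) (axis i \<i>)) * (1/2))"
    "Ck_on k S (\<lambda>z. (frechet_derivative f (at z) (axis i 1) + \<i> * frechet_derivative f (at z) (axis i \<i>)) * (1/2))"
    by (intro Ck_on_mult Ck_on_diff Ck_on_add assms(1) d Ck_on_const)+
  then show "Ck_on k S (dz i f)" "Ck_on k S (dzbar i f)"
    by (simp_all add: dz_def[abs_def] dzbar_def[abs_def])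
qed

lemma Ck_on_differentiable: "Ck_on (Suc k) S f \<Longrightarrow> z \<in> S \<Longrightarrow> f differentiable (at z)"
  by simp

context
  fixes f g :: "complex^'n \<Rightarrow> complex" and z
  assumes f: "f differentiable (at z)" and g: "g differentiable (at z)"
begin

lemma dzbar_add: "dzbar i (\<lambda>z. f z + g z) z = dzbar i f z + dzbar i g z"
  using has_derivative_add[OF f[unfolded frechet_derivative_works] g[unfolded frechet_derivative_works], THEN frechet_derivative_eqI]
  by (simp_all add: dz_def dzbar_def field_simps)

lemma dz_mult: "dz i (\<lambda>z. f z * g z) z = dz i f z * g z + f z * dz i g z"
  and dzbar_mult: "dzbar i (\<lambda>z. f z * g z) z = dzbar i f z * g z + f z * dzbar i g z"
  using has_derivative_mult[OF f[unfolded frechet_derivative_works] g[unfolded frechet_derivative_works], THEN frechet_derivative_eqI]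
  by (simp_all add: dz_def dzbar_def field_simps)

lemma dz_cnj: "dz i (\<lambda>z. cnj (f z)) z = cnj (dzbar i f z)"
  and dzbar_cnj: "dzbar i (\<lambda>z. cnj (f z)) z = cnj (dz i f z)"
  using has_derivative_cnj[OF f[unfolded frechet_derivative_works], THEN frechet_derivative_eqI]
  by (simp_all add: dz_def dzbar_def field_simps)

end

lemma dz_const [simp]: "dz i (\<lambda>z. c) z = 0" "dzbar i (\<lambda>z. c) z = 0"
  by (simp_all add: dz_def dzbar_def)

lemma dz_sum:
  assumes "\<And>a. a \<in> I \<Longrightarrow> f a differentiable (at z)"
  shows "dz i (\<lambda>z. \<Sum>a\<in>I. f a z) z = (\<Sum>a\<in>I. dz i (f a) z)"
    and "dzbar i (\<lambda>z. \<Sum>a\<in>I. f a z) z = (\<Sum>a\<in>I. dzbar i (f a) z)"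
  using has_derivative_sum[of I f _ "at z", OF assms[unfolded frechet_derivative_works], THEN frechet_derivative_eqI]
  by (simp_all add: dz_def dzbar_def sum_divide_distrib sum_subtractf sum.distrib sum_distrib_left
      diff_divide_distrib add_divide_distrib)

lemma axis_i: "axis i \<i> = \<i> *s (axis i 1 :: complex^'n)"
  by (simp add: vec_eq_iff axis_def)

lemma holo_on_dz:
  assumes "holo_on S f" "z \<in> S"
  shows "dzbar i f z = 0" "dz i f z = frechet_derivative f (at z) (axis i 1)"
  using holo_on_frechet(2)[OF assms] by (simp_all add: dz_def dzbar_def axis_i)

lemma holo_on_dz_holo: "holo_on S f \<Longrightarrow> open S \<Longrightarrow> holo_on S (dz i f)"
proof -
  assume *: "holo_on S f" "open S"
  have h: "holo_on S (\<lambda>z. frechet_derivative f (at z) (axis i 1))" using holo_on_deriv[OF *] .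
  have "\<exists>D. (dz i f has_derivative D) (at z) \<and> (\<forall>c v. D (c *s v) = c * D v)" if z: "z \<in> S" for z
  proof -
    obtain D where D: "((\<lambda>z. frechet_derivative f (at z) (axis i 1)) has_derivative D) (at z)"
      "\<forall>c v. D (c *s v) = c * D v" using h z unfolding holo_on_def by blast
    have "(dz i f has_derivative D) (at z)"
      by (rule has_derivative_transform_within_open[OF D(1) *(2) z]) (simp add: holo_on_dz(2)[OF *(1)])
    then show ?thesis using D(2) by blast
  qed
  then show ?thesis unfolding holo_on_def by blast
qed

text \<open>The vectors \<open>axis k 1\<close> and \<open>axis k \<i>\<close> form a real basis,
  and the Wirtinger derivatives are invertible combinations of the derivatives along it.\<close>

lemma frechet_wirtinger:
  fixes f :: "complex^'n \<Rightarrow> complex"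
  assumes "f differentiable (at z)"
  shows "frechet_derivative f (at z) w = (\<Sum>k\<in>UNIV. dz k f z * w $ k + dzbar k f z * cnj (w $ k))"
proof -
  interpret D: linear "frechet_derivative f (at z)"
    using assms linear_frechet_derivative by blast
  have w: "w = (\<Sum>k\<in>UNIV. Re (w $ k) *\<^sub>R axis k 1 + Im (w $ k) *\<^sub>R axis k \<i>)"
  proof -
    have "w $ j = (\<Sum>k\<in>UNIV. Re (w $ k) *\<^sub>R axis k 1 + Im (w $ k) *\<^sub>R axis k \<i>) $ j" for j
    proof -
      have "(\<Sum>k\<in>UNIV. Re (w $ k) *\<^sub>R axis k 1 + Im (w $ k) *\<^sub>R axis k \<i>) $ j
         = (\<Sum>k\<in>UNIV. if k = j then w $ k else 0)"
        unfolding sum_component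
        by (rule sum.cong) (auto simp: axis_def complex_eq_iff)
      then show ?thesis by simp
    qed
    then show ?thesis unfolding vec_eq_iff by blast
  qed
  have "frechet_derivative f (at z) w = (\<Sum>k\<in>UNIV. Re (w $ k) *\<^sub>R frechet_derivative f (at z) (axis k 1)
      + Im (w $ k) *\<^sub>R frechet_derivative f (at z) (axis k \<i>))"
    by (subst w) (simp only: D.sum D.add D.scale)
  also have "\<dots> = (\<Sum>k\<in>UNIV. dz k f z * w $ k + dzbar k f z * cnj (w $ k))"
  proof (rule sum.cong[OF refl])
    fix k
    obtain x y where "w $ k = Complex x y" by (cases "w $ k")
    then show "Re (w $ k) *\<^sub>R frechet_derivative f (at z) (axis k 1)
      + Im (w $ k) *\<^sub>R frechet_derivative f (at z) (axis k \<i>) = dz k f z * w $ k + dzbar k f z * cnj (w $ k)"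
      by (simp add: dz_def dzbar_def complex_eq_iff field_simps)
  qed
  finally show ?thesis .
qed

text \<open>A holomorphic map preserves types: all terms with \<open>dzbar\<close> of a component of
  \<open>\<phi>\<close> vanish, so \<open>dz\<close> and \<open>dzbar\<close> of \<open>f\<close> do
  not mix.\<close>

lemma wirtinger_chain_holo:
  fixes f :: "complex^'m \<Rightarrow> complex" and \<phi> :: "complex^'n \<Rightarrow> complex^'m"
  assumes f: "f differentiable (at (\<phi> z))" and h: "\<And>k. holo_on S (\<lambda>z. \<phi> z $ k)" and z: "z \<in> S"
  shows "dz i (\<lambda>z. f (\<phi> z)) z = (\<Sum>k\<in>UNIV. dz k f (\<phi> z) * dz i (\<lambda>z. \<phi> z $ k) z)"
    and "dzbar i (\<lambda>z. f (\<phi> z)) z = (\<Sum>k\<in>UNIV. dzbar k f (\<phi> z) * cnj (dz i (\<lambda>z. \<phi> z $ k) z))"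
proof -
  let ?d = "\<lambda>v. \<chi> k. frechet_derivative (\<lambda>z. \<phi> z $ k) (at z) v"
  have "((\<lambda>z. \<phi> z $ k) has_derivative (\<lambda>v. ?d v $ k)) (at z)" for k
    using holo_on_frechet(1)[OF h z] by simp
  then have "((\<lambda>z. \<phi> z $ k \<bullet> b) has_derivative (\<lambda>v. ?d v $ k \<bullet> b)) (at z)" for k b
    by (rule bounded_linear.has_derivative[OF bounded_linear_inner_left])
  then have "((\<lambda>z. \<phi> z \<bullet> axis k b) has_derivative (\<lambda>v. ?d v \<bullet> axis k b)) (at z)" for k b
    unfolding inner_axis .
  then have "\<forall>i\<in>Basis. ((\<lambda>z. \<phi> z \<bullet> i) has_derivative (\<lambda>v. ?d v \<bullet> i)) (at z)"
    unfolding Basis_vec_def by blast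
  then have "(\<phi> has_derivative ?d) (at z)"
    unfolding has_derivative_componentwise_within[of \<phi>] .
  from diff_chain_at[OF this f[unfolded frechet_derivative_works]]
  have "((\<lambda>z. f (\<phi> z)) has_derivative (\<lambda>v. frechet_derivative f (at (\<phi> z)) (?d v))) (at z)"
    by (simp add: o_def)
  note d = dz_eqI[OF this] dzbar_eqI[OF this]
  have e: "?d (axis i 1) $ k = dz i (\<lambda>z. \<phi> z $ k) z" "?d (axis i \<i>) $ k = \<i> * dz i (\<lambda>z. \<phi> z $ k) z" for k
    using holo_on_dz(2)[OF h z] holo_on_frechet(2)[OF h z] by (simp_all add: axis_i)
  show "dz i (\<lambda>z. f (\<phi> z)) z = (\<Sum>k\<in>UNIV. dz k f (\<phi> z) * dz i (\<lambda>z. \<phi> z $ k) z)"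
    unfolding d frechet_wirtinger[OF f] e
    by (simp add: sum_subtractf[symmetric] sum_distrib_left sum_divide_distrib)
       (rule sum.cong, auto simp: algebra_simps)
  show "dzbar i (\<lambda>z. f (\<phi> z)) z = (\<Sum>k\<in>UNIV. dzbar k f (\<phi> z) * cnj (dz i (\<lambda>z. \<phi> z $ k) z))"
    unfolding d frechet_wirtinger[OF f] e
    by (simp add: sum.distrib[symmetric] sum_distrib_left sum_divide_distrib)
       (rule sum.cong, auto simp: algebra_simps)
qed

subsection \<open>Symmetry of second derivatives\<close>

text \<open>The second difference is the increment along \<open>a\<close> of the increment along
  \<open>b\<close>. The mean value theorem, once in each direction, puts the mixed derivative at
  some point of the parallelogram.\<close>

lemma second_difference_mvt:
  fixes u :: "'a::real_normed_vector \<Rightarrow> real"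
  assumes u: "Ck_on 2 S u" and h: "h > 0"
    and sub: "\<And>s t. 0 \<le> s \<Longrightarrow> s \<le> h \<Longrightarrow> 0 \<le> t \<Longrightarrow> t \<le> h \<Longrightarrow> z + s *\<^sub>R a + t *\<^sub>R b \<in> S"
  shows "\<exists>s t. 0 \<le> s \<and> s \<le> h \<and> 0 \<le> t \<and> t \<le> h \<and>
    u (z + h *\<^sub>R a + h *\<^sub>R b) - u (z + h *\<^sub>R a) - u (z + h *\<^sub>R b) + u z
     = h * h * frechet_derivative (\<lambda>w. frechet_derivative u (at w) a) (at (z + s *\<^sub>R a + t *\<^sub>R b)) b"
proof -
  let ?Da = "\<lambda>w. frechet_derivative u (at w) a"
  have u1: "Ck_on (Suc 0) S ?Da" and d: "\<And>w. w \<in> S \<Longrightarrow> (u has_derivative frechet_derivative u (at w)) (at w)"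
    using Ck_on_SucE[of "Suc 0" S u] u by (simp_all add: numeral_2_eq_2)
  have da: "((\<lambda>s. u (z + s *\<^sub>R a + t *\<^sub>R b)) has_real_derivative ?Da (z + s *\<^sub>R a + t *\<^sub>R b)) (at s)"
    if "0 \<le> s" "s \<le> h" "0 \<le> t" "t \<le> h" for s t
  proof -
    have l: "linear (frechet_derivative u (at (z + s *\<^sub>R a + t *\<^sub>R b)))"
      using d[OF sub[OF that]] has_derivative_linear by blast
    have "((\<lambda>s. z + s *\<^sub>R a + t *\<^sub>R b) has_derivative (\<lambda>x. x *\<^sub>R a)) (at s)"
      by (auto intro!: derivative_eq_intros)
    from diff_chain_at[OF this d[OF sub[OF that]]] show ?thesis
      by (simp add: has_field_derivative_def o_def linear_cmul[OF l] mult_commute_abs)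
  qed
  have db: "((\<lambda>t. ?Da (z + s *\<^sub>R a + t *\<^sub>R b)) has_real_derivative
     frechet_derivative ?Da (at (z + s *\<^sub>R a + t *\<^sub>R b)) b) (at t)"
    if "0 \<le> s" "s \<le> h" "0 \<le> t" "t \<le> h" for s t
  proof -
    have d: "(?Da has_derivative frechet_derivative ?Da (at (z + s *\<^sub>R a + t *\<^sub>R b))) (at (z + s *\<^sub>R a + t *\<^sub>R b))"
      using Ck_on_SucE(1)[OF u1 sub[OF that]] .
    have l: "linear (frechet_derivative ?Da (at (z + s *\<^sub>R a + t *\<^sub>R b)))"
      using d has_derivative_linear by blast
    have "((\<lambda>t. z + s *\<^sub>R a + t *\<^sub>R b) has_derivative (\<lambda>x. x *\<^sub>R b)) (at t)"
      by (auto intro!: derivative_eq_intros)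
    from diff_chain_at[OF this d] show ?thesis
      by (simp add: has_field_derivative_def o_def linear_cmul[OF l] mult_commute_abs)
  qed
  let ?G = "\<lambda>s. u (z + s *\<^sub>R a + h *\<^sub>R b) - u (z + s *\<^sub>R a + 0 *\<^sub>R b)"
  have "\<exists>s>0. s < h \<and> ?G h - ?G 0 = (h - 0) * (?Da (z + s *\<^sub>R a + h *\<^sub>R b) - ?Da (z + s *\<^sub>R a + 0 *\<^sub>R b))"
    by (rule MVT2[OF h]) (intro DERIV_diff da, use h in auto)
  then obtain s where s: "0 < s" "s < h"
    "?G h - ?G 0 = h * (?Da (z + s *\<^sub>R a + h *\<^sub>R b) - ?Da (z + s *\<^sub>R a + 0 *\<^sub>R b))" by auto
  have "\<exists>t>0. t < h \<and> ?Da (z + s *\<^sub>R a + h *\<^sub>R b) - ?Da (z + s *\<^sub>R a + 0 *\<^sub>R b)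
     = (h - 0) * frechet_derivative ?Da (at (z + s *\<^sub>R a + t *\<^sub>R b)) b"
    by (rule MVT2[OF h]) (intro db, use s in auto)
  then obtain t where t: "0 < t" "t < h" "?Da (z + s *\<^sub>R a + h *\<^sub>R b) - ?Da (z + s *\<^sub>R a + 0 *\<^sub>R b)
     = h * frechet_derivative ?Da (at (z + s *\<^sub>R a + t *\<^sub>R b)) b" by auto
  show ?thesis
    using s t by (intro exI[of _ s] exI[of _ t]) auto
qed

text \<open>The second difference is unchanged when \<open>a\<close> and \<open>b\<close> are
  exchanged, so the two mixed derivatives take equal values at two points arbitrarily close to
  \<open>z\<close>. Their continuity then gives equality at \<open>z\<close>.\<close>

lemma second_derivative_symmetric_real:
  fixes u :: "'a::real_normed_vector \<Rightarrow> real"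
  assumes S: "open S" and u: "Ck_on 2 S u" and z: "z \<in> S"
  shows "frechet_derivative (\<lambda>w. frechet_derivative u (at w) a) (at z) b
       = frechet_derivative (\<lambda>w. frechet_derivative u (at w) b) (at z) a"
proof (rule ccontr)
  let ?ab = "\<lambda>w. frechet_derivative (\<lambda>w. frechet_derivative u (at w) a) (at w) b"
  let ?ba = "\<lambda>w. frechet_derivative (\<lambda>w. frechet_derivative u (at w) b) (at w) a"
  assume ne: "?ab z \<noteq> ?ba z"
  have "continuous_on S ?ab" "continuous_on S ?ba"
    using Ck_on_SucE(2)[of "Suc 0" S u] Ck_on_SucE(2)[of 0 S "\<lambda>w. frechet_derivative u (at w) _"] u
    by (simp_all add: numeral_2_eq_2)
  then have c: "isCont ?ab z" "isCont ?ba z"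
    using S z by (simp_all add: continuous_on_eq_continuous_at)
  define e where "e = dist (?ab z) (?ba z) / 2"
  have e: "e > 0" using ne by (simp add: e_def)
  obtain d1 where d1: "d1 > 0" "\<And>w. dist w z < d1 \<Longrightarrow> dist (?ab w) (?ab z) < e"
    using c(1) e unfolding continuous_at_eps_delta by blast
  obtain d2 where d2: "d2 > 0" "\<And>w. dist w z < d2 \<Longrightarrow> dist (?ba w) (?ba z) < e"
    using c(2) e unfolding continuous_at_eps_delta by blast
  obtain d3 where d3: "d3 > 0" "ball z d3 \<subseteq> S" using S z open_contains_ball by blast
  define d where "d = min d1 (min d2 d3)"
  have d: "d > 0" using d1 d2 d3 by (simp add: d_def)
  \<comment> \<open>With this choice every point of both parallelograms is closer than
    \<open>d\<close> to \<open>z\<close>.\<close>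
  define h where "h = d / (2 * (norm a + norm b + 1))"
  have pos: "norm a + norm b + 1 > 0" by (simp add: add_nonneg_pos)
  have h: "h > 0" using d pos by (simp add: h_def)
  have near: "dist (z + s *\<^sub>R a' + t *\<^sub>R b') z < d"
    if "0 \<le> s" "s \<le> h" "0 \<le> t" "t \<le> h" "a' = a \<and> b' = b \<or> a' = b \<and> b' = a" for s t a' b'
  proof -
    have "norm (s *\<^sub>R a' + t *\<^sub>R b') \<le> s * norm a' + t * norm b'"
      using norm_triangle_ineq[of "s *\<^sub>R a'" "t *\<^sub>R b'"] that by simp
    also have "\<dots> \<le> h * norm a' + h * norm b'"
      using that by (intro add_mono mult_right_mono) auto
    also have "\<dots> \<le> h * (norm a + norm b + 1)" using that(5) h by (auto simp: algebra_simps)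
    also have "\<dots> = d / 2" using pos by (simp add: h_def divide_simps)
    also have "\<dots> < d" using d by simp
    finally show ?thesis by (simp add: dist_norm add.assoc)
  qed
  then have sub: "z + s *\<^sub>R a' + t *\<^sub>R b' \<in> S"
    if "0 \<le> s" "s \<le> h" "0 \<le> t" "t \<le> h" "a' = a \<and> b' = b \<or> a' = b \<and> b' = a" for s t a' b'
    using near[OF that] d3 by (auto simp: d_def dist_commute)
  obtain s t where st: "0 \<le> s" "s \<le> h" "0 \<le> t" "t \<le> h"
    "u (z + h *\<^sub>R a + h *\<^sub>R b) - u (z + h *\<^sub>R a) - u (z + h *\<^sub>R b) + u z = h * h * ?ab (z + s *\<^sub>R a + t *\<^sub>R b)"
    using second_difference_mvt[OF u h sub, of a b] by auto
  obtain s' t' where st': "0 \<le> s'" "s' \<le> h" "0 \<le> t'" "t' \<le> h"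
    "u (z + h *\<^sub>R b + h *\<^sub>R a) - u (z + h *\<^sub>R b) - u (z + h *\<^sub>R a) + u z = h * h * ?ba (z + s' *\<^sub>R b + t' *\<^sub>R a)"
    using second_difference_mvt[OF u h sub, of b a] by auto
  have "h * h * ?ab (z + s *\<^sub>R a + t *\<^sub>R b) = h * h * ?ba (z + s' *\<^sub>R b + t' *\<^sub>R a)"
    using st(5) st'(5) by (simp add: algebra_simps)
  then have "?ab (z + s *\<^sub>R a + t *\<^sub>R b) = ?ba (z + s' *\<^sub>R b + t' *\<^sub>R a)"
    using h by simp
  moreover have "dist (?ab (z + s *\<^sub>R a + t *\<^sub>R b)) (?ab z) < e"
    by (rule d1(2)) (use near[OF st(1-4), of a b] in \<open>simp add: d_def\<close>)
  moreover have "dist (?ba (z + s' *\<^sub>R b + t' *\<^sub>R a)) (?ba z) < e"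
    by (rule d2(2)) (use near[OF st'(1-4), of b a] in \<open>simp add: d_def\<close>)
  ultimately have "dist (?ab z) (?ba z) < e + e"
    using dist_triangle3[of "?ab z" "?ba z" "?ab (z + s *\<^sub>R a + t *\<^sub>R b)"] by simp
  then show False by (simp add: e_def)
qed

text \<open>The mean value theorem used before is for real functions, so real and imaginary parts
  are treated separately through a bounded linear \<open>L\<close>.\<close>

lemma second_derivative_symmetric:
  fixes f :: "'a::real_normed_vector \<Rightarrow> complex"
  assumes S: "open S" and f: "Ck_on 2 S f" and z: "z \<in> S"
  shows "frechet_derivative (\<lambda>w. frechet_derivative f (at w) a) (at z) b
       = frechet_derivative (\<lambda>w. frechet_derivative f (at w) b) (at z) a"
proof -
  have *: "L (frechet_derivative (\<lambda>w. frechet_derivative f (at w) a) (at z) b)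
       = L (frechet_derivative (\<lambda>w. frechet_derivative f (at w) b) (at z) a)"
    if L: "bounded_linear L" for L :: "complex \<Rightarrow> real"
  proof -
    have 1: "frechet_derivative (\<lambda>w. L (f w)) (at w) a = L (frechet_derivative f (at w) a)" if "w \<in> S" for w a
      using bounded_linear.has_derivative[OF L Ck_on_SucE(1)[of 1 S f w]] f that
      by (intro frechet_derivative_eqI[THEN fun_cong]) (auto simp: numeral_2_eq_2)
    have 2: "frechet_derivative (\<lambda>w. frechet_derivative (\<lambda>w. L (f w)) (at w) a) (at z) b
       = L (frechet_derivative (\<lambda>w. frechet_derivative f (at w) a) (at z) b)" for a b
    proof -
      have "frechet_derivative (\<lambda>w. frechet_derivative (\<lambda>w. L (f w)) (at w) a) (at z)
         = frechet_derivative (\<lambda>w. L (frechet_derivative f (at w) a)) (at z)"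
        by (rule frechet_derivative_cong_open[OF S z 1])
      also have "\<dots> = (\<lambda>b. L (frechet_derivative (\<lambda>w. frechet_derivative f (at w) a) (at z) b))"
        by (intro frechet_derivative_eqI bounded_linear.has_derivative[OF L] Ck_on_SucE(1)[of 0 S] z
          Ck_on_SucE(2)) (use f in \<open>simp add: numeral_2_eq_2\<close>)
      finally show ?thesis by metis
    qed
    show ?thesis
      using second_derivative_symmetric_real[OF S Ck_on_bounded_linear_comp[OF L S f] z] by (simp add: 2)
  qed
  from *[OF bounded_linear_Re] *[OF bounded_linear_Im] show ?thesis by (simp add: complex_eq_iff)
qed

text \<open>Both sides expand into the same four mixed real derivatives. The lemma is the source of
  the Hermitian symmetry of the curvature.\<close>

lemma dz_dzbar_commute:
  assumes S: "open S" and f: "Ck_on 2 S f" and z: "z \<in> S"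
  shows "dz i (dzbar j f) z = dzbar j (dz i f) z"
proof -
  have d: "((\<lambda>w. frechet_derivative f (at w) a) has_derivative
     frechet_derivative (\<lambda>w. frechet_derivative f (at w) a) (at z)) (at z)" for a
    by (intro Ck_on_SucE(1)[of 0 S] z Ck_on_SucE(2)) (use f in \<open>simp add: numeral_2_eq_2\<close>)
  have 1: "(dz i f has_derivative (\<lambda>b. (frechet_derivative (\<lambda>w. frechet_derivative f (at w) (axis i 1)) (at z) b
     - \<i> * frechet_derivative (\<lambda>w. frechet_derivative f (at w) (axis i \<i>)) (at z) b) / 2)) (at z)"
    unfolding dz_def[abs_def]
    by (intro bounded_linear.has_derivative[OF bounded_linear_divide] has_derivative_diff
       bounded_linear.has_derivative[OF bounded_linear_mult_right] d)
  have 2: "(dzbar j f has_derivative (\<lambda>b. (frechet_derivative (\<lambda>w. frechet_derivative f (at w) (axis j 1)) (at z) b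
     + \<i> * frechet_derivative (\<lambda>w. frechet_derivative f (at w) (axis j \<i>)) (at z) b) / 2)) (at z)"
    unfolding dzbar_def[abs_def]
    by (intro bounded_linear.has_derivative[OF bounded_linear_divide] has_derivative_add
       bounded_linear.has_derivative[OF bounded_linear_mult_right] d)
  note sym = second_derivative_symmetric[OF S f z]
  show ?thesis
    unfolding dzbar_eqI[OF 1] dz_eqI[OF 2]
    unfolding sym[of "axis j _"]
    by (simp add: field_simps)
qed

section \<open>Powers of the fundamental form and determinants\<close>

definition less_sign :: "'a::linorder \<Rightarrow> 'a \<Rightarrow> complex" where
  "less_sign x y = (if x < y then 1 else - 1)"

text \<open>The sign is computed from inversions because this makes sense for bijections between two
  different index sets, as they occur in minors. On permutations of the whole type it agrees with
  \<open>sign\<close>.\<close>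

definition perm_sign :: "'a::linorder set \<Rightarrow> ('a \<Rightarrow> 'b::linorder) \<Rightarrow> complex" where
  "perm_sign I \<sigma> = (\<Prod>(a, b) \<in> {(a, b). a \<in> I \<and> b \<in> I \<and> a < b}. less_sign (\<sigma> a) (\<sigma> b))"

text \<open>The sign of moving \<open>i\<close> to the front of the sorted set \<open>I\<close>. The
  product for a row and a column is the checkerboard sign of the Laplace expansion.\<close>

definition rank_sign :: "'a::linorder set \<Rightarrow> 'a \<Rightarrow> complex" where
  "rank_sign I i = (-1) ^ card {a \<in> I. a < i}"

lemma rank_sign_prod:
  assumes "finite I" "i \<in> I"
  shows "rank_sign I i = (\<Prod>a\<in>I - {i}. less_sign i a)"
proof -
  have "(\<Prod>a\<in>I - {i}. less_sign i a) = (\<Prod>a\<in>{a \<in> I - {i}. a < i}. less_sign i a) * (\<Prod>a\<in>{a \<in> I - {i}. \<not> a < i}. less_sign i a)"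
    using assms by (subst prod.union_disjoint[symmetric]) (auto intro!: prod.cong)
  also have "(\<Prod>a\<in>{a \<in> I - {i}. \<not> a < i}. less_sign i a) = 1"
    by (intro prod.neutral) (auto simp: less_sign_def)
  also have "(\<Prod>a\<in>{a \<in> I - {i}. a < i}. less_sign i a) = (\<Prod>a\<in>{a \<in> I. a < i}. -1)"
    by (rule prod.cong) (auto simp: less_sign_def)
  finally show ?thesis by (simp add: rank_sign_def)
qed

lemma rank_sign_square [simp]: "rank_sign I i * rank_sign I i = 1"
  by (simp add: rank_sign_def power_add[symmetric] mult_2[symmetric])

lemma less_sign_swap: "x \<noteq> y \<Longrightarrow> less_sign y x = - less_sign x y"
  by (auto simp: less_sign_def)

lemma less_sign_square [simp]: "less_sign x y * less_sign x y = 1"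
  by (auto simp: less_sign_def)

text \<open>Only the pairs containing \<open>i\<close> are lost. Those with the other element below
  \<open>i\<close> are oriented the wrong way, and reversing them costs
  \<open>rank_sign I i\<close>; what is left compares \<open>\<sigma> i\<close> with all other
  elements of \<open>J\<close>.\<close>

lemma perm_sign_remove:
  assumes I: "finite I" "i \<in> I" and \<sigma>: "bij_betw \<sigma> I J"
  shows "perm_sign I \<sigma> = rank_sign I i * rank_sign J (\<sigma> i) * perm_sign (I - {i}) \<sigma>"
proof -
  have inj: "inj_on \<sigma> I" and J: "J = \<sigma> ` I" using \<sigma> by (auto simp: bij_betw_def)
  let ?f = "\<lambda>(a, b). less_sign (\<sigma> a) (\<sigma> b)"
  let ?R = "{(a, b). a \<in> I - {i} \<and> b \<in> I - {i} \<and> a < b}"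
  let ?L = "{a \<in> I. a < i}" and ?U = "{a \<in> I. i < a}"
  have fin: "finite {(a, b). a \<in> I \<and> b \<in> I \<and> a < b}"
    by (rule finite_subset[of _ "I \<times> I"]) (use I in auto)
  have split: "{(a, b). a \<in> I \<and> b \<in> I \<and> a < b} = ?R \<union> ((\<lambda>a. (a, i)) ` ?L \<union> (\<lambda>b. (i, b)) ` ?U)"
    using I by auto
  have finR: "finite ?R" by (rule finite_subset[OF _ fin]) auto
  have "perm_sign I \<sigma> = perm_sign (I - {i}) \<sigma> * (prod ?f ((\<lambda>a. (a, i)) ` ?L) * prod ?f ((\<lambda>b. (i, b)) ` ?U))"
    unfolding perm_sign_def split
    using I finR by (subst prod.union_disjoint, simp, simp, force, subst prod.union_disjoint) auto
  also have "prod ?f ((\<lambda>b. (i, b)) ` ?U) = (\<Prod>b\<in>?U. less_sign (\<sigma> i) (\<sigma> b))"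
    by (subst prod.reindex) (auto simp: inj_on_def)
  also have "prod ?f ((\<lambda>a. (a, i)) ` ?L) = (\<Prod>a\<in>?L. less_sign (\<sigma> a) (\<sigma> i))"
    by (subst prod.reindex) (auto simp: inj_on_def)
  also have "(\<Prod>a\<in>?L. less_sign (\<sigma> a) (\<sigma> i)) = (\<Prod>a\<in>?L. (- 1) * less_sign (\<sigma> i) (\<sigma> a))"
  proof (rule prod.cong[OF refl])
    fix a assume "a \<in> ?L"
    then have "\<sigma> a \<noteq> \<sigma> i" using inj I(2) by (auto dest: inj_onD)
    then show "less_sign (\<sigma> a) (\<sigma> i) = (- 1) * less_sign (\<sigma> i) (\<sigma> a)" using less_sign_swap[of "\<sigma> i" "\<sigma> a"] by simp
  qed
  also have "\<dots> = rank_sign I i * (\<Prod>a\<in>?L. less_sign (\<sigma> i) (\<sigma> a))"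
    by (simp only: prod.distrib prod_constant rank_sign_def)
  also have "rank_sign I i * (\<Prod>a\<in>?L. less_sign (\<sigma> i) (\<sigma> a)) * (\<Prod>b\<in>?U. less_sign (\<sigma> i) (\<sigma> b))
     = rank_sign I i * (\<Prod>a\<in>I - {i}. less_sign (\<sigma> i) (\<sigma> a))"
  proof -
    have "I - {i} = ?L \<union> ?U" by auto
    then have "(\<Prod>a\<in>I - {i}. less_sign (\<sigma> i) (\<sigma> a)) =
        (\<Prod>a\<in>?L. less_sign (\<sigma> i) (\<sigma> a)) * (\<Prod>b\<in>?U. less_sign (\<sigma> i) (\<sigma> b))"
      using prod.union_disjoint[of ?L ?U "\<lambda>a. less_sign (\<sigma> i) (\<sigma> a)"] I(1) by force
    then show ?thesis by (simp only: mult.assoc)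
  qed
  also have "(\<Prod>a\<in>I - {i}. less_sign (\<sigma> i) (\<sigma> a)) = (\<Prod>c\<in>J - {\<sigma> i}. less_sign (\<sigma> i) c)"
  proof -
    have "J - {\<sigma> i} = \<sigma> ` (I - {i})" using inj I J by (auto dest: inj_onD)
    moreover have "inj_on \<sigma> (I - {i})" using inj by (rule inj_on_subset) auto
    ultimately show ?thesis by (simp add: prod.reindex)
  qed
  also have "\<dots> = rank_sign J (\<sigma> i)"
    by (rule rank_sign_prod[symmetric]) (use I J in auto)
  finally show ?thesis by (simp add: mult_ac)
qed

lemma perm_sign_ident: "(\<And>x. x \<in> I \<Longrightarrow> \<sigma> x = x) \<Longrightarrow> perm_sign I \<sigma> = 1"
  unfolding perm_sign_def by (intro prod.neutral) (auto simp: less_sign_def)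

text \<open>Removing \<open>x\<close> and then \<open>y\<close> leaves the identity. The four rank
  signs cancel in pairs up to one factor -1: once \<open>x\<close> is removed, one element fewer
  lies below \<open>y\<close>.\<close>

lemma perm_sign_transpose:
  fixes x y :: "'a::{finite,linorder}"
  assumes "x < y"
  shows "perm_sign UNIV (Transposition.transpose x y) = - 1"
proof -
  let ?t = "Transposition.transpose x y"
  have b: "bij_betw ?t (UNIV - {x}) (UNIV - {y})"
    by (rule bij_betw_byWitness[where f' = ?t]) (auto simp: Transposition.transpose_def)
  have "perm_sign UNIV ?t = rank_sign UNIV x * rank_sign UNIV (?t x) * perm_sign (UNIV - {x}) ?t"
    by (rule perm_sign_remove) auto
  also have "perm_sign (UNIV - {x}) ?t = rank_sign (UNIV - {x}) y * rank_sign (UNIV - {y}) (?t y) * perm_sign (UNIV - {x} - {y}) ?t"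
    by (rule perm_sign_remove[OF _ _ b]) (use assms in auto)
  also have "perm_sign (UNIV - {x} - {y}) ?t = 1"
    by (rule perm_sign_ident) (auto simp: Transposition.transpose_def)
  also have "rank_sign (UNIV - {y}) (?t y) = rank_sign UNIV x"
    unfolding rank_sign_def using assms by (intro arg_cong[where f = "\<lambda>A. (-1) ^ card A"]) auto
  also have "rank_sign (UNIV - {x}) y = - rank_sign UNIV (?t x)"
  proof -
    have "{a \<in> UNIV. a < y} = insert x {a \<in> UNIV - {x}. a < y}" using assms by auto
    then show ?thesis by (simp add: rank_sign_def)
  qed
  finally have "perm_sign UNIV ?t = - ((rank_sign UNIV x * rank_sign UNIV x) * (rank_sign UNIV (?t x) * rank_sign UNIV (?t x)))"
    by (simp only: mult_ac mult_minus_left mult_minus_right mult_1_right mult_1_left)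
  then show ?thesis by (simp only: rank_sign_square mult_1_right)
qed

text \<open>The product of \<open>less_sign (q a) (q b)\<close> and \<open>less_sign a b\<close> is
  unchanged by swapping \<open>a\<close> and \<open>b\<close>. It is therefore a function of
  unordered pairs, and \<open>p\<close> permutes these; \<open>?h p\<close> is this action when the
  smaller element of a pair is listed first.\<close>

lemma perm_sign_compose:
  fixes p q :: "'a::{finite,linorder} \<Rightarrow> 'a"
  assumes p: "bij p" and q: "bij q"
  shows "perm_sign UNIV (q \<circ> p) = perm_sign UNIV q * perm_sign UNIV p"
proof -
  let ?P = "{(a, b). a \<in> (UNIV :: 'a set) \<and> b \<in> UNIV \<and> a < b}"
  let ?t = "\<lambda>(a, b). less_sign (q a) (q b) * less_sign a b"
  let ?h = "\<lambda>p (a, b). if p a < p b then (p a, p b) else (p b, p a :: 'a)"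
  have sym: "?t (a, b) = ?t (b, a)" for a b
  proof (cases "a = b")
    case False
    then have "q a \<noteq> q b" using q by (auto simp: bij_def inj_def)
    then have "less_sign (q b) (q a) = - less_sign (q a) (q b)" by (rule less_sign_swap)
    moreover have "less_sign b a = - less_sign a b" using False by (rule less_sign_swap)
    ultimately show ?thesis by simp
  qed simp
  have hh: "?h (inv p) (?h p x) = x" "?h p x \<in> ?P" if pb: "bij p" and xP: "x \<in> ?P" for p :: "'a \<Rightarrow> 'a" and x
  proof -
    obtain a b where x: "x = (a, b)" "a < b" using xP by blast
    have iv: "inv p (p c) = c" for c using pb by (simp add: bij_is_inj)
    have "p a \<noteq> p b" using x(2) iv by (metis less_irrefl)
    then consider "p a < p b" | "p b < p a" "\<not> p a < p b" by fastforce
    then have c: "?h (inv p) (?h p x) = x \<and> ?h p x \<in> ?P"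
    proof cases
      case 1
      then show ?thesis using x iv by simp
    next
      case 2
      moreover have "\<not> b < a" using x by simp
      ultimately show ?thesis using x iv by simp
    qed
    show "?h (inv p) (?h p x) = x" by (rule conjunct1[OF c])
    show "?h p x \<in> ?P" by (rule conjunct2[OF c])
  qed
  have ip: "bij (inv p)" "inv (inv p) = p" using p by (auto simp: bij_imp_bij_inv inv_inv_eq)
  have "(\<Prod>x\<in>?P. ?t (?h p x)) = (\<Prod>x\<in>?P. ?t x)"
    by (rule prod.reindex_bij_witness[where i = "?h (inv p)" and j = "?h p"])
       (erule hh(1)[OF p], erule hh(2)[OF p], erule hh(1)[OF ip(1), unfolded ip(2)], erule hh(2)[OF ip(1)], rule refl)
  moreover have "?t (?h p x) = ?t (p (fst x), p (snd x))" for x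
    using sym by (cases x) auto
  ultimately have "(\<Prod>x\<in>?P. ?t (p (fst x), p (snd x))) = (\<Prod>x\<in>?P. ?t x)" by simp
  moreover have "(\<Prod>x\<in>?P. ?t x) = perm_sign UNIV q"
    unfolding perm_sign_def by (rule prod.cong) (auto simp: less_sign_def)
  moreover have "perm_sign UNIV (q \<circ> p) = (\<Prod>x\<in>?P. ?t (p (fst x), p (snd x)) * less_sign (p (fst x)) (p (snd x)))"
    unfolding perm_sign_def by (rule prod.cong) (auto simp: mult.assoc)
  moreover have "(\<Prod>x\<in>?P. less_sign (p (fst x)) (p (snd x))) = perm_sign UNIV p"
    unfolding perm_sign_def by (rule prod.cong) auto
  ultimately show ?thesis by (simp only: prod.distrib)
qed

text \<open>Both signs are multiplicative and equal to -1 on transpositions.\<close>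

lemma perm_sign_eq_sign:
  fixes p :: "'a::{finite,linorder} \<Rightarrow> 'a"
  assumes "p permutes UNIV"
  shows "perm_sign UNIV p = of_int (sign p)"
  using assms finite[of UNIV]
proof (induction rule: permutes_induct)
  case id
  then show ?case by (simp add: perm_sign_ident)
next
  case (swap a b p)
  have t: "perm_sign UNIV (Transposition.transpose a b) = - 1"
    using perm_sign_transpose[of a b] perm_sign_transpose[of b a] \<open>a \<noteq> b\<close>
    by (metis linorder_neqE transpose_commute)
  have "permutation p" "permutation (Transposition.transpose a b)"
    using permutes_imp_permutation[OF finite \<open>p permutes UNIV\<close>] permutation_swap_id by auto
  then have "sign (Transposition.transpose a b \<circ> p) = - sign p"
    using sign_compose[of "Transposition.transpose a b" p] sign_swap_id[of a b] \<open>a \<noteq> b\<close>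
    by (simp only: if_False mult_minus1)
  moreover have "perm_sign UNIV (Transposition.transpose a b \<circ> p) = perm_sign UNIV (Transposition.transpose a b) * perm_sign UNIV p"
    by (rule perm_sign_compose[OF permutes_bij[OF \<open>p permutes UNIV\<close>] bij_transpose])
  ultimately show ?case
    using t swap.IH by (simp only: of_int_minus) simp
qed

text \<open>The determinant of the submatrix with rows \<open>I\<close> and columns
  \<open>J\<close>. Extensional functions make each bijection count exactly once.\<close>

definition minor :: "('n::{finite,linorder} \<Rightarrow> 'n \<Rightarrow> complex) \<Rightarrow> 'n set \<Rightarrow> 'n set \<Rightarrow> complex" where
  "minor G I J = (\<Sum>\<sigma> \<in> {\<sigma> \<in> I \<rightarrow>\<^sub>E J. bij_betw \<sigma> I J}. perm_sign I \<sigma> * (\<Prod>i\<in>I. G i (\<sigma> i)))"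

lemma perm_sign_cong: "(\<And>x. x \<in> I \<Longrightarrow> \<sigma> x = \<tau> x) \<Longrightarrow> perm_sign I \<sigma> = perm_sign I \<tau>"
  unfolding perm_sign_def by (rule prod.cong) auto

lemma minor_empty: "minor G {} ({} :: 'n::{finite,linorder} set) = 1"
proof -
  have e: "{\<sigma> \<in> ({} :: 'n set) \<rightarrow>\<^sub>E {}. bij_betw \<sigma> {} ({} :: 'n set)} = {\<lambda>x. undefined}"
    by (auto simp: bij_betw_def)
  show ?thesis unfolding minor_def e by (simp add: perm_sign_def)
qed

text \<open>Bijections of \<open>I\<close> onto \<open>J\<close> that send \<open>i\<close> to
  \<open>j\<close> correspond by restriction to bijections of the smaller sets, and
  \<open>perm_sign_remove\<close> supplies the sign.\<close>

lemma minor_laplace: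
  fixes G :: "'n::{finite,linorder} \<Rightarrow> 'n \<Rightarrow> complex"
  assumes i: "i \<in> I"
  shows "(\<Sum>j\<in>J. rank_sign I i * rank_sign J j * G i j * minor G (I - {i}) (J - {j})) = minor G I J"
proof -
  let ?B = "\<lambda>I J. {\<sigma> \<in> I \<rightarrow>\<^sub>E J. bij_betw \<sigma> I (J :: 'n set)}"
  have fB: "finite (?B I J)" for I J :: "'n set" by simp
  have "(\<Sum>j\<in>J. rank_sign I i * rank_sign J j * G i j * minor G (I - {i}) (J - {j}))
     = (\<Sum>(j, \<sigma>)\<in>Sigma J (\<lambda>j. ?B (I - {i}) (J - {j})).
         rank_sign I i * rank_sign J j * G i j * (perm_sign (I - {i}) \<sigma> * (\<Prod>k\<in>I - {i}. G k (\<sigma> k))))"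
    unfolding minor_def sum_distrib_left by (subst sum.Sigma) (auto simp: fB)
  also have "\<dots> = (\<Sum>\<sigma> \<in> ?B I J. perm_sign I \<sigma> * (\<Prod>i\<in>I. G i (\<sigma> i)))"
  proof (rule sum.reindex_bij_witness[where i = "\<lambda>\<sigma>. (\<sigma> i, restrict \<sigma> (I - {i}))" and j = "\<lambda>(j, \<sigma>). \<sigma>(i := j)"])
    fix \<sigma> assume \<sigma>: "\<sigma> \<in> ?B I J"
    then have ex: "\<sigma> \<in> extensional I" by (auto simp: PiE_def)
    show "(case (\<sigma> i, restrict \<sigma> (I - {i})) of (j, \<sigma>) \<Rightarrow> \<sigma>(i := j)) = \<sigma>"
      using ex i by (auto simp: fun_eq_iff extensional_def)
    have "bij_betw \<sigma> (I - {i}) (J - {\<sigma> i})"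
      using \<sigma> i by (intro bij_betw_DiffI) (auto simp: bij_betw_def)
    then show "(\<sigma> i, restrict \<sigma> (I - {i})) \<in> Sigma J (\<lambda>j. ?B (I - {i}) (J - {j}))"
      using \<sigma> i by (auto simp: bij_betw_def PiE_def cong: bij_betw_cong)
  next
    fix x assume x: "x \<in> Sigma J (\<lambda>j. ?B (I - {i}) (J - {j}))"
    obtain j \<sigma> where [simp]: "x = (j, \<sigma>)" by (cases x)
    have \<sigma>: "bij_betw \<sigma> (I - {i}) (J - {j})" "\<sigma> \<in> extensional (I - {i})" and j: "j \<in> J"
      using x by (auto simp: PiE_def)
    have b: "bij_betw (\<sigma>(i := j)) I J"
    proof -
      have "bij_betw (\<sigma>(i := j)) (I - {i}) (J - {j})"
        using \<sigma>(1) bij_betw_cong[of "I - {i}" "\<sigma>(i := j)" \<sigma> "J - {j}"] by simp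
      then have "bij_betw (\<sigma>(i := j)) ((I - {i}) \<union> {i}) ((J - {j}) \<union> {j})"
        by (rule bij_betw_combine) auto
      moreover have "(I - {i}) \<union> {i} = I" "(J - {j}) \<union> {j} = J" using i j by auto
      ultimately show ?thesis by simp
    qed
    then show "(case x of (j, \<sigma>) \<Rightarrow> \<sigma>(i := j)) \<in> ?B I J"
      using \<sigma>(2) i by (auto simp: PiE_def extensional_def bij_betw_def)
    show "((case x of (j, \<sigma>) \<Rightarrow> \<sigma>(i := j)) i, restrict (case x of (j, \<sigma>) \<Rightarrow> \<sigma>(i := j)) (I - {i})) = x"
      using \<sigma>(2) by (auto simp: fun_eq_iff extensional_def)
    have p: "perm_sign I (\<sigma>(i := j)) = rank_sign I i * rank_sign J j * perm_sign (I - {i}) \<sigma>"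
      using perm_sign_remove[OF finite i b] perm_sign_cong[of "I - {i}" "\<sigma>(i := j)" \<sigma>] by simp
    have "(\<Prod>k\<in>I. G k ((\<sigma>(i := j)) k)) = G i j * (\<Prod>k\<in>I - {i}. G k (\<sigma> k))"
      using i by (subst prod.remove[of I i]) auto
    then show "perm_sign I (case x of (j, \<sigma>) \<Rightarrow> \<sigma>(i := j)) * (\<Prod>ia\<in>I. G ia ((case x of (j, \<sigma>) \<Rightarrow> \<sigma>(i := j)) ia))
      = (case x of (j, \<sigma>) \<Rightarrow> rank_sign I i * rank_sign J j * G i j * (perm_sign (I - {i}) \<sigma> * (\<Prod>k\<in>I - {i}. G k (\<sigma> k))))"
      using p by (simp add: mult_ac)
  qed
  finally show ?thesis by (simp add: minor_def)
qed

lemma minor_UNIV: "minor G UNIV UNIV = det (\<chi> i j. G i j)"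
  unfolding minor_def det_def
proof (rule sum.cong)
  have "bij \<sigma> \<longleftrightarrow> \<sigma> permutes UNIV" for \<sigma> :: "'a \<Rightarrow> 'a"
    using bij_imp_permutes[of \<sigma> UNIV] permutes_bij[of \<sigma> UNIV] by blast
  then show "{\<sigma> \<in> UNIV \<rightarrow>\<^sub>E UNIV. bij_betw \<sigma> UNIV UNIV} = {p. p permutes (UNIV :: 'a set)}"
    by (simp add: PiE_UNIV_domain)
qed (simp add: perm_sign_eq_sign)

lemma minor_row_cong:
  "(\<And>k l. k \<in> I \<Longrightarrow> l \<in> J \<Longrightarrow> G k l = G' k l) \<Longrightarrow> minor G I J = minor G' I J"
  unfolding minor_def by (intro sum.cong refl arg_cong2[where f="(*)"] prod.cong) (auto simp: PiE_def Pi_def)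

subsection \<open>Coefficients of the wedge powers\<close>

lemma wedge_gen_gen:
  "wedge (gen a) (gen b) z S = (if a \<noteq> b \<and> S = {a, b} then shuffle_sign {a} {b} else 0)"
proof -
  have "wedge (gen a) (gen b) z S = (\<Sum>T\<in>Pow S. if T = {a} then (if S - {a} = {b} then shuffle_sign {a} {b} else 0) else 0)"
    unfolding wedge_def gen_def by (rule sum.cong) auto
  also have "\<dots> = (if a \<noteq> b \<and> S = {a, b} then shuffle_sign {a} {b} else 0)"
    by (auto simp: sum.delta)
  finally show ?thesis .
qed

lemma shuffle_sign_Inl_Inr [simp]: "shuffle_sign {Inl i} {Inr j} = 1"
proof -
  have *: "{(a, b). a \<in> {Inl i} \<and> b \<in> {Inr j :: 'a + 'a} \<and> gen_less b a} = {}" by auto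
  show ?thesis unfolding shuffle_sign_def * by simp
qed

lemma shuffle_sign_insert:
  fixes S :: "('n::{finite,linorder} + 'n) set"
  assumes "a \<notin> A"
  shows "shuffle_sign (insert a A) S = shuffle_sign {a} S * shuffle_sign A S"
proof -
  have "{(x, b). x \<in> insert a A \<and> b \<in> S \<and> gen_less b x} =
     {(x, b). x \<in> {a} \<and> b \<in> S \<and> gen_less b x} \<union> {(x, b). x \<in> A \<and> b \<in> S \<and> gen_less b x}" by auto
  moreover have "card ({(x, b). x \<in> {a} \<and> b \<in> S \<and> gen_less b x} \<union> {(x, b). x \<in> A \<and> b \<in> S \<and> gen_less b x})
    = card {(x, b). x \<in> {a} \<and> b \<in> S \<and> gen_less b x} + card {(x, b). x \<in> A \<and> b \<in> S \<and> gen_less b x}"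
    by (rule card_Un_disjoint) (use assms in \<open>auto intro: finite_subset[OF subset_UNIV finite]\<close>)
  ultimately show ?thesis unfolding shuffle_sign_def by (simp only: power_add)
qed

lemma shuffle_sign_Inl:
  fixes I J :: "'n::{finite,linorder} set"
  shows "shuffle_sign {Inl i} (I <+> J) = rank_sign I i"
proof -
  have "{(a, b). a \<in> {Inl i} \<and> b \<in> I <+> J \<and> gen_less b a} = (\<lambda>k. (Inl i, Inl k)) ` {k \<in> I. k < i}"
    by (auto simp: Plus_def)
  then show ?thesis unfolding shuffle_sign_def rank_sign_def by (simp add: card_image inj_on_def)
qed

lemma shuffle_sign_Inr:
  fixes I J :: "'n::{finite,linorder} set"
  shows "shuffle_sign {Inr j} (I <+> J) = (- 1) ^ card I * rank_sign J j"
proof -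
  have "{(a, b). a \<in> {Inr j} \<and> b \<in> I <+> J \<and> gen_less b a} = (\<lambda>k. (Inr j, Inl k)) ` I \<union> (\<lambda>k. (Inr j, Inr k)) ` {k \<in> J. k < j}"
    by (auto simp: Plus_def)
  moreover have "card ((\<lambda>k. (Inr j :: 'n + 'n, Inl k :: 'n + 'n)) ` I \<union> (\<lambda>k. (Inr j, Inr k)) ` {k \<in> J. k < j})
     = card I + card {k \<in> J. k < j}"
    by (subst card_Un_disjoint) (auto simp: card_image inj_on_def)
  ultimately show ?thesis unfolding shuffle_sign_def rank_sign_def by (simp add: power_add)
qed

lemma metric_form_eq:
  "metric_form g c z S = (\<Sum>i\<in>UNIV. \<Sum>j\<in>UNIV. if S = {Inl i, Inr j} then \<i> * g c z $ i $ j else 0)"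
  unfolding metric_form_def wedge_gen_gen by (intro sum.cong refl) auto

text \<open>Only sets \<open>{Inl i, Inr j}\<close> carry a coefficient of the metric form. The sign
  comes from sorting \<open>dz^i\<close> among the other \<open>dz\<close>, and
  \<open>dzbar^j\<close> first past the \<open>card I - 1\<close> remaining \<open>dz\<close> and
  then among the \<open>dzbar\<close>.\<close>

lemma wedge_metric_form:
  "wedge (metric_form g c) \<beta> z (I <+> J) =
    (\<Sum>i\<in>I. \<Sum>j\<in>J. \<i> * g c z $ i $ j * rank_sign I i * rank_sign J j * (-1) ^ (card I - 1) * \<beta> z ((I - {i}) <+> (J - {j})))"
proof -
  let ?S = "I <+> J"
  have "wedge (metric_form g c) \<beta> z ?S = (\<Sum>T\<in>Pow ?S. \<Sum>i\<in>UNIV. \<Sum>j\<in>UNIV.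
     if T = {Inl i, Inr j} then shuffle_sign T (?S - T) * (\<i> * g c z $ i $ j) * \<beta> z (?S - T) else 0)"
    unfolding wedge_def metric_form_eq sum_distrib_left sum_distrib_right
    by (intro sum.cong refl) auto
  also have "\<dots> = (\<Sum>i\<in>UNIV. \<Sum>j\<in>UNIV. \<Sum>T\<in>Pow ?S.
     if T = {Inl i, Inr j} then shuffle_sign T (?S - T) * (\<i> * g c z $ i $ j) * \<beta> z (?S - T) else 0)"
    by (subst sum.swap, intro sum.cong refl) (rule sum.swap)
  also have "\<dots> = (\<Sum>i\<in>UNIV. \<Sum>j\<in>UNIV. if i \<in> I \<and> j \<in> J then
      \<i> * g c z $ i $ j * rank_sign I i * rank_sign J j * (-1) ^ (card I - 1) * \<beta> z ((I - {i}) <+> (J - {j})) else 0)"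
  proof (intro sum.cong refl)
    fix i j
    have eq: "(\<Sum>T\<in>Pow ?S. if T = {Inl i, Inr j} then shuffle_sign T (?S - T) * (\<i> * g c z $ i $ j) * \<beta> z (?S - T) else 0)
       = (if {Inl i, Inr j} \<subseteq> ?S then shuffle_sign {Inl i, Inr j} (?S - {Inl i, Inr j}) * (\<i> * g c z $ i $ j) * \<beta> z (?S - {Inl i, Inr j}) else 0)"
      by (subst sum.delta) auto
    have d: "?S - {Inl i, Inr j} = (I - {i}) <+> (J - {j})" by auto
    have r: "rank_sign (I - {i}) i = rank_sign I i" "rank_sign (J - {j}) j = rank_sign J j"
      unfolding rank_sign_def by (auto intro!: arg_cong[where f = "\<lambda>A. (-1) ^ card A"])
    have "shuffle_sign {Inl i, Inr j} ((I - {i}) <+> (J - {j})) = rank_sign I i * rank_sign J j * (-1) ^ (card I - 1)" if "i \<in> I"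
      using that by (subst shuffle_sign_insert) (simp_all add: shuffle_sign_Inl shuffle_sign_Inr r)
    then show "(\<Sum>T\<in>Pow ?S. if T = {Inl i, Inr j} then shuffle_sign T (?S - T) * (\<i> * g c z $ i $ j) * \<beta> z (?S - T) else 0) =
       (if i \<in> I \<and> j \<in> J then
      \<i> * g c z $ i $ j * rank_sign I i * rank_sign J j * (-1) ^ (card I - 1) * \<beta> z ((I - {i}) <+> (J - {j})) else 0)"
      unfolding eq d by (auto simp: mult_ac)
  qed
  also have "\<dots> = (\<Sum>i\<in>I. \<Sum>j\<in>J. \<i> * g c z $ i $ j * rank_sign I i * rank_sign J j * (-1) ^ (card I - 1) * \<beta> z ((I - {i}) <+> (J - {j})))"
  proof -
    have "(\<Sum>i\<in>UNIV. \<Sum>j\<in>UNIV. if i \<in> I \<and> j \<in> J then f i j else 0) = (\<Sum>i\<in>I. \<Sum>j\<in>J. f i j)"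
      for f :: "'a \<Rightarrow> 'a \<Rightarrow> complex"
    proof -
      have "(\<Sum>j\<in>UNIV. if i \<in> I \<and> j \<in> J then f i j else 0) = (if i \<in> I then \<Sum>j\<in>J. f i j else 0)" for i
        by (simp add: sum.If_cases)
      then show ?thesis by (simp add: sum.If_cases)
    qed
    then show ?thesis .
  qed
  finally show ?thesis .
qed

text \<open>The power of \<open>\<i>\<close> stems from the factor \<open>\<i>\<close> in the metric
  form, the other sign from sorting alternating \<open>dz\<close> and \<open>dzbar\<close> so that
  all \<open>dz\<close> come first.\<close>

definition form_const :: "nat \<Rightarrow> complex" where
  "form_const k = \<i> ^ k * (- 1) ^ (k * (k - 1) div 2)"

lemma form_const_Suc: "form_const (Suc k) = \<i> * (-1) ^ k * form_const k"
proof -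
  have "Suc k * k div 2 = k + k * (k - 1) div 2"
    by (cases k) (auto simp: algebra_simps)
  then show ?thesis by (simp add: form_const_def power_add mult_ac)
qed

lemma wedge_pow_metric_form:
  assumes "card I = k" "card J = k"
  shows "wedge_pow (metric_form g c) k z (I <+> J) = form_const k * fact k * minor (\<lambda>i j. g c z $ i $ j) I J"
  using assms
proof (induction k arbitrary: I J)
  case 0
  then have [simp]: "I = {}" "J = {}" by auto
  show ?case by (simp add: minor_empty zero_form_def form_const_def)
next
  case (Suc k)
  let ?G = "\<lambda>i j. g c z $ i $ j"
  have "wedge_pow (metric_form g c) (Suc k) z (I <+> J) =
    (\<Sum>i\<in>I. \<Sum>j\<in>J. \<i> * g c z $ i $ j * rank_sign I i * rank_sign J j * (-1) ^ k
       * (form_const k * fact k * minor ?G (I - {i}) (J - {j})))"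
    using Suc.prems by (simp add: wedge_metric_form Suc.IH)
  also have "\<dots> = (\<Sum>i\<in>I. form_const (Suc k) * fact k * (\<Sum>j\<in>J. rank_sign I i * rank_sign J j * ?G i j * minor ?G (I - {i}) (J - {j})))"
    unfolding sum_distrib_left form_const_Suc by (intro sum.cong refl) (simp add: mult_ac)
  \<comment> \<open>Every one of the \<open>k + 1\<close> rows in \<open>I\<close> yields a Laplace
    expansion of the same minor, which turns \<open>k!\<close> into \<open>(k + 1)!\<close>.\<close>
  also have "\<dots> = (\<Sum>i\<in>I. form_const (Suc k) * fact k * minor ?G I J)"
    by (intro sum.cong refl arg_cong[where f = "\<lambda>x. form_const (Suc k) * fact k * x"] minor_laplace)
  also have "\<dots> = form_const (Suc k) * fact (Suc k) * minor ?G I J"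
    using Suc.prems by (simp add: mult_ac)
  finally show ?case .
qed

lemma wedge_pow_metric_form_top:
  fixes g :: "('m, 'n::{finite,linorder}) metric_tensor"
  shows "wedge_pow (metric_form g c) CARD('n) z UNIV = form_const CARD('n) * fact CARD('n) * det (g c z)"
  using wedge_pow_metric_form[of "UNIV :: 'n set" "CARD('n)" "UNIV :: 'n set" g c z] by (simp add: minor_UNIV UNIV_Plus_UNIV)

text \<open>The sorting signs of \<open>form_const\<close> and of the orientation cancel, and
  \<open>(-2 i) i = 2\<close>. Integration against the top power of the form thus becomes
  integration against a positive constant times \<open>det g\<close>.\<close>

lemma top_density_volume_multiple:
  fixes g :: "('m, 'n::{finite,linorder}) metric_tensor"
  shows "top_density (volume_multiple g f c) z = 2 ^ CARD('n) * fact CARD('n) * of_real (f (chart_inv c z)) * det (g c z)"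
proof -
  have "(-1) ^ (k * (k - 1) div 2) * (- 2 * \<i>) ^ k * form_const k = 2 ^ k" for k
  proof -
    have "(-1) ^ (k * (k - 1) div 2) * (- 2 * \<i>) ^ k * form_const k
      = ((- 2 * \<i>) * \<i>) ^ k * ((-1) ^ (k * (k - 1) div 2) * (-1) ^ (k * (k - 1) div 2))"
      unfolding form_const_def power_mult_distrib[of _ "\<i>"] by (simp only: mult_ac)
    also have "(-1 :: complex) ^ (k * (k - 1) div 2) * (-1) ^ (k * (k - 1) div 2) = 1"
      by (simp add: power_add[symmetric] mult_2[symmetric])
    also have "(- 2 * \<i>) * \<i> = 2" by (simp add: mult.assoc)
    finally show ?thesis by simp
  qed
  from arg_cong[OF this, of "\<lambda>x. x * (fact CARD('n) * of_real (f (chart_inv c z)) * det (g c z))" "CARD('n)"]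
  show ?thesis unfolding top_density_def volume_multiple_def wedge_pow_metric_form_top by (simp add: mult_ac)
qed

text \<open>Up to \<open>form_const\<close> and a factorial this is the cofactor of \<open>g\<close>
  at \<open>(i, j)\<close>. It is written as a coefficient of a power of the form because that is
  what the Gauduchon condition differentiates.\<close>

definition cofactor_coeff :: "('m, 'n::{finite,linorder}) metric_tensor \<Rightarrow> ('m, 'n) chart \<Rightarrow> 'n \<Rightarrow> 'n \<Rightarrow> (complex, 'n) vec \<Rightarrow> complex" where
  "cofactor_coeff g c i j z = rank_sign UNIV i * rank_sign UNIV j *
     wedge_pow (metric_form g c) (CARD('n) - 1) z ((UNIV - {i}) <+> (UNIV - {j}))"

text \<open>For fixed \<open>i\<close>, the sum over \<open>j\<close> is the Laplace expansion along
  row \<open>i\<close> of the matrix obtained from \<open>g\<close> by replacing this row with the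
  one of \<open>A\<close>. The minors avoid row \<open>i\<close> and do not notice the
  replacement.\<close>

lemma cofactor_coeff_sum_det:
  fixes A :: "((complex, 'n::{finite,linorder}) vec, 'n) vec" and g :: "('m, 'n) metric_tensor"
  shows "(\<Sum>i\<in>UNIV. \<Sum>j\<in>UNIV. A $ i $ j * cofactor_coeff g c i j z) =
   form_const (CARD('n) - 1) * fact (CARD('n) - 1) * (\<Sum>i\<in>UNIV. det (\<chi> k. if k = i then A $ i else g c z $ k))"
proof -
  have "(\<Sum>j\<in>UNIV. A $ i $ j * cofactor_coeff g c i j z) =
     form_const (CARD('n) - 1) * fact (CARD('n) - 1) * det (\<chi> k. if k = i then A $ i else g c z $ k)" for i
  proof -
    let ?G = "\<lambda>k l. if k = i then A $ i $ l else g c z $ k $ l"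
    have "(\<Sum>j\<in>UNIV. A $ i $ j * cofactor_coeff g c i j z) = form_const (CARD('n) - 1) * fact (CARD('n) - 1) *
       (\<Sum>j\<in>UNIV. rank_sign UNIV i * rank_sign UNIV j * ?G i j * minor ?G (UNIV - {i}) (UNIV - {j}))"
      unfolding sum_distrib_left cofactor_coeff_def
    proof (rule sum.cong[OF refl])
      fix j
      have "minor (\<lambda>i j. g c z $ i $ j) (UNIV - {i}) (UNIV - {j}) = minor ?G (UNIV - {i}) (UNIV - {j})"
        by (rule minor_row_cong) auto
      then show "A $ i $ j * (rank_sign UNIV i * rank_sign UNIV j *
         wedge_pow (metric_form g c) (CARD('n) - 1) z ((UNIV - {i}) <+> (UNIV - {j}))) =
         form_const (CARD('n) - 1) * fact (CARD('n) - 1) *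
        (rank_sign UNIV i * rank_sign UNIV j * ?G i j * minor ?G (UNIV - {i}) (UNIV - {j}))"
        by (subst wedge_pow_metric_form) (simp_all add: card_Diff_singleton mult_ac)
    qed
    also have "(\<Sum>j\<in>UNIV. rank_sign UNIV i * rank_sign UNIV j * ?G i j * minor ?G (UNIV - {i}) (UNIV - {j})) = minor ?G UNIV UNIV"
      by (rule minor_laplace) simp
    also have "\<dots> = det (\<chi> k. if k = i then A $ i else g c z $ k)"
      unfolding minor_UNIV by (rule arg_cong[where f = det]) (simp add: vec_eq_iff)
    finally show ?thesis .
  qed
  then show ?thesis by (simp add: sum_distrib_left)
qed

section \<open>Cofactors and the trace against the inverse matrix\<close>

lemma matrix_inv_mult:
  fixes G :: "complex^'n^'n"
  assumes "det G \<noteq> 0"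
  shows "matrix_inv G ** G = mat 1" "G ** matrix_inv G = mat 1"
proof -
  have "\<exists>A'. G ** A' = mat 1 \<and> A' ** G = mat 1"
    using assms unfolding invertible_det_nz[symmetric] invertible_def .
  from someI_ex[OF this] show "matrix_inv G ** G = mat 1" "G ** matrix_inv G = mat 1"
    unfolding matrix_inv_def by blast+
qed

text \<open>With \<open>A = B G\<close>, every row of \<open>A\<close> is a combination of rows of
  \<open>G\<close>, and Cramer's rule leaves \<open>B i i\<close> times \<open>det G\<close>. The
  sum is thus \<open>det G\<close> times the trace of \<open>A G^(-1)\<close>, the derivative of the
  determinant at \<open>G\<close> in direction \<open>A\<close>.\<close>

lemma sum_det_replace_row:
  fixes A G :: "complex^'n^'n"
  assumes "det G \<noteq> 0"
  shows "(\<Sum>i\<in>UNIV. det (\<chi> k. if k = i then A $ i else G $ k)) = det G * (\<Sum>i\<in>UNIV. \<Sum>j\<in>UNIV. matrix_inv G $ j $ i * A $ i $ j)"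
proof -
  define B where "B = A ** matrix_inv G"
  have "A = B ** G"
    unfolding B_def using assms by (simp add: matrix_mul_assoc[symmetric] matrix_inv_mult)
  then have Ai: "A $ i = (\<Sum>k\<in>UNIV. B $ i $ k *s row k G)" for i
    by (simp add: vec_eq_iff matrix_matrix_mult_def row_def)
  have "det (\<chi> k. if k = i then A $ i else G $ k) = B $ i $ i * det G" for i
  proof -
    have "(\<chi> k. if k = i then A $ i else G $ k) = (\<chi> k. if k = i then (\<Sum>l\<in>UNIV. (B $ i) $ l *s row l G) else row k G)"
      by (simp add: vec_eq_iff Ai row_def)
    then show ?thesis by (simp only: cramer_lemma_transpose)
  qed
  then have "(\<Sum>i\<in>UNIV. det (\<chi> k. if k = i then A $ i else G $ k)) = det G * (\<Sum>i\<in>UNIV. B $ i $ i)"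
    by (simp add: sum_distrib_left mult.commute)
  then show ?thesis by (simp add: B_def matrix_matrix_mult_def mult.commute)
qed

lemma Ck_on_wedge_pow_metric_form:
  assumes "open S" "\<And>i j. Ck_on k S (\<lambda>z. g c z $ i $ j)"
  shows "Ck_on k S (\<lambda>z. wedge_pow (metric_form g c) m z T)"
proof (induction m arbitrary: T)
  case 0
  then show ?case by (simp add: zero_form_def)
next
  case (Suc m)
  have "Ck_on k S (\<lambda>z. metric_form g c z U)" for U
  proof -
    have "Ck_on k S (\<lambda>z. if U = {Inl i, Inr j} then \<i> * g c z $ i $ j else 0)" for i j
      by (cases "U = {Inl i, Inr j}") (auto intro: Ck_on_mult assms)
    then show ?thesis unfolding metric_form_eq by (intro Ck_on_sum assms(1))
  qed
  then show ?case
    by (simp add: wedge_def) (intro Ck_on_sum Ck_on_mult assms(1) Ck_on_const Suc.IH)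
qed

section \<open>The Gauduchon condition in coordinates\<close>

lemma del_top:
  fixes \<alpha> :: "'n::{finite,linorder} form"
  shows "del \<alpha> z UNIV = (\<Sum>i\<in>UNIV. rank_sign UNIV i * dz i (\<lambda>w. \<alpha> w ((UNIV - {i}) <+> UNIV)) z)"
  unfolding del_def
proof (rule sum.cong[OF refl])
  fix i :: 'n
  have u: "UNIV - {Inl i} = (UNIV - {i}) <+> (UNIV :: 'n set)" by (auto simp: UNIV_Plus_UNIV[symmetric] simp del: UNIV_Plus_UNIV)
  have r: "rank_sign (UNIV - {i}) i = rank_sign UNIV i"
    unfolding rank_sign_def by (auto intro!: arg_cong[where f = "\<lambda>A. (-1) ^ card A"])
  have "wedge (gen (Inl i)) (\<lambda>z T. dz i (\<lambda>w. \<alpha> w T) z) z UNIV =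
    (\<Sum>T\<in>(UNIV :: ('n + 'n) set set). if T = {Inl i} then shuffle_sign {Inl i} (UNIV - {Inl i}) * dz i (\<lambda>w. \<alpha> w (UNIV - {Inl i})) z else 0)"
    unfolding wedge_def gen_def Pow_UNIV by (rule sum.cong) auto
  then show "wedge (gen (Inl i)) (\<lambda>z T. dz i (\<lambda>w. \<alpha> w T) z) z UNIV = rank_sign UNIV i * dz i (\<lambda>w. \<alpha> w ((UNIV - {i}) <+> UNIV)) z"
    by (simp add: u shuffle_sign_Inl r)
qed

lemma delbar_subtop:
  fixes \<alpha> :: "'n::{finite,linorder} form"
  shows "delbar \<alpha> z ((UNIV - {i}) <+> UNIV) =
     (- 1) ^ (CARD('n) - 1) * (\<Sum>j\<in>UNIV. rank_sign UNIV j * dzbar j (\<lambda>w. \<alpha> w ((UNIV - {i}) <+> (UNIV - {j}))) z)"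
  unfolding delbar_def sum_distrib_left
proof (rule sum.cong[OF refl])
  fix j :: 'n
  let ?S = "(UNIV - {i}) <+> (UNIV :: 'n set)"
  have u: "?S - {Inr j} = (UNIV - {i}) <+> (UNIV - {j})" by auto
  have r: "rank_sign (UNIV - {j}) j = rank_sign UNIV j"
    unfolding rank_sign_def by (auto intro!: arg_cong[where f = "\<lambda>A. (-1) ^ card A"])
  have "wedge (gen (Inr j)) (\<lambda>z T. dzbar j (\<lambda>w. \<alpha> w T) z) z ?S =
    (\<Sum>T\<in>Pow ?S. if T = {Inr j} then shuffle_sign {Inr j} (?S - {Inr j}) * dzbar j (\<lambda>w. \<alpha> w (?S - {Inr j})) z else 0)"
    unfolding wedge_def gen_def by (rule sum.cong) auto
  also have "\<dots> = shuffle_sign {Inr j} (?S - {Inr j}) * dzbar j (\<lambda>w. \<alpha> w (?S - {Inr j})) z"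
    by (subst sum.delta) auto
  finally show "wedge (gen (Inr j)) (\<lambda>z T. dzbar j (\<lambda>w. \<alpha> w T) z) z ?S =
      (- 1) ^ (CARD('n) - 1) * (rank_sign UNIV j * dzbar j (\<lambda>w. \<alpha> w ((UNIV - {i}) <+> (UNIV - {j}))) z)"
    unfolding u by (simp add: shuffle_sign_Inr r card_Diff_singleton)
qed

lemma dz_cmult:
  assumes "f differentiable (at z)"
  shows "dz i (\<lambda>z. c * f z) z = c * dz i f z" "dzbar i (\<lambda>z. c * f z) z = c * dzbar i f z"
  using dz_mult[OF differentiable_const assms] dzbar_mult[OF differentiable_const assms] by simp_all

text \<open>The signs of \<open>del\<close> and \<open>delbar\<close> in top degree are those built
  into \<open>cofactor_coeff\<close>, apart from a common factor \<open>(-1)^(n-1)\<close>. The top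
  coefficient is therefore the double divergence of the cofactor matrix up to sign.\<close>

lemma gauduchon_cofactor:
  fixes g :: "('m, 'n::{finite,linorder}) metric_tensor"
  assumes S: "open S" and g: "\<And>i j. Ck_on 2 S (\<lambda>z. g c z $ i $ j)" and z: "z \<in> S"
    and G: "del (delbar (wedge_pow (metric_form g c) (CARD('n) - 1))) z UNIV = 0"
  shows "(\<Sum>i\<in>UNIV. \<Sum>j\<in>UNIV. dz i (dzbar j (cofactor_coeff g c i j)) z) = 0"
proof -
  let ?W = "\<lambda>i j w. wedge_pow (metric_form g c) (CARD('n) - 1) w ((UNIV - {i}) <+> (UNIV - {j}))"
  let ?s = "(- 1) ^ (CARD('n) - 1) :: complex"
  have W: "Ck_on (Suc (Suc 0)) S (?W i j)" for i j
    using Ck_on_wedge_pow_metric_form[of S 2 g c, OF S g] by (simp only: numeral_2_eq_2)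
  have d1: "?W i j differentiable (at w)" if "w \<in> S" for i j w
    using Ck_on_differentiable[OF W that] .
  have W2: "Ck_on (Suc 0) S (dzbar j (?W i j))" for i j
    by (rule Ck_on_dz(2)[OF S W])
  have d2: "(\<lambda>z. dzbar j (?W i j) z) differentiable (at w)" if "w \<in> S" for i j w
    using Ck_on_differentiable[OF W2 that] by simp
  have 1: "dz i (\<lambda>w. delbar (wedge_pow (metric_form g c) (CARD('n) - 1)) w ((UNIV - {i}) <+> UNIV)) z =
      (\<Sum>j\<in>UNIV. ?s * rank_sign UNIV j * dz i (dzbar j (?W i j)) z)" for i
  proof -
    have "dz i (\<lambda>w. delbar (wedge_pow (metric_form g c) (CARD('n) - 1)) w ((UNIV - {i}) <+> UNIV)) z
      = dz i (\<lambda>w. \<Sum>j\<in>UNIV. (?s * rank_sign UNIV j) * dzbar j (?W i j) w) z"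
      unfolding delbar_subtop by (simp add: sum_distrib_left mult_ac)
    also have "\<dots> = (\<Sum>j\<in>UNIV. dz i (\<lambda>w. (?s * rank_sign UNIV j) * dzbar j (?W i j) w) z)"
      by (rule dz_sum(1)) (intro differentiable_mult differentiable_const d2 z)
    also have "\<dots> = (\<Sum>j\<in>UNIV. ?s * rank_sign UNIV j * dz i (dzbar j (?W i j)) z)"
      by (intro sum.cong refl dz_cmult d2 z)
    finally show ?thesis .
  qed
  have 2: "dz i (dzbar j (cofactor_coeff g c i j)) z = rank_sign UNIV i * rank_sign UNIV j * dz i (dzbar j (?W i j)) z" for i j
  proof -
    have "dzbar j (cofactor_coeff g c i j) w = (rank_sign UNIV i * rank_sign UNIV j) * dzbar j (?W i j) w" if "w \<in> S" for w
      unfolding cofactor_coeff_def[abs_def] by (intro dz_cmult d1 that)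
    then have "dz i (dzbar j (cofactor_coeff g c i j)) z = dz i (\<lambda>w. (rank_sign UNIV i * rank_sign UNIV j) * dzbar j (?W i j) w) z"
      by (rule dz_cong_open[OF S z])
    also have "\<dots> = (rank_sign UNIV i * rank_sign UNIV j) * dz i (dzbar j (?W i j)) z"
      by (intro dz_cmult d2 z)
    finally show ?thesis .
  qed
  have "?s * (\<Sum>i\<in>UNIV. \<Sum>j\<in>UNIV. dz i (dzbar j (cofactor_coeff g c i j)) z) = del (delbar (wedge_pow (metric_form g c) (CARD('n) - 1))) z UNIV"
    unfolding del_top 1 2 sum_distrib_left by (intro sum.cong refl) (simp add: mult_ac)
  then show ?thesis using G by simp
qed

section \<open>Integration by parts\<close>

lemma continuous_compact_support_bounded:
  fixes f :: "'a::topological_space \<Rightarrow> 'b::real_normed_vector"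
  assumes "compact K" "continuous_on UNIV f" "\<And>x. x \<notin> K \<Longrightarrow> f x = 0"
  shows "\<exists>B\<ge>0. \<forall>x. norm (f x) \<le> B"
proof -
  have "compact (f ` K)" using assms by (intro compact_continuous_image continuous_on_subset[OF assms(2)]) auto
  from compact_imp_bounded[OF this] obtain B where "\<forall>y\<in>f ` K. norm y \<le> B"
    unfolding bounded_iff by blast
  then have B: "\<And>x. x \<in> K \<Longrightarrow> norm (f x) \<le> B" by blast
  have "norm (f x) \<le> max B 0" for x
    using B[of x] assms(3)[of x] by (cases "x \<in> K") auto
  then show ?thesis by (intro exI[of _ "max B 0"]) auto
qed

lemma integrable_continuous_compact_support:
  fixes f :: "'a::euclidean_space \<Rightarrow> 'b::{banach, second_countable_topology}"
  assumes "compact K" "continuous_on UNIV f" "\<And>x. x \<notin> K \<Longrightarrow> f x = 0"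
  shows "integrable lborel f"
proof -
  have "integrable lborel (\<lambda>x. indicator K x *\<^sub>R f x)"
    by (rule borel_integrable_compact) (use assms in \<open>auto intro: continuous_on_subset\<close>)
  moreover have "(\<lambda>x. indicator K x *\<^sub>R f x) = f" using assms(3) by (auto simp: indicator_def fun_eq_iff)
  ultimately show ?thesis by simp
qed

lemma integral_translation:
  fixes f :: "'a::euclidean_space \<Rightarrow> 'b::{banach, second_countable_topology}"
  assumes "f \<in> borel_measurable borel"
  shows "(LINT x|lborel. f (x + v)) = integral\<^sup>L lborel f"
proof -
  have "(LINT x|lborel. f x) = (LINT x|distr lborel borel ((+) v). f x)"
    by (simp add: lborel_distr_plus)
  also have "\<dots> = (LINT x|lborel. f (v + x))"
    by (rule integral_distr) (use assms in auto)
  finally show ?thesis by (simp add: add.commute)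
qed

text \<open>The mean value inequality along a segment bounds difference quotients independently of
  the step, as dominated convergence requires.\<close>

lemma increment_bound:
  fixes F :: "'a::euclidean_space \<Rightarrow> complex"
  assumes d: "\<And>x. (F has_derivative F' x) (at x)" and B: "\<And>x. norm (F' x v) \<le> B" and h: "h \<ge> 0"
  shows "norm (F (x + h *\<^sub>R v) - F x) \<le> h * B"
proof -
  have D: "((\<lambda>t. F (x + t *\<^sub>R v)) has_derivative (\<lambda>s. s *\<^sub>R F' (x + t *\<^sub>R v) v)) (at t)" for t
  proof -
    have l: "linear (F' (x + t *\<^sub>R v))" using d has_derivative_linear by blast
    have "((\<lambda>t. x + t *\<^sub>R v) has_derivative (\<lambda>s. s *\<^sub>R v)) (at t)"
      by (auto intro!: derivative_eq_intros)
    from diff_chain_at[OF this d[of "x + t *\<^sub>R v"]] show ?thesis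
      by (simp add: o_def linear_cmul[OF l])
  qed
  have "norm ((\<lambda>t. F (x + t *\<^sub>R v)) h - (\<lambda>t. F (x + t *\<^sub>R v)) 0) \<le> B * norm (h - 0)"
  proof (rule differentiable_bound[OF convex_UNIV])
    fix t show "((\<lambda>t. F (x + t *\<^sub>R v)) has_derivative (\<lambda>s. s *\<^sub>R F' (x + t *\<^sub>R v) v)) (at t within UNIV)"
      using D by simp
    show "onorm (\<lambda>s::real. s *\<^sub>R F' (x + t *\<^sub>R v) v) \<le> B"
      by (rule onorm_le) (use mult_left_mono[OF B abs_ge_zero] in \<open>simp add: mult.commute\<close>)
  qed auto
  then show ?thesis using h by (simp add: mult.commute)
qed

text \<open>By translation invariance every difference quotient of \<open>F\<close> along
  \<open>v\<close> has integral zero. The quotients converge to the derivative and are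
  dominated.\<close>

lemma integral_derivative_zero:
  fixes F :: "'a::euclidean_space \<Rightarrow> complex"
  assumes d: "\<And>x. (F has_derivative F' x) (at x)" and c: "continuous_on UNIV (\<lambda>x. F' x v)"
    and K: "compact K" "\<And>x. x \<notin> K \<Longrightarrow> F x = 0"
  shows "(LINT x|lborel. F' x v) = 0"
proof -
  have cF: "continuous_on UNIV F"
    using d has_derivative_continuous by (blast intro: continuous_at_imp_continuous_on)
  have F'0: "F' x v = 0" if "x \<notin> K" for x
  proof -
    have "open (- K)" using K by (simp add: compact_imp_closed open_Compl)
    then have "(F has_derivative (\<lambda>_. 0)) (at x)"
      by (rule has_derivative_transform_within_open[OF has_derivative_const]) (use that K in auto)
    then show ?thesis using has_derivative_unique[OF d] by metis
  qed
  obtain B where B: "B \<ge> 0" "\<And>x. norm (F' x v) \<le> B"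
    using continuous_compact_support_bounded[OF K(1) c] F'0 by blast
  let ?h = "\<lambda>m. 1 / real (Suc m)"
  let ?q = "\<lambda>m x. of_real (real (Suc m)) * (F (x + ?h m *\<^sub>R v) - F x)"
  \<comment> \<open>The compact set swept out by moving \<open>K\<close> along \<open>- v\<close> up
    to time 1. It contains the support of every difference quotient, as the steps
    \<open>?h m\<close> are at most 1.\<close>
  let ?K' = "(\<lambda>(x, t). x - t *\<^sub>R v) ` (K \<times> {0..1::real})"
  have K': "compact ?K'"
    by (rule compact_continuous_image) (auto intro!: continuous_intros compact_Times K simp: split_beta)
  have inF: "integrable lborel F" by (rule integrable_continuous_compact_support[OF K(1) cF K(2)])
  have mF: "F \<in> borel_measurable borel" using cF by (rule borel_measurable_continuous_onI)
  have inFt: "integrable lborel (\<lambda>x. F (x + w))" for w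
  proof (rule integrable_continuous_compact_support)
    show "compact ((\<lambda>x. x - w) ` K)" by (intro compact_continuous_image K continuous_intros)
    show "continuous_on UNIV (\<lambda>x. F (x + w))"
      by (rule continuous_on_compose2[OF cF]) (auto intro: continuous_intros)
    show "F (x + w) = 0" if "x \<notin> (\<lambda>x. x - w) ` K" for x
      using that K(2)[of "x + w"] by force
  qed
  have lim: "(\<lambda>m. integral\<^sup>L lborel (?q m)) \<longlonglongrightarrow> (LINT x|lborel. F' x v)"
  proof (rule integral_dominated_convergence[where w = "\<lambda>x. indicator ?K' x *\<^sub>R B"])
    show "(\<lambda>x. F' x v) \<in> borel_measurable lborel" using c by (simp add: borel_measurable_continuous_onI)
    show "?q m \<in> borel_measurable lborel" for m
      using borel_measurable_integrable[OF inFt[of "?h m *\<^sub>R v"]] borel_measurable_integrable[OF inF] by measurable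
    show "integrable lborel (\<lambda>x. indicator ?K' x *\<^sub>R B)"
      by (rule borel_integrable_compact[OF K']) auto
    show "AE x in lborel. (\<lambda>m. ?q m x) \<longlonglongrightarrow> F' x v"
    proof (rule AE_I2)
      fix x
      have l: "linear (F' x)" using d has_derivative_linear by blast
      have "((\<lambda>t. x + t *\<^sub>R v) has_derivative (\<lambda>s. s *\<^sub>R v)) (at 0)"
        by (auto intro!: derivative_eq_intros)
      from diff_chain_at[OF this, of F "F' x"] d[of x]
      have "((\<lambda>t. F (x + t *\<^sub>R v)) has_derivative (\<lambda>s. s *\<^sub>R F' x v)) (at 0)"
        by (simp add: o_def linear_cmul[OF l])
      then have "((\<lambda>t. norm (F (x + t *\<^sub>R v) - F x - t *\<^sub>R F' x v) / norm t) \<longlongrightarrow> 0) (at 0)"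
        by (simp add: has_derivative_at)
      then have "((\<lambda>t. norm ((F (x + t *\<^sub>R v) - F x) /\<^sub>R t - F' x v)) \<longlongrightarrow> 0) (at 0)"
      proof (rule Lim_transform_eventually)
        have "norm (F (x + t *\<^sub>R v) - F x - t *\<^sub>R F' x v) / norm t = norm ((F (x + t *\<^sub>R v) - F x) /\<^sub>R t - F' x v)"
          if "t \<noteq> 0" for t
        proof -
          have "(F (x + t *\<^sub>R v) - F x) /\<^sub>R t - F' x v = (F (x + t *\<^sub>R v) - F x - t *\<^sub>R F' x v) /\<^sub>R t"
            using that by (simp add: scaleR_diff_right)
          then show ?thesis by (simp only: norm_scaleR norm_inverse real_norm_def abs_inverse) (simp add: divide_inverse mult.commute)
        qed
        then show "\<forall>\<^sub>F t in at 0. norm (F (x + t *\<^sub>R v) - F x - t *\<^sub>R F' x v) / norm t = norm ((F (x + t *\<^sub>R v) - F x) /\<^sub>R t - F' x v)"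
          by (auto simp: eventually_at_filter)
      qed
      then have lim: "((\<lambda>t. (F (x + t *\<^sub>R v) - F x) /\<^sub>R t) \<longlongrightarrow> F' x v) (at 0)"
        unfolding Lim_null[of _ "F' x v"] by (rule tendsto_norm_zero_cancel)
      have "filterlim ?h (at 0) sequentially"
        unfolding filterlim_at using LIMSEQ_Suc[OF lim_1_over_n[where 'a = real]] by auto
      from filterlim_compose[OF lim this]
      show "(\<lambda>m. ?q m x) \<longlonglongrightarrow> F' x v"
        by (simp add: scaleR_conv_of_real)
    qed
    show "AE x in lborel. norm (?q m x) \<le> indicator ?K' x *\<^sub>R B" for m
    proof (rule AE_I2)
      fix x
      show "norm (?q m x) \<le> indicator ?K' x *\<^sub>R B"
      proof (cases "x \<in> ?K'")
        case True
        have "norm (?q m x) = real (Suc m) * norm (F (x + ?h m *\<^sub>R v) - F x)"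
          by (simp only: norm_mult norm_of_real)
        also have "\<dots> \<le> real (Suc m) * (?h m * B)"
          by (intro mult_left_mono increment_bound[OF d B(2)]) auto
        also have "\<dots> = B" by simp
        finally show ?thesis using True by simp
      next
        case False
        have h1: "?h m \<in> {0..1}" by simp
        have "x \<notin> K" using False by force
        moreover have "x + ?h m *\<^sub>R v \<notin> K"
        proof
          assume "x + ?h m *\<^sub>R v \<in> K"
          then have "(x + ?h m *\<^sub>R v, ?h m) \<in> K \<times> {0..1}" using h1 by blast
          then have "(\<lambda>(x, t). x - t *\<^sub>R v) (x + ?h m *\<^sub>R v, ?h m) \<in> ?K'" by (rule imageI)
          then show False using False by simp
        qed
        ultimately show ?thesis using K(2) False by simp
      qed
    qed
  qed
  have "integral\<^sup>L lborel (?q m) = 0" for m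
  proof -
    have "integral\<^sup>L lborel (?q m) = of_real (real (Suc m)) * (LINT x|lborel. F (x + ?h m *\<^sub>R v) - F x)"
      by (rule integral_mult_right_zero)
    also have "(LINT x|lborel. F (x + ?h m *\<^sub>R v) - F x) = 0"
      using inFt[of "?h m *\<^sub>R v"] inF by (simp add: integral_translation[OF mF])
    finally show ?thesis by simp
  qed
  then have "(\<lambda>m. integral\<^sup>L lborel (?q m)) = (\<lambda>m. 0)" by (rule ext)
  from lim[unfolded this] have "(\<lambda>m. 0 :: complex) \<longlonglongrightarrow> (LINT x|lborel. F' x v)" .
  then show ?thesis by (simp add: LIMSEQ_const_iff)
qed

text \<open>\<open>f\<close> has to vanish at all points outside \<open>K\<close>, also outside
  \<open>S\<close>, so it is its own extension by zero.\<close>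

definition supported_in :: "'a::topological_space set \<Rightarrow> ('a \<Rightarrow> 'b::zero) \<Rightarrow> bool" where
  "supported_in S f \<longleftrightarrow> (\<exists>K. compact K \<and> K \<subseteq> S \<and> (\<forall>x. x \<notin> K \<longrightarrow> f x = 0))"

text \<open>The open sets \<open>S\<close> and \<open>- K\<close> cover the space, and
  \<open>f\<close> is zero on the second.\<close>

lemma Ck_on_extend:
  fixes f :: "'a::{real_normed_vector} \<Rightarrow> 'b::real_normed_vector"
  assumes "open S" "Ck_on k S f" "supported_in S f"
  shows "Ck_on k UNIV f"
proof (rule Ck_on_local)
  obtain K where K: "compact K" "K \<subseteq> S" "\<And>x. x \<notin> K \<Longrightarrow> f x = 0"
    using assms(3) unfolding supported_in_def by blast
  have o: "open (- K)" using K by (simp add: compact_imp_closed open_Compl)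
  have "Ck_on k (- K) f"
    using Ck_on_cong[OF o, of f "\<lambda>_. 0"] K(3) by simp
  then show "\<exists>U. open U \<and> x \<in> U \<and> Ck_on k U f" for x
    using assms o K by (cases "x \<in> K") blast+
qed

lemma supported_in_dz:
  assumes "supported_in S f"
  shows "supported_in S (dz i f)" "supported_in S (dzbar i f)"
proof -
  obtain K where K: "compact K" "K \<subseteq> S" "\<And>x. x \<notin> K \<Longrightarrow> f x = 0"
    using assms unfolding supported_in_def by blast
  have o: "open (- K)" using K by (simp add: compact_imp_closed open_Compl)
  have "dz i f x = 0" "dzbar i f x = 0" if "x \<notin> K" for x
    using dz_cong_open[OF o, of x f "\<lambda>_. 0" i] that K(3) by auto
  then show "supported_in S (dz i f)" "supported_in S (dzbar i f)"
    using K unfolding supported_in_def by blast+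
qed

lemma supported_in_mult:
  fixes f :: "'a::topological_space \<Rightarrow> 'b::mult_zero"
  assumes "supported_in S f"
  shows "supported_in S (\<lambda>x. f x * g x)" "supported_in S (\<lambda>x. g x * f x)"
  using assms unfolding supported_in_def by (metis mult_zero_left, metis mult_zero_right)

lemma integral_dz_zero:
  fixes F :: "complex^'n \<Rightarrow> complex"
  assumes "open S" "Ck_on 1 S F" "supported_in S F"
  shows "(LINT z|lborel. dz i F z) = 0" "(LINT z|lborel. dzbar i F z) = 0"
proof -
  have C: "Ck_on 1 UNIV F" by (rule Ck_on_extend[OF assms])
  have d: "(F has_derivative frechet_derivative F (at z)) (at z)" for z
    using Ck_on_SucE(1)[of 0 UNIV F] C by simp
  have c: "continuous_on UNIV (\<lambda>z. frechet_derivative F (at z) v)" for v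
    using Ck_on_SucE(2)[of 0 UNIV F v] C by simp
  obtain K where K: "compact K" "\<And>x. x \<notin> K \<Longrightarrow> F x = 0"
    using assms(3) unfolding supported_in_def by blast
  have z: "(LINT z|lborel. frechet_derivative F (at z) v) = 0" for v
    by (rule integral_derivative_zero[OF d c K])
  have F'0: "frechet_derivative F (at x) v = 0" if "x \<notin> K" for x v
  proof -
    have "open (- K)" using K by (simp add: compact_imp_closed open_Compl)
    from frechet_derivative_cong_open[OF this, of x F "\<lambda>_. 0"] that K show ?thesis by simp
  qed
  have i: "integrable lborel (\<lambda>z. frechet_derivative F (at z) v)" for v
    by (rule integrable_continuous_compact_support[OF K(1) c F'0])
  show "(LINT z|lborel. dz i F z) = 0" "(LINT z|lborel. dzbar i F z) = 0"
    unfolding dz_def dzbar_def using i by (simp_all add: z)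
qed

text \<open>The product with \<open>C\<close> inherits the compact support of \<open>u\<close>, so
  its derivatives have integral zero. \<open>C\<close> is controlled on \<open>S\<close> only, hence
  the integrals over \<open>S\<close>.\<close>

lemma integral_by_parts_dz:
  fixes C u :: "complex^'n \<Rightarrow> complex"
  assumes S: "open S" and C: "Ck_on 1 S C" and u: "Ck_on 1 S u" "supported_in S u"
  shows "(LINT z:S|lborel. C z * dz i u z) = - (LINT z:S|lborel. dz i C z * u z)"
    and "(LINT z:S|lborel. C z * dzbar i u z) = - (LINT z:S|lborel. dzbar i C z * u z)"
    and "set_integrable lborel S (\<lambda>z. C z * u z)"
proof -
  obtain K where K: "compact K" "K \<subseteq> S" "\<And>x. x \<notin> K \<Longrightarrow> u x = 0"
    using u(2) unfolding supported_in_def by blast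
  have int: "set_integrable lborel S (\<lambda>z. f z * w z)" if "continuous_on S f" "continuous_on S w" "\<And>x. x \<notin> K \<Longrightarrow> w x = 0" for f w :: "complex^'n \<Rightarrow> complex"
  proof -
    have "integrable lborel (\<lambda>x. indicator K x *\<^sub>R (f x * w x))"
      by (rule borel_integrable_compact) (use that K in \<open>auto intro!: continuous_intros intro: continuous_on_subset\<close>)
    moreover have "(\<lambda>x. indicator K x *\<^sub>R (f x * w x)) = (\<lambda>x. indicator S x *\<^sub>R (f x * w x))"
      using that K(2) by (auto simp: indicator_def fun_eq_iff)
    ultimately show ?thesis by (simp add: set_integrable_def)
  qed
  have cC: "continuous_on S C" "continuous_on S (dz i C)" "continuous_on S (dzbar i C)" for i
    using Ck_on_continuous[OF C] Ck_on_dz[OF S, of 0 C i] C by auto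
  have cu: "continuous_on S u" "continuous_on S (dz i u)" "continuous_on S (dzbar i u)" for i
    using Ck_on_continuous[OF u(1)] Ck_on_dz[OF S, of 0 u i] u(1) by auto
  have o: "open (- K)" using K by (simp add: compact_imp_closed open_Compl)
  have u0: "dz i u x = 0" "dzbar i u x = 0" if "x \<notin> K" for x
    using dz_cong_open[OF o, of x u "\<lambda>_. 0" i] that K(3) by auto
  show "set_integrable lborel S (\<lambda>z. C z * u z)" by (rule int[OF cC(1) cu(1) K(3)])
  let ?F = "\<lambda>z. C z * u z"
  have F: "Ck_on 1 S ?F" "supported_in S ?F"
    using Ck_on_mult[OF S C u(1)] supported_in_mult(2)[OF u(2)] by auto
  have Cd: "C differentiable (at z)" "u differentiable (at z)" if "z \<in> S" for z
    using C u(1) that by simp_all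
  have sF: "dz i ?F x = 0" "dzbar i ?F x = 0" if "x \<notin> S" for x
    using dz_cong_open[OF o, of x ?F "\<lambda>_. 0" i] that K(2,3) by auto
  have F_int: "(LINT z:S|lborel. dz i ?F z) = 0" "(LINT z:S|lborel. dzbar i ?F z) = 0"
  proof -
    have "(\<lambda>z. indicator S z *\<^sub>R dz i ?F z) = dz i ?F" "(\<lambda>z. indicator S z *\<^sub>R dzbar i ?F z) = dzbar i ?F"
      using sF by (auto simp: indicator_def fun_eq_iff)
    then show "(LINT z:S|lborel. dz i ?F z) = 0" "(LINT z:S|lborel. dzbar i ?F z) = 0"
      using integral_dz_zero[OF S F] unfolding set_lebesgue_integral_def by simp_all
  qed
  have i: "set_integrable lborel S (\<lambda>z. C z * dz i u z)" "set_integrable lborel S (\<lambda>z. dz i C z * u z)"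
    "set_integrable lborel S (\<lambda>z. C z * dzbar i u z)" "set_integrable lborel S (\<lambda>z. dzbar i C z * u z)"
    by (intro int cC cu u0 K(3); assumption)+
  have "(LINT z:S|lborel. dz i ?F z) = (LINT z:S|lborel. dz i C z * u z + C z * dz i u z)"
    by (rule set_lebesgue_integral_cong) (use S Cd in \<open>auto simp: dz_mult\<close>)
  then show "(LINT z:S|lborel. C z * dz i u z) = - (LINT z:S|lborel. dz i C z * u z)"
    using F_int i by (simp add: set_integral_add add_eq_0_iff)
  have "(LINT z:S|lborel. dzbar i ?F z) = (LINT z:S|lborel. dzbar i C z * u z + C z * dzbar i u z)"
    by (rule set_lebesgue_integral_cong) (use S Cd in \<open>auto simp: dzbar_mult\<close>)
  then show "(LINT z:S|lborel. C z * dzbar i u z) = - (LINT z:S|lborel. dzbar i C z * u z)"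
    using F_int i by (simp add: set_integral_add add_eq_0_iff)
qed

lemma integral_by_parts_twice:
  fixes C u :: "complex^'n \<Rightarrow> complex"
  assumes S: "open S" and C: "Ck_on 2 S C" and u: "Ck_on 2 S u" "supported_in S u"
  shows "(LINT z:S|lborel. C z * dzbar j (dz i u) z) = (LINT z:S|lborel. dz i (dzbar j C) z * u z)"
proof -
  have C1: "Ck_on 1 S C" "Ck_on 1 S (dzbar j C)" and u1: "Ck_on 1 S u" "Ck_on 1 S (dz i u)"
    using Ck_on_dz[OF S, of 1] Ck_on_Suc_D[of 1] C u(1) by (simp_all only: numeral_2_eq_2 One_nat_def)
  have "(LINT z:S|lborel. C z * dzbar j (dz i u) z) = - (LINT z:S|lborel. dzbar j C z * dz i u z)"
    by (rule integral_by_parts_dz(2)[OF S C1(1) u1(2) supported_in_dz(1)[OF u(2)]])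
  also have "\<dots> = (LINT z:S|lborel. dz i (dzbar j C) z * u z)"
    using integral_by_parts_dz(1)[OF S C1(2) u1(1) u(2), of i] by simp
  finally show ?thesis .
qed

section \<open>Holomorphic changes of variables\<close>

lemma det_reindex:
  fixes M :: "'c::comm_ring_1^'b^'b" and b :: "'a::finite \<Rightarrow> 'b::finite"
  assumes b: "bij b"
  shows "det (\<chi> i j. M $ b i $ b j) = det M"
proof -
  \<comment> \<open>Transport of permutations along \<open>b\<close>. It preserves the sign and
    reindexes the factors of each product.\<close>
  let ?m = "map_permutation UNIV b"
  have bb: "bij_betw b UNIV UNIV" and inj: "inj b" using b by (auto simp: bij_is_inj)
  have ap: "?m p (b i) = b (p i)" for p i
    by (rule map_permutation_apply) (use inj in auto)
  have inv_p: "bij (inv b)" using b by (rule bij_imp_bij_inv)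
  have perm: "?m p permutes UNIV" if "p permutes UNIV" for p
    using map_permutation_permutes[OF bb that] .
  have perm': "map_permutation UNIV (inv b) q permutes UNIV" if "q permutes UNIV" for q
    using map_permutation_permutes[of "inv b" UNIV UNIV q] that inv_p by simp
  have ap': "map_permutation UNIV (inv b) q (inv b j) = inv b (q j)" for q j
    by (rule map_permutation_apply) (use inv_p in \<open>auto simp: bij_is_inj\<close>)
  have i1: "map_permutation UNIV (inv b) (?m p) = p" for p
  proof
    fix i
    have "map_permutation UNIV (inv b) (?m p) (inv b (b i)) = inv b (?m p (b i))" by (rule ap')
    then show "map_permutation UNIV (inv b) (?m p) i = p i" using inj by (simp add: ap)
  qed
  have i2: "?m (map_permutation UNIV (inv b) q) = q" for q
  proof
    fix j
    have "?m (map_permutation UNIV (inv b) q) (b (inv b j)) = b (map_permutation UNIV (inv b) q (inv b j))" by (rule ap)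
    then show "?m (map_permutation UNIV (inv b) q) j = q j"
      using b by (simp add: ap' surj_f_inv_f bij_is_surj)
  qed
  show ?thesis
    unfolding det_def
  proof (rule sum.reindex_bij_witness[where i = "map_permutation UNIV (inv b)" and j = ?m])
    fix p assume p: "p \<in> {p. p permutes (UNIV :: 'a set)}"
    then have "sign (?m p) = sign p" using inj by (intro sign_map_permutation) auto
    moreover have "(\<Prod>j\<in>UNIV. M $ j $ ?m p j) = (\<Prod>i\<in>UNIV. M $ b i $ ?m p (b i))"
      by (rule prod.reindex_bij_betw[OF bb, symmetric])
    ultimately show "of_int (sign (?m p)) * (\<Prod>j\<in>UNIV. M $ j $ ?m p j) = of_int (sign p) * (\<Prod>i\<in>UNIV. (\<chi> i j. M $ b i $ b j) $ i $ p i)"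
      by (simp add: ap)
  qed (use i1 i2 perm perm' in auto)
qed

text \<open>An injective map of the finite set \<open>range Inl\<close> into itself is onto, so the
  other block is preserved as well.\<close>

lemma permutes_Inl_decompose:
  fixes p :: "'a::finite + 'b::finite \<Rightarrow> 'a + 'b"
  assumes p: "p permutes UNIV" and Inl: "\<And>i. p (Inl i) \<in> range Inl"
  shows "\<exists>p1 p2. p1 permutes UNIV \<and> p2 permutes UNIV \<and> p = map_sum p1 p2"
proof -
  have inj: "inj p" using p by (rule permutes_inj)
  have im: "p ` range Inl = range Inl"
    by (rule endo_inj_surj) (use Inl inj in \<open>auto intro: inj_on_subset finite_imageI\<close>)
  have Inr: "p (Inr j) \<in> range Inr" for j
  proof (rule ccontr)
    assume "p (Inr j) \<notin> range Inr"
    then have "p (Inr j) \<in> p ` range Inl" unfolding im by (cases "p (Inr j)") auto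
    then show False using inj by (auto dest: injD)
  qed
  obtain p1 where p1: "\<And>i. p (Inl i) = Inl (p1 i)" using choice[of "\<lambda>i k. p (Inl i) = Inl k"] Inl by blast
  obtain p2 where p2: "\<And>j. p (Inr j) = Inr (p2 j)" using choice[of "\<lambda>i k. p (Inr i) = Inr k"] Inr by blast
  have "p = map_sum p1 p2"
  proof
    fix x show "p x = map_sum p1 p2 x" by (cases x) (simp_all add: p1 p2)
  qed
  moreover have "inj p1" "inj p2"
    using inj p1 p2 unfolding inj_def by (metis sum.inject(1), metis sum.inject(2))
  then have "p1 permutes UNIV" "p2 permutes UNIV"
    by (auto intro!: bij_imp_permutes simp: bij_def finite_UNIV_inj_surj)
  ultimately show ?thesis by blast
qed

text \<open>The block map is a product of two permutations, each fixing one block pointwise, and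
  extension by fixed points keeps the sign.\<close>

lemma map_sum_permutes_sign:
  fixes p1 :: "'a::finite \<Rightarrow> 'a" and p2 :: "'b::finite \<Rightarrow> 'b"
  assumes "p1 permutes UNIV" "p2 permutes UNIV"
  shows "map_sum p1 p2 permutes UNIV" "sign (map_sum p1 p2) = sign p1 * sign p2"
proof -
  let ?l = "map_permutation UNIV (Inl :: 'a \<Rightarrow> 'a + 'b) p1" and ?r = "map_permutation UNIV (Inr :: 'b \<Rightarrow> 'a + 'b) p2"
  have l: "?l permutes range Inl" by (rule map_permutation_permutes[OF _ assms(1)]) (auto simp: bij_betw_def)
  have r: "?r permutes range Inr" by (rule map_permutation_permutes[OF _ assms(2)]) (auto simp: bij_betw_def)
  have apl: "?l (Inl i) = Inl (p1 i)" for i by (rule map_permutation_apply) auto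
  have apr: "?r (Inr i) = Inr (p2 i)" for i by (rule map_permutation_apply) auto
  have eq: "map_sum p1 p2 = ?l \<circ> ?r"
  proof
    fix x
    show "map_sum p1 p2 x = (?l \<circ> ?r) x"
    proof (cases x)
      case (Inl a)
      have "?r (Inl a) = Inl a" by (rule permutes_not_in[OF r]) auto
      then show ?thesis using Inl apl by simp
    next
      case (Inr b)
      have "?l (Inr (p2 b)) = Inr (p2 b)" by (rule permutes_not_in[OF l]) auto
      then show ?thesis using Inr apr by simp
    qed
  qed
  show "map_sum p1 p2 permutes UNIV"
    unfolding eq by (rule permutes_compose[OF permutes_subset[OF r] permutes_subset[OF l]]) auto
  have "permutation ?l" "permutation ?r"
    by (auto intro: permutes_imp_permutation[OF _ l] permutes_imp_permutation[OF _ r])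
  then have "sign (map_sum p1 p2) = sign ?l * sign ?r" unfolding eq by (rule sign_compose)
  also have "sign ?l = sign p1" by (rule sign_map_permutation) (use assms in auto)
  also have "sign ?r = sign p2" by (rule sign_map_permutation) (use assms in auto)
  finally show "sign (map_sum p1 p2) = sign p1 * sign p2" .
qed

text \<open>A permutation that sends some \<open>Inl i\<close> to an \<open>Inr j\<close> meets a
  zero entry. All others preserve both blocks, and their signs multiply.\<close>

lemma det_block_triangular:
  fixes M :: "'c::comm_ring_1^('a::finite + 'b::finite)^('a + 'b)"
  assumes z: "\<And>i j. M $ Inl i $ Inr j = 0"
  shows "det M = det (\<chi> i j. M $ Inl i $ Inl j) * det (\<chi> i j. M $ Inr i $ Inr j)"
proof -
  let ?P1 = "{p. p permutes (UNIV :: 'a set)}" and ?P2 = "{p. p permutes (UNIV :: 'b set)}"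
  let ?P = "{p. p permutes (UNIV :: ('a + 'b) set)}"
  let ?f = "\<lambda>p. of_int (sign p) * (\<Prod>x\<in>UNIV. M $ x $ p x)"
  have inj: "inj_on (\<lambda>(p1, p2). map_sum p1 p2 :: 'a + 'b \<Rightarrow> _) (?P1 \<times> ?P2)"
  proof (rule inj_onI, clarsimp)
    fix p1 p1' :: "'a \<Rightarrow> 'a" and p2 p2' :: "'b \<Rightarrow> 'b"
    assume eq: "map_sum p1 p2 = map_sum p1' p2'"
    have "p1 x = p1' x" for x using fun_cong[OF eq, of "Inl x"] by simp
    moreover have "p2 x = p2' x" for x using fun_cong[OF eq, of "Inr x"] by simp
    ultimately show "p1 = p1' \<and> p2 = p2'" by auto
  qed
  have "det M = sum ?f ?P" by (simp add: det_def)
  also have "\<dots> = sum ?f ((\<lambda>(p1, p2). map_sum p1 p2) ` (?P1 \<times> ?P2))"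
  proof (rule sum.mono_neutral_right)
    show "finite ?P" by (rule finite_permutations) simp
    show "(\<lambda>(p1, p2). map_sum p1 p2) ` (?P1 \<times> ?P2) \<subseteq> ?P" using map_sum_permutes_sign(1) by auto
    show "\<forall>p\<in>?P - (\<lambda>(p1, p2). map_sum p1 p2) ` (?P1 \<times> ?P2). ?f p = 0"
    proof
      fix p assume p: "p \<in> ?P - (\<lambda>(p1, p2). map_sum p1 p2) ` (?P1 \<times> ?P2)"
      then have "\<exists>i. p (Inl i) \<notin> range Inl" using permutes_Inl_decompose[of p] by force
      then obtain i where "p (Inl i) \<notin> range Inl" by blast
      then obtain j where "p (Inl i) = Inr j" by (cases "p (Inl i)") auto
      then have "M $ Inl i $ p (Inl i) = 0" using z by simp
      then have "(\<Prod>x\<in>UNIV. M $ x $ p x) = 0" by (intro prod_zero) auto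
      then show "?f p = 0" by simp
    qed
  qed
  also have "\<dots> = (\<Sum>(p1, p2)\<in>?P1 \<times> ?P2. ?f (map_sum p1 p2))"
    by (subst sum.reindex[OF inj]) (simp add: o_def split_beta)
  also have "\<dots> = (\<Sum>(p1, p2)\<in>?P1 \<times> ?P2. (of_int (sign p1) * (\<Prod>i\<in>UNIV. M $ Inl i $ Inl (p1 i))) *
      (of_int (sign p2) * (\<Prod>i\<in>UNIV. M $ Inr i $ Inr (p2 i))))"
  proof (intro sum.cong refl, clarsimp)
    fix p1 :: "'a \<Rightarrow> 'a" and p2 :: "'b \<Rightarrow> 'b" assume p: "p1 permutes UNIV" "p2 permutes UNIV"
    have "(\<Prod>x\<in>UNIV <+> UNIV. M $ x $ map_sum p1 p2 x) = (\<Prod>i\<in>UNIV. M $ Inl i $ Inl (p1 i)) * (\<Prod>i\<in>UNIV. M $ Inr i $ Inr (p2 i))"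
      by (subst prod.Plus) auto
    then show "of_int (sign (map_sum p1 p2)) * (\<Prod>x\<in>UNIV. M $ x $ map_sum p1 p2 x) =
      of_int (sign p1) * (\<Prod>i\<in>UNIV. M $ Inl i $ Inl (p1 i)) * (of_int (sign p2) * (\<Prod>i\<in>UNIV. M $ Inr i $ Inr (p2 i)))"
      by (simp add: UNIV_Plus_UNIV map_sum_permutes_sign(2)[OF p] mult_ac)
  qed
  also have "\<dots> = det (\<chi> i j. M $ Inl i $ Inl j) * det (\<chi> i j. M $ Inr i $ Inr j)"
    unfolding det_def by (simp add: sum_product sum.cartesian_product)
  finally show ?thesis .
qed

lemma det_cnj: "det (\<chi> i j. cnj (J $ i $ j)) = cnj (det (J :: complex^'n^'n))"
  unfolding det_def by (simp add: cnj_sum cnj_prod)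

lemma det_of_real: "det (\<chi> i j. complex_of_real (M $ i $ j)) = of_real (det (M :: real^'n^'n))"
  unfolding det_def by (simp add: of_real_sum of_real_prod)

text \<open>Entry of the real matrix of the complex linear map with matrix \<open>J\<close>, where \<open>Inl\<close> and \<open>Inr\<close>
  mark real and imaginary parts.\<close>

fun real_entry :: "complex^'n^'n \<Rightarrow> 'n + 'n \<Rightarrow> 'n + 'n \<Rightarrow> real" where
  "real_entry J (Inl k) (Inl i) = Re (J $ k $ i)"
| "real_entry J (Inl k) (Inr i) = - Im (J $ k $ i)"
| "real_entry J (Inr k) (Inl i) = Im (J $ k $ i)"
| "real_entry J (Inr k) (Inr i) = Re (J $ k $ i)"

text \<open>Conjugation with the unipotent matrix \<open>P \<i>\<close>, whose inverse is
  \<open>P (- \<i>)\<close>, adds \<open>\<i>\<close> times the lower rows to the upper ones and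
  subtracts \<open>\<i>\<close> times the left columns from the right ones. The result is block
  triangular with diagonal blocks \<open>J\<close> and its complex conjugate.\<close>

lemma det_real_entry:
  fixes J :: "complex^'n^'n"
  shows "det (\<chi> x y. real_entry J x y) = (norm (det J))\<^sup>2"
proof -
  define X :: "complex^('n + 'n)^('n + 'n)" where "X = (\<chi> x y. complex_of_real (real_entry J x y))"
  define P :: "complex \<Rightarrow> complex^('n + 'n)^('n + 'n)" where
    "P c = (\<chi> x y. case x of Inl i \<Rightarrow> (case y of Inl j \<Rightarrow> (if i = j then 1 else 0) | Inr j \<Rightarrow> (if i = j then c else 0))
       | Inr i \<Rightarrow> (case y of Inl j \<Rightarrow> 0 | Inr j \<Rightarrow> (if i = j then 1 else 0)))" for c
  have detP: "det (P c) = 1" for c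
  proof -
    have "det (P c) = det (Finite_Cartesian_Product.transpose (P c))" by (simp add: det_transpose)
    also have "\<dots> = det (\<chi> i j. Finite_Cartesian_Product.transpose (P c) $ Inl i $ Inl j) * det (\<chi> i j. Finite_Cartesian_Product.transpose (P c) $ Inr i $ Inr j)"
      by (rule det_block_triangular) (simp add: P_def Finite_Cartesian_Product.transpose_def)
    also have "(\<chi> i j. Finite_Cartesian_Product.transpose (P c) $ Inl i $ Inl j) = (mat 1 :: complex^'n^'n)"
      by (auto simp: P_def Finite_Cartesian_Product.transpose_def mat_def vec_eq_iff)
    also have "(\<chi> i j. Finite_Cartesian_Product.transpose (P c) $ Inr i $ Inr j) = (mat 1 :: complex^'n^'n)"
      by (auto simp: P_def Finite_Cartesian_Product.transpose_def mat_def vec_eq_iff)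
    finally show ?thesis by simp
  qed
  have sumP: "(\<Sum>x\<in>UNIV. f x) = (\<Sum>i\<in>UNIV. f (Inl i)) + (\<Sum>i\<in>UNIV. f (Inr i))" for f :: "'n + 'n \<Rightarrow> complex"
    unfolding UNIV_Plus_UNIV[symmetric] by (subst sum.Plus) auto
  define Y where "Y = P \<i> ** X ** P (- \<i>)"
  have Xe: "X $ Inl k $ Inl i = of_real (Re (J $ k $ i))" "X $ Inl k $ Inr i = - of_real (Im (J $ k $ i))"
    "X $ Inr k $ Inl i = of_real (Im (J $ k $ i))" "X $ Inr k $ Inr i = of_real (Re (J $ k $ i))" for k i
    by (simp_all add: X_def)
  have PX: "(P \<i> ** X) $ Inl i $ y = X $ Inl i $ y + \<i> * X $ Inr i $ y" "(P \<i> ** X) $ Inr i $ y = X $ Inr i $ y" for i y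
    unfolding matrix_matrix_mult_def
    by (simp_all add: sumP P_def if_distrib[of "\<lambda>x. x * _"] cong: if_cong)
  have Y: "Y $ x $ Inl j = (P \<i> ** X) $ x $ Inl j" "Y $ x $ Inr j = (P \<i> ** X) $ x $ Inr j - \<i> * (P \<i> ** X) $ x $ Inl j" for x j
    unfolding Y_def matrix_matrix_mult_def[of _ "P (- \<i>)"]
    by (simp_all add: sumP P_def if_distrib[of "\<lambda>x. _ * x"] cong: if_cong)
  have "det Y = det (\<chi> i j. Y $ Inl i $ Inl j) * det (\<chi> i j. Y $ Inr i $ Inr j)"
    by (rule det_block_triangular) (simp add: Y PX Xe complex_eq_iff)
  also have "(\<chi> i j. Y $ Inl i $ Inl j) = J"
    by (simp add: Y PX Xe vec_eq_iff complex_eq_iff)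
  also have "(\<chi> i j. Y $ Inr i $ Inr j) = (\<chi> i j. cnj (J $ i $ j))"
    by (simp add: Y PX Xe vec_eq_iff complex_eq_iff)
  also have "det J * det (\<chi> i j. cnj (J $ i $ j)) = of_real ((norm (det J))\<^sup>2)"
    by (simp only: det_cnj complex_norm_square)
  finally have "det Y = of_real ((norm (det J))\<^sup>2)" .
  moreover have "det Y = det X" by (simp add: Y_def det_mul detP)
  moreover have "det X = of_real (det (\<chi> x y. real_entry J x y))"
    using det_of_real[of "\<chi> x y. real_entry J x y"] by (simp add: X_def)
  ultimately show ?thesis by (simp only: of_real_eq_iff)
qed

section \<open>Identification of complex n-space with real 2n-space\<close>

context
  fixes b :: "'n::finite + 'n \<Rightarrow> 'n bit0"
  assumes b: "bij b"
begin

text \<open>\<open>'n bit0\<close> has \<open>2 n\<close> elements and is well-ordered, as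
  \<open>change_of_variables_real_aux\<close> demands of its index type. The bijection
  \<open>b\<close> matches these elements with the real and imaginary parts.\<close>

definition to_real_vec :: "complex^'n \<Rightarrow> real^('n bit0)" where
  "to_real_vec z = (\<chi> k. case inv b k of Inl i \<Rightarrow> Re (z $ i) | Inr i \<Rightarrow> Im (z $ i))"

definition of_real_vec :: "real^('n bit0) \<Rightarrow> complex^'n" where
  "of_real_vec w = (\<chi> i. Complex (w $ b (Inl i)) (w $ b (Inr i)))"

lemma inv_b [simp]: "inv b (b x) = x"
  using b by (simp add: bij_is_inj)

lemma b_inv [simp]: "b (inv b k) = k"
  using b by (simp add: surj_f_inv_f bij_is_surj)

lemma to_real_vec_b [simp]: "to_real_vec z $ b (Inl i) = Re (z $ i)" "to_real_vec z $ b (Inr i) = Im (z $ i)"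
  by (simp_all add: to_real_vec_def)

lemma of_real_vec_to [simp]: "of_real_vec (to_real_vec z) = z"
  by (simp add: of_real_vec_def vec_eq_iff)

lemma to_real_vec_of [simp]: "to_real_vec (of_real_vec w) = w"
proof -
  have "to_real_vec (of_real_vec w) $ b (inv b k) = w $ b (inv b k)" for k
    by (cases "inv b k") (simp_all only: to_real_vec_b, simp_all add: of_real_vec_def)
  then show ?thesis by (simp add: vec_eq_iff)
qed

lemma linear_to_real_vec: "linear to_real_vec"
  by (rule linearI) (auto simp: to_real_vec_def vec_eq_iff split: sum.splits)

lemma linear_of_real_vec: "linear of_real_vec"
  by (rule linearI) (auto simp: of_real_vec_def vec_eq_iff complex_eq_iff)

lemma bl_to: "bounded_linear to_real_vec" and bl_of: "bounded_linear of_real_vec"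
  using linear_to_real_vec linear_of_real_vec by (simp_all add: linear_conv_bounded_linear)

lemma of_real_vec_axis: "of_real_vec (axis (b (Inl i)) 1) = axis i 1" "of_real_vec (axis (b (Inr i)) 1) = axis i \<i>"
  using b by (auto simp: of_real_vec_def vec_eq_iff axis_def complex_eq_iff dest: injD[OF bij_is_inj])

lemma of_real_vec_Basis: "bij_betw of_real_vec Basis Basis"
proof (rule bij_betw_byWitness[where f' = to_real_vec])
  have 1: "axis (b x) (1::real) \<in> Basis" "of_real_vec (axis (b x) 1) \<in> Basis" for x
    by (cases x; simp add: of_real_vec_axis axis_in_Basis_iff Basis_complex_def)+
  show "of_real_vec ` Basis \<subseteq> Basis"
  proof
    fix z assume "z \<in> of_real_vec ` Basis"
    then obtain k where "z = of_real_vec (axis k 1)" by (auto simp: Basis_vec_def)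
    then show "z \<in> Basis" using 1(2)[of "inv b k"] by simp
  qed
  show "to_real_vec ` Basis \<subseteq> Basis"
  proof
    fix w assume "w \<in> to_real_vec ` Basis"
    then obtain i c where w: "w = to_real_vec (axis i c)" "c = 1 \<or> c = \<i>"
      by (auto simp: Basis_vec_def Basis_complex_def)
    then have "w = to_real_vec (of_real_vec (axis (b (Inl i)) 1)) \<or> w = to_real_vec (of_real_vec (axis (b (Inr i)) 1))"
      by (auto simp: of_real_vec_axis)
    then show "w \<in> Basis" using 1(1) by auto
  qed
qed auto

lemma to_real_vec_inner: "y \<in> Basis \<Longrightarrow> to_real_vec z \<bullet> y = z \<bullet> of_real_vec y"
proof -
  assume "y \<in> Basis"
  then obtain k where k: "y = axis k 1" by (auto simp: Basis_vec_def)
  have "to_real_vec z \<bullet> axis (b (inv b k)) 1 = z \<bullet> of_real_vec (axis (b (inv b k)) 1)"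
    by (cases "inv b k") (simp_all only: inner_axis of_real_vec_axis to_real_vec_b, simp_all add: inner_complex_def)
  then show ?thesis using k by simp
qed

text \<open>Coordinates are only relabelled, so the preimage of a box is a box with the same edge
  lengths, and Lebesgue measure is determined by its values on boxes.\<close>

lemma distr_to_real_vec: "distr lborel borel to_real_vec = lborel"
proof (rule lborel_eqI[symmetric])
  have m: "to_real_vec \<in> borel_measurable borel"
    using bl_to by (intro borel_measurable_continuous_onI linear_continuous_on)
  fix l u :: "real^('n bit0)" assume le: "\<And>b. b \<in> Basis \<Longrightarrow> l \<bullet> b \<le> u \<bullet> b"
  have inn: "of_real_vec w \<bullet> of_real_vec y = w \<bullet> y" if "y \<in> Basis" for w y
    using to_real_vec_inner[OF that, of "of_real_vec w"] by simp
  have ball: "(\<forall>y\<in>Basis. P (of_real_vec y)) \<longleftrightarrow> (\<forall>e\<in>Basis. P e)" for P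
    using of_real_vec_Basis unfolding bij_betw_def by (metis (no_types, lifting) image_iff)
  have pre: "to_real_vec -` box l u = box (of_real_vec l) (of_real_vec u)"
  proof (rule set_eqI)
    fix z
    have "z \<in> to_real_vec -` box l u \<longleftrightarrow> (\<forall>y\<in>Basis. of_real_vec l \<bullet> of_real_vec y < z \<bullet> of_real_vec y \<and> z \<bullet> of_real_vec y < of_real_vec u \<bullet> of_real_vec y)"
      by (simp add: mem_box to_real_vec_inner inn)
    also have "\<dots> \<longleftrightarrow> z \<in> box (of_real_vec l) (of_real_vec u)"
      unfolding mem_box by (rule ball[of "\<lambda>e. of_real_vec l \<bullet> e < z \<bullet> e \<and> z \<bullet> e < of_real_vec u \<bullet> e"])
    finally show "z \<in> to_real_vec -` box l u \<longleftrightarrow> z \<in> box (of_real_vec l) (of_real_vec u)" .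
  qed
  have le': "\<forall>e\<in>Basis. of_real_vec l \<bullet> e \<le> of_real_vec u \<bullet> e"
    using le inn ball[of "\<lambda>e. of_real_vec l \<bullet> e \<le> of_real_vec u \<bullet> e"] by simp
  have "emeasure (distr lborel borel to_real_vec) (box l u) = emeasure lborel (box (of_real_vec l) (of_real_vec u))"
    using m by (simp add: emeasure_distr pre)
  also have "\<dots> = (\<Prod>e\<in>Basis. (of_real_vec u - of_real_vec l) \<bullet> e)"
    using le' by (simp add: emeasure_lborel_box)
  also have "(\<Prod>e\<in>Basis. (of_real_vec u - of_real_vec l) \<bullet> e) = (\<Prod>y\<in>Basis. (of_real_vec u - of_real_vec l) \<bullet> of_real_vec y)"
    by (rule prod.reindex_bij_betw[OF of_real_vec_Basis, symmetric])
  also have "\<dots> = (\<Prod>y\<in>Basis. (u - l) \<bullet> y)"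
    by (rule prod.cong) (auto simp: inn inner_diff_left)
  finally show "emeasure (distr lborel borel to_real_vec) (box l u) = (\<Prod>y\<in>Basis. (u - l) \<bullet> y)" .
qed simp

lemma integral_to_real_vec:
  fixes f :: "complex^'n \<Rightarrow> real"
  assumes "f \<in> borel_measurable borel"
  shows "(LINT w|lborel. f (of_real_vec w)) = (LINT z|lborel. f z)"
    and "integrable lborel f \<Longrightarrow> integrable lborel (\<lambda>w. f (of_real_vec w))"
proof -
  have m: "to_real_vec \<in> borel_measurable borel" "of_real_vec \<in> borel_measurable borel"
    using bl_to bl_of by (intro borel_measurable_continuous_onI linear_continuous_on; simp)+
  have fm: "(\<lambda>w. f (of_real_vec w)) \<in> borel_measurable borel"
    using assms m by measurable
  have "(LINT w|distr lborel borel to_real_vec. f (of_real_vec w)) = (LINT z|lborel. f (of_real_vec (to_real_vec z)))"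
    using m fm by (intro integral_distr) auto
  then show "(LINT w|lborel. f (of_real_vec w)) = (LINT z|lborel. f z)" by (simp add: distr_to_real_vec)
  have "integrable (distr lborel borel to_real_vec) (\<lambda>w. f (of_real_vec w)) \<longleftrightarrow> integrable lborel (\<lambda>z. f (of_real_vec (to_real_vec z)))"
    using m fm by (intro integrable_distr_eq) auto
  then show "integrable lborel f \<Longrightarrow> integrable lborel (\<lambda>w. f (of_real_vec w))" by (simp add: distr_to_real_vec)
qed

lemma det_to_real_vec:
  fixes J :: "complex^'n^'n"
  shows "det (matrix (\<lambda>w. to_real_vec (J *v of_real_vec w))) = (norm (det J))\<^sup>2"
proof -
  let ?M = "matrix (\<lambda>w. to_real_vec (J *v of_real_vec w))"
  have mva: "(J *v axis i c) $ k = J $ k $ i * c" for i k c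
    by (simp add: matrix_vector_mult_def axis_def if_distrib[of "\<lambda>x. _ * x"] cong: if_cong)
  have "?M $ b x $ b y = real_entry J x y" for x y
    by (cases x; cases y; simp only: matrix_def vec_lambda_beta of_real_vec_axis to_real_vec_b mva; simp)
  then have "(\<chi> x y. ?M $ b x $ b y) = (\<chi> x y. real_entry J x y)" by simp
  then show ?thesis using det_reindex[OF b, of ?M] det_real_entry[of J] by simp
qed

end

section \<open>Change of variables under holomorphic maps\<close>

lemma change_of_variables_real_aux:
  fixes f :: "(real, 'm::{finite,wellorder}) vec \<Rightarrow> real" and \<phi> :: "(real, 'm) vec \<Rightarrow> (real, 'm) vec"
  assumes S: "S \<in> sets lebesgue" and d: "\<And>x. x \<in> S \<Longrightarrow> (\<phi> has_derivative \<phi>' x) (at x within S)"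
    and inj: "inj_on \<phi> S" and f: "f absolutely_integrable_on \<phi> ` S"
  shows "(\<lambda>x. \<bar>det (matrix (\<phi>' x))\<bar> * f (\<phi> x)) absolutely_integrable_on S"
    and "integral S (\<lambda>x. \<bar>det (matrix (\<phi>' x))\<bar> * f (\<phi> x)) = integral (\<phi> ` S) f"
proof -
  \<comment> \<open>The general theorem concerns vector-valued functions, so a real function is
    viewed as one with values in \<open>real^1\<close>.\<close>
  let ?f = "\<lambda>x. vec (f x) :: real^1"
  have f': "?f absolutely_integrable_on \<phi> ` S"
    using f by (simp add: absolutely_integrable_on_1_iff)
  have "(\<lambda>x. \<bar>det (matrix (\<phi>' x))\<bar> *\<^sub>R ?f (\<phi> x)) absolutely_integrable_on S \<and>
     integral S (\<lambda>x. \<bar>det (matrix (\<phi>' x))\<bar> *\<^sub>R ?f (\<phi> x)) = integral (\<phi> ` S) ?f"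
    using has_absolute_integral_change_of_variables[OF S d inj, of ?f "integral (\<phi> ` S) ?f"] f' by simp
  then show "(\<lambda>x. \<bar>det (matrix (\<phi>' x))\<bar> * f (\<phi> x)) absolutely_integrable_on S"
    "integral S (\<lambda>x. \<bar>det (matrix (\<phi>' x))\<bar> * f (\<phi> x)) = integral (\<phi> ` S) f"
    by (simp_all add: absolutely_integrable_on_1_iff integral_on_1_eq vec_eq_iff)
qed


lemma holo_has_derivative_matrix:
  fixes \<phi> :: "complex^'n \<Rightarrow> complex^'n"
  assumes h: "\<And>k. holo_on S (\<lambda>z. \<phi> z $ k)" and z: "z \<in> S"
  shows "(\<phi> has_derivative (\<lambda>v. (\<chi> k i. dz i (\<lambda>z. \<phi> z $ k) z) *v v)) (at z)"
proof -
  have D: "((\<lambda>z. \<phi> z $ k) has_derivative (\<lambda>v. ((\<chi> k i. dz i (\<lambda>z. \<phi> z $ k) z) *v v) $ k)) (at z)" for k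
  proof -
    have d: "(\<lambda>z. \<phi> z $ k) differentiable (at z)"
      using holo_on_frechet(1)[OF h z] by (auto simp: differentiable_def)
    have "frechet_derivative (\<lambda>z. \<phi> z $ k) (at z) = (\<lambda>v. ((\<chi> k i. dz i (\<lambda>z. \<phi> z $ k) z) *v v) $ k)"
      by (rule ext) (simp add: frechet_wirtinger[OF d] holo_on_dz(1)[OF h z] matrix_vector_mult_def)
    then show ?thesis using d by (simp only: frechet_derivative_works)
  qed
  have "((\<lambda>z. \<phi> z \<bullet> axis k b) has_derivative (\<lambda>v. ((\<chi> k i. dz i (\<lambda>z. \<phi> z $ k) z) *v v) \<bullet> axis k b)) (at z)" for k b
    unfolding inner_axis by (rule bounded_linear.has_derivative[OF bounded_linear_inner_left D])
  then have "\<forall>i\<in>Basis. ((\<lambda>z. \<phi> z \<bullet> i) has_derivative (\<lambda>v. ((\<chi> k i. dz i (\<lambda>z. \<phi> z $ k) z) *v v) \<bullet> i)) (at z)"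
    unfolding Basis_vec_def by blast
  then show ?thesis unfolding has_derivative_componentwise_within[of \<phi>] .
qed

lemma holo_on_dz_continuous: "holo_on S f \<Longrightarrow> open S \<Longrightarrow> continuous_on S (dz i f)"
  using Ck_on_dz(1)[of S 0 f i] holo_on_Ck[of S f "Suc 0"] Ck_on.simps(1) by blast

lemma continuous_on_det:
  fixes M :: "'a::topological_space \<Rightarrow> complex^'n^'n"
  assumes "\<And>i j. continuous_on S (\<lambda>z. M z $ i $ j)"
  shows "continuous_on S (\<lambda>z. det (M z))"
  unfolding det_def by (intro continuous_intros assms)

text \<open>In real coordinates the Jacobian determinant of \<open>\<phi>\<close> is
  \<open>(norm (det J))^2\<close> by \<open>det_to_real_vec\<close>. Being nonnegative, it equals
  its absolute value.\<close>

lemma holo_change_of_variables_real: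
  fixes \<phi> :: "complex^'n \<Rightarrow> complex^'n" and f :: "complex^'n \<Rightarrow> real"
  assumes S: "open S" and h: "\<And>k. holo_on S (\<lambda>z. \<phi> z $ k)" and inj: "inj_on \<phi> S" and I: "open (\<phi> ` S)"
    and c: "continuous_on (\<phi> ` S) f" and K: "compact K" "K \<subseteq> \<phi> ` S" "\<And>x. x \<notin> K \<Longrightarrow> f x = 0"
  shows "(LINT z:S|lborel. (norm (det (\<chi> k i. dz i (\<lambda>z. \<phi> z $ k) z)))\<^sup>2 * f (\<phi> z)) = (LINT w:\<phi> ` S|lborel. f w)"
proof -
  have "card (UNIV :: ('n + 'n) set) = card (UNIV :: 'n bit0 set)"
    by simp
  from finite_same_card_bij[OF finite finite this] obtain b :: "'n + 'n \<Rightarrow> 'n bit0" where b: "bij b"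
    by blast
  let ?to = "to_real_vec b" and ?of = "of_real_vec b"
  note to_of = to_real_vec_of[OF b] of_real_vec_to[OF b]
  note inti = integral_to_real_vec[OF b]
  let ?J = "\<lambda>z. (\<chi> k i. dz i (\<lambda>z. \<phi> z $ k) z) :: complex^'n^'n"
  let ?d = "\<lambda>z. (norm (det (?J z)))\<^sup>2"
  let ?\<phi> = "\<lambda>w. ?to (\<phi> (?of w))" and ?f = "\<lambda>w. f (?of w)"
  let ?S = "?of -` S"
  have blof: "bounded_linear ?of" and blto: "bounded_linear ?to" using bl_of[OF b] bl_to[OF b] by auto
  have cof: "continuous_on A ?of" for A using blof by (rule linear_continuous_on)
  have oS: "open ?S" using continuous_open_vimage[OF S] cof continuous_on_eq_continuous_at[OF open_UNIV] by blast
  have Sl: "?S \<in> sets lebesgue" using oS by (simp add: borel_open)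
  have \<phi>S: "?\<phi> ` ?S = ?of -` (\<phi> ` S)"
  proof (intro set_eqI iffI)
    fix w assume "w \<in> ?\<phi> ` ?S"
    then show "w \<in> ?of -` (\<phi> ` S)" using to_of by auto
  next
    fix w assume "w \<in> ?of -` (\<phi> ` S)"
    then obtain z where "z \<in> S" "?of w = \<phi> z" by auto
    then have "w = ?\<phi> (?to z)" "?to z \<in> ?S" using to_of(1)[of w] to_of(2)[of z] by auto
    then show "w \<in> ?\<phi> ` ?S" by blast
  qed
  have oI: "open (?of -` (\<phi> ` S))"
    using continuous_open_vimage[OF I] cof continuous_on_eq_continuous_at[OF open_UNIV] by blast
  have Il: "?\<phi> ` ?S \<in> sets lebesgue" unfolding \<phi>S using oI by (simp add: borel_open)
  have der: "(?\<phi> has_derivative (\<lambda>v. ?to (?J (?of w) *v ?of v))) (at w within ?S)" if "w \<in> ?S" for w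
  proof -
    have z: "?of w \<in> S" using that by simp
    have "(?of has_derivative ?of) (at w)" using blof by (rule bounded_linear_imp_has_derivative)
    from diff_chain_at[OF this holo_has_derivative_matrix[OF h z]]
    have "((\<lambda>w. \<phi> (?of w)) has_derivative (\<lambda>v. ?J (?of w) *v ?of v)) (at w)" by (simp add: o_def)
    from bounded_linear.has_derivative[OF blto this] show ?thesis by (rule has_derivative_at_withinI)
  qed
  have inj': "inj_on ?\<phi> ?S"
  proof (rule inj_onI)
    fix x y assume xy: "x \<in> ?S" "y \<in> ?S" "?\<phi> x = ?\<phi> y"
    then have "?of (?\<phi> x) = ?of (?\<phi> y)" by simp
    then have "\<phi> (?of x) = \<phi> (?of y)" by (simp only: to_of)
    then have "?of x = ?of y" using inj xy by (auto dest: inj_onD)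
    then show "x = y" using to_of(1) by metis
  qed
  \<comment> \<open>\<open>f\<close> is continuous on the image of \<open>\<phi>\<close> only. Its
    equality with its cutoff to the compact set \<open>K\<close> makes it measurable and integrable
    on the whole space.\<close>
  have f_eq: "f = (\<lambda>x. indicator K x *\<^sub>R f x)" using K(3) by (auto simp: indicator_def fun_eq_iff)
  have cK: "continuous_on K f" using c K(2) by (rule continuous_on_subset)
  have fm: "f \<in> borel_measurable borel"
    by (subst f_eq, rule borel_measurable_continuous_on_indicator) (use K(1) cK in \<open>auto simp: borel_compact\<close>)
  have fi: "integrable lborel f"
    by (subst f_eq, rule borel_integrable_compact[OF K(1) cK])
  have fm': "?f \<in> borel_measurable lborel"
    using measurable_compose[OF borel_measurable_continuous_onI[OF cof] fm] by simp
  have fi': "integrable lebesgue ?f" using inti(2)[OF fm fi] fm' by (simp add: integrable_completion)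
  have "?f absolutely_integrable_on ?\<phi> ` ?S"
    unfolding set_integrable_def by (rule integrable_mult_indicator[OF Il fi'])
  note cv = change_of_variables_real_aux[OF Sl der inj' this]
  have det: "\<bar>det (matrix (\<lambda>v. ?to (?J z *v ?of v)))\<bar> = ?d z" for z
    unfolding det_to_real_vec[OF b] by simp
  let ?G = "\<lambda>z. indicator S z *\<^sub>R (?d z * f (\<phi> z))"
  have cJ: "continuous_on S (\<lambda>z. det (?J z))"
    by (rule continuous_on_det) (simp add: holo_on_dz_continuous[OF h S])
  have c\<phi>: "continuous_on S \<phi>"
    using holo_has_derivative_matrix[OF h] has_derivative_continuous by (blast intro: continuous_at_imp_continuous_on)
  have "continuous_on S (\<lambda>z. ?d z * f (\<phi> z))"
    by (rule continuous_on_mult[OF continuous_on_power[OF continuous_on_norm[OF cJ]] continuous_on_compose2[OF c c\<phi>]]) simp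
  then have Gm: "?G \<in> borel_measurable borel"
    by (intro borel_measurable_continuous_on_indicator) (use S in auto)
  have Gm': "(\<lambda>w. ?G (?of w)) \<in> borel_measurable lborel"
    using measurable_compose[OF borel_measurable_continuous_onI[OF cof] Gm] by simp
  have "(LINT z:S|lborel. ?d z * f (\<phi> z)) = (LINT w|lborel. ?G (?of w))"
    unfolding set_lebesgue_integral_def using inti(1)[OF Gm] by simp
  also have "\<dots> = (LINT w|lebesgue. ?G (?of w))" using Gm' by (simp add: integral_completion)
  also have "\<dots> = (LINT w:?S|lebesgue. ?d (?of w) * f (\<phi> (?of w)))"
    unfolding set_lebesgue_integral_def by (intro Bochner_Integration.integral_cong refl) (simp add: indicator_def)
  also have "\<dots> = integral ?S (\<lambda>w. ?d (?of w) * f (\<phi> (?of w)))"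
    by (rule set_lebesgue_integral_eq_integral(2)) (use cv(1) in \<open>simp only: det to_of\<close>)
  also have "\<dots> = integral (?\<phi> ` ?S) ?f" using cv(2) by (simp only: det to_of)
  also have "\<dots> = (LINT w:?\<phi> ` ?S|lebesgue. ?f w)"
    by (rule set_lebesgue_integral_eq_integral(2)[symmetric])
       (unfold set_integrable_def, rule integrable_mult_indicator[OF Il fi'])
  also have "\<dots> = (LINT w|lebesgue. ?f w)"
    unfolding set_lebesgue_integral_def \<phi>S
    by (intro Bochner_Integration.integral_cong refl) (use K in \<open>auto simp: indicator_def\<close>)
  also have "\<dots> = (LINT w|lborel. ?f w)" using fm' by (rule integral_completion)
  also have "\<dots> = (LINT z|lborel. f z)" by (rule inti(1)[OF fm])
  also have "\<dots> = (LINT w:\<phi> ` S|lborel. f w)"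
    unfolding set_lebesgue_integral_def
    by (intro Bochner_Integration.integral_cong refl) (use K in \<open>auto simp: indicator_def\<close>)
  finally show ?thesis .
qed

lemma set_integral_Re_Im:
  fixes f :: "'a \<Rightarrow> complex"
  assumes "set_integrable M A f"
  shows "Re (LINT x:A|M. f x) = (LINT x:A|M. Re (f x))" "Im (LINT x:A|M. f x) = (LINT x:A|M. Im (f x))"
  using integral_Re[OF assms[unfolded set_integrable_def]] integral_Im[OF assms[unfolded set_integrable_def]]
  unfolding set_lebesgue_integral_def by simp_all

lemma set_integrable_supported:
  fixes f :: "'a::euclidean_space \<Rightarrow> 'b::{banach, second_countable_topology}"
  assumes "continuous_on S f" "compact K" "K \<subseteq> S" "\<And>x. x \<in> S \<Longrightarrow> x \<notin> K \<Longrightarrow> f x = 0"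
  shows "set_integrable lborel S f"
proof -
  have "integrable lborel (\<lambda>x. indicator K x *\<^sub>R f x)"
    by (rule borel_integrable_compact[OF assms(2) continuous_on_subset[OF assms(1,3)]])
  moreover have "(\<lambda>x. indicator K x *\<^sub>R f x) = (\<lambda>x. indicator S x *\<^sub>R f x)"
    using assms(3,4) by (auto simp: indicator_def fun_eq_iff)
  ultimately show ?thesis by (simp add: set_integrable_def)
qed

text \<open>Real and imaginary parts are treated separately. Splitting the two integrals requires
  integrability on both sides, which \<open>K'\<close> and \<open>K\<close> provide.\<close>

lemma holo_change_of_variables:
  fixes \<phi> :: "complex^'n \<Rightarrow> complex^'n" and f :: "complex^'n \<Rightarrow> complex"
  assumes S: "open S" and h: "\<And>k. holo_on S (\<lambda>z. \<phi> z $ k)" and inj: "inj_on \<phi> S" and I: "open (\<phi> ` S)"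
    and c: "continuous_on (\<phi> ` S) f" and K: "compact K" "K \<subseteq> \<phi> ` S" "\<And>x. x \<notin> K \<Longrightarrow> f x = 0"
    and K': "compact K'" "K' \<subseteq> S" "\<And>z. z \<in> S \<Longrightarrow> z \<notin> K' \<Longrightarrow> f (\<phi> z) = 0"
  shows "(LINT z:S|lborel. of_real ((norm (det (\<chi> k i. dz i (\<lambda>z. \<phi> z $ k) z)))\<^sup>2) * f (\<phi> z)) = (LINT w:\<phi> ` S|lborel. f w)"
proof -
  let ?d = "\<lambda>z. (norm (det (\<chi> k i. dz i (\<lambda>z. \<phi> z $ k) z)))\<^sup>2"
  have cJ: "continuous_on S (\<lambda>z. det (\<chi> k i. dz i (\<lambda>z. \<phi> z $ k) z))"
    by (rule continuous_on_det) (simp add: holo_on_dz_continuous[OF h S])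
  have c\<phi>: "continuous_on S \<phi>"
    using holo_has_derivative_matrix[OF h] has_derivative_continuous by (blast intro: continuous_at_imp_continuous_on)
  have "continuous_on S (\<lambda>z. of_real (?d z) * f (\<phi> z))"
    by (intro continuous_on_mult continuous_on_of_real continuous_on_power continuous_on_norm cJ
        continuous_on_compose2[OF c c\<phi>]) simp
  then have i1: "set_integrable lborel S (\<lambda>z. of_real (?d z) * f (\<phi> z))"
    by (rule set_integrable_supported[OF _ K'(1,2)]) (use K'(3) in simp)
  have i2: "set_integrable lborel (\<phi> ` S) f"
    by (rule set_integrable_supported[OF c K(1,2)]) (use K(3) in simp)
  have "(LINT z:S|lborel. ?d z * Re (f (\<phi> z))) = (LINT w:\<phi> ` S|lborel. Re (f w))"
    by (rule holo_change_of_variables_real[OF S h inj I _ K(1,2)]) (use K(3) c in \<open>auto intro: continuous_on_Re\<close>)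
  moreover have "(LINT z:S|lborel. ?d z * Im (f (\<phi> z))) = (LINT w:\<phi> ` S|lborel. Im (f w))"
    by (rule holo_change_of_variables_real[OF S h inj I _ K(1,2)]) (use K(3) c in \<open>auto intro: continuous_on_Im\<close>)
  ultimately show ?thesis
    by (simp only: complex_eq_iff set_integral_Re_Im[OF i1] set_integral_Re_Im[OF i2] Re_complex_of_real Im_complex_of_real
        times_complex.simps) simp
qed

section \<open>Hermitian forms\<close>

text \<open>Vectors are plain functions, so that covariant derivatives and columns of matrices can
  be inserted directly.\<close>

definition sform :: "('i::finite \<Rightarrow> 'i \<Rightarrow> complex) \<Rightarrow> ('i \<Rightarrow> complex) \<Rightarrow> ('i \<Rightarrow> complex) \<Rightarrow> complex" where
  "sform B u v = (\<Sum>i\<in>UNIV. \<Sum>j\<in>UNIV. B i j * u i * cnj (v j))"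

definition hermitian :: "('i::finite \<Rightarrow> 'i \<Rightarrow> complex) \<Rightarrow> bool" where
  "hermitian B \<longleftrightarrow> (\<forall>i j. B j i = cnj (B i j))"

definition pos_semidef :: "('i::finite \<Rightarrow> 'i \<Rightarrow> complex) \<Rightarrow> bool" where
  "pos_semidef B \<longleftrightarrow> hermitian B \<and> (\<forall>v. 0 \<le> Re (sform B v v))"

definition pos_def :: "('i::finite \<Rightarrow> 'i \<Rightarrow> complex) \<Rightarrow> bool" where
  "pos_def B \<longleftrightarrow> hermitian B \<and> (\<forall>v. v \<noteq> (\<lambda>i. 0) \<longrightarrow> 0 < Re (sform B v v))"

lemma hermitianD: "hermitian B \<Longrightarrow> cnj (B i j) = B j i"
  unfolding hermitian_def by metis

lemma hermitianI: "(\<And>i j. cnj (B i j) = B j i) \<Longrightarrow> hermitian B"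
  unfolding hermitian_def by metis

lemma sform_add:
  "sform B (\<lambda>i. u i + u' i) v = sform B u v + sform B u' v"
  "sform B u (\<lambda>i. v i + v' i) = sform B u v + sform B u v'"
  by (simp_all add: sform_def ring_distribs sum.distrib)

lemma sform_scale:
  "sform B (\<lambda>i. c * u i) v = c * sform B u v" "sform B u (\<lambda>i. c * v i) = cnj c * sform B u v"
  by (simp_all add: sform_def sum_distrib_left mult_ac)

lemma sform_zero [simp]: "sform B (\<lambda>i. 0) v = 0" "sform B u (\<lambda>i. 0) = 0"
  by (simp_all add: sform_def)

lemma sform_unit_right: "sform B u (\<lambda>i. if i = k then 1 else 0) = (\<Sum>i\<in>UNIV. B i k * u i)"
  by (simp add: sform_def if_distrib[of cnj] if_distrib[of "\<lambda>x. _ * x"] cong: if_cong)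

lemma sform_unit_left: "sform B (\<lambda>i. if i = k then 1 else 0) u = (\<Sum>j\<in>UNIV. B k j * cnj (u j))"
proof -
  have "sform B (\<lambda>i. if i = k then 1 else 0) u = (\<Sum>i\<in>UNIV. if i = k then \<Sum>j\<in>UNIV. B k j * cnj (u j) else 0)"
    unfolding sform_def by (rule sum.cong) auto
  then show ?thesis by simp
qed

lemma sform_unit_unit: "sform B (\<lambda>j. if j = i then 1 else 0) (\<lambda>i. if i = k then 1 else 0) = B i k"
  by (simp add: sform_unit_right if_distrib[of "\<lambda>x. _ * x"] cong: if_cong)

lemma sform_sum:
  "sform B (\<lambda>i. \<Sum>k\<in>A. u k i) v = (\<Sum>k\<in>A. sform B (u k) v)"
  "sform B u' (\<lambda>i. \<Sum>k\<in>A. v' k i) = (\<Sum>k\<in>A. sform B u' (v' k))"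
  by (induction A rule: infinite_finite_induct) (simp_all add: sform_add)

lemma sform_swap: "hermitian B \<Longrightarrow> sform B v u = cnj (sform B u v)"
  unfolding sform_def cnj_sum
  by (subst sum.swap) (intro sum.cong refl, simp add: hermitianD mult_ac)

lemma sform_real: "hermitian B \<Longrightarrow> sform B v v = of_real (Re (sform B v v))"
  using sform_swap[of B v v] by (simp add: complex_eq_iff)

lemma pos_def_imp_semidef: "pos_def B \<Longrightarrow> pos_semidef B"
  unfolding pos_def_def pos_semidef_def by (metis less_eq_real_def sform_zero(1) zero_complex.simps(1))

lemma sform_shift:
  assumes "hermitian B"
  shows "Re (sform B (\<lambda>i. u i + c * v i) (\<lambda>i. u i + c * v i)) =
    Re (sform B u u) + 2 * Re (cnj c * sform B u v) + (norm c)\<^sup>2 * Re (sform B v v)"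
proof -
  have "sform B (\<lambda>i. u i + c * v i) (\<lambda>i. u i + c * v i) =
    sform B u u + (cnj c * sform B u v + cnj (cnj c * sform B u v)) + c * cnj c * sform B v v"
    by (simp add: sform_add sform_scale sform_swap[OF assms, of v u] algebra_simps)
  moreover have "Re (c * cnj c * sform B v v) = (norm c)\<^sup>2 * Re (sform B v v)"
    unfolding complex_norm_square[symmetric] by simp
  ultimately show ?thesis by simp
qed

text \<open>A positive bound \<open>q\<close> takes the place of \<open>B(v, v)\<close>. This avoids
  the degenerate case \<open>B(v, v) = 0\<close>, and in the Bochner estimate \<open>q\<close> is
  \<open>f + \<epsilon>\<close>.\<close>

lemma pos_semidef_cauchy_schwarz_eps:
  assumes B: "pos_semidef B" and q: "Re (sform B v v) \<le> q" "q > 0"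
  shows "(norm (sform B u v))\<^sup>2 \<le> Re (sform B u u) * q"
proof -
  have h: "hermitian B" and p: "0 \<le> Re (sform B w w)" for w using B by (auto simp: pos_semidef_def)
  define s where "s = sform B u v"
  \<comment> \<open>For \<open>q = B(v, v)\<close> this is the minimizer of
    \<open>B(u + c v, u + c v)\<close>.\<close>
  define c where "c = - s / of_real q"
  have nc: "(norm c)\<^sup>2 = (norm s)\<^sup>2 / q\<^sup>2"
    using q by (simp add: c_def norm_divide power_divide)
  have "cnj c * s = - of_real ((norm s)\<^sup>2 / q)"
    unfolding c_def of_real_divide complex_norm_square by (simp add: mult.commute)
  then have rc: "Re (cnj c * s) = - ((norm s)\<^sup>2 / q)" by simp
  have "0 \<le> Re (sform B u u) + 2 * Re (cnj c * s) + (norm c)\<^sup>2 * Re (sform B v v)"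
    using p[of "\<lambda>i. u i + c * v i"] unfolding sform_shift[OF h] s_def .
  also have "\<dots> \<le> Re (sform B u u) + 2 * Re (cnj c * s) + (norm c)\<^sup>2 * q"
    using q by (intro add_left_mono mult_left_mono) auto
  also have "\<dots> = Re (sform B u u) - (norm s)\<^sup>2 / q"
    unfolding rc nc using q by (simp add: power2_eq_square)
  finally have "(norm s)\<^sup>2 / q \<le> Re (sform B u u)" by simp
  then show ?thesis using q by (simp add: s_def pos_divide_le_eq)
qed

lemma pos_semidef_null:
  assumes B: "pos_semidef B" and u: "Re (sform B u u) = 0"
  shows "sform B u v = 0"
proof -
  have "Re (sform B v v) \<le> Re (sform B v v) + 1" "Re (sform B v v) + 1 > 0"
    using B unfolding pos_semidef_def by (auto simp: add_nonneg_pos)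
  from pos_semidef_cauchy_schwarz_eps[OF B this, of u] u show ?thesis by simp
qed

text \<open>The rank one matrix that is subtracted clears row and column \<open>k\<close>.\<close>

lemma pos_semidef_clear:
  assumes B: "pos_semidef B" and k: "B k k \<noteq> 0"
  defines "B' \<equiv> \<lambda>i j. B i j - B i k * B k j / B k k"
  shows "pos_semidef B'" "{i. B' i i \<noteq> 0} \<subset> {i. B i i \<noteq> 0}"
proof -
  have h: "hermitian B" and p: "0 \<le> Re (sform B w w)" for w using B by (auto simp: pos_semidef_def)
  define e :: "'a \<Rightarrow> complex" where "e = (\<lambda>i. if i = k then 1 else 0)"
  have se: "sform B u e = (\<Sum>i\<in>UNIV. B i k * u i)" "sform B e u = (\<Sum>j\<in>UNIV. B k j * cnj (u j))" for u
    unfolding e_def by (rule sform_unit_right, rule sform_unit_left)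
  have ee: "sform B e e = B k k"
    unfolding e_def by (rule sform_unit_unit)
  have rk: "B k k = of_real (Re (B k k))" using sform_real[OF h, of e] by (simp add: ee)
  have pk: "Re (B k k) > 0" using p[of e] k rk by (metis ee less_eq_real_def of_real_0)
  have diag_nonneg: "0 \<le> Re (C i i)" if "pos_semidef C" for C :: "'a \<Rightarrow> 'a \<Rightarrow> complex" and i
  proof -
    have "sform C (\<lambda>j. if j = i then 1 else 0) (\<lambda>j. if j = i then 1 else 0) = C i i"
      by (rule sform_unit_unit)
    then show ?thesis using that unfolding pos_semidef_def by metis
  qed
  have h': "hermitian B'"
    by (rule hermitianI) (simp add: B'_def hermitianD[OF h] mult.commute)
  have "sform B' v v = sform B v v - sform B v e * sform B e v / B k k" for v
  proof -
    have "sform B' v v = (\<Sum>i\<in>UNIV. \<Sum>j\<in>UNIV. B i j * v i * cnj (v j) - (B i k * v i) * (B k j * cnj (v j)) / B k k)"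
      unfolding sform_def B'_def by (intro sum.cong refl) (simp add: left_diff_distrib right_diff_distrib mult_ac)
    then show ?thesis
      unfolding se by (simp add: sform_def sum_subtractf sum_product sum_divide_distrib)
  qed
  then have "Re (sform B' v v) = Re (sform B v v) - (norm (sform B v e))\<^sup>2 / Re (B k k)" for v
  proof -
    assume *: "\<And>v. sform B' v v = sform B v v - sform B v e * sform B e v / B k k"
    have "sform B v e * sform B e v = of_real ((norm (sform B v e))\<^sup>2)"
      unfolding sform_swap[OF h, of e v] complex_norm_square ..
    then show ?thesis unfolding * by (subst rk) (simp del: of_real_power)
  qed
  moreover have "(norm (sform B v e))\<^sup>2 \<le> Re (sform B v v) * Re (B k k)" for v
    by (rule pos_semidef_cauchy_schwarz_eps[OF B]) (use pk ee in auto)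
  ultimately have "0 \<le> Re (sform B' v v)" for v using pk by (simp add: pos_divide_le_eq)
  then show psd: "pos_semidef B'" using h' by (simp add: pos_semidef_def)
  \<comment> \<open>If \<open>B i i = 0\<close>, the new entry is
    \<open>- |B i k|^2 / B k k\<close>, which is at most zero, while diagonal entries of a
    semidefinite form are at least zero. So no diagonal entry becomes nonzero, and the one at
    \<open>k\<close> disappears.\<close>
  have "B' i i = 0" if "B i i = 0" for i
  proof -
    have "B' i i = - (of_real ((norm (B i k))\<^sup>2) / of_real (Re (B k k)))"
      unfolding B'_def complex_norm_square hermitianD[OF h] rk[symmetric] using that by simp
    then have eq: "B' i i = of_real (- ((norm (B i k))\<^sup>2 / Re (B k k)))" by simp
    have "- ((norm (B i k))\<^sup>2 / Re (B k k)) \<le> 0" using pk by simp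
    moreover have "0 \<le> - ((norm (B i k))\<^sup>2 / Re (B k k))" using diag_nonneg[OF psd, of i] unfolding eq by simp
    ultimately show ?thesis unfolding eq by simp
  qed
  moreover have "B' k k = 0" using k by (simp add: B'_def)
  ultimately show "{i. B' i i \<noteq> 0} \<subset> {i. B i i \<noteq> 0}" using k by blast
qed

text \<open>Each clearing step splits off \<open>v v* / B k k\<close>, where \<open>v\<close> is
  column \<open>k\<close> of \<open>B\<close>, and this contributes \<open>A(v, v) / B k k\<close>.
  The number of nonzero diagonal entries drops, and a semidefinite matrix with zero diagonal is zero
  by \<open>pos_semidef_null\<close>.\<close>

lemma trace_pos_semidef:
  assumes A: "\<And>u. 0 \<le> Re (sform A u u)" and B: "pos_semidef B"
  shows "0 \<le> Re (\<Sum>i\<in>UNIV. \<Sum>j\<in>UNIV. A i j * B i j)"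
  using B
proof (induction "card {i. B i i \<noteq> 0}" arbitrary: B rule: less_induct)
  case less
  have h: "hermitian B" using less.prems by (simp add: pos_semidef_def)
  show ?case
  proof (cases "\<exists>k. B k k \<noteq> 0")
    case True
    then obtain k where k: "B k k \<noteq> 0" by blast
    define B' where "B' = (\<lambda>i j. B i j - B i k * B k j / B k k)"
    have c: "pos_semidef B'" "{i. B' i i \<noteq> 0} \<subset> {i. B i i \<noteq> 0}"
      using pos_semidef_clear[OF less.prems k] unfolding B'_def by blast+
    have "card {i. B' i i \<noteq> 0} < card {i. B i i \<noteq> 0}" by (rule psubset_card_mono[OF finite c(2)])
    from less.hyps[OF this c(1)] have 1: "0 \<le> Re (\<Sum>i\<in>UNIV. \<Sum>j\<in>UNIV. A i j * B' i j)" .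
    have rk: "B k k = of_real (Re (B k k))" using hermitianD[OF h, of k k] by (simp add: complex_eq_iff)
    have pk: "Re (B k k) > 0"
    proof -
      have "sform B (\<lambda>j. if j = k then 1 else 0) (\<lambda>j. if j = k then 1 else 0) = B k k"
        by (rule sform_unit_unit)
      then have "0 \<le> Re (B k k)" using less.prems unfolding pos_semidef_def by metis
      then show ?thesis using k rk by (metis less_eq_real_def of_real_0)
    qed
    have "(\<Sum>i\<in>UNIV. \<Sum>j\<in>UNIV. A i j * B i j) = (\<Sum>i\<in>UNIV. \<Sum>j\<in>UNIV. A i j * B' i j) + sform A (\<lambda>i. B i k) (\<lambda>i. B i k) / B k k"
    proof -
      have "A i j * B i j = A i j * B' i j + A i j * B i k * cnj (B j k) / B k k" for i j
        by (simp add: B'_def hermitianD[OF h] algebra_simps)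
      then show ?thesis by (simp add: sform_def sum.distrib sum_divide_distrib)
    qed
    moreover have "0 \<le> Re (sform A (\<lambda>i. B i k) (\<lambda>i. B i k) / B k k)"
      using A[of "\<lambda>i. B i k"] pk by (subst rk) (simp add: Re_divide_of_real)
    ultimately show ?thesis using 1 by simp
  next
    case False
    have "B i j = 0" for i j
    proof -
      let ?e = "\<lambda>i k. if k = i then 1 else 0 :: complex"
      have e: "sform B (?e i) (?e j) = B i j" for i j
        by (rule sform_unit_unit)
      have "sform B (?e i) (?e j) = 0" by (rule pos_semidef_null[OF less.prems]) (use e False in simp)
      then show ?thesis using e by simp
    qed
    then show ?thesis by simp
  qed
qed

section \<open>Positive definite matrices: determinant, inverse and largest eigenvalue\<close>

lemma pos_def_det_nonzero:
  fixes G :: "complex^'n^'n"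
  assumes "pos_def (\<lambda>i j. G $ i $ j)"
  shows "det G \<noteq> 0"
proof -
  have "x = 0" if x: "G *v x = 0" for x
  proof (rule ccontr)
    assume "x \<noteq> 0"
    \<comment> \<open>The conjugate of \<open>x\<close> is inserted because \<open>sform\<close>
      conjugates its second argument, whereas \<open>G *v x\<close> contracts that index with
      \<open>x\<close> itself.\<close>
    then have "(\<lambda>i. cnj (x $ i)) \<noteq> (\<lambda>i. 0)" by (metis complex_cnj_zero_iff vec_eq_iff zero_index)
    then have "0 < Re (sform (\<lambda>i j. G $ i $ j) (\<lambda>i. cnj (x $ i)) (\<lambda>i. cnj (x $ i)))"
      using assms unfolding pos_def_def by blast
    also have "sform (\<lambda>i j. G $ i $ j) (\<lambda>i. cnj (x $ i)) (\<lambda>i. cnj (x $ i)) = (\<Sum>i\<in>UNIV. cnj (x $ i) * (G *v x) $ i)"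
      by (simp add: sform_def matrix_vector_mult_def sum_distrib_left mult_ac)
    finally show False using x by simp
  qed
  then have "\<exists>B. B ** G = mat 1" by (simp add: matrix_left_invertible_ker)
  then have "invertible G" by (simp add: invertible_left_inverse)
  then show ?thesis by (simp add: invertible_det_nz)
qed

lemma hermitian_det_real:
  fixes G :: "complex^'n^'n"
  assumes "hermitian (\<lambda>i j. G $ i $ j)"
  shows "det G = of_real (Re (det G))"
proof -
  have "cnj (det G) = det (\<chi> i j. cnj (G $ i $ j))" by (rule det_cnj[symmetric])
  also have "(\<chi> i j. cnj (G $ i $ j)) = Finite_Cartesian_Product.transpose G"
    by (simp add: hermitianD[OF assms] Finite_Cartesian_Product.transpose_def vec_eq_iff)
  finally show ?thesis by (simp add: det_transpose complex_eq_iff)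
qed

text \<open>The segment from the identity to \<open>G\<close> consists of positive definite
  matrices, whose determinants are real and nonzero. By the intermediate value theorem their sign is
  constant.\<close>

lemma pos_def_det_pos:
  fixes G :: "complex^'n^'n"
  assumes G: "pos_def (\<lambda>i j. G $ i $ j)"
  shows "0 < Re (det G)"
proof (rule ccontr)
  assume neg: "\<not> 0 < Re (det G)"
  define M where "M = (\<lambda>t::real. (1 - t) *\<^sub>R mat 1 + t *\<^sub>R G)"
  have sf: "sform (\<lambda>i j. M t $ i $ j) v v = of_real (1 - t) * (\<Sum>i\<in>UNIV. of_real ((norm (v i))\<^sup>2)) + of_real t * sform (\<lambda>i j. G $ i $ j) v v" for t v
  proof -
    have "M t $ i $ j * v i * cnj (v j) = (if i = j then of_real (1 - t) * of_real ((norm (v i))\<^sup>2) else 0) + of_real t * (G $ i $ j * v i * cnj (v j))" for i j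
    proof -
      have e: "M t $ i $ j = of_real (1 - t) * (if i = j then 1 else 0) + of_real t * G $ i $ j"
        by (simp add: M_def mat_def) (simp add: scaleR_conv_of_real)
      show ?thesis unfolding e complex_norm_square by (cases "i = j") (simp_all add: algebra_simps)
    qed
    then show ?thesis by (simp add: sform_def sum.distrib sum_distrib_left)
  qed
  have pd: "pos_def (\<lambda>i j. M t $ i $ j)" if t: "0 \<le> t" "t \<le> 1" for t
  proof -
    have "hermitian (\<lambda>i j. M t $ i $ j)"
      using G unfolding pos_def_def M_def by (intro hermitianI) (auto simp: mat_def hermitianD[of "\<lambda>i j. G $ i $ j"])
    moreover have "0 < Re (sform (\<lambda>i j. M t $ i $ j) v v)" if v: "v \<noteq> (\<lambda>i. 0)" for v
    proof -
      have g: "0 < Re (sform (\<lambda>i j. G $ i $ j) v v)" using G v by (simp add: pos_def_def)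
      obtain i where "v i \<noteq> 0" using v by blast
      then have n: "0 < (\<Sum>i\<in>UNIV. (norm (v i))\<^sup>2)" by (intro sum_pos2[of UNIV i]) auto
      have "Re (sform (\<lambda>i j. M t $ i $ j) v v) = (1 - t) * (\<Sum>i\<in>UNIV. (norm (v i))\<^sup>2) + t * Re (sform (\<lambda>i j. G $ i $ j) v v)"
        unfolding sf of_real_sum[symmetric] by simp
      also have "\<dots> > 0"
        using g n t by (cases "t = 0") (auto intro: add_nonneg_pos)
      finally show ?thesis .
    qed
    ultimately show ?thesis by (simp add: pos_def_def)
  qed
  have c: "continuous_on {0..1} (\<lambda>t. Re (det (M t)))"
    by (intro continuous_on_Re continuous_on_det) (simp add: M_def, intro continuous_intros)
  have "M 0 = mat 1" "M 1 = G" by (simp_all add: M_def)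
  then have "Re (det (M 1)) \<le> 0" "0 \<le> Re (det (M 0))" using neg by simp_all
  from IVT2'[OF this _ c] obtain t where t: "0 \<le> t" "t \<le> 1" "Re (det (M t)) = 0" by auto
  have "det (M t) = of_real (Re (det (M t)))"
    using pd[OF t(1,2)] by (intro hermitian_det_real) (simp add: pos_def_def)
  then show False using pos_def_det_nonzero[OF pd[OF t(1,2)]] t(3) by simp
qed

text \<open>The conjugate transpose of the inverse is again a left inverse of
  \<open>G\<close>.\<close>

lemma matrix_inv_hermitian:
  fixes G :: "complex^'n^'n"
  assumes G: "pos_def (\<lambda>i j. G $ i $ j)"
  shows "hermitian (\<lambda>i j. matrix_inv G $ i $ j)"
proof -
  note I = matrix_inv_mult[OF pos_def_det_nonzero[OF G]]
  define H where "H = (\<chi> i j. cnj (matrix_inv G $ j $ i))"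
  have g: "cnj (G $ i $ j) = G $ j $ i" for i j
    using G hermitianD[of "\<lambda>i j. G $ i $ j"] by (simp add: pos_def_def)
  have "H ** G = mat 1"
  proof -
    have "(H ** G) $ i $ j = cnj ((G ** matrix_inv G) $ j $ i)" for i j
      by (simp add: matrix_matrix_mult_def H_def g mult.commute)
    then show ?thesis unfolding I by (simp add: vec_eq_iff mat_def)
  qed
  then have "H = matrix_inv G" using I by (metis matrix_mul_assoc matrix_mul_lid matrix_mul_rid)
  then have "H $ j $ i = matrix_inv G $ j $ i" for i j by simp
  then show ?thesis by (intro hermitianI) (simp add: H_def)
qed

text \<open>With \<open>u = G y\<close> the value becomes that of \<open>G\<close> at the conjugate
  of \<open>y\<close>. The transposed index order is the one of the contraction in
  \<open>mean_curv_coeff\<close>.\<close>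

lemma sform_matrix_inv_nonneg:
  fixes G :: "complex^'n^'n"
  assumes G: "pos_def (\<lambda>i j. G $ i $ j)"
  shows "0 \<le> Re (sform (\<lambda>i j. matrix_inv G $ j $ i) u u)"
proof -
  note I = matrix_inv_mult[OF pos_def_det_nonzero[OF G]]
  have g: "cnj (G $ i $ j) = G $ j $ i" for i j
    using G hermitianD[of "\<lambda>i j. G $ i $ j"] by (simp add: pos_def_def)
  define y where "y = matrix_inv G *v (\<chi> i. u i)"
  have Gy: "(\<Sum>k\<in>UNIV. G $ j $ k * y $ k) = u j" for j
  proof -
    have "G *v y = (\<chi> i. u i)" by (simp add: y_def matrix_vector_mul_assoc I)
    from arg_cong[OF this, of "\<lambda>x. x $ j"] show ?thesis by (simp add: matrix_vector_mult_def)
  qed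
  have "sform (\<lambda>i j. matrix_inv G $ j $ i) u u = (\<Sum>j\<in>UNIV. y $ j * cnj (u j))"
    unfolding sform_def by (subst sum.swap) (simp add: y_def matrix_vector_mult_def sum_distrib_right)
  also have "\<dots> = (\<Sum>j\<in>UNIV. \<Sum>k\<in>UNIV. G $ k $ j * cnj (y $ k) * cnj (cnj (y $ j)))"
    unfolding Gy[symmetric] by (simp add: cnj_sum sum_distrib_left g mult_ac)
  also have "\<dots> = sform (\<lambda>i j. G $ i $ j) (\<lambda>k. cnj (y $ k)) (\<lambda>k. cnj (y $ k))"
    unfolding sform_def by (rule sum.swap)
  finally show ?thesis using pos_def_imp_semidef[OF G] by (simp add: pos_semidef_def)
qed

text \<open>The Rayleigh quotient attains its maximum \<open>M\<close> on the unit sphere at some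
  \<open>\<xi>\<close>. Then \<open>M H - K\<close> is semidefinite and vanishes at
  \<open>\<xi>\<close>, so \<open>\<xi>\<close> lies in its kernel; this is the eigenvalue
  equation.\<close>

lemma rayleigh_max:
  fixes H K :: "'r::finite \<Rightarrow> 'r \<Rightarrow> complex"
  assumes H: "pos_def H" and K: "hermitian K"
  shows "\<exists>M \<xi>. \<xi> \<noteq> (\<lambda>i. 0) \<and> (\<forall>\<eta>. sform K \<xi> \<eta> = of_real M * sform H \<xi> \<eta>) \<and>
     (\<forall>\<eta>. Re (sform K \<eta> \<eta>) \<le> M * Re (sform H \<eta> \<eta>))"
proof -
  let ?v = "\<lambda>\<xi> :: complex^'r. \<lambda>i. \<xi> $ i"
  let ?R = "\<lambda>\<xi> :: complex^'r. Re (sform K (?v \<xi>) (?v \<xi>)) / Re (sform H (?v \<xi>) (?v \<xi>))"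
  have nz: "?v \<xi> \<noteq> (\<lambda>i. 0)" if "\<xi> \<noteq> 0" for \<xi> :: "complex^'r" using that by (metis vec_eq_iff zero_index)
  have Hpos: "0 < Re (sform H v v)" if "v \<noteq> (\<lambda>i. 0)" for v using H that by (simp add: pos_def_def)
  have cont: "continuous_on A (\<lambda>\<xi> :: complex^'r. Re (sform B (?v \<xi>) (?v \<xi>)))" for A B
    unfolding sform_def by (intro continuous_intros)
  have "continuous_on (sphere 0 1) ?R"
  proof (intro continuous_on_divide cont ballI)
    fix \<xi> :: "complex^'r" assume "\<xi> \<in> sphere 0 1"
    then have "\<xi> \<noteq> 0" by auto
    from Hpos[OF nz[OF this]] show "Re (sform H (?v \<xi>) (?v \<xi>)) \<noteq> 0" by simp
  qed
  from continuous_attains_sup[OF _ _ this] obtain \<xi> where \<xi>: "\<xi> \<in> sphere 0 1" "\<And>\<eta>. \<eta> \<in> sphere 0 1 \<Longrightarrow> ?R \<eta> \<le> ?R \<xi>"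
    by auto
  define M where "M = ?R \<xi>"
  have \<xi>0: "?v \<xi> \<noteq> (\<lambda>i. 0)" using nz[of \<xi>] \<xi>(1) by fastforce
  have sphere_bound: "Re (sform K (?v \<eta>) (?v \<eta>)) \<le> M * Re (sform H (?v \<eta>) (?v \<eta>))" if "\<eta> \<in> sphere 0 1" for \<eta>
  proof -
    have "0 < Re (sform H (?v \<eta>) (?v \<eta>))" using Hpos[OF nz[of \<eta>]] that by fastforce
    then show ?thesis using \<xi>(2)[OF that] by (simp add: M_def[symmetric] pos_divide_le_eq)
  qed
  have bound: "Re (sform K \<eta> \<eta>) \<le> M * Re (sform H \<eta> \<eta>)" for \<eta>
  proof (cases "\<eta> = (\<lambda>i. 0)")
    case False
    define y :: "complex^'r" where "y = (\<chi> i. \<eta> i)"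
    have "y \<noteq> 0" using False by (auto simp: y_def vec_eq_iff)
    define x where "x = (1 / norm y) *\<^sub>R y"
    have x: "x \<in> sphere 0 1" using \<open>y \<noteq> 0\<close> by (simp add: x_def)
    have \<eta>: "\<eta> = (\<lambda>i. of_real (norm y) * x $ i)"
    proof
      fix i
      have "x $ i = (1 / norm y) *\<^sub>R y $ i" by (simp add: x_def)
      also have "\<dots> = of_real (1 / norm y) * y $ i" by (rule scaleR_conv_of_real)
      finally show "\<eta> i = of_real (norm y) * x $ i" using \<open>y \<noteq> 0\<close> by (simp add: y_def)
    qed
    have sc: "Re (sform B \<eta> \<eta>) = (norm y)\<^sup>2 * Re (sform B (?v x) (?v x))" for B
      unfolding arg_cong2[OF \<eta> \<eta>, of "sform B"] by (simp add: sform_scale power2_eq_square)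
    show ?thesis unfolding sc
      using mult_left_mono[OF sphere_bound[OF x], of "(norm y)\<^sup>2"] by (simp add: mult_ac)
  qed simp
  define T where "T = (\<lambda>i j. of_real M * H i j - K i j)"
  have sT: "sform T u v = of_real M * sform H u v - sform K u v" for u v
    by (simp add: sform_def T_def left_diff_distrib right_diff_distrib sum_subtractf sum_distrib_left mult_ac)
  have "hermitian T" using H K unfolding T_def by (intro hermitianI) (simp add: pos_def_def hermitianD)
  then have "pos_semidef T" using bound by (simp add: pos_semidef_def sT)
  moreover have "Re (sform T (?v \<xi>) (?v \<xi>)) = 0"
    using Hpos[OF \<xi>0] by (simp add: sT M_def)
  ultimately have "sform T (?v \<xi>) \<eta> = 0" for \<eta> by (rule pos_semidef_null)
  then have "sform K (?v \<xi>) \<eta> = of_real M * sform H (?v \<xi>) \<eta>" for \<eta> by (simp add: sT)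
  then show ?thesis using \<xi>0 bound by blast
qed

section \<open>The Chern connection in coordinates\<close>

lemma wedge_gen:
  "wedge (gen a) \<beta> z S = (if a \<in> S then shuffle_sign {a} (S - {a}) * \<beta> z (S - {a}) else 0)"
proof -
  have "wedge (gen a) \<beta> z S = (\<Sum>T\<in>Pow S. if T = {a} then shuffle_sign {a} (S - {a}) * \<beta> z (S - {a}) else 0)"
    unfolding wedge_def gen_def by (rule sum.cong) auto
  then show ?thesis by (simp add: sum.delta)
qed

lemma shuffle_sign_empty [simp]: "shuffle_sign S {} = 1" "shuffle_sign {} S = 1"
  by (simp_all add: shuffle_sign_def)

lemma shuffle_sign_Inr_Inl: "shuffle_sign {Inr j} {Inl i} = - 1"
proof -
  have *: "{(a, b). a \<in> {Inr j :: 'a + 'a} \<and> b \<in> {Inl i} \<and> gen_less b a} = {(Inr j, Inl i)}" by auto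
  show ?thesis unfolding shuffle_sign_def * by simp
qed

lemma ext_d_zero_form:
  "ext_d (zero_form f) z {Inl i} = dz i f z" "ext_d (zero_form f) z {Inr j} = dzbar j f z"
  by (simp_all add: ext_d_def del_def delbar_def wedge_gen zero_form_def sum.If_cases if_distrib cong: if_cong)

lemma cov_d_frame:
  fixes \<theta> :: "'r::finite \<Rightarrow> 'r \<Rightarrow> 'n::{finite,linorder} form"
  shows "cov_d \<theta> 0 (\<lambda>\<beta>. zero_form (\<lambda>z. if \<beta> = \<alpha> then 1 else 0)) = \<theta> \<alpha>"
proof (intro ext)
  fix \<beta> :: 'r and z :: "(complex, 'n) vec" and S :: "('n + 'n) set"
  have e: "ext_d (zero_form (\<lambda>z. c)) z S = 0" for c
    by (simp add: ext_d_def del_def delbar_def wedge_gen zero_form_def cong: if_cong)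
  have w: "wedge (zero_form (\<lambda>z. c)) \<eta> z S = c * \<eta> z S" for c and \<eta> :: "'n form"
  proof -
    have "wedge (zero_form (\<lambda>z. c)) \<eta> z S = (\<Sum>T\<in>Pow S. if T = {} then c * \<eta> z S else 0)"
      unfolding wedge_def zero_form_def by (rule sum.cong) auto
    then show ?thesis by (simp add: sum.delta)
  qed
  have "(\<Sum>\<gamma>\<in>UNIV. wedge (zero_form (\<lambda>z. if \<gamma> = \<alpha> then 1 else 0)) (\<theta> \<gamma> \<beta>) z S) = \<theta> \<alpha> \<beta> z S"
    unfolding w by (simp add: if_distrib[of "\<lambda>x. x * _"] cong: if_cong)
  then show "cov_d \<theta> 0 (\<lambda>\<beta>. zero_form (\<lambda>z. if \<beta> = \<alpha> then 1 else 0)) \<beta> z S = \<theta> \<alpha> \<beta> z S"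
    by (simp add: cov_d_def e)
qed

text \<open>In holomorphic frames \<open>\<theta>\<close> has type (1,0), so neither
  \<open>\<theta> \<and> \<theta>\<close> nor \<open>del\<close> has a mixed component. Only
  \<open>delbar\<close> remains, with a minus sign from moving \<open>dzbar^j\<close> behind
  \<open>dz^i\<close>.\<close>

lemma curvature_coeff:
  assumes S: "open S" and z: "z \<in> S"
    and deg: "\<And>w \<alpha> \<beta> T. w \<in> S \<Longrightarrow> card T \<noteq> 1 \<Longrightarrow> \<theta> \<alpha> \<beta> w T = 0"
    and bar: "\<And>w \<alpha> \<beta> j. w \<in> S \<Longrightarrow> \<theta> \<alpha> \<beta> w {Inr j} = 0"
  shows "curvature \<theta> \<alpha> \<gamma> z {Inl i, Inr j} = - dzbar j (\<lambda>w. \<theta> \<alpha> \<gamma> w {Inl i}) z"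
proof -
  have d0: "dz k (\<lambda>w. \<theta> \<alpha> \<gamma> w {Inr j}) z = 0" for k
    using dz_cong_open(1)[OF S z, of "\<lambda>w. \<theta> \<alpha> \<gamma> w {Inr j}" "\<lambda>_. 0" k] bar by simp
  have "del (\<theta> \<alpha> \<gamma>) z {Inl i, Inr j} = 0"
  proof -
    have "wedge (gen (Inl k)) (\<lambda>z T. dz k (\<lambda>w. \<theta> \<alpha> \<gamma> w T) z) z {Inl i, Inr j} = 0" for k
    proof (cases "k = i")
      case True
      have "{Inl i, Inr j} - {Inl i} = {Inr j}" by auto
      then show ?thesis using True d0 by (simp add: wedge_gen)
    qed (simp add: wedge_gen)
    then show ?thesis by (simp add: del_def)
  qed
  moreover have "delbar (\<theta> \<alpha> \<gamma>) z {Inl i, Inr j} = - dzbar j (\<lambda>w. \<theta> \<alpha> \<gamma> w {Inl i}) z"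
  proof -
    have e: "{Inl i, Inr j} - {Inr j} = {Inl i}" by auto
    have "wedge (gen (Inr k)) (\<lambda>z T. dzbar k (\<lambda>w. \<theta> \<alpha> \<gamma> w T) z) z {Inl i, Inr j} =
      (if k = j then - dzbar j (\<lambda>w. \<theta> \<alpha> \<gamma> w {Inl i}) z else 0)" for k
      by (simp add: wedge_gen e shuffle_sign_Inr_Inl)
    then show ?thesis by (simp add: delbar_def)
  qed
  moreover have "wedge (\<theta> \<alpha> \<delta>) (\<theta> \<delta> \<gamma>) z {Inl i, Inr j} = 0" for \<delta>
    unfolding wedge_def
  proof (rule sum.neutral, rule ballI)
    fix T assume T: "T \<in> Pow {Inl i, Inr j}"
    have "\<theta> \<alpha> \<delta> z T = 0 \<or> \<theta> \<delta> \<gamma> z ({Inl i, Inr j} - T) = 0"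
    proof (cases "Inl i \<in> T")
      case True
      show ?thesis
      proof (cases "Inr j \<in> T")
        case False
        then have "{Inl i, Inr j} - T = {Inr j}" using T True by auto
        then show ?thesis using bar[OF z] by simp
      next
        case T2: True
        then have "T = {Inl i, Inr j}" using T True by auto
        then show ?thesis using deg[OF z, of T] by simp
      qed
    next
      case False
      then have "T = {} \<or> T = {Inr j}" using T by auto
      then show ?thesis using bar[OF z] deg[OF z, of "{}"] by auto
    qed
    then show "shuffle_sign T ({Inl i, Inr j} - T) * \<theta> \<alpha> \<delta> z T * \<theta> \<delta> \<gamma> z ({Inl i, Inr j} - T) = 0" by auto
  qed
  ultimately show ?thesis
    unfolding curvature_def cov_d_frame by (simp add: cov_d_def ext_d_def)
qed

lemma sum_swap3:
  "(\<Sum>i\<in>A. \<Sum>j\<in>B. \<Sum>k\<in>C. f i j k) = (\<Sum>k\<in>C. \<Sum>i\<in>A. \<Sum>j\<in>B. f i j k)"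
proof -
  have "(\<Sum>i\<in>A. \<Sum>j\<in>B. \<Sum>k\<in>C. f i j k) = (\<Sum>i\<in>A. \<Sum>k\<in>C. \<Sum>j\<in>B. f i j k)"
    by (rule sum.cong[OF refl]) (rule sum.swap)
  also have "\<dots> = (\<Sum>k\<in>C. \<Sum>i\<in>A. \<Sum>j\<in>B. f i j k)" by (rule sum.swap)
  finally show ?thesis .
qed

context
  fixes S :: "(complex^'n) set" and h :: "'r::finite \<Rightarrow> 'r \<Rightarrow> complex^'n \<Rightarrow> complex"
    and a :: "'n \<Rightarrow> 'r \<Rightarrow> 'r \<Rightarrow> complex^'n \<Rightarrow> complex"
  assumes S: "open S"
    and h2: "\<And>\<alpha> \<beta>. Ck_on 2 S (h \<alpha> \<beta>)"
    and a1: "\<And>i \<alpha> \<gamma>. Ck_on 1 S (a i \<alpha> \<gamma>)"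
    and dzh: "\<And>z i \<alpha> \<beta>. z \<in> S \<Longrightarrow> dz i (h \<alpha> \<beta>) z = (\<Sum>\<gamma>\<in>UNIV. a i \<alpha> \<gamma> z * h \<gamma> \<beta> z)"
    and dzbarh: "\<And>z j \<alpha> \<beta>. z \<in> S \<Longrightarrow> dzbar j (h \<alpha> \<beta>) z = (\<Sum>\<gamma>\<in>UNIV. cnj (a j \<beta> \<gamma> z) * h \<alpha> \<gamma> z)"
    and hherm: "\<And>z \<alpha> \<beta>. z \<in> S \<Longrightarrow> cnj (h \<alpha> \<beta> z) = h \<beta> \<alpha> z"
begin

lemma h_diff: "z \<in> S \<Longrightarrow> h \<alpha> \<beta> differentiable (at z)"
  using h2 by (simp add: numeral_2_eq_2)

lemma a_diff: "z \<in> S \<Longrightarrow> a i \<alpha> \<beta> differentiable (at z)"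
  using a1 by simp

text \<open>The equations \<open>dzh\<close> and \<open>dzbarh\<close> are the compatibility of the
  connection \<open>a\<close> with \<open>h\<close>. Differentiating one and inserting the other
  produces the curvature with lowered index, up to sign, and a term quadratic in
  \<open>a\<close>.\<close>

lemma dzbar_dz_h:
  assumes z: "z \<in> S"
  shows "dzbar j (dz i (h \<alpha> \<beta>)) z = (\<Sum>\<gamma>\<in>UNIV. dzbar j (a i \<alpha> \<gamma>) z * h \<gamma> \<beta> z)
     + (\<Sum>\<gamma>\<in>UNIV. \<Sum>\<delta>\<in>UNIV. a i \<alpha> \<gamma> z * cnj (a j \<beta> \<delta> z) * h \<gamma> \<delta> z)"
proof -
  have "dzbar j (dz i (h \<alpha> \<beta>)) z = dzbar j (\<lambda>z. \<Sum>\<gamma>\<in>UNIV. a i \<alpha> \<gamma> z * h \<gamma> \<beta> z) z"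
    by (rule dz_cong_open(2)[OF S z dzh])
  also have "\<dots> = (\<Sum>\<gamma>\<in>UNIV. dzbar j (\<lambda>z. a i \<alpha> \<gamma> z * h \<gamma> \<beta> z) z)"
    by (rule dz_sum(2)) (intro differentiable_mult a_diff h_diff z)
  also have "\<dots> = (\<Sum>\<gamma>\<in>UNIV. dzbar j (a i \<alpha> \<gamma>) z * h \<gamma> \<beta> z + a i \<alpha> \<gamma> z * (\<Sum>\<delta>\<in>UNIV. cnj (a j \<beta> \<delta> z) * h \<gamma> \<delta> z))"
    by (simp add: dzbar_mult a_diff h_diff z dzbarh)
  finally show ?thesis by (simp add: sum.distrib sum_distrib_left mult.assoc)
qed

text \<open>The sum is a mixed second derivative of \<open>h\<close> minus the quadratic term. Both
  are Hermitian under exchange of \<open>(i, \<alpha>)\<close> with \<open>(j, \<beta>)\<close>; for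
  the first this is the commutation of \<open>dz\<close> and \<open>dzbar\<close>.\<close>

lemma curv_hermitian:
  assumes z: "z \<in> S"
  shows "cnj (\<Sum>\<gamma>\<in>UNIV. h \<gamma> \<beta> z * dzbar j (a i \<alpha> \<gamma>) z) = (\<Sum>\<gamma>\<in>UNIV. h \<gamma> \<alpha> z * dzbar i (a j \<beta> \<gamma>) z)"
proof -
  let ?N = "\<lambda>i j \<alpha> \<beta>. \<Sum>\<gamma>\<in>UNIV. \<Sum>\<delta>\<in>UNIV. a i \<alpha> \<gamma> z * cnj (a j \<beta> \<delta> z) * h \<gamma> \<delta> z"
  have eq: "(\<Sum>\<gamma>\<in>UNIV. h \<gamma> \<beta> z * dzbar j (a i \<alpha> \<gamma>) z) = dzbar j (dz i (h \<alpha> \<beta>)) z - ?N i j \<alpha> \<beta>" for i j \<alpha> \<beta>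
    using dzbar_dz_h[OF z, of j i \<alpha> \<beta>] by (simp add: mult.commute)
  have N: "cnj (?N i j \<alpha> \<beta>) = ?N j i \<beta> \<alpha>"
    unfolding cnj_sum by (subst sum.swap) (simp add: hherm[OF z] mult_ac)
  have L: "cnj (dzbar j (dz i (h \<alpha> \<beta>)) z) = dzbar i (dz j (h \<beta> \<alpha>)) z"
  proof -
    have d: "dz i (h \<alpha> \<beta>) differentiable (at w)" if "w \<in> S" for w
      using Ck_on_dz(1)[OF S, of 1 "h \<alpha> \<beta>" i] h2 that by (simp add: numeral_2_eq_2)
    have "cnj (dzbar j (dz i (h \<alpha> \<beta>)) z) = dz j (\<lambda>w. cnj (dz i (h \<alpha> \<beta>) w)) z"
      by (rule dz_cnj[OF d[OF z] d[OF z], symmetric])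
    also have "\<dots> = dz j (dzbar i (h \<beta> \<alpha>)) z"
    proof (rule dz_cong_open(1)[OF S z])
      fix w assume w: "w \<in> S"
      have "cnj (dz i (h \<alpha> \<beta>) w) = dzbar i (\<lambda>w. cnj (h \<alpha> \<beta> w)) w"
        by (rule dzbar_cnj[OF h_diff[OF w] h_diff[OF w], symmetric])
      also have "\<dots> = dzbar i (h \<beta> \<alpha>) w" by (rule dz_cong_open(2)[OF S w hherm])
      finally show "cnj (dz i (h \<alpha> \<beta>) w) = dzbar i (h \<beta> \<alpha>) w" .
    qed
    also have "\<dots> = dzbar i (dz j (h \<beta> \<alpha>)) z"
      by (rule dz_dzbar_commute[OF S h2 z])
    finally show ?thesis .
  qed
  show ?thesis unfolding eq complex_cnj_diff N L ..
qed

text \<open>Contraction with a Hermitian \<open>C\<close> preserves the symmetry of the curvature.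
  This is what makes the greatest eigenvalue a maximum of a Rayleigh quotient.\<close>

lemma mean_curv_hermitian:
  fixes C :: "'n \<Rightarrow> 'n \<Rightarrow> complex"
  assumes z: "z \<in> S" and C: "hermitian C"
  shows "hermitian (\<lambda>\<alpha> \<beta>. \<Sum>\<gamma>\<in>UNIV. \<Sum>i\<in>UNIV. \<Sum>j\<in>UNIV. h \<gamma> \<beta> z * C j i * - dzbar j (a i \<alpha> \<gamma>) z)"
proof (rule hermitianI)
  fix \<alpha> \<beta>
  have eq: "(\<Sum>\<gamma>\<in>UNIV. \<Sum>i\<in>UNIV. \<Sum>j\<in>UNIV. h \<gamma> \<beta> z * C j i * - dzbar j (a i \<alpha> \<gamma>) z) =
     - (\<Sum>i\<in>UNIV. \<Sum>j\<in>UNIV. C j i * (\<Sum>\<gamma>\<in>UNIV. h \<gamma> \<beta> z * dzbar j (a i \<alpha> \<gamma>) z))" for \<alpha> \<beta>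
  proof -
    have "(\<Sum>\<gamma>\<in>UNIV. \<Sum>i\<in>UNIV. \<Sum>j\<in>UNIV. h \<gamma> \<beta> z * C j i * - dzbar j (a i \<alpha> \<gamma>) z) =
       (\<Sum>i\<in>UNIV. \<Sum>j\<in>UNIV. \<Sum>\<gamma>\<in>UNIV. h \<gamma> \<beta> z * C j i * - dzbar j (a i \<alpha> \<gamma>) z)"
      by (subst sum.swap, intro sum.cong refl) (rule sum.swap)
    then show ?thesis by (simp add: sum_negf sum_distrib_left mult_ac)
  qed
  have "cnj (\<Sum>i\<in>UNIV. \<Sum>j\<in>UNIV. C j i * (\<Sum>\<gamma>\<in>UNIV. h \<gamma> \<beta> z * dzbar j (a i \<alpha> \<gamma>) z)) =
    (\<Sum>i\<in>UNIV. \<Sum>j\<in>UNIV. C i j * (\<Sum>\<gamma>\<in>UNIV. h \<gamma> \<alpha> z * dzbar i (a j \<beta> \<gamma>) z))"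
    unfolding cnj_sum complex_cnj_mult hermitianD[OF C] curv_hermitian[OF z, unfolded cnj_sum complex_cnj_mult] ..
  also have "\<dots> = (\<Sum>i\<in>UNIV. \<Sum>j\<in>UNIV. C j i * (\<Sum>\<gamma>\<in>UNIV. h \<gamma> \<alpha> z * dzbar j (a i \<beta> \<gamma>) z))"
    by (rule sum.swap)
  finally show "cnj (\<Sum>\<gamma>\<in>UNIV. \<Sum>i\<in>UNIV. \<Sum>j\<in>UNIV. h \<gamma> \<beta> z * C j i * - dzbar j (a i \<alpha> \<gamma>) z) =
     (\<Sum>\<gamma>\<in>UNIV. \<Sum>i\<in>UNIV. \<Sum>j\<in>UNIV. h \<gamma> \<alpha> z * C j i * - dzbar j (a i \<beta> \<gamma>) z)"
    unfolding eq complex_cnj_minus by simp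
qed

section \<open>The Bochner formula for a holomorphic section\<close>

context
  fixes \<sigma> :: "'r \<Rightarrow> complex^'n \<Rightarrow> complex"
  assumes \<sigma>: "\<And>\<alpha>. holo_on S (\<sigma> \<alpha>)"
begin

text \<open>Kept complex-valued because the Wirtinger derivatives act on complex functions; its
  values on \<open>S\<close> are real, see \<open>sq_norm_real\<close>.\<close>

definition sq_norm :: "complex^'n \<Rightarrow> complex" where
  "sq_norm z = sform (\<lambda>\<alpha> \<beta>. h \<alpha> \<beta> z) (\<lambda>\<alpha>. \<sigma> \<alpha> z) (\<lambda>\<beta>. \<sigma> \<beta> z)"

text \<open>Components of the (1,0)-part of the covariant derivative of the section; its (0,1)-part
  vanishes.\<close>

definition cov_deriv :: "'n \<Rightarrow> complex^'n \<Rightarrow> 'r \<Rightarrow> complex" where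
  "cov_deriv i z \<gamma> = dz i (\<sigma> \<gamma>) z + (\<Sum>\<alpha>\<in>UNIV. a i \<alpha> \<gamma> z * \<sigma> \<alpha> z)"

lemma \<sigma>_diff: "z \<in> S \<Longrightarrow> \<sigma> \<alpha> differentiable (at z)"
  using holo_on_frechet(1)[OF \<sigma>] by (auto simp: differentiable_def)

lemma dz_\<sigma>_diff: "z \<in> S \<Longrightarrow> dz i (\<sigma> \<alpha>) differentiable (at z)"
  using holo_on_frechet(1)[OF holo_on_dz_holo[OF \<sigma> S]] by (auto simp: differentiable_def)

lemma cnj_\<sigma>_diff: "z \<in> S \<Longrightarrow> (\<lambda>z. cnj (\<sigma> \<alpha> z)) differentiable (at z)"
  using \<sigma>_diff[of z \<alpha>] unfolding differentiable_def by (blast intro: has_derivative_cnj)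

lemma wirtinger_\<sigma>:
  assumes "z \<in> S"
  shows "dzbar i (\<sigma> \<alpha>) z = 0" "dz i (\<lambda>z. cnj (\<sigma> \<alpha> z)) z = 0" "dzbar i (\<lambda>z. cnj (\<sigma> \<alpha> z)) z = cnj (dz i (\<sigma> \<alpha>) z)"
    "dzbar i (dz j (\<sigma> \<alpha>)) z = 0"
  using holo_on_dz(1)[OF \<sigma> assms] dz_cnj[OF \<sigma>_diff \<sigma>_diff, OF assms assms] dzbar_cnj[OF \<sigma>_diff \<sigma>_diff, OF assms assms]
    holo_on_dz(1)[OF holo_on_dz_holo[OF \<sigma> S] assms] by simp_all

text \<open>By metric compatibility each derivative is distributed over the two slots of
  \<open><s, s>\<close>. As the section has no (0,1)-derivative, \<open>dz\<close> acts on the first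
  slot only and \<open>dzbar\<close> on the second only.\<close>

lemma dz_sq_norm:
  assumes z: "z \<in> S"
  shows "dz i sq_norm z = sform (\<lambda>\<alpha> \<beta>. h \<alpha> \<beta> z) (cov_deriv i z) (\<lambda>\<beta>. \<sigma> \<beta> z)"
    and "dzbar i sq_norm z = sform (\<lambda>\<alpha> \<beta>. h \<alpha> \<beta> z) (\<lambda>\<beta>. \<sigma> \<beta> z) (cov_deriv i z)"
proof -
  have d: "(\<lambda>z. h \<alpha> \<beta> z * \<sigma> \<alpha> z) differentiable (at z)" for \<alpha> \<beta>
    by (intro differentiable_mult h_diff \<sigma>_diff z)
  have d': "(\<lambda>z. h \<alpha> \<beta> z * \<sigma> \<alpha> z * cnj (\<sigma> \<beta> z)) differentiable (at z)" for \<alpha> \<beta>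
    by (intro differentiable_mult d cnj_\<sigma>_diff z)
  have d'': "(\<lambda>z. \<Sum>\<beta>\<in>UNIV. h \<alpha> \<beta> z * \<sigma> \<alpha> z * cnj (\<sigma> \<beta> z)) differentiable (at z)" for \<alpha>
    by (intro differentiable_sum d' ballI) simp
  have "dz i sq_norm z = (\<Sum>\<alpha>\<in>UNIV. \<Sum>\<beta>\<in>UNIV. (dz i (h \<alpha> \<beta>) z * \<sigma> \<alpha> z + h \<alpha> \<beta> z * dz i (\<sigma> \<alpha>) z) * cnj (\<sigma> \<beta> z))"
    unfolding sq_norm_def[abs_def] sform_def
    by (simp add: dz_sum d' d'' dz_mult[OF d cnj_\<sigma>_diff[OF z]] dz_mult[OF h_diff[OF z] \<sigma>_diff[OF z]] wirtinger_\<sigma>[OF z])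
  also have "\<dots> = (\<Sum>\<beta>\<in>UNIV. \<Sum>\<alpha>\<in>UNIV. (\<Sum>\<gamma>\<in>UNIV. a i \<alpha> \<gamma> z * h \<gamma> \<beta> z * \<sigma> \<alpha> z * cnj (\<sigma> \<beta> z)) + h \<alpha> \<beta> z * dz i (\<sigma> \<alpha>) z * cnj (\<sigma> \<beta> z))"
    by (subst sum.swap) (simp add: dzh[OF z] sum_distrib_right ring_distribs)
  also have "\<dots> = (\<Sum>\<beta>\<in>UNIV. \<Sum>\<gamma>\<in>UNIV. h \<gamma> \<beta> z * cov_deriv i z \<gamma> * cnj (\<sigma> \<beta> z))"
  proof (rule sum.cong[OF refl])
    fix \<beta>
    have "(\<Sum>\<alpha>\<in>UNIV. \<Sum>\<gamma>\<in>UNIV. a i \<alpha> \<gamma> z * h \<gamma> \<beta> z * \<sigma> \<alpha> z * cnj (\<sigma> \<beta> z)) =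
       (\<Sum>\<gamma>\<in>UNIV. \<Sum>\<alpha>\<in>UNIV. a i \<alpha> \<gamma> z * h \<gamma> \<beta> z * \<sigma> \<alpha> z * cnj (\<sigma> \<beta> z))"
      by (rule sum.swap)
    then show "(\<Sum>\<alpha>\<in>UNIV. (\<Sum>\<gamma>\<in>UNIV. a i \<alpha> \<gamma> z * h \<gamma> \<beta> z * \<sigma> \<alpha> z * cnj (\<sigma> \<beta> z)) + h \<alpha> \<beta> z * dz i (\<sigma> \<alpha>) z * cnj (\<sigma> \<beta> z)) =
       (\<Sum>\<gamma>\<in>UNIV. h \<gamma> \<beta> z * cov_deriv i z \<gamma> * cnj (\<sigma> \<beta> z))"
      by (simp add: cov_deriv_def sum.distrib sum_distrib_left sum_distrib_right ring_distribs mult_ac)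
  qed
  finally show "dz i sq_norm z = sform (\<lambda>\<alpha> \<beta>. h \<alpha> \<beta> z) (cov_deriv i z) (\<lambda>\<beta>. \<sigma> \<beta> z)"
    unfolding sform_def by (subst sum.swap)
  have "dzbar i sq_norm z = (\<Sum>\<alpha>\<in>UNIV. \<Sum>\<beta>\<in>UNIV. dzbar i (h \<alpha> \<beta>) z * \<sigma> \<alpha> z * cnj (\<sigma> \<beta> z) + h \<alpha> \<beta> z * \<sigma> \<alpha> z * cnj (dz i (\<sigma> \<beta>) z))"
    unfolding sq_norm_def[abs_def] sform_def
    by (simp add: dz_sum d' d'' dzbar_mult[OF d cnj_\<sigma>_diff[OF z]] dzbar_mult[OF h_diff[OF z] \<sigma>_diff[OF z]] wirtinger_\<sigma>[OF z])
  also have "\<dots> = (\<Sum>\<alpha>\<in>UNIV. \<Sum>\<gamma>\<in>UNIV. h \<alpha> \<gamma> z * \<sigma> \<alpha> z * cnj (cov_deriv i z \<gamma>))"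
  proof (rule sum.cong[OF refl])
    fix \<alpha>
    have "(\<Sum>\<beta>\<in>UNIV. \<Sum>\<gamma>\<in>UNIV. cnj (a i \<beta> \<gamma> z) * h \<alpha> \<gamma> z * \<sigma> \<alpha> z * cnj (\<sigma> \<beta> z)) =
       (\<Sum>\<gamma>\<in>UNIV. \<Sum>\<beta>\<in>UNIV. cnj (a i \<beta> \<gamma> z) * h \<alpha> \<gamma> z * \<sigma> \<alpha> z * cnj (\<sigma> \<beta> z))"
      by (rule sum.swap)
    then show "(\<Sum>\<beta>\<in>UNIV. dzbar i (h \<alpha> \<beta>) z * \<sigma> \<alpha> z * cnj (\<sigma> \<beta> z) + h \<alpha> \<beta> z * \<sigma> \<alpha> z * cnj (dz i (\<sigma> \<beta>) z)) =
       (\<Sum>\<gamma>\<in>UNIV. h \<alpha> \<gamma> z * \<sigma> \<alpha> z * cnj (cov_deriv i z \<gamma>))"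
      by (simp add: dzbarh[OF z] cov_deriv_def cnj_sum sum.distrib sum_distrib_left sum_distrib_right ring_distribs mult_ac)
  qed
  finally show "dzbar i sq_norm z = sform (\<lambda>\<alpha> \<beta>. h \<alpha> \<beta> z) (\<lambda>\<beta>. \<sigma> \<beta> z) (cov_deriv i z)"
    unfolding sform_def .
qed

text \<open>Applying \<open>dzbar j\<close> to the first slot of \<open><\<nabla>_i s, s>\<close>
  yields only the derivative of the connection, that is curvature, since the components of the
  section and their \<open>dz\<close> are holomorphic. The second slot yields
  \<open><\<nabla>_i s, \<nabla>_j s>\<close>.\<close>

lemma dzbar_dz_sq_norm:
  assumes z: "z \<in> S"
  shows "dzbar j (dz i sq_norm) z = sform (\<lambda>\<alpha> \<beta>. h \<alpha> \<beta> z) (cov_deriv i z) (cov_deriv j z)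
     + (\<Sum>\<alpha>\<in>UNIV. \<Sum>\<beta>\<in>UNIV. (\<Sum>\<gamma>\<in>UNIV. h \<gamma> \<beta> z * dzbar j (a i \<alpha> \<gamma>) z) * \<sigma> \<alpha> z * cnj (\<sigma> \<beta> z))"
proof -
  let ?c = "\<lambda>\<gamma> z. cov_deriv i z \<gamma>"
  have as: "(\<lambda>z. a i \<alpha> \<gamma> z * \<sigma> \<alpha> z) differentiable (at z)" for \<alpha> \<gamma>
    by (intro differentiable_mult a_diff \<sigma>_diff z)
  have as': "(\<lambda>z. \<Sum>\<alpha>\<in>UNIV. a i \<alpha> \<gamma> z * \<sigma> \<alpha> z) differentiable (at z)" for \<gamma>
    by (intro differentiable_sum as ballI) simp
  have cd: "?c \<gamma> differentiable (at z)" for \<gamma>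
    unfolding cov_deriv_def by (intro differentiable_add dz_\<sigma>_diff z as')
  have dc: "dzbar j (?c \<gamma>) z = (\<Sum>\<alpha>\<in>UNIV. dzbar j (a i \<alpha> \<gamma>) z * \<sigma> \<alpha> z)" for \<gamma>
    unfolding cov_deriv_def
    by (simp add: dzbar_add[OF dz_\<sigma>_diff[OF z] as'] dz_sum as dzbar_mult[OF a_diff[OF z] \<sigma>_diff[OF z]] wirtinger_\<sigma>[OF z])
  have d: "(\<lambda>z. h \<gamma> \<beta> z * ?c \<gamma> z) differentiable (at z)" for \<gamma> \<beta>
    by (intro differentiable_mult h_diff cd z)
  have d': "(\<lambda>z. h \<gamma> \<beta> z * ?c \<gamma> z * cnj (\<sigma> \<beta> z)) differentiable (at z)" for \<gamma> \<beta>
    by (intro differentiable_mult d cnj_\<sigma>_diff z)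
  have d'': "(\<lambda>z. \<Sum>\<beta>\<in>UNIV. h \<gamma> \<beta> z * ?c \<gamma> z * cnj (\<sigma> \<beta> z)) differentiable (at z)" for \<gamma>
    by (intro differentiable_sum d' ballI) simp
  have "dzbar j (dz i sq_norm) z = dzbar j (\<lambda>z. \<Sum>\<gamma>\<in>UNIV. \<Sum>\<beta>\<in>UNIV. h \<gamma> \<beta> z * ?c \<gamma> z * cnj (\<sigma> \<beta> z)) z"
    by (rule dz_cong_open(2)[OF S z]) (simp add: dz_sq_norm sform_def)
  also have "\<dots> = (\<Sum>\<gamma>\<in>UNIV. \<Sum>\<beta>\<in>UNIV. dzbar j (h \<gamma> \<beta>) z * ?c \<gamma> z * cnj (\<sigma> \<beta> z)
      + h \<gamma> \<beta> z * ?c \<gamma> z * cnj (dz j (\<sigma> \<beta>) z) + h \<gamma> \<beta> z * dzbar j (?c \<gamma>) z * cnj (\<sigma> \<beta> z))"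
    by (simp add: dz_sum d' d'' dzbar_mult[OF d cnj_\<sigma>_diff[OF z]] dzbar_mult[OF h_diff[OF z] cd] wirtinger_\<sigma>[OF z] ring_distribs add_ac)
  also have "\<dots> = (\<Sum>\<gamma>\<in>UNIV. (\<Sum>\<beta>\<in>UNIV. dzbar j (h \<gamma> \<beta>) z * ?c \<gamma> z * cnj (\<sigma> \<beta> z)
      + h \<gamma> \<beta> z * ?c \<gamma> z * cnj (dz j (\<sigma> \<beta>) z))) + (\<Sum>\<gamma>\<in>UNIV. \<Sum>\<beta>\<in>UNIV. h \<gamma> \<beta> z * dzbar j (?c \<gamma>) z * cnj (\<sigma> \<beta> z))"
    by (simp add: sum.distrib)
  also have "(\<Sum>\<gamma>\<in>UNIV. (\<Sum>\<beta>\<in>UNIV. dzbar j (h \<gamma> \<beta>) z * ?c \<gamma> z * cnj (\<sigma> \<beta> z)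
      + h \<gamma> \<beta> z * ?c \<gamma> z * cnj (dz j (\<sigma> \<beta>) z))) = sform (\<lambda>\<alpha> \<beta>. h \<alpha> \<beta> z) (cov_deriv i z) (cov_deriv j z)"
    unfolding sform_def
  proof (rule sum.cong[OF refl])
    fix \<gamma>
    have "(\<Sum>\<beta>\<in>UNIV. \<Sum>\<delta>\<in>UNIV. cnj (a j \<beta> \<delta> z) * h \<gamma> \<delta> z * ?c \<gamma> z * cnj (\<sigma> \<beta> z)) =
       (\<Sum>\<delta>\<in>UNIV. \<Sum>\<beta>\<in>UNIV. cnj (a j \<beta> \<delta> z) * h \<gamma> \<delta> z * ?c \<gamma> z * cnj (\<sigma> \<beta> z))"
      by (rule sum.swap)
    then show "(\<Sum>\<beta>\<in>UNIV. dzbar j (h \<gamma> \<beta>) z * ?c \<gamma> z * cnj (\<sigma> \<beta> z) + h \<gamma> \<beta> z * ?c \<gamma> z * cnj (dz j (\<sigma> \<beta>) z)) =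
       (\<Sum>\<beta>\<in>UNIV. h \<gamma> \<beta> z * cov_deriv i z \<gamma> * cnj (cov_deriv j z \<beta>))"
      unfolding cov_deriv_def[of j]
      by (simp add: dzbarh[OF z] cnj_sum sum.distrib sum_distrib_left sum_distrib_right ring_distribs mult_ac)
  qed
  also have "(\<Sum>\<gamma>\<in>UNIV. \<Sum>\<beta>\<in>UNIV. h \<gamma> \<beta> z * dzbar j (?c \<gamma>) z * cnj (\<sigma> \<beta> z)) =
     (\<Sum>\<alpha>\<in>UNIV. \<Sum>\<beta>\<in>UNIV. (\<Sum>\<gamma>\<in>UNIV. h \<gamma> \<beta> z * dzbar j (a i \<alpha> \<gamma>) z) * \<sigma> \<alpha> z * cnj (\<sigma> \<beta> z))"
  proof -
    have "(\<Sum>\<gamma>\<in>UNIV. \<Sum>\<beta>\<in>UNIV. h \<gamma> \<beta> z * dzbar j (?c \<gamma>) z * cnj (\<sigma> \<beta> z)) =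
      (\<Sum>\<gamma>\<in>UNIV. \<Sum>\<beta>\<in>UNIV. \<Sum>\<alpha>\<in>UNIV. h \<gamma> \<beta> z * dzbar j (a i \<alpha> \<gamma>) z * \<sigma> \<alpha> z * cnj (\<sigma> \<beta> z))"
      unfolding dc by (simp add: sum_distrib_left sum_distrib_right mult_ac)
    also have "\<dots> = (\<Sum>\<gamma>\<in>UNIV. \<Sum>\<alpha>\<in>UNIV. \<Sum>\<beta>\<in>UNIV. h \<gamma> \<beta> z * dzbar j (a i \<alpha> \<gamma>) z * \<sigma> \<alpha> z * cnj (\<sigma> \<beta> z))"
      by (intro sum.cong refl sum.swap)
    also have "\<dots> = (\<Sum>\<alpha>\<in>UNIV. \<Sum>\<gamma>\<in>UNIV. \<Sum>\<beta>\<in>UNIV. h \<gamma> \<beta> z * dzbar j (a i \<alpha> \<gamma>) z * \<sigma> \<alpha> z * cnj (\<sigma> \<beta> z))"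
      by (rule sum.swap)
    also have "\<dots> = (\<Sum>\<alpha>\<in>UNIV. \<Sum>\<beta>\<in>UNIV. \<Sum>\<gamma>\<in>UNIV. h \<gamma> \<beta> z * dzbar j (a i \<alpha> \<gamma>) z * \<sigma> \<alpha> z * cnj (\<sigma> \<beta> z))"
      by (intro sum.cong refl sum.swap)
    finally show ?thesis by (simp add: sum_distrib_right)
  qed
  finally show ?thesis .
qed


lemma sq_norm_diff:
  assumes z: "z \<in> S"
  shows "sq_norm differentiable (at z)"
  unfolding sq_norm_def[abs_def] sform_def
  by (intro differentiable_sum ballI differentiable_mult h_diff \<sigma>_diff cnj_\<sigma>_diff z) simp_all

lemma dz_sq_norm_diff:
  assumes z: "z \<in> S"
  shows "dz i sq_norm differentiable (at z)"
proof -
  let ?c = "\<lambda>\<gamma> z. cov_deriv i z \<gamma>"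
  have cd: "?c \<gamma> differentiable (at z)" for \<gamma>
    unfolding cov_deriv_def
    by (intro differentiable_add dz_\<sigma>_diff z differentiable_sum ballI differentiable_mult a_diff \<sigma>_diff) simp
  have "(\<lambda>z. \<Sum>\<gamma>\<in>UNIV. \<Sum>\<beta>\<in>UNIV. h \<gamma> \<beta> z * ?c \<gamma> z * cnj (\<sigma> \<beta> z)) differentiable (at z)"
    by (intro differentiable_sum ballI differentiable_mult h_diff cd cnj_\<sigma>_diff z) simp_all
  then show ?thesis
    using differentiable_cong_open[OF S z, of "dz i sq_norm" "\<lambda>z. \<Sum>\<gamma>\<in>UNIV. \<Sum>\<beta>\<in>UNIV. h \<gamma> \<beta> z * ?c \<gamma> z * cnj (\<sigma> \<beta> z)"]
    by (simp add: dz_sq_norm sform_def)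
qed

context
  fixes \<epsilon> :: real
  assumes hpos: "\<And>z. z \<in> S \<Longrightarrow> pos_def (\<lambda>\<alpha> \<beta>. h \<alpha> \<beta> z)" and eps: "\<epsilon> > 0"
begin

lemma sq_norm_real: "z \<in> S \<Longrightarrow> sq_norm z = of_real (Re (sq_norm z))" "z \<in> S \<Longrightarrow> 0 \<le> Re (sq_norm z)"
  unfolding sq_norm_def using sform_real[of "\<lambda>\<alpha> \<beta>. h \<alpha> \<beta> z"] pos_def_imp_semidef[OF hpos[of z]]
  by (auto simp: pos_semidef_def)

lemma dz_log_sq_norm:
  assumes z: "z \<in> S"
  shows "dz i (\<lambda>z. of_real (ln (Re (sq_norm z) + \<epsilon>))) z = dz i sq_norm z * inverse (sq_norm z + of_real \<epsilon>)"
proof -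
  let ?D = "frechet_derivative sq_norm (at z)"
  have D: "(sq_norm has_derivative ?D) (at z)" using sq_norm_diff[OF z] by (simp add: frechet_derivative_works)
  have "((\<lambda>z. of_real (Re (sq_norm z))) has_derivative (\<lambda>v. of_real (Re (?D v)) :: complex)) (at z)"
    by (intro bounded_linear.has_derivative[OF bounded_linear_of_real] bounded_linear.has_derivative[OF bounded_linear_Re] D)
  \<comment> \<open>On the open set \<open>S\<close> the function coincides with its real part, so
    its derivative has real values. The real logarithm can then be differentiated and the result
    written with the complex derivative.\<close>
  then have "(sq_norm has_derivative (\<lambda>v. of_real (Re (?D v)))) (at z)"
    by (rule has_derivative_transform_within_open[OF _ S z]) (simp add: sq_norm_real(1)[symmetric])
  from frechet_derivative_eqI[OF this] have DR: "?D v = of_real (Re (?D v))" for v by metis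
  have pos: "0 < Re (sq_norm z) + \<epsilon>" using sq_norm_real(2)[OF z] eps by simp
  have "((\<lambda>z. ln (Re (sq_norm z) + \<epsilon>)) has_derivative (\<lambda>v. Re (?D v) * inverse (Re (sq_norm z) + \<epsilon>))) (at z)"
  proof -
    have "((\<lambda>z. Re (sq_norm z) + \<epsilon>) has_derivative (\<lambda>v. Re (?D v))) (at z)"
      using has_derivative_add[OF bounded_linear.has_derivative[OF bounded_linear_Re D] has_derivative_const[of \<epsilon>]] by simp
    from diff_chain_at[OF this DERIV_ln[OF pos, unfolded has_field_derivative_def]]
    show ?thesis by (simp add: o_def mult.commute)
  qed
  from bounded_linear.has_derivative[OF bounded_linear_of_real[where 'a = complex] this]
  have "((\<lambda>z. of_real (ln (Re (sq_norm z) + \<epsilon>))) has_derivative (\<lambda>v. of_real (Re (?D v)) * inverse (of_real (Re (sq_norm z)) + of_real \<epsilon>) :: complex)) (at z)"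
    by simp
  moreover have "(\<lambda>v. of_real (Re (?D v)) * inverse (of_real (Re (sq_norm z)) + of_real \<epsilon>)) = (\<lambda>v. ?D v * inverse (sq_norm z + of_real \<epsilon>))"
    by (rule ext) (simp only: DR[symmetric] sq_norm_real(1)[OF z, symmetric])
  ultimately have "((\<lambda>z. of_real (ln (Re (sq_norm z) + \<epsilon>))) has_derivative (\<lambda>v. ?D v * inverse (sq_norm z + of_real \<epsilon>))) (at z)"
    by (simp only:)
  note d = dz_eqI[OF this]
  have "(a * v - \<i> * (b * v)) / 2 = (a - \<i> * b) / 2 * v" for a b v :: complex
    by (simp add: field_simps)
  then show ?thesis unfolding d unfolding dz_def .
qed

lemma dzbar_dz_log_sq_norm:
  assumes z: "z \<in> S"
  defines "F \<equiv> sq_norm z + of_real \<epsilon>"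
  shows "dzbar j (dz i (\<lambda>z. of_real (ln (Re (sq_norm z) + \<epsilon>)))) z =
     dzbar j (dz i sq_norm) z / F - dz i sq_norm z * dzbar j sq_norm z / F\<^sup>2"
proof -
  have "Re F > 0" using sq_norm_real(2)[OF z] eps by (simp add: F_def)
  then have F: "F \<noteq> 0" by auto
  let ?D = "frechet_derivative sq_norm (at z)"
  have D: "(sq_norm has_derivative ?D) (at z)" using sq_norm_diff[OF z] by (simp add: frechet_derivative_works)
  have "((\<lambda>z. sq_norm z + of_real \<epsilon>) has_derivative ?D) (at z)"
    using has_derivative_add[OF D has_derivative_const] by simp
  from Deriv.has_derivative_inverse[OF F[unfolded F_def] this]
  have I: "((\<lambda>z. inverse (sq_norm z + of_real \<epsilon>)) has_derivative (\<lambda>v. - (inverse F * ?D v * inverse F))) (at z)"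
    by (simp add: F_def)
  then have dI: "(\<lambda>z. inverse (sq_norm z + of_real \<epsilon>)) differentiable (at z)"
    by (auto simp: differentiable_def)
  have "dzbar j (\<lambda>z. inverse (sq_norm z + of_real \<epsilon>)) z = - dzbar j sq_norm z / F\<^sup>2"
    unfolding dzbar_eqI[OF I] using F by (simp add: dzbar_def field_simps power2_eq_square)
  moreover have "dzbar j (dz i (\<lambda>z. of_real (ln (Re (sq_norm z) + \<epsilon>)))) z =
      dzbar j (\<lambda>z. dz i sq_norm z * inverse (sq_norm z + of_real \<epsilon>)) z"
    by (rule dz_cong_open(2)[OF S z dz_log_sq_norm])
  ultimately have e: "dzbar j (dz i (\<lambda>z. of_real (ln (Re (sq_norm z) + \<epsilon>)))) z =
      dzbar j (dz i sq_norm) z * inverse F + dz i sq_norm z * (- dzbar j sq_norm z / F\<^sup>2)"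
    by (simp only: dzbar_mult[OF dz_sq_norm_diff[OF z] dI] F_def)
  show ?thesis unfolding e divide_inverse
    by (simp only: mult_minus_left mult_minus_right mult.assoc diff_conv_add_uminus)
qed

text \<open>With \<open>F = f + \<epsilon>\<close>, the mixed derivative of \<open>ln F\<close> is
  \<open>B / F^2 + R / F\<close>. By Cauchy-Schwarz \<open>B\<close> is semidefinite, so its trace
  may be dropped; the trace of \<open>R\<close>, the curvature term, is minus the mean curvature of
  the section.\<close>

lemma bochner_log:
  fixes G :: "complex^'n^'n"
  assumes z: "z \<in> S" and G: "pos_def (\<lambda>i j. G $ i $ j)"
    and K: "Re (sform (\<lambda>\<alpha> \<beta>. \<Sum>\<gamma>\<in>UNIV. \<Sum>i\<in>UNIV. \<Sum>j\<in>UNIV. h \<gamma> \<beta> z * matrix_inv G $ j $ i * - dzbar j (a i \<alpha> \<gamma>) z)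
        (\<lambda>\<alpha>. \<sigma> \<alpha> z) (\<lambda>\<alpha>. \<sigma> \<alpha> z)) \<le> c * Re (sq_norm z)"
  shows "- (c * Re (sq_norm z) / (Re (sq_norm z) + \<epsilon>)) \<le>
     Re (\<Sum>i\<in>UNIV. \<Sum>j\<in>UNIV. matrix_inv G $ j $ i * dzbar j (dz i (\<lambda>z. of_real (ln (Re (sq_norm z) + \<epsilon>)))) z)"
proof -
  let ?H = "\<lambda>\<alpha> \<beta>. h \<alpha> \<beta> z" and ?s = "\<lambda>\<alpha>. \<sigma> \<alpha> z" and ?W = "\<lambda>i. cov_deriv i z" and ?C = "\<lambda>i j. matrix_inv G $ j $ i"
  let ?K = "\<lambda>\<alpha> \<beta>. \<Sum>\<gamma>\<in>UNIV. \<Sum>i\<in>UNIV. \<Sum>j\<in>UNIV. h \<gamma> \<beta> z * matrix_inv G $ j $ i * - dzbar j (a i \<alpha> \<gamma>) z"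
  define F where "F = Re (sq_norm z) + \<epsilon>"
  have F: "F > 0" using sq_norm_real(2)[OF z] eps by (simp add: F_def)
  have fF: "sq_norm z + of_real \<epsilon> = of_real F" using sq_norm_real(1)[OF z] by (simp add: F_def)
  have Hh: "hermitian ?H" and Hs: "pos_semidef ?H" using hpos[OF z] pos_def_imp_semidef by (auto simp: pos_def_def)
  define R where "R = (\<lambda>i j. \<Sum>\<alpha>\<in>UNIV. \<Sum>\<beta>\<in>UNIV. (\<Sum>\<gamma>\<in>UNIV. h \<gamma> \<beta> z * dzbar j (a i \<alpha> \<gamma>) z) * \<sigma> \<alpha> z * cnj (\<sigma> \<beta> z))"
  define B where "B = (\<lambda>i j. of_real F * sform ?H (?W i) (?W j) - sform ?H (?W i) ?s * sform ?H ?s (?W j))"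
  have psd: "pos_semidef B"
  proof -
    have "hermitian B"
    proof (rule hermitianI)
      fix i j
      have "cnj (sform ?H u v) = sform ?H v u" for u v by (rule sform_swap[OF Hh, symmetric])
      then show "cnj (B i j) = B j i" by (simp add: B_def mult.commute)
    qed
    moreover have "0 \<le> Re (sform B v v)" for v
    proof -
      \<comment> \<open>The value of \<open>B\<close> at \<open>v\<close> is the defect in the
        Cauchy-Schwarz inequality between the section and this combination of its covariant
        derivatives, with \<open>F\<close> in place of the squared norm of the section.\<close>
      define w where "w = (\<lambda>\<gamma>. \<Sum>i\<in>UNIV. v i * ?W i \<gamma>)"
      have w1: "sform ?H w u = (\<Sum>i\<in>UNIV. v i * sform ?H (?W i) u)" and
        w2: "sform ?H u w = (\<Sum>i\<in>UNIV. cnj (v i) * sform ?H u (?W i))" for u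
        unfolding w_def sform_sum sform_scale by (rule refl)+
      have "sform B v v = (\<Sum>i\<in>UNIV. \<Sum>j\<in>UNIV. of_real F * (cnj (v j) * (v i * sform ?H (?W i) (?W j)))
          - (v i * sform ?H (?W i) ?s) * (cnj (v j) * sform ?H ?s (?W j)))"
        unfolding sform_def[of B v v]
        by (intro sum.cong refl) (simp add: B_def left_diff_distrib right_diff_distrib mult_ac)
      also have "\<dots> = of_real F * sform ?H w w - sform ?H w ?s * sform ?H ?s w"
      proof -
        have "sform ?H w w = (\<Sum>i\<in>UNIV. \<Sum>j\<in>UNIV. cnj (v j) * (v i * sform ?H (?W i) (?W j)))"
          unfolding w2 w1 by (subst sum.swap) (simp add: sum_distrib_left)
        moreover have "sform ?H w ?s * sform ?H ?s w = (\<Sum>i\<in>UNIV. \<Sum>j\<in>UNIV. (v i * sform ?H (?W i) ?s) * (cnj (v j) * sform ?H ?s (?W j)))"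
          unfolding w1 w2 by (rule sum_product)
        ultimately show ?thesis by (simp add: sum_subtractf sum_distrib_left)
      qed
      also have "sform ?H w ?s * sform ?H ?s w = of_real ((norm (sform ?H w ?s))\<^sup>2)"
        unfolding complex_norm_square sform_swap[OF Hh, of ?s w] ..
      finally have "Re (sform B v v) = F * Re (sform ?H w w) - (norm (sform ?H w ?s))\<^sup>2"
        by (simp del: of_real_power)
      moreover have "(norm (sform ?H w ?s))\<^sup>2 \<le> Re (sform ?H w w) * F"
        by (rule pos_semidef_cauchy_schwarz_eps[OF Hs]) (use F eps in \<open>simp_all add: F_def sq_norm_def\<close>)
      ultimately show ?thesis by (simp add: mult.commute)
    qed
    ultimately show ?thesis by (simp add: pos_semidef_def)
  qed
  have tr: "0 \<le> Re (\<Sum>i\<in>UNIV. \<Sum>j\<in>UNIV. ?C i j * B i j)"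
    by (rule trace_pos_semidef[OF sform_matrix_inv_nonneg[OF G] psd])
  have RK: "(\<Sum>i\<in>UNIV. \<Sum>j\<in>UNIV. ?C i j * R i j) = - sform ?K ?s ?s"
  proof -
    let ?t = "\<lambda>i j \<alpha> \<beta> \<gamma>. ?C i j * h \<gamma> \<beta> z * dzbar j (a i \<alpha> \<gamma>) z * \<sigma> \<alpha> z * cnj (\<sigma> \<beta> z)"
    have "(\<Sum>i\<in>UNIV. \<Sum>j\<in>UNIV. ?C i j * R i j) = (\<Sum>i\<in>UNIV. \<Sum>j\<in>UNIV. \<Sum>\<alpha>\<in>UNIV. \<Sum>\<beta>\<in>UNIV. \<Sum>\<gamma>\<in>UNIV. ?t i j \<alpha> \<beta> \<gamma>)"
      unfolding R_def by (simp add: sum_distrib_left sum_distrib_right mult_ac)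
    also have "\<dots> = (\<Sum>\<alpha>\<in>UNIV. \<Sum>\<beta>\<in>UNIV. \<Sum>\<gamma>\<in>UNIV. \<Sum>i\<in>UNIV. \<Sum>j\<in>UNIV. ?t i j \<alpha> \<beta> \<gamma>)"
    proof -
      have "(\<Sum>i\<in>UNIV. \<Sum>j\<in>UNIV. \<Sum>\<alpha>\<in>UNIV. \<Sum>\<beta>\<in>UNIV. \<Sum>\<gamma>\<in>UNIV. ?t i j \<alpha> \<beta> \<gamma>) =
        (\<Sum>\<alpha>\<in>UNIV. \<Sum>i\<in>UNIV. \<Sum>j\<in>UNIV. \<Sum>\<beta>\<in>UNIV. \<Sum>\<gamma>\<in>UNIV. ?t i j \<alpha> \<beta> \<gamma>)" by (rule sum_swap3)
      also have "\<dots> = (\<Sum>\<alpha>\<in>UNIV. \<Sum>\<beta>\<in>UNIV. \<Sum>i\<in>UNIV. \<Sum>j\<in>UNIV. \<Sum>\<gamma>\<in>UNIV. ?t i j \<alpha> \<beta> \<gamma>)"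
        by (rule sum.cong[OF refl]) (rule sum_swap3)
      also have "\<dots> = (\<Sum>\<alpha>\<in>UNIV. \<Sum>\<beta>\<in>UNIV. \<Sum>\<gamma>\<in>UNIV. \<Sum>i\<in>UNIV. \<Sum>j\<in>UNIV. ?t i j \<alpha> \<beta> \<gamma>)"
        by (rule sum.cong[OF refl], rule sum.cong[OF refl]) (rule sum_swap3)
      finally show ?thesis .
    qed
    also have "\<dots> = - sform ?K ?s ?s"
      unfolding sform_def by (simp add: sum_negf sum_distrib_left sum_distrib_right mult_ac)
    finally show ?thesis .
  qed
  have "(\<Sum>i\<in>UNIV. \<Sum>j\<in>UNIV. ?C i j * dzbar j (dz i (\<lambda>z. of_real (ln (Re (sq_norm z) + \<epsilon>)))) z) =
     (\<Sum>i\<in>UNIV. \<Sum>j\<in>UNIV. (1 / (of_real F)\<^sup>2) * (?C i j * B i j) + (1 / of_real F) * (?C i j * R i j))"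
  proof (intro sum.cong refl)
    fix i j
    have "dzbar j (dz i (\<lambda>z. of_real (ln (Re (sq_norm z) + \<epsilon>)))) z = (1 / (of_real F)\<^sup>2) * B i j + (1 / of_real F) * R i j"
      unfolding dzbar_dz_log_sq_norm[OF z] fF dzbar_dz_sq_norm[OF z] dz_sq_norm[OF z] B_def R_def
      using F by (simp add: field_simps power2_eq_square)
    then show "?C i j * dzbar j (dz i (\<lambda>z. of_real (ln (Re (sq_norm z) + \<epsilon>)))) z =
      (1 / (of_real F)\<^sup>2) * (?C i j * B i j) + (1 / of_real F) * (?C i j * R i j)" by (simp add: algebra_simps)
  qed
  also have "\<dots> = of_real (1 / F\<^sup>2) * (\<Sum>i\<in>UNIV. \<Sum>j\<in>UNIV. ?C i j * B i j) + of_real (1 / F) * (\<Sum>i\<in>UNIV. \<Sum>j\<in>UNIV. ?C i j * R i j)"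
    by (simp only: sum.distrib sum_distrib_left of_real_divide of_real_1 of_real_power)
  finally have main: "Re (\<Sum>i\<in>UNIV. \<Sum>j\<in>UNIV. ?C i j * dzbar j (dz i (\<lambda>z. of_real (ln (Re (sq_norm z) + \<epsilon>)))) z) =
     (1 / F\<^sup>2) * Re (\<Sum>i\<in>UNIV. \<Sum>j\<in>UNIV. ?C i j * B i j) - (1 / F) * Re (sform ?K ?s ?s)"
    unfolding RK by (simp only: plus_complex.sel Re_complex_of_real times_complex.sel Im_complex_of_real uminus_complex.sel)
  have nonneg: "0 \<le> (1 / F\<^sup>2) * Re (\<Sum>i\<in>UNIV. \<Sum>j\<in>UNIV. ?C i j * B i j)" using tr by simp
  have le: "(1 / F) * Re (sform ?K ?s ?s) \<le> (1 / F) * (c * Re (sq_norm z))"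
    using K F by (intro mult_left_mono) auto
  have eq: "(1 / F) * (c * Re (sq_norm z)) = c * Re (sq_norm z) / (Re (sq_norm z) + \<epsilon>)"
    by (simp add: F_def)
  have arith: "x = p - q \<Longrightarrow> 0 \<le> p \<Longrightarrow> q \<le> q' \<Longrightarrow> q' = r \<Longrightarrow> - r \<le> x" for x p q q' r :: real
    by linarith
  show ?thesis by (rule arith[OF main nonneg le eq])
qed

end

end

end

section \<open>Smooth partitions of unity\<close>

text \<open>The powers of \<open>1 / t\<close> make the family closed under differentiation up to
  linear combinations, so one induction proves that all members are smooth, in particular
  \<open>exp (- 1 / t)\<close> extended by zero.\<close>

definition flat_exp :: "nat \<Rightarrow> real \<Rightarrow> real" where
  "flat_exp n t = (if t > 0 then (1 / t) ^ n * exp (- (1 / t)) else 0)"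

lemma flat_exp_tendsto: "(flat_exp n \<longlongrightarrow> 0) (at_right 0)"
proof -
  have "((\<lambda>t. inverse t ^ n / exp (inverse t)) \<longlongrightarrow> (0 :: real)) (at_right 0)"
    by (rule filterlim_compose[OF tendsto_power_div_exp_0 filterlim_inverse_at_top_right])
  then show ?thesis
  proof (rule Lim_transform_eventually)
    have "inverse t ^ n / exp (inverse t) = flat_exp n t" if "t > 0" for t
      using that by (simp add: flat_exp_def exp_minus divide_inverse)
    then show "\<forall>\<^sub>F t in at_right 0. inverse t ^ n / exp (inverse t) = flat_exp n t"
      by (auto simp: eventually_at_filter)
  qed
qed

lemma flat_exp_deriv:
  "(flat_exp n has_real_derivative (- real n * flat_exp (Suc n) t + flat_exp (Suc (Suc n)) t)) (at t)"
proof -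
  consider "t > 0" | "t < 0" | "t = 0" by linarith
  then show ?thesis
  proof cases
    case 1
    have "((\<lambda>t. inverse t ^ n * exp (- inverse t)) has_real_derivative
       (- real n * (inverse t ^ Suc n * exp (- inverse t)) + inverse t ^ Suc (Suc n) * exp (- inverse t))) (at t)"
    proof -
      have i: "(inverse has_real_derivative - (inverse t * inverse t)) (at t)"
        using DERIV_inverse'[OF DERIV_ident, of t] 1 by simp
      have e: "((\<lambda>t. exp (- inverse t)) has_real_derivative exp (- inverse t) * (inverse t * inverse t)) (at t)"
        using DERIV_fun_exp[OF DERIV_minus[OF i]] by simp
      have "((\<lambda>t. inverse t ^ n * exp (- inverse t)) has_real_derivative
          real n * (- (inverse t * inverse t) * inverse t ^ (n - Suc 0)) * exp (- inverse t)
          + exp (- inverse t) * (inverse t * inverse t) * inverse t ^ n) (at t)"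
        by (rule DERIV_mult[OF DERIV_power[OF i] e])
      moreover have "real n * (- (inverse t * inverse t) * inverse t ^ (n - Suc 0)) * exp (- inverse t)
          + exp (- inverse t) * (inverse t * inverse t) * inverse t ^ n =
          - real n * (inverse t ^ Suc n * exp (- inverse t)) + inverse t ^ Suc (Suc n) * exp (- inverse t)"
        by (cases n) (simp_all add: algebra_simps)
      ultimately show ?thesis by (simp only:)
    qed
    then have "((\<lambda>t. inverse t ^ n * exp (- inverse t)) has_real_derivative (- real n * flat_exp (Suc n) t + flat_exp (Suc (Suc n)) t)) (at t)"
      using 1 by (simp add: flat_exp_def divide_inverse)
    then show ?thesis
      by (rule has_field_derivative_transform_within_open[of _ _ _ "{0<..}"]) (use 1 in \<open>auto simp: flat_exp_def divide_inverse\<close>)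
  next
    case 2
    have "((\<lambda>t. 0) has_real_derivative (- real n * flat_exp (Suc n) t + flat_exp (Suc (Suc n)) t)) (at t)"
      using 2 by (simp add: flat_exp_def)
    then show ?thesis
      by (rule has_field_derivative_transform_within_open[of _ _ _ "{..<0}"]) (use 2 in \<open>auto simp: flat_exp_def\<close>)
  next
    case 3
    \<comment> \<open>At 0 the difference quotient from the right is the next member of the family,
      which tends to 0.\<close>
    have "((\<lambda>y. (flat_exp n y - flat_exp n 0) / (y - 0)) \<longlongrightarrow> 0) (at 0)"
    proof (rule filterlim_split_at)
      have "(flat_exp n y - flat_exp n 0) / (y - 0) = 0" if "y < 0" for y
        using that by (simp add: flat_exp_def)
      then show "((\<lambda>y. (flat_exp n y - flat_exp n 0) / (y - 0)) \<longlongrightarrow> 0) (at_left 0)"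
        by (intro tendsto_eventually) (auto simp: eventually_at_filter)
      have "flat_exp (Suc n) y = (flat_exp n y - flat_exp n 0) / (y - 0)" if "y > 0" for y
        using that by (simp add: flat_exp_def)
      then show "((\<lambda>y. (flat_exp n y - flat_exp n 0) / (y - 0)) \<longlongrightarrow> 0) (at_right 0)"
        by (intro Lim_transform_eventually[OF flat_exp_tendsto[of "Suc n"]]) (auto simp: eventually_at_filter)
    qed
    then show ?thesis unfolding 3 has_field_derivative_iff by (simp add: flat_exp_def)
  qed
qed

lemma Ck_on_flat_exp: "Ck_on k UNIV (flat_exp n)"
proof (induction k arbitrary: n)
  case 0
  have "isCont (flat_exp n) x" for x by (rule DERIV_isCont[OF flat_exp_deriv])
  then show ?case by (simp add: continuous_at_imp_continuous_on)
next
  case (Suc k)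
  show ?case
    by (rule Ck_on_real_SucI[OF flat_exp_deriv open_UNIV]) (intro Ck_on_add Ck_on_mult Ck_on_const Suc open_UNIV)
qed

text \<open>The squared norm is an inner product, hence smooth at the centre too.\<close>

lemma Ck_on_bump:
  fixes z0 :: "'a::euclidean_space"
  shows "Ck_on k UNIV (\<lambda>z. flat_exp 0 (r\<^sup>2 - (norm (z - z0))\<^sup>2))"
proof -
  have d: "Ck_on k UNIV (\<lambda>z. z - z0)"
    by (intro Ck_on_diff Ck_on_id Ck_on_const open_UNIV)
  have "Ck_on k UNIV (\<lambda>z. r\<^sup>2 - (z - z0) \<bullet> (z - z0))"
    by (intro Ck_on_diff Ck_on_const open_UNIV Ck_on_bilinear[OF bounded_bilinear_inner] d)
  then show ?thesis
    unfolding power2_norm_eq_inner by (intro Ck_on_compose[OF open_UNIV open_UNIV Ck_on_flat_exp]) auto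
qed

lemma bump_pos_iff: "r > 0 \<Longrightarrow> 0 < flat_exp 0 (r\<^sup>2 - (norm x)\<^sup>2) \<longleftrightarrow> norm x < r"
  using power2_less_imp_less[of "norm x" r] power_strict_mono[of "norm x" r 2] by (auto simp: flat_exp_def)

lemma flat_exp_nonneg: "0 \<le> flat_exp n t"
  by (simp add: flat_exp_def)

lemma Ck_on_vec:
  fixes \<phi> :: "'a::real_normed_vector \<Rightarrow> complex^'n"
  assumes "open S" "\<And>i. Ck_on k S (\<lambda>z. \<phi> z $ i)"
  shows "Ck_on k S \<phi>"
proof -
  have bl: "bounded_linear (\<lambda>x. axis i x :: complex^'n)" for i
    unfolding linear_conv_bounded_linear[symmetric] by (rule linearI) (auto simp: axis_def vec_eq_iff)
  have "Ck_on k S (\<lambda>z. \<Sum>i\<in>UNIV. axis i (\<phi> z $ i))"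
    by (intro Ck_on_sum assms(1) Ck_on_bounded_linear_comp[OF bl] assms(2))
  moreover have "(\<Sum>i\<in>UNIV. axis i (v $ i)) = v" for v :: "complex^'n"
  proof -
    have "(\<Sum>i\<in>UNIV. axis i (v $ i)) $ j = v $ j" for j
      unfolding sum_component by (simp add: axis_def if_distrib cong: if_cong)
    then show ?thesis unfolding vec_eq_iff by blast
  qed
  ultimately show ?thesis by simp
qed

section \<open>Charts, bump functions and the partition of unity\<close>

locale atlas =
  fixes A :: "('m::t2_space, 'n::finite) chart set"
  assumes atlas: "complex_atlas A"
begin

lemma chart_exists: "\<exists>c\<in>A. x \<in> fst c"
proof -
  have "x \<in> \<Union> (fst ` A)" using atlas by (simp add: complex_atlas_def)
  then show ?thesis by blast
qed

lemma chart_facts: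
  assumes "c \<in> A"
  shows "open (fst c)" "open (snd c ` fst c)" "homeomorphism (fst c) (snd c ` fst c) (snd c) (chart_inv c)"
  using atlas assms unfolding complex_atlas_def by blast+

lemma chart_inv_snd: "c \<in> A \<Longrightarrow> x \<in> fst c \<Longrightarrow> chart_inv c (snd c x) = x"
  and snd_chart_inv: "c \<in> A \<Longrightarrow> z \<in> snd c ` fst c \<Longrightarrow> snd c (chart_inv c z) = z"
  and chart_inv_mem: "c \<in> A \<Longrightarrow> z \<in> snd c ` fst c \<Longrightarrow> chart_inv c z \<in> fst c"
  and continuous_chart: "c \<in> A \<Longrightarrow> continuous_on (fst c) (snd c)"
  and continuous_chart_inv: "c \<in> A \<Longrightarrow> continuous_on (snd c ` fst c) (chart_inv c)"
  using chart_facts(3)[of c] unfolding homeomorphism_def by auto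

lemma chart_open_image:
  assumes c: "c \<in> A" and V: "open V" "V \<subseteq> fst c"
  shows "open (snd c ` V)"
proof -
  have "snd c ` V = snd c ` fst c \<inter> chart_inv c -` V"
  proof (intro set_eqI iffI)
    fix z assume "z \<in> snd c ` V"
    then obtain x where "x \<in> V" "z = snd c x" by blast
    then show "z \<in> snd c ` fst c \<inter> chart_inv c -` V" using chart_inv_snd[OF c, of x] V(2) by auto
  next
    fix z assume z: "z \<in> snd c ` fst c \<inter> chart_inv c -` V"
    then have "z = snd c (chart_inv c z)" using snd_chart_inv[OF c, of z] by simp
    then show "z \<in> snd c ` V" using z by blast
  qed
  then show ?thesis
    using continuous_open_preimage[OF continuous_chart_inv[OF c] chart_facts(2)[OF c] V(1)] by simp
qed

lemma chart_image_mem: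
  assumes "c \<in> A" "V \<subseteq> fst c"
  shows "z \<in> snd c ` V \<longleftrightarrow> z \<in> snd c ` fst c \<and> chart_inv c z \<in> V"
proof
  assume "z \<in> snd c ` V"
  then obtain x where x: "x \<in> V" "z = snd c x" by blast
  then have "chart_inv c z = x" using assms chart_inv_snd[of c x] by auto
  then show "z \<in> snd c ` fst c \<and> chart_inv c z \<in> V" using x assms(2) by auto
next
  assume z: "z \<in> snd c ` fst c \<and> chart_inv c z \<in> V"
  then have "z = snd c (chart_inv c z)" using snd_chart_inv[OF assms(1), of z] by simp
  then show "z \<in> snd c ` V" using z by blast
qed

lemma chart_open_preimage:
  assumes c: "c \<in> A" and V: "open V" "V \<subseteq> snd c ` fst c"
  shows "open (chart_inv c ` V)"
proof -
  have "chart_inv c ` V = fst c \<inter> snd c -` V"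
  proof (intro set_eqI iffI)
    fix x assume "x \<in> chart_inv c ` V"
    then obtain z where "z \<in> V" "x = chart_inv c z" by blast
    then show "x \<in> fst c \<inter> snd c -` V" using snd_chart_inv[OF c, of z] chart_inv_mem[OF c, of z] V(2) by auto
  next
    fix x assume x: "x \<in> fst c \<inter> snd c -` V"
    then have "x = chart_inv c (snd c x)" using chart_inv_snd[OF c, of x] by simp
    then show "x \<in> chart_inv c ` V" using x by blast
  qed
  then show ?thesis
    using continuous_open_preimage[OF continuous_chart[OF c] chart_facts(1)[OF c] V(1)] by simp
qed

lemma transition_holo:
  assumes "c \<in> A" "c' \<in> A"
  shows "holo_on (snd c ` (fst c \<inter> fst c')) (\<lambda>z. snd c' (chart_inv c z) $ i)"
  using atlas assms unfolding complex_atlas_def by blast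

lemma overlap_open: "c \<in> A \<Longrightarrow> c' \<in> A \<Longrightarrow> open (snd c ` (fst c \<inter> fst c'))"
  by (rule chart_open_image) (auto simp: chart_facts)

lemma transition_Ck:
  assumes "c \<in> A" "c' \<in> A"
  shows "Ck_on k (snd c ` (fst c \<inter> fst c')) (\<lambda>z. snd c' (chart_inv c z))"
  by (rule Ck_on_vec[OF overlap_open[OF assms]], rule holo_on_Ck[OF transition_holo[OF assms] overlap_open[OF assms]])

lemma mfd_smoothD: "mfd_smooth A f \<Longrightarrow> c \<in> A \<Longrightarrow> Ck_on k (snd c ` fst c) (\<lambda>z. f (chart_inv c z))"
  by (simp add: mfd_smooth_def smooth_on_def)

lemma mfd_smoothI: "(\<And>c k. c \<in> A \<Longrightarrow> Ck_on k (snd c ` fst c) (\<lambda>z. f (chart_inv c z))) \<Longrightarrow> mfd_smooth A f"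
  by (simp add: mfd_smooth_def smooth_on_def)

text \<open>Any chart is covered by its overlap with \<open>c\<close>, where the transition maps are
  smooth, and the complement of \<open>K\<close>, where \<open>f\<close> is zero.\<close>

lemma mfd_smooth_extend:
  assumes c: "c \<in> A" and f: "\<And>k. Ck_on k (snd c ` fst c) (\<lambda>z. f (chart_inv c z))"
    and K: "closed K" "K \<subseteq> fst c" "\<And>x. x \<notin> K \<Longrightarrow> f x = 0"
  shows "mfd_smooth A f"
proof (rule mfd_smoothI, rule Ck_on_local)
  fix c' k z assume c': "c' \<in> A" and z: "z \<in> snd c' ` fst c'"
  show "\<exists>U. open U \<and> z \<in> U \<and> Ck_on k U (\<lambda>z. f (chart_inv c' z))"
  proof (cases "chart_inv c' z \<in> fst c")
    case True
    let ?U = "snd c' ` (fst c' \<inter> fst c)"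
    have U: "open ?U" by (rule overlap_open[OF c' c])
    have mem: "chart_inv c' w \<in> fst c \<inter> fst c'" if "w \<in> ?U" for w
      using that chart_image_mem[OF c', of "fst c' \<inter> fst c" w] by auto
    have "Ck_on k ?U (\<lambda>w. f (chart_inv c (snd c (chart_inv c' w))))"
      by (rule Ck_on_compose[OF U chart_facts(2)[OF c], of k "\<lambda>z. f (chart_inv c z)" "\<lambda>w. snd c (chart_inv c' w)"])
         (use f transition_Ck[OF c' c] mem in auto)
    moreover have "f (chart_inv c (snd c (chart_inv c' w))) = f (chart_inv c' w)" if "w \<in> ?U" for w
      using mem[OF that] chart_inv_snd[OF c] by auto
    ultimately have "Ck_on k ?U (\<lambda>w. f (chart_inv c' w))"
      using Ck_on_cong[OF U, of "\<lambda>w. f (chart_inv c (snd c (chart_inv c' w)))" "\<lambda>w. f (chart_inv c' w)"] by simp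
    moreover have "z \<in> ?U"
      using True z chart_image_mem[OF c', of "fst c' \<inter> fst c" z] chart_inv_mem[OF c' z] by auto
    ultimately show ?thesis using U by blast
  next
    case False
    let ?U = "snd c' ` (fst c' - K)"
    have U: "open ?U" by (rule chart_open_image[OF c']) (use chart_facts(1)[OF c'] K(1) in auto)
    have "f (chart_inv c' w) = 0" if "w \<in> ?U" for w
      using that chart_image_mem[OF c', of "fst c' - K" w] K(3) by auto
    then have "Ck_on k ?U (\<lambda>w. f (chart_inv c' w))"
      using Ck_on_cong[OF U, of "\<lambda>w. f (chart_inv c' w)" "\<lambda>w. 0"] by simp
    moreover have "z \<in> ?U"
      using False z K(2) chart_image_mem[OF c', of "fst c' - K" z] chart_inv_mem[OF c' z] by auto
    ultimately show ?thesis using U by blast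
  qed
qed

text \<open>\<open>K\<close> corresponds to a closed ball in the chart. It is compact, hence closed
  in the Hausdorff space \<open>'m\<close>, and this permits extension by zero.\<close>

lemma bump_exists:
  assumes c: "c \<in> A" and x: "x \<in> fst c"
  shows "\<exists>(b :: 'm \<Rightarrow> real) K. mfd_smooth A b \<and> (\<forall>y. 0 \<le> b y) \<and> 0 < b x \<and> open {y. 0 < b y} \<and>
     closed K \<and> K \<subseteq> fst c \<and> (\<forall>y. y \<notin> K \<longrightarrow> b y = 0)"
proof -
  let ?O = "snd c ` fst c"
  obtain r where r: "r > 0" "cball (snd c x) r \<subseteq> ?O"
    using chart_facts(2)[OF c] x open_contains_cball by blast
  define K where "K = chart_inv c ` cball (snd c x) r"
  define b where "b = (\<lambda>y. if y \<in> fst c then flat_exp 0 (r\<^sup>2 - (norm (snd c y - snd c x))\<^sup>2) else 0)"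
  have "compact K" unfolding K_def
    using continuous_on_subset[OF continuous_chart_inv[OF c] r(2)] by (intro compact_continuous_image) auto
  then have Kc: "closed K" by (rule compact_imp_closed)
  have Ks: "K \<subseteq> fst c" using r(2) chart_inv_mem[OF c] unfolding K_def by blast
  have bpos: "0 < b y \<longleftrightarrow> y \<in> chart_inv c ` ball (snd c x) r" for y
  proof
    assume "0 < b y"
    then have y: "y \<in> fst c" "norm (snd c y - snd c x) < r"
      using bump_pos_iff[OF r(1), of "snd c y - snd c x"] by (auto simp: b_def split: if_splits)
    then have "snd c y \<in> ball (snd c x) r" by (simp add: dist_norm norm_minus_commute)
    then show "y \<in> chart_inv c ` ball (snd c x) r" using chart_inv_snd[OF c y(1)] by force
  next
    assume "y \<in> chart_inv c ` ball (snd c x) r"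
    then obtain z where z: "z \<in> ball (snd c x) r" "y = chart_inv c z" by blast
    then have "z \<in> ?O" using r(2) by auto
    then have "y \<in> fst c" "snd c y = z" using z(2) chart_inv_mem[OF c] snd_chart_inv[OF c] by auto
    then show "0 < b y"
      using z(1) bump_pos_iff[OF r(1), of "z - snd c x"] by (simp add: b_def dist_norm norm_minus_commute)
  qed
  have nn: "0 \<le> b y" for y by (simp add: b_def flat_exp_nonneg)
  have b0: "b y = 0" if "y \<notin> K" for y
  proof -
    have "\<not> 0 < b y" using that unfolding bpos K_def by auto
    then show ?thesis using nn[of y] by simp
  qed
  have "Ck_on k ?O (\<lambda>z. b (chart_inv c z))" for k
  proof -
    have "Ck_on k ?O (\<lambda>z. flat_exp 0 (r\<^sup>2 - (norm (z - snd c x))\<^sup>2))"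
      by (rule Ck_on_subset[OF Ck_on_bump]) simp
    moreover have "flat_exp 0 (r\<^sup>2 - (norm (z - snd c x))\<^sup>2) = b (chart_inv c z)" if "z \<in> ?O" for z
      using chart_inv_mem[OF c that] snd_chart_inv[OF c that] by (simp add: b_def)
    ultimately show ?thesis
      using Ck_on_cong[OF chart_facts(2)[OF c], of "\<lambda>z. flat_exp 0 (r\<^sup>2 - (norm (z - snd c x))\<^sup>2)" "\<lambda>z. b (chart_inv c z)"] by simp
  qed
  then have "mfd_smooth A b" by (rule mfd_smooth_extend[OF c _ Kc Ks b0])
  moreover have "open {y. 0 < b y}"
  proof -
    have "{y. 0 < b y} = chart_inv c ` ball (snd c x) r" using bpos by blast
    moreover have "open (chart_inv c ` ball (snd c x) r)"
      by (rule chart_open_preimage[OF c]) (use r(2) in auto)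
    ultimately show ?thesis by simp
  qed
  moreover have "0 < b x" unfolding bpos
    using chart_inv_snd[OF c x] r(1) by (metis centre_in_ball imageI)
  ultimately show ?thesis using Kc Ks b0 nn by blast
qed

lemma partition_of_unity_exists:
  assumes "compact (UNIV :: 'm set)"
  shows "\<exists>I \<rho>. partition_of_unity A I \<rho>"
proof -
  obtain ch where ch: "\<And>x. ch x \<in> A" "\<And>x. x \<in> fst (ch x)" using chart_exists by metis
  have "\<forall>x. \<exists>p :: ('m \<Rightarrow> real) \<times> 'm set. mfd_smooth A (fst p) \<and> (\<forall>y. 0 \<le> fst p y) \<and> 0 < fst p x \<and> open {y. 0 < fst p y} \<and>
     closed (snd p) \<and> snd p \<subseteq> fst (ch x) \<and> (\<forall>y. y \<notin> snd p \<longrightarrow> fst p y = 0)"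
    using bump_exists[OF ch] by simp
  from choice[OF this] obtain p :: "'m \<Rightarrow> ('m \<Rightarrow> real) \<times> 'm set" where
    p: "\<And>x. mfd_smooth A (fst (p x)) \<and> (\<forall>y. 0 \<le> fst (p x) y) \<and> 0 < fst (p x) x \<and> open {y. 0 < fst (p x) y} \<and>
     closed (snd (p x)) \<and> snd (p x) \<subseteq> fst (ch x) \<and> (\<forall>y. y \<notin> snd (p x) \<longrightarrow> fst (p x) y = 0)" by blast
  define b where "b = (\<lambda>x. fst (p x))"
  define K where "K = (\<lambda>x. snd (p x))"
  have b: "mfd_smooth A (b x)" "0 \<le> b x y" "0 < b x x" "open {y. 0 < b x y}"
    "closed (K x)" "K x \<subseteq> fst (ch x)" "y \<notin> K x \<Longrightarrow> b x y = 0" for x y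
    using p[of x] by (auto simp: b_def K_def)
  have cover: "UNIV \<subseteq> (\<Union>x\<in>UNIV. {y. 0 < b x y})" using b(3) by blast
  have "\<exists>X. finite X \<and> UNIV \<subseteq> (\<Union>x\<in>X. {y. 0 < b x y})"
  proof (rule compactE_image[OF assms _ cover])
    show "open {y. 0 < b x y}" for x by (rule b(4))
  qed blast
  then obtain X where X: "finite X" "UNIV \<subseteq> (\<Union>x\<in>X. {y. 0 < b x y})" by blast
  define T where "T = (\<lambda>y. \<Sum>x\<in>X. b x y)"
  have Tpos: "0 < T y" for y
  proof -
    obtain x where "x \<in> X" "0 < b x y" using X(2) by blast
    then show ?thesis unfolding T_def using X(1) b(2) by (intro sum_pos2) auto
  qed
  \<comment> \<open>\<open>partition_of_unity\<close> is indexed by charts, so bumps that belong to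
    the same chart are added up before the division by the total.\<close>
  define \<rho> where "\<rho> = (\<lambda>c y. (\<Sum>x\<in>{x \<in> X. ch x = c}. b x y) * inverse (T y))"
  have sm: "mfd_smooth A (\<rho> c)" for c
  proof (rule mfd_smoothI)
    fix c' k assume c': "c' \<in> A"
    let ?O = "snd c' ` fst c'"
    have O: "open ?O" by (rule chart_facts(2)[OF c'])
    have "Ck_on k ?O (\<lambda>z. T (chart_inv c' z))"
      unfolding T_def by (intro Ck_on_sum O mfd_smoothD b(1) c')
    then have iT: "Ck_on k ?O (\<lambda>z. inverse (T (chart_inv c' z)))"
      by (rule Ck_on_compose[OF O open_greaterThan Ck_on_inverse_real]) (use Tpos in auto)
    show "Ck_on k ?O (\<lambda>z. \<rho> c (chart_inv c' z))"
      unfolding \<rho>_def by (rule Ck_on_mult[OF O _ iT]) (intro Ck_on_sum O mfd_smoothD b(1) c')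
  qed
  have cl: "closure {x. \<rho> c x \<noteq> 0} \<subseteq> fst c" for c
  proof -
    let ?K = "\<Union>x\<in>{x \<in> X. ch x = c}. K x"
    have "closed ?K" using X(1) b(5) by (intro closed_UN) auto
    moreover have "{x. \<rho> c x \<noteq> 0} \<subseteq> ?K"
    proof
      fix y assume "y \<in> {x. \<rho> c x \<noteq> 0}"
      then have "(\<Sum>x\<in>{x \<in> X. ch x = c}. b x y) \<noteq> 0" by (auto simp: \<rho>_def)
      then obtain x where "x \<in> {x \<in> X. ch x = c}" "b x y \<noteq> 0" by (meson sum.neutral)
      then show "y \<in> ?K" using b(7) by blast
    qed
    ultimately have "closure {x. \<rho> c x \<noteq> 0} \<subseteq> ?K" by (rule closure_minimal[rotated])
    also have "?K \<subseteq> fst c" using b(6) by blast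
    finally show ?thesis .
  qed
  have sum1: "(\<Sum>c\<in>ch ` X. \<rho> c y) = 1" for y
  proof -
    have "(\<Sum>c\<in>ch ` X. \<rho> c y) = T y * inverse (T y)"
      unfolding \<rho>_def sum_distrib_right[symmetric] T_def using sum.image_gen[OF X(1), of "\<lambda>x. b x y" ch] by simp
    then show ?thesis using Tpos[of y] by simp
  qed
  have "0 \<le> \<rho> c y" for c y
    unfolding \<rho>_def using b(2) Tpos[of y] by (intro mult_nonneg_nonneg sum_nonneg) auto
  then have "partition_of_unity A (ch ` X) \<rho>"
    unfolding partition_of_unity_def using X(1) ch(1) sm cl sum1 by blast
  then show ?thesis by blast
qed

end

section \<open>Zeros of holomorphic functions\<close>

text \<open>By Fubini, almost all of the homothetic images \<open>S/t\<close> with \<open>1 \<le> t \<le> 2\<close> are null sets.\<close>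

lemma countable_rays_null:
  fixes S :: "'a::euclidean_space set"
  assumes S: "S \<in> sets borel" and ray: "\<And>x. countable {t::real. t *\<^sub>R x \<in> S}"
  shows "emeasure lborel S = 0"
proof -
  let ?f = "\<lambda>t x. indicator {1..2} t * indicator S (t *\<^sub>R x) :: ennreal"
  have m: "(\<lambda>p. fst p *\<^sub>R snd p :: 'a) \<in> borel_measurable (lborel \<Otimes>\<^sub>M lborel)"
    by measurable
  have mf: "case_prod ?f \<in> borel_measurable (lborel \<Otimes>\<^sub>M lborel)"
    using S by measurable
  have "(\<integral>\<^sup>+ t. (\<integral>\<^sup>+ x. ?f t x \<partial>lborel) \<partial>lborel) = (\<integral>\<^sup>+ x. (\<integral>\<^sup>+ t. ?f t x \<partial>lborel) \<partial>lborel)"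
    by (rule lborel_pair.Fubini'[OF mf, symmetric])
  also have "\<dots> = 0"
  proof -
    have "(\<integral>\<^sup>+ t. ?f t x \<partial>lborel) = 0" for x
    proof -
      have "{t::real. t *\<^sub>R x \<in> S} \<in> null_sets lborel" using ray by (rule countable_imp_null_set_lborel)
      then have "AE t in lborel. t *\<^sub>R x \<notin> S" by (auto dest: AE_not_in)
      then have "AE t in lborel. ?f t x = 0" by eventually_elim simp
      then have "(\<integral>\<^sup>+ t. ?f t x \<partial>lborel) = (\<integral>\<^sup>+ t. 0 \<partial>(lborel :: real measure))" by (rule nn_integral_cong_AE)
      then show ?thesis by simp
    qed
    then show ?thesis by simp
  qed
  finally have "(\<integral>\<^sup>+ t. (\<integral>\<^sup>+ x. ?f t x \<partial>lborel) \<partial>lborel) = 0" .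
  moreover have "(\<lambda>t. \<integral>\<^sup>+ x. ?f t x \<partial>lborel) \<in> borel_measurable lborel"
    using lborel.borel_measurable_nn_integral_fst[OF mf] by simp
  ultimately have ae: "AE t in lborel. (\<integral>\<^sup>+ x. ?f t x \<partial>lborel) = 0"
    by (simp add: nn_integral_0_iff_AE)
  \<comment> \<open>The interval has positive length, so the exceptional parameters cannot fill
    it.\<close>
  have "\<exists>t\<in>{1..2::real}. (\<integral>\<^sup>+ x. ?f t x \<partial>lborel) = 0"
  proof (rule ccontr)
    assume "\<not> ?thesis"
    then have "AE t in lborel. t \<notin> {1..2::real}" using ae by (auto elim: eventually_mono)
    then have "emeasure lborel {1..2::real} = 0"
      by (subst (asm) AE_iff_null_sets[symmetric]) auto
    then show False by simp
  qed
  then obtain t :: real where t: "1 \<le> t" "(\<integral>\<^sup>+ x. ?f t x \<partial>lborel) = 0" "t \<le> 2" by auto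
  have mt: "(\<lambda>x. 0 + t *\<^sub>R x :: 'a) \<in> borel \<rightarrow>\<^sub>M borel" by measurable
  have pre: "(\<lambda>x. 0 + t *\<^sub>R x) -` S \<inter> space lborel \<in> sets (lborel :: 'a measure)"
    using measurable_sets[OF mt S] by simp
  have "(\<integral>\<^sup>+ x. ?f t x \<partial>lborel) = (\<integral>\<^sup>+ x. indicator ((\<lambda>x. 0 + t *\<^sub>R x) -` S) x \<partial>lborel)"
    using t by (intro nn_integral_cong) (auto simp: indicator_def)
  also have "\<dots> = emeasure lborel ((\<lambda>x. 0 + t *\<^sub>R x) -` S)" using pre by (intro nn_integral_indicator) simp
  finally have "emeasure lborel ((\<lambda>x. 0 + t *\<^sub>R x) -` S) = 0" using t(2) by simp
  then have "emeasure (distr lborel borel (\<lambda>x. 0 + t *\<^sub>R x)) S = 0"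
    using S mt by (simp add: emeasure_distr)
  \<comment> \<open>\<open>lborel\<close> is its image under the homothety with density
    \<open>t ^ DIM('a)\<close>, so a null preimage makes \<open>S\<close> itself null.\<close>
  then have "emeasure (density (distr lborel borel (\<lambda>x. 0 + t *\<^sub>R x)) (\<lambda>_. \<bar>t\<bar> ^ DIM('a))) S = 0"
    using S by (subst emeasure_density) (auto simp: nn_integral_cmult_indicator)
  then show ?thesis using lborel_affine[of t "0 :: 'a"] t(1) by simp
qed

lemma open_imp_fsigma:
  fixes S :: "'a::euclidean_space set"
  assumes "open S"
  shows "fsigma S"
proof -
  obtain D where D: "countable D" "\<And>X. X \<in> D \<Longrightarrow> \<exists>a b. X = cbox a b" "\<Union>D = S"
    using open_countable_Union_open_cbox[OF assms] by metis
  have c: "closed (from_nat_into (insert {} D) n)" for n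
    using from_nat_into[of "insert {} D" n] D(2) by force
  have "S = \<Union>(range (from_nat_into (insert {} D)))"
    using D(1,3) by (simp add: range_from_nat_into)
  then show ?thesis using fsigma.intros[of "from_nat_into (insert {} D)"] c by simp
qed

text \<open>On each complex line through \<open>q\<close> the function is holomorphic in one
  variable on a convex domain and nonzero at \<open>q\<close>, so it has countably many zeros there.
  With \<open>q\<close> moved to the origin, the zero set meets every real ray in a countable
  set.\<close>

lemma holo_zeros_null:
  fixes F :: "complex^'n \<Rightarrow> complex"
  assumes S: "open S" "convex S" and F: "holo_on S F" and q: "q \<in> S" "F q \<noteq> 0"
  shows "{z \<in> S. F z = 0} \<in> null_sets lborel"
proof -
  let ?Z = "{z \<in> S. F z = 0}"
  have cF: "continuous_on S F" using Ck_on_continuous[OF holo_on_Ck[OF F S(1), of 0]] .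
  have "open (S \<inter> F -` (- {0}))" by (rule continuous_open_preimage[OF cF S(1)]) auto
  moreover have "?Z = S - (S \<inter> F -` (- {0}))" by auto
  ultimately have Zm: "?Z \<in> sets borel" using S(1) by (metis borel_open sets.Diff)
  let ?Z' = "(+) q -` ?Z"
  have mq: "(+) q \<in> borel \<rightarrow>\<^sub>M borel" by measurable
  have Z'm: "?Z' \<in> sets borel" using measurable_sets[OF mq Zm] by simp
  have "countable {t::real. t *\<^sub>R x \<in> ?Z'}" for x
  proof -
    let ?T = "{t::complex. q + t *s x \<in> S}"
    let ?G = "\<lambda>t. F (q + t *s x)"
    have cont: "continuous_on UNIV (\<lambda>t. q + t *s x)"
      by (intro continuous_on_add continuous_on_const linear_continuous_on smult_bounded_linear)
    have T: "open ?T" using continuous_open_preimage[OF cont open_UNIV S(1)] by (simp add: vimage_def)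
    have "convex ?T"
    proof (rule convexI)
      fix a b :: complex and u v :: real
      assume ab: "a \<in> ?T" "b \<in> ?T" and uv: "0 \<le> u" "0 \<le> v" "u + v = 1"
      have "q + (u *\<^sub>R a + v *\<^sub>R b) *s x = u *\<^sub>R (q + a *s x) + v *\<^sub>R (q + b *s x)"
      proof -
        have v: "v = 1 - u" using uv(3) by simp
        have "(q + (u *\<^sub>R a + v *\<^sub>R b) *s x) $ i = (u *\<^sub>R (q + a *s x) + v *\<^sub>R (q + b *s x)) $ i" for i
          by (simp only: vector_add_component vector_scaleR_component vector_smult_component v)
             (simp add: scaleR_conv_of_real algebra_simps)
        then show ?thesis unfolding vec_eq_iff by blast
      qed
      then show "u *\<^sub>R a + v *\<^sub>R b \<in> ?T"
        using convexD[OF S(2), of "q + a *s x" "q + b *s x" u v] ab uv by simp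
    qed
    then have conn: "connected ?T" by (rule convex_connected)
    have hol: "?G holomorphic_on ?T"
    proof (rule holomorphic_onI)
      fix t assume "t \<in> ?T"
      then have "(?G has_field_derivative frechet_derivative F (at (q + t *s x)) x) (at t)"
        by (intro holo_on_line[OF F]) simp
      then show "?G field_differentiable (at t within ?T)"
        unfolding field_differentiable_def using has_field_derivative_at_within by blast
    qed
    have "countable {t \<in> ?T. ?G t = 0}"
    proof (cases "?G constant_on ?T")
      case True
      have "0 \<in> ?T" "?G 0 \<noteq> 0" using q by auto
      obtain y where y: "\<forall>t\<in>?T. ?G t = y" using True unfolding constant_on_def by blast
      then have "y \<noteq> 0" using bspec[OF y \<open>0 \<in> ?T\<close>] \<open>?G 0 \<noteq> 0\<close> by simp
      then have "{t \<in> ?T. ?G t = 0} = {}" using y by simp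
      then show ?thesis by (simp only: countable_empty)
    next
      case False
      show ?thesis
        by (rule holomorphic_countable_zeros[OF hol T conn open_imp_fsigma[OF T] False])
    qed
    moreover have "{t::real. t *\<^sub>R x \<in> ?Z'} = of_real -` {t \<in> ?T. ?G t = 0}"
      by (auto simp: vector_smult_eq_scaleR)
    moreover have "countable (of_real -` X :: real set)" if "countable X" for X :: "complex set"
    proof (rule countable_image_inj_on)
      show "countable (complex_of_real ` (of_real -` X))" by (rule countable_subset[OF _ that]) blast
      show "inj_on complex_of_real (of_real -` X)" by (simp add: inj_on_def)
    qed
    ultimately show ?thesis by (simp only:)
  qed
  from countable_rays_null[OF Z'm this] have "emeasure lborel ?Z' = 0" .
  moreover have "emeasure lborel ?Z = emeasure (distr lborel borel ((+) q)) ?Z"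
    by (simp add: lborel_distr_plus)
  moreover have "emeasure (distr lborel borel ((+) q)) ?Z = emeasure lborel ?Z'"
    using Zm mq by (simp add: emeasure_distr)
  ultimately show ?thesis using Zm by (simp add: null_sets_def)
qed

text \<open>The identity theorem, obtained from measure theory: a nonempty open set is not
  null.\<close>

lemma holo_zero_on_open_imp_zero:
  fixes F :: "complex^'n \<Rightarrow> complex"
  assumes S: "open S" "convex S" and F: "holo_on S F" and W: "open W" "W \<noteq> {}" "W \<subseteq> S" "\<And>z. z \<in> W \<Longrightarrow> F z = 0"
    and z: "z \<in> S"
  shows "F z = 0"
proof (rule ccontr)
  assume "F z \<noteq> 0"
  from holo_zeros_null[OF S F z this] have n: "{z \<in> S. F z = 0} \<in> null_sets lborel" .
  have "W \<subseteq> {z \<in> S. F z = 0}" using W by blast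
  then have "W \<in> null_sets lborel"
    using null_sets_subset[OF n, of W] W(1) by simp
  then have "negligible W" by (simp add: negligible_iff_null_sets null_sets_completionI)
  then show False using W(1,2) open_not_negligible by blast
qed

section \<open>The Laplacian of a Gauduchon metric\<close>

lemma Ck_on_Re: "open S \<Longrightarrow> Ck_on k S f \<Longrightarrow> Ck_on k S (\<lambda>z. Re (f z))"
  by (rule Ck_on_bounded_linear_comp[OF bounded_linear_Re])

lemma Ck_on_of_real: "open S \<Longrightarrow> Ck_on k S f \<Longrightarrow> Ck_on k S (\<lambda>z. complex_of_real (f z))"
  by (rule Ck_on_bounded_linear_comp[OF bounded_linear_of_real])

lemma Ck_on_cnj: "open S \<Longrightarrow> Ck_on k S f \<Longrightarrow> Ck_on k S (\<lambda>z. cnj (f z))"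
  by (rule Ck_on_bounded_linear_comp[OF bounded_linear_cnj])

lemma dz_const_fun: "dz i (\<lambda>z. c) = (\<lambda>z. 0)" "dzbar i (\<lambda>z. c) = (\<lambda>z. 0)"
  by (rule ext, simp)+

lemma dzbar_dz_cong_open:
  assumes "open S" "z \<in> S" "\<And>x. x \<in> S \<Longrightarrow> f x = g x"
  shows "dzbar j (dz i f) z = dzbar j (dz i g) z"
  by (rule dz_cong_open(2)[OF assms(1,2)], rule dz_cong_open(1)[OF assms(1)]) (use assms(3) in auto)

lemma C2_diff:
  assumes S: "open S" and f: "Ck_on 2 S f" and z: "z \<in> S"
  shows "f differentiable (at z)" "dz i f differentiable (at z)"
proof -
  have f': "Ck_on (Suc (Suc 0)) S f" using f by (simp only: numeral_2_eq_2)
  show "f differentiable (at z)" by (rule Ck_on_differentiable[OF f' z])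
  show "dz i f differentiable (at z)" by (rule Ck_on_differentiable[OF Ck_on_dz(1)[OF S f'] z])
qed

locale gauduchon_manifold = atlas A
  for A :: "('m::t2_space, 'n::{finite,linorder}) chart set" +
  fixes g :: "('m, 'n) metric_tensor"
  assumes compact_UNIV: "compact (UNIV :: 'm set)"
    and metric: "hermitian_metric A g"
    and gaud: "gauduchon A g"
begin

lemma metric_Ck: "c \<in> A \<Longrightarrow> Ck_on k (snd c ` fst c) (\<lambda>z. g c z $ i $ j)"
  using metric unfolding hermitian_metric_def smooth_on_def by blast

lemma metric_pos_def:
  assumes "c \<in> A" "z \<in> snd c ` fst c"
  shows "pos_def (\<lambda>i j. g c z $ i $ j)"
  unfolding pos_def_def
proof (intro conjI allI impI)
  have *: "(\<forall>i j. g c z $ j $ i = cnj (g c z $ i $ j)) \<and>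
        (\<forall>v. v \<noteq> 0 \<longrightarrow> 0 < Re (\<Sum>i\<in>UNIV. \<Sum>j\<in>UNIV. g c z $ i $ j * v $ i * cnj (v $ j)))"
    using metric assms unfolding hermitian_metric_def by blast
  then show "hermitian (\<lambda>i j. g c z $ i $ j)" unfolding hermitian_def by blast
  fix v :: "'n \<Rightarrow> complex" assume "v \<noteq> (\<lambda>i. 0)"
  then have "(\<chi> i. v i) \<noteq> 0" by (auto simp: vec_eq_iff)
  then show "0 < Re (sform (\<lambda>i j. g c z $ i $ j) v v)"
    using conjunct2[OF *, rule_format, of "\<chi> i. v i"] by (simp add: sform_def)
qed

lemma metric_det:
  assumes "c \<in> A" "z \<in> snd c ` fst c"
  shows "det (g c z) \<noteq> 0" "0 < Re (det (g c z))" "det (g c z) = of_real (Re (det (g c z)))"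
  using pos_def_det_nonzero[OF metric_pos_def[OF assms]] pos_def_det_pos[OF metric_pos_def[OF assms]]
    hermitian_det_real[of "g c z"] metric_pos_def[OF assms] by (auto simp: pos_def_def)

lemma metric_det_continuous: "c \<in> A \<Longrightarrow> continuous_on (snd c ` fst c) (\<lambda>z. det (g c z))"
  by (rule continuous_on_det) (rule Ck_on_continuous[OF metric_Ck])

section \<open>The Laplacian, its invariance and its cofactor form\<close>

definition jacobian :: "('m, 'n) chart \<Rightarrow> ('m, 'n) chart \<Rightarrow> (complex, 'n) vec \<Rightarrow> ((complex, 'n) vec, 'n) vec" where
  "jacobian c c' z = (\<chi> k i. dz i (\<lambda>z. snd c' (chart_inv c z) $ k) z)"

definition conj_mat :: "((complex, 'n) vec, 'n) vec \<Rightarrow> ((complex, 'n) vec, 'n) vec" where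
  "conj_mat J = (\<chi> i j. cnj (J $ i $ j))"

lemma form_transform:
  "(Finite_Cartesian_Product.transpose J ** M ** conj_mat J) $ i $ j = (\<Sum>k\<in>UNIV. \<Sum>l\<in>UNIV. M $ k $ l * J $ k $ i * cnj (J $ l $ j))"
  unfolding matrix_matrix_mult_def Finite_Cartesian_Product.transpose_def conj_mat_def
  by (simp add: sum_distrib_right, subst sum.swap) (simp add: mult_ac)

lemma metric_transform:
  assumes "c \<in> A" "c' \<in> A" "x \<in> fst c \<inter> fst c'"
  shows "g c (snd c x) = Finite_Cartesian_Product.transpose (jacobian c c' (snd c x)) ** g c' (snd c' x) ** conj_mat (jacobian c c' (snd c x))"
proof -
  have "g c (snd c x) $ i $ j =
          (\<Sum>k\<in>UNIV. \<Sum>l\<in>UNIV. g c' (snd c' x) $ k $ l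
             * dz i (\<lambda>z. snd c' (chart_inv c z) $ k) (snd c x)
             * cnj (dz j (\<lambda>z. snd c' (chart_inv c z) $ l) (snd c x)))" for i j
    using metric assms unfolding hermitian_metric_def by blast
  then show ?thesis by (simp add: vec_eq_iff form_transform jacobian_def)
qed

lemma det_conj_mat: "det (conj_mat J) = cnj (det J)"
  unfolding conj_mat_def by (rule det_cnj)

lemma metric_det_transform:
  assumes "c \<in> A" "c' \<in> A" "x \<in> fst c \<inter> fst c'"
  shows "det (g c (snd c x)) = of_real ((norm (det (jacobian c c' (snd c x))))\<^sup>2) * det (g c' (snd c' x))"
  unfolding metric_transform[OF assms] complex_norm_square
  by (simp add: det_mul det_transpose det_conj_mat mult_ac)

text \<open>The trace of the complex Hessian, without first-order terms. For a metric that is not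
  Kaehler it differs in general from the Laplace-Beltrami operator and is not self-adjoint, which is
  why a condition on the metric is needed to integrate it to zero.\<close>

definition Lap :: "('m, 'n) chart \<Rightarrow> ((complex, 'n) vec \<Rightarrow> complex) \<Rightarrow> (complex, 'n) vec \<Rightarrow> complex" where
  "Lap c u z = (\<Sum>i\<in>UNIV. \<Sum>j\<in>UNIV. matrix_inv (g c z) $ j $ i * dzbar j (dz i u) z)"

lemma Lap_trace: "Lap c u z = trace (matrix_inv (g c z) ** (\<chi> i j. dzbar j (dz i u) z))"
  unfolding Lap_def trace_def matrix_matrix_mult_def by (simp, rule sum.swap)

lemma Lap_cong: "open S \<Longrightarrow> z \<in> S \<Longrightarrow> (\<And>x. x \<in> S \<Longrightarrow> u x = u' x) \<Longrightarrow> Lap c u z = Lap c u' z"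
  unfolding Lap_def using dzbar_dz_cong_open[of S z u u'] by simp

lemma Lap_zero [simp]: "Lap c (\<lambda>z. 0) z = 0"
  by (simp add: Lap_def dz_const_fun)

lemma Lap_sum:
  assumes S: "open S" "z \<in> S" and u: "\<And>a. a \<in> I \<Longrightarrow> Ck_on 2 S (u a)"
  shows "Lap c (\<lambda>z. \<Sum>a\<in>I. u a z) z = (\<Sum>a\<in>I. Lap c (u a) z)"
proof -
  have "dzbar j (dz i (\<lambda>z. \<Sum>a\<in>I. u a z)) z = (\<Sum>a\<in>I. dzbar j (dz i (u a)) z)" for i j
  proof -
    have "dzbar j (dz i (\<lambda>z. \<Sum>a\<in>I. u a z)) z = dzbar j (\<lambda>z. \<Sum>a\<in>I. dz i (u a) z) z"
      by (rule dz_cong_open(2)[OF S]) (rule dz_sum(1), rule C2_diff(1)[OF S(1) u])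
    also have "\<dots> = (\<Sum>a\<in>I. dzbar j (dz i (u a)) z)"
      by (rule dz_sum(2)) (rule C2_diff(2)[OF S(1) u S(2)])
    finally show ?thesis .
  qed
  then show ?thesis unfolding Lap_def by (simp only: sum_distrib_left) (rule sum_swap3)
qed

text \<open>\<open>matrix_inv G ** H\<close> is conjugate to \<open>matrix_inv G' ** H'\<close> by
  \<open>Q\<close>.\<close>

lemma trace_conj:
  fixes G G' H H' P Q :: "((complex, 'n) vec, 'n) vec"
  assumes G: "G = P ** G' ** Q" and H: "H = P ** H' ** Q" and d: "det G \<noteq> 0"
  shows "trace (matrix_inv G ** H) = trace (matrix_inv G' ** H')"
proof -
  have nz: "det P \<noteq> 0" "det G' \<noteq> 0" "det Q \<noteq> 0" using d unfolding G by (auto simp: det_mul)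
  note I = matrix_inv_mult[OF nz(1)] matrix_inv_mult[OF nz(2)] matrix_inv_mult[OF nz(3)] matrix_inv_mult[OF d]
  let ?X = "matrix_inv G' ** H'" and ?Qi = "matrix_inv Q"
  have "H = G ** (?Qi ** (?X ** Q))"
  proof -
    have "G ** (?Qi ** (?X ** Q)) = P ** G' ** (Q ** ?Qi) ** matrix_inv G' ** H' ** Q"
      unfolding G by (simp only: matrix_mul_assoc)
    also have "\<dots> = P ** G' ** matrix_inv G' ** H' ** Q" by (simp only: I matrix_mul_rid)
    also have "\<dots> = P ** (G' ** matrix_inv G') ** H' ** Q" by (simp only: matrix_mul_assoc)
    also have "\<dots> = H" by (simp only: I matrix_mul_rid H)
    finally show ?thesis by simp
  qed
  then have "matrix_inv G ** H = ?Qi ** (?X ** Q)"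
    using I by (simp add: matrix_mul_assoc)
  then have "trace (matrix_inv G ** H) = trace (?Qi ** (?X ** Q))" by (rule arg_cong)
  also have "\<dots> = trace ((?X ** Q) ** ?Qi)" by (rule trace_mul_sym)
  also have "(?X ** Q) ** ?Qi = ?X" by (simp only: matrix_mul_assoc[symmetric] I matrix_mul_rid)
  finally show ?thesis .
qed

text \<open>For holomorphic transition maps the complex Hessian transforms with the same two factors
  as the metric, without derivatives of the Jacobian, so \<open>trace_conj\<close> applies.\<close>

lemma Lap_invariant:
  assumes c: "c \<in> A" and c': "c' \<in> A" and x: "x \<in> fst c \<inter> fst c'"
    and v: "Ck_on 2 (snd c' ` fst c') (\<lambda>z. v (chart_inv c' z))"
  shows "Lap c (\<lambda>z. v (chart_inv c z)) (snd c x) = Lap c' (\<lambda>z. v (chart_inv c' z)) (snd c' x)"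
proof -
  let ?O = "snd c ` (fst c \<inter> fst c')" and ?O' = "snd c' ` fst c'"
  let ?\<phi> = "\<lambda>z. snd c' (chart_inv c z)"
  let ?V = "\<lambda>z. v (chart_inv c' z)"
  have O: "open ?O" by (rule overlap_open[OF c c'])
  have O': "open ?O'" by (rule chart_facts(2)[OF c'])
  have z: "snd c x \<in> ?O" using x by blast
  have mem: "chart_inv c w \<in> fst c \<inter> fst c'" if "w \<in> ?O" for w
    using that chart_image_mem[OF c, of "fst c \<inter> fst c'" w] by auto
  have \<phi>O: "?\<phi> w \<in> ?O'" if "w \<in> ?O" for w using mem[OF that] by blast
  note hol = transition_holo[OF c c']
  have eq: "v (chart_inv c w) = ?V (?\<phi> w)" if "w \<in> ?O" for w
    using mem[OF that] chart_inv_snd[OF c'] by auto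
  have "dzbar j (dz i (\<lambda>z. v (chart_inv c z))) (snd c x) =
     (\<Sum>k\<in>UNIV. \<Sum>l\<in>UNIV. dzbar l (dz k ?V) (snd c' x) * jacobian c c' (snd c x) $ k $ i * cnj (jacobian c c' (snd c x) $ l $ j))" for i j
  proof -
    have \<phi>x: "?\<phi> (snd c x) = snd c' x" using x chart_inv_snd[OF c] by auto
    have d\<phi>: "?\<phi> differentiable (at (snd c x))"
      using holo_has_derivative_matrix[OF hol z] by (auto simp: differentiable_def)
    have dk: "(\<lambda>w. dz k ?V (?\<phi> w)) differentiable (at (snd c x))" for k
      using differentiable_chain_at[OF d\<phi> C2_diff(2)[OF O' v \<phi>O[OF z], of k]] by (simp add: o_def)
    have dJ: "dz i (\<lambda>z. ?\<phi> z $ k) differentiable (at (snd c x))" for k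
      using holo_on_frechet(1)[OF holo_on_dz_holo[OF hol O] z] by (auto simp: differentiable_def)
    have "dzbar j (dz i (\<lambda>z. v (chart_inv c z))) (snd c x) = dzbar j (\<lambda>w. \<Sum>k\<in>UNIV. dz k ?V (?\<phi> w) * dz i (\<lambda>z. ?\<phi> z $ k) w) (snd c x)"
    proof (rule dz_cong_open(2)[OF O z])
      fix w assume w: "w \<in> ?O"
      have "dz i (\<lambda>z. v (chart_inv c z)) w = dz i (\<lambda>z. ?V (?\<phi> z)) w"
        by (rule dz_cong_open(1)[OF O w eq])
      also have "\<dots> = (\<Sum>k\<in>UNIV. dz k ?V (?\<phi> w) * dz i (\<lambda>z. ?\<phi> z $ k) w)"
        by (rule wirtinger_chain_holo(1)[OF C2_diff(1)[OF O' v \<phi>O[OF w]] hol w])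
      finally show "dz i (\<lambda>z. v (chart_inv c z)) w = (\<Sum>k\<in>UNIV. dz k ?V (?\<phi> w) * dz i (\<lambda>z. ?\<phi> z $ k) w)" .
    qed
    also have "\<dots> = (\<Sum>k\<in>UNIV. dzbar j (\<lambda>w. dz k ?V (?\<phi> w) * dz i (\<lambda>z. ?\<phi> z $ k) w) (snd c x))"
      by (rule dz_sum(2)) (intro differentiable_mult dk dJ)
    \<comment> \<open>The entries of the Jacobian are holomorphic and are annihilated by
      \<open>dzbar j\<close>.\<close>
    also have "\<dots> = (\<Sum>k\<in>UNIV. dzbar j (\<lambda>w. dz k ?V (?\<phi> w)) (snd c x) * dz i (\<lambda>z. ?\<phi> z $ k) (snd c x))"
      by (intro sum.cong refl) (simp add: dzbar_mult[OF dk dJ] holo_on_dz(1)[OF holo_on_dz_holo[OF hol O] z])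
    also have "\<dots> = (\<Sum>k\<in>UNIV. (\<Sum>l\<in>UNIV. dzbar l (dz k ?V) (snd c' x) * cnj (jacobian c c' (snd c x) $ l $ j)) * jacobian c c' (snd c x) $ k $ i)"
      using wirtinger_chain_holo(2)[OF C2_diff(2)[OF O' v \<phi>O[OF z]] hol z] by (simp add: \<phi>x jacobian_def)
    finally show ?thesis by (simp add: sum_distrib_left sum_distrib_right mult_ac)
  qed
  then have H: "(\<chi> i j. dzbar j (dz i (\<lambda>z. v (chart_inv c z))) (snd c x)) =
     Finite_Cartesian_Product.transpose (jacobian c c' (snd c x)) ** (\<chi> i j. dzbar j (dz i ?V) (snd c' x)) ** conj_mat (jacobian c c' (snd c x))"
    by (simp add: vec_eq_iff form_transform)
  have "det (g c (snd c x)) \<noteq> 0" using metric_det(1)[OF c] x by blast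
  from trace_conj[OF metric_transform[OF c c' x] H this] show ?thesis unfolding Lap_trace .
qed

definition lap_const :: complex where
  "lap_const = form_const (CARD('n) - 1) * fact (CARD('n) - 1)"

lemma lap_const_nz: "lap_const \<noteq> 0"
  by (simp add: lap_const_def form_const_def)

text \<open>The inverse metric times \<open>det g\<close> is a multiple of the cofactor matrix. In
  this form the coefficients are those of the Gauduchon condition.\<close>

lemma Lap_cofactor:
  assumes "c \<in> A" "z \<in> snd c ` fst c"
  shows "Lap c u z * det (g c z) = (1 / lap_const) * (\<Sum>i\<in>UNIV. \<Sum>j\<in>UNIV. cofactor_coeff g c i j z * dzbar j (dz i u) z)"
proof -
  let ?H = "\<chi> i j. dzbar j (dz i u) z"
  have "(\<Sum>i\<in>UNIV. \<Sum>j\<in>UNIV. ?H $ i $ j * cofactor_coeff g c i j z) = lap_const * (det (g c z) * Lap c u z)"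
    unfolding cofactor_coeff_sum_det sum_det_replace_row[OF metric_det(1)[OF assms]] lap_const_def Lap_def by simp
  then have e: "(\<Sum>i\<in>UNIV. \<Sum>j\<in>UNIV. cofactor_coeff g c i j z * dzbar j (dz i u) z) = lap_const * (det (g c z) * Lap c u z)"
    by (simp add: mult.commute)
  show ?thesis unfolding e using lap_const_nz by simp
qed

lemma cofactor_Ck: "c \<in> A \<Longrightarrow> Ck_on k (snd c ` fst c) (cofactor_coeff g c i j)"
  unfolding cofactor_coeff_def[abs_def]
  by (intro Ck_on_mult chart_facts(2) Ck_on_const Ck_on_wedge_pow_metric_form metric_Ck)

text \<open>Continuity of the inverse metric is read off from Cramer's formula, cofactors divided by
  the determinant.\<close>

lemma Lap_continuous:
  assumes c: "c \<in> A" and u: "Ck_on 2 (snd c ` fst c) u"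
  shows "continuous_on (snd c ` fst c) (Lap c u)"
proof -
  let ?O = "snd c ` fst c"
  have O: "open ?O" by (rule chart_facts(2)[OF c])
  have "Ck_on 0 ?O (dzbar j (dz i u))" for i j
    using Ck_on_dz(2)[OF O Ck_on_dz(1)[OF O, of "Suc 0" u]] u by (simp add: numeral_2_eq_2 del: Ck_on.simps)
  then have d: "continuous_on ?O (dzbar j (dz i u))" for i j by simp
  have cc: "continuous_on ?O (cofactor_coeff g c i j)" for i j
    by (rule Ck_on_continuous[OF cofactor_Ck[OF c, of 0]])
  have s: "continuous_on ?O (\<lambda>z. \<Sum>i\<in>UNIV. \<Sum>j\<in>UNIV. cofactor_coeff g c i j z * dzbar j (dz i u) z)"
    by (rule continuous_on_sum, rule continuous_on_sum, rule continuous_on_mult[OF cc d])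
  have "continuous_on ?O (\<lambda>z. (1 / lap_const) * (\<Sum>i\<in>UNIV. \<Sum>j\<in>UNIV. cofactor_coeff g c i j z * dzbar j (dz i u) z) / det (g c z))"
    by (rule continuous_on_divide[OF continuous_on_mult[OF continuous_on_const s] metric_det_continuous[OF c]])
       (use metric_det(1)[OF c] in blast)
  then show ?thesis
  proof (rule continuous_on_eq)
    fix z assume z: "z \<in> ?O"
    show "(1 / lap_const) * (\<Sum>i\<in>UNIV. \<Sum>j\<in>UNIV. cofactor_coeff g c i j z * dzbar j (dz i u) z) / det (g c z) = Lap c u z"
      unfolding Lap_cofactor[OF c z, symmetric] using metric_det(1)[OF c z] by simp
  qed
qed

text \<open>Two integrations by parts put all derivatives on the cofactors, whose double divergence
  vanishes by the Gauduchon condition.\<close>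

lemma integral_cofactor_compact_support:
  assumes c: "c \<in> A" and u: "Ck_on 2 (snd c ` fst c) u" "supported_in (snd c ` fst c) u"
  shows "(LINT z:snd c ` fst c|lborel. \<Sum>i\<in>UNIV. \<Sum>j\<in>UNIV. cofactor_coeff g c i j z * dzbar j (dz i u) z) = 0"
proof -
  let ?O = "snd c ` fst c" and ?C = "cofactor_coeff g c"
  have O: "open ?O" by (rule chart_facts(2)[OF c])
  obtain K where K: "compact K" "K \<subseteq> ?O" "\<And>x. x \<notin> K \<Longrightarrow> u x = 0"
    using u(2) unfolding supported_in_def by blast
  have oK: "open (- K)" using K(1) by (simp add: compact_imp_closed open_Compl)
  have "Ck_on 0 ?O (dzbar j (dz i u))" for i j
    using Ck_on_dz(2)[OF O Ck_on_dz(1)[OF O, of "Suc 0" u]] u(1) by (simp add: numeral_2_eq_2 del: Ck_on.simps)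
  then have d: "continuous_on ?O (dzbar j (dz i u))" for i j by simp
  have d0: "dzbar j (dz i u) z = 0" if "z \<notin> K" for z i j
  proof -
    have "dzbar j (dz i u) z = dzbar j (dz i (\<lambda>_. 0)) z"
    proof (rule dzbar_dz_cong_open[OF oK])
      show "z \<in> - K" using that by blast
      show "u x = 0" if "x \<in> - K" for x by (rule K(3)) (use that in blast)
    qed
    then show ?thesis by (simp add: dz_const_fun)
  qed
  have "Ck_on 0 ?O (dz i (dzbar j (?C i j)))" for i j
    using Ck_on_dz(1)[OF O Ck_on_dz(2)[OF O cofactor_Ck[OF c, of "Suc (Suc 0)"]]] .
  then have dC: "continuous_on ?O (dz i (dzbar j (?C i j)))" for i j by simp
  have i1: "set_integrable lborel ?O (\<lambda>z. ?C i j z * dzbar j (dz i u) z)" for i j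
    by (rule set_integrable_supported[OF continuous_on_mult[OF Ck_on_continuous[OF cofactor_Ck[OF c, of 0]] d] K(1,2)])
       (simp add: d0)
  have i2: "set_integrable lborel ?O (\<lambda>z. dz i (dzbar j (?C i j)) z * u z)" for i j
    by (rule set_integrable_supported[OF continuous_on_mult[OF dC Ck_on_continuous[OF u(1)]] K(1,2)])
       (simp add: K(3))
  have sum_int: "(LINT z:?O|lborel. \<Sum>i\<in>UNIV. \<Sum>j\<in>UNIV. f i j z) = (\<Sum>i\<in>UNIV. \<Sum>j\<in>UNIV. (LINT z:?O|lborel. f i j z))"
    if "\<And>i j. set_integrable lborel ?O (f i j)" for f :: "'n \<Rightarrow> 'n \<Rightarrow> (complex, 'n) vec \<Rightarrow> complex"
  proof -
    have i: "integrable lborel (\<lambda>z. indicator ?O z *\<^sub>R f i j z)" for i j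
      using that[of i j] unfolding set_integrable_def .
    have "(LINT z|lborel. (\<Sum>i\<in>UNIV. \<Sum>j\<in>UNIV. indicator ?O z *\<^sub>R f i j z)) = (\<Sum>i\<in>UNIV. (LINT z|lborel. (\<Sum>j\<in>UNIV. indicator ?O z *\<^sub>R f i j z)))"
      by (rule Bochner_Integration.integral_sum) (intro Bochner_Integration.integrable_sum i)
    also have "\<dots> = (\<Sum>i\<in>UNIV. \<Sum>j\<in>UNIV. (LINT z|lborel. indicator ?O z *\<^sub>R f i j z))"
      by (intro sum.cong refl Bochner_Integration.integral_sum i)
    finally show ?thesis unfolding set_lebesgue_integral_def scaleR_sum_right .
  qed
  have "(LINT z:?O|lborel. \<Sum>i\<in>UNIV. \<Sum>j\<in>UNIV. ?C i j z * dzbar j (dz i u) z) =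
     (\<Sum>i\<in>UNIV. \<Sum>j\<in>UNIV. (LINT z:?O|lborel. ?C i j z * dzbar j (dz i u) z))"
    by (rule sum_int[OF i1])
  also have "\<dots> = (\<Sum>i\<in>UNIV. \<Sum>j\<in>UNIV. (LINT z:?O|lborel. dz i (dzbar j (?C i j)) z * u z))"
    by (intro sum.cong refl integral_by_parts_twice[OF O cofactor_Ck[OF c] u])
  also have "\<dots> = (LINT z:?O|lborel. \<Sum>i\<in>UNIV. \<Sum>j\<in>UNIV. dz i (dzbar j (?C i j)) z * u z)"
    by (rule sum_int[OF i2, symmetric])
  also have "\<dots> = (LINT z:?O|lborel. 0)"
  proof (rule set_lebesgue_integral_cong)
    show "?O \<in> sets lborel" using O by simp
    show "\<forall>z. z \<in> ?O \<longrightarrow> (\<Sum>i\<in>UNIV. \<Sum>j\<in>UNIV. dz i (dzbar j (?C i j)) z * u z) = 0"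
    proof (intro allI impI)
      fix z assume z: "z \<in> ?O"
      have "del (delbar (wedge_pow (metric_form g c) (CARD('n) - 1))) z UNIV = 0"
        using gaud c z unfolding gauduchon_def by blast
      from gauduchon_cofactor[OF O metric_Ck[OF c] z this]
      show "(\<Sum>i\<in>UNIV. \<Sum>j\<in>UNIV. dz i (dzbar j (?C i j)) z * u z) = 0"
        by (simp add: sum_distrib_right[symmetric])
    qed
  qed
  also have "\<dots> = 0" unfolding set_lebesgue_integral_def by (simp only: scaleR_zero_right Bochner_Integration.integral_zero)
  finally show ?thesis .
qed

lemma integral_Lap_compact_support:
  assumes c: "c \<in> A" and u: "Ck_on 2 (snd c ` fst c) u" "supported_in (snd c ` fst c) u"
  shows "(LINT z:snd c ` fst c|lborel. Lap c u z * det (g c z)) = 0"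
proof -
  let ?O = "snd c ` fst c" and ?C = "cofactor_coeff g c"
  have O: "?O \<in> sets lborel" using chart_facts(2)[OF c] by simp
  note zero = integral_cofactor_compact_support[OF c u]
  have e1: "(LINT z:?O|lborel. Lap c u z * det (g c z)) =
    (LINT z:?O|lborel. (1 / lap_const) * (\<Sum>i\<in>UNIV. \<Sum>j\<in>UNIV. ?C i j z * dzbar j (dz i u) z))"
    by (rule set_lebesgue_integral_cong[OF O]) (intro allI impI Lap_cofactor[OF c])
  have e2: "(LINT z:?O|lborel. (1 / lap_const) * (\<Sum>i\<in>UNIV. \<Sum>j\<in>UNIV. ?C i j z * dzbar j (dz i u) z)) =
    (1 / lap_const) * (LINT z:?O|lborel. \<Sum>i\<in>UNIV. \<Sum>j\<in>UNIV. ?C i j z * dzbar j (dz i u) z)"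
    by (rule set_integral_mult_right)
  have e3: "(1 / lap_const) * (LINT z:?O|lborel. \<Sum>i\<in>UNIV. \<Sum>j\<in>UNIV. ?C i j z * dzbar j (dz i u) z) = 0"
    unfolding zero by (rule mult_zero_right)
  show ?thesis by (rule trans[OF e1 trans[OF e2 e3]])
qed

end

section \<open>Integration over the manifold\<close>

context gauduchon_manifold
begin

lemma chart_compact_image:
  "c \<in> A \<Longrightarrow> compact K \<Longrightarrow> K \<subseteq> fst c \<Longrightarrow> compact (snd c ` K)"
  by (rule compact_continuous_image[OF continuous_on_subset[OF continuous_chart]])

text \<open>The factor \<open>|det J|^2\<close> from the change of variables is the one that relates
  \<open>det g\<close> in the two charts.\<close>

lemma chart_change:
  assumes c: "c \<in> A" and c': "c' \<in> A" and K: "compact K" "K \<subseteq> fst c \<inter> fst c'" "\<And>x. x \<notin> K \<Longrightarrow> Q x = 0"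
    and Q: "continuous_on (snd c' ` fst c') (\<lambda>z. Q (chart_inv c' z))"
  shows "(LINT z:snd c ` fst c|lborel. Q (chart_inv c z) * det (g c z)) =
         (LINT z:snd c' ` fst c'|lborel. Q (chart_inv c' z) * det (g c' z))"
proof -
  let ?W = "fst c \<inter> fst c'"
  let ?O = "snd c ` ?W" and ?O' = "snd c' ` ?W"
  let ?\<phi> = "\<lambda>z. snd c' (chart_inv c z)"
  have O: "open ?O" by (rule overlap_open[OF c c'])
  have O': "open ?O'" by (rule chart_open_image[OF c']) (use chart_facts(1)[OF c] chart_facts(1)[OF c'] in auto)
  have mem: "chart_inv c w \<in> ?W" "snd c (chart_inv c w) = w" if "w \<in> ?O" for w
    using that chart_inv_snd[OF c] by auto
  have mem': "chart_inv c' w \<in> ?W" "snd c' (chart_inv c' w) = w" if "w \<in> ?O'" for w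
    using that chart_inv_snd[OF c'] by auto
  have im: "?\<phi> ` ?O = ?O'"
  proof (intro set_eqI iffI)
    fix w assume "w \<in> ?\<phi> ` ?O"
    then show "w \<in> ?O'" using mem(1) by blast
  next
    fix w assume "w \<in> ?O'"
    then obtain x where x: "x \<in> ?W" "w = snd c' x" by blast
    then have "?\<phi> (snd c x) = w" using chart_inv_snd[OF c] by auto
    moreover have "snd c x \<in> ?O" using x(1) by blast
    ultimately show "w \<in> ?\<phi> ` ?O" by blast
  qed
  have inj: "inj_on ?\<phi> ?O"
  proof (rule inj_onI)
    fix a b assume ab: "a \<in> ?O" "b \<in> ?O" "?\<phi> a = ?\<phi> b"
    have "chart_inv c' (?\<phi> a) = chart_inv c a" "chart_inv c' (?\<phi> b) = chart_inv c b"
      by (rule chart_inv_snd[OF c' IntD2[OF mem(1)[OF ab(1)]]], rule chart_inv_snd[OF c' IntD2[OF mem(1)[OF ab(2)]]])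
    then have "chart_inv c a = chart_inv c b" using ab(3) by metis
    then show "a = b" using mem(2)[OF ab(1)] mem(2)[OF ab(2)] by metis
  qed
  \<comment> \<open>The change of variables asks for a function that vanishes outside a compact set
    at every point, also where \<open>chart_inv c'\<close> has no meaning.\<close>
  define f where "f = (\<lambda>w. if w \<in> ?O' then Q (chart_inv c' w) * det (g c' w) else 0)"
  have "continuous_on ?O' (\<lambda>w. Q (chart_inv c' w) * det (g c' w))"
    by (rule continuous_on_subset[OF continuous_on_mult[OF Q metric_det_continuous[OF c']]]) blast
  then have fc: "continuous_on (?\<phi> ` ?O) f"
    unfolding im by (rule continuous_on_eq) (simp add: f_def)
  have f0: "f w = 0" if "w \<notin> snd c' ` K" for w
  proof (cases "w \<in> ?O'")
    case True
    then have "chart_inv c' w \<notin> K" using that mem'(2)[OF True] by (metis imageI)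
    then show ?thesis using K(3) by (simp add: f_def)
  qed (simp add: f_def)
  have f\<phi>: "f (?\<phi> z) = Q (chart_inv c z) * det (g c' (?\<phi> z))" if "z \<in> ?O" for z
  proof -
    have e: "chart_inv c' (?\<phi> z) = chart_inv c z" by (rule chart_inv_snd[OF c' IntD2[OF mem(1)[OF that]]])
    show ?thesis unfolding f_def e by (rule if_P[OF imageI[OF mem(1)[OF that]]])
  qed
  have f\<phi>0: "f (?\<phi> z) = 0" if "z \<in> ?O" "z \<notin> snd c ` K" for z
  proof -
    have "chart_inv c z \<notin> K" using that(2) mem(2)[OF that(1)] by (metis imageI)
    then show ?thesis unfolding f\<phi>[OF that(1)] by (simp add: K(3))
  qed
  have cv: "(LINT z:?O|lborel. of_real ((norm (det (jacobian c c' z)))\<^sup>2) * f (?\<phi> z)) = (LINT w:?\<phi> ` ?O|lborel. f w)"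
    unfolding jacobian_def
    by (rule holo_change_of_variables[OF O transition_holo[OF c c'] inj _ fc _ _ f0 _ _ f\<phi>0])
       (use K(2) O' im chart_compact_image[OF c K(1)] chart_compact_image[OF c' K(1)] in auto)
  have out: "Q (chart_inv c z) = 0" if "z \<in> snd c ` fst c" "z \<notin> ?O" for z
  proof (rule K(3))
    show "chart_inv c z \<notin> K"
    proof
      assume "chart_inv c z \<in> K"
      from that(2) iffD2[OF chart_image_mem[OF c Int_lower1] conjI[OF that(1) subsetD[OF K(2) this]]]
      show False by (rule notE)
    qed
  qed
  have out': "Q (chart_inv c' z) = 0" if "z \<in> snd c' ` fst c'" "z \<notin> ?O'" for z
  proof (rule K(3))
    show "chart_inv c' z \<notin> K"
    proof
      assume "chart_inv c' z \<in> K"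
      from that(2) iffD2[OF chart_image_mem[OF c' Int_lower2] conjI[OF that(1) subsetD[OF K(2) this]]]
      show False by (rule notE)
    qed
  qed
  have "(LINT z:snd c ` fst c|lborel. Q (chart_inv c z) * det (g c z)) = (LINT z:?O|lborel. of_real ((norm (det (jacobian c c' z)))\<^sup>2) * f (?\<phi> z))"
    unfolding set_lebesgue_integral_def
  proof (intro Bochner_Integration.integral_cong refl)
    fix z
    show "indicator (snd c ` fst c) z *\<^sub>R (Q (chart_inv c z) * det (g c z)) = indicator ?O z *\<^sub>R (of_real ((norm (det (jacobian c c' z)))\<^sup>2) * f (?\<phi> z))"
    proof (cases "z \<in> ?O")
      case True
      then have z: "z \<in> snd c ` fst c" by blast
      have "det (g c z) = of_real ((norm (det (jacobian c c' z)))\<^sup>2) * det (g c' (?\<phi> z))"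
        using metric_det_transform[OF c c' mem(1)[OF True]] unfolding mem(2)[OF True] .
      then show ?thesis using True z f\<phi>[OF True] by (simp only: indicator_simps mult_ac)
    next
      case False
      then show ?thesis using out[of z] by (simp add: indicator_def)
    qed
  qed
  also have "\<dots> = (LINT w:?O'|lborel. f w)" unfolding cv im ..
  also have "\<dots> = (LINT z:snd c' ` fst c'|lborel. Q (chart_inv c' z) * det (g c' z))"
    unfolding set_lebesgue_integral_def
  proof (intro Bochner_Integration.integral_cong refl)
    fix w
    show "indicator ?O' w *\<^sub>R f w = indicator (snd c' ` fst c') w *\<^sub>R (Q (chart_inv c' w) * det (g c' w))"
    proof (cases "w \<in> ?O'")
      case True
      then have "w \<in> snd c' ` fst c'" by blast
      then show ?thesis using True by (simp add: f_def)
    next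
      case False
      then show ?thesis using out'[of w] by (simp add: indicator_def)
    qed
  qed
  finally show ?thesis .
qed

context
  fixes I \<rho> assumes part: "partition_of_unity A I \<rho>"
begin

lemma part_facts:
  "finite I" "I \<subseteq> A" "c \<in> I \<Longrightarrow> mfd_smooth A (\<rho> c)" "c \<in> I \<Longrightarrow> 0 \<le> \<rho> c x"
  "(\<Sum>c\<in>I. \<rho> c x) = 1"
  using part unfolding partition_of_unity_def by blast+

definition part_support :: "('m, 'n) chart \<Rightarrow> 'm set" where
  "part_support c = closure {x. \<rho> c x \<noteq> 0}"

lemma part_support:
  "c \<in> I \<Longrightarrow> part_support c \<subseteq> fst c" "compact (part_support c)" "closed (part_support c)"
  "x \<notin> part_support c \<Longrightarrow> \<rho> c x = 0"
proof -
  show "c \<in> I \<Longrightarrow> part_support c \<subseteq> fst c"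
    using part unfolding partition_of_unity_def part_support_def by blast
  show cl: "closed (part_support c)" by (simp add: part_support_def)
  then show "compact (part_support c)" using compact_Int_closed[OF compact_UNIV cl] by simp
  show "x \<notin> part_support c \<Longrightarrow> \<rho> c x = 0"
    using closure_subset[of "{x. \<rho> c x \<noteq> 0}"] unfolding part_support_def by blast
qed

text \<open>Besides the weights \<open>\<rho> c'\<close> of the integral, \<open>v\<close> itself is
  decomposed into pieces \<open>w c = \<rho> c * v\<close>. In the double sum the integral over
  chart \<open>c'\<close> is moved to chart \<open>c\<close>, where the weights add up to 1 and
  \<open>w c\<close> has compact support.\<close>

lemma integral_Lap_zero:
  fixes v :: "'m \<Rightarrow> complex"
  assumes v: "mfd_smooth A v"
  shows "(\<Sum>c\<in>I. LINT z:snd c ` fst c|lborel. of_real (\<rho> c (chart_inv c z)) * Lap c (\<lambda>z. v (chart_inv c z)) z * det (g c z)) = 0"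
proof -
  define w where "w = (\<lambda>c x. of_real (\<rho> c x) * v x)"
  \<comment> \<open>The Laplacian of \<open>w c\<close> as a function on the manifold, the form in
    which \<open>chart_change\<close> can use it. Outside the chart \<open>c\<close> it is zero
    because \<open>w c\<close> is.\<close>
  define P where "P = (\<lambda>c x. if x \<in> fst c then Lap c (\<lambda>z. w c (chart_inv c z)) (snd c x) else 0)"
  have IA: "c \<in> A" if "c \<in> I" for c using part_facts(2) that by blast
  have \<rho>C: "Ck_on k (snd c' ` fst c') (\<lambda>z. complex_of_real (\<rho> c (chart_inv c' z)))" if "c \<in> I" "c' \<in> A" for k c c'
    by (rule Ck_on_of_real[OF chart_facts(2)[OF that(2)] mfd_smoothD[OF part_facts(3)[OF that(1)] that(2)]])
  have wC: "Ck_on k (snd c' ` fst c') (\<lambda>z. w c (chart_inv c' z))" if "c \<in> I" "c' \<in> A" for k c c'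
    unfolding w_def by (rule Ck_on_mult[OF chart_facts(2)[OF that(2)] \<rho>C[OF that] mfd_smoothD[OF v that(2)]])
  have w0: "w c x = 0" if "x \<notin> part_support c" for c x
    using part_support(4)[OF that] by (simp add: w_def)
  have Lap0: "Lap c' (\<lambda>z. w c (chart_inv c' z)) z = 0"
    if c': "c' \<in> A" and z: "z \<in> snd c' ` fst c'" "chart_inv c' z \<notin> part_support c" for c c' z
  proof -
    let ?U = "snd c' ` (fst c' - part_support c)"
    have U: "open ?U" by (rule chart_open_image[OF c' open_Diff[OF chart_facts(1)[OF c'] part_support(3)] Diff_subset])
    have zU: "z \<in> ?U"
      by (rule iffD2[OF chart_image_mem[OF c' Diff_subset] conjI[OF z(1) DiffI[OF chart_inv_mem[OF c' z(1)] z(2)]]])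
    have "Lap c' (\<lambda>z. w c (chart_inv c' z)) z = Lap c' (\<lambda>z. 0) z"
    proof (rule Lap_cong[OF U zU])
      fix y assume "y \<in> ?U"
      then have "chart_inv c' y \<in> fst c' - part_support c" by (rule conjunct2[OF iffD1[OF chart_image_mem[OF c' Diff_subset]]])
      then have "chart_inv c' y \<notin> part_support c" by simp
      then show "w c (chart_inv c' y) = 0" by (rule w0)
    qed
    then show ?thesis by simp
  qed
  have LP: "Lap c' (\<lambda>z. w c (chart_inv c' z)) z = P c (chart_inv c' z)"
    if c: "c \<in> I" and c': "c' \<in> A" and z: "z \<in> snd c' ` fst c'" for c c' z
  proof (cases "chart_inv c' z \<in> fst c")
    case True
    have "chart_inv c' z \<in> fst c' \<inter> fst c" using True chart_inv_mem[OF c' z] by blast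
    from Lap_invariant[where v = "w c", OF c' IA[OF c] this wC[OF c IA[OF c]]]
    have "Lap c' (\<lambda>z. w c (chart_inv c' z)) z = Lap c (\<lambda>z. w c (chart_inv c z)) (snd c (chart_inv c' z))"
      unfolding snd_chart_inv[OF c' z] .
    also have "\<dots> = P c (chart_inv c' z)" unfolding P_def by (rule if_P[OF True, symmetric])
    finally show ?thesis .
  next
    case False
    then have "chart_inv c' z \<notin> part_support c" using part_support(1)[OF c] by blast
    from Lap0[OF c' z this] show ?thesis using False by (simp add: P_def)
  qed
  have P0: "P c x = 0" if c: "c \<in> I" and x: "x \<notin> part_support c" for c x
  proof (cases "x \<in> fst c")
    case True
    have "Lap c (\<lambda>z. w c (chart_inv c z)) (snd c x) = 0"
      by (rule Lap0[OF IA[OF c] imageI[OF True]]) (unfold chart_inv_snd[OF IA[OF c] True], rule x)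
    then show ?thesis by (simp add: P_def)
  qed (simp add: P_def)
  have PC: "continuous_on (snd c' ` fst c') (\<lambda>z. P c (chart_inv c' z))" if "c \<in> I" "c' \<in> A" for c c'
    by (rule continuous_on_eq[OF Lap_continuous[OF that(2) wC[OF that]]]) (rule LP[OF that])
  let ?Q = "\<lambda>c' c x. of_real (\<rho> c' x) * P c x"
  let ?O = "\<lambda>c. snd c ` fst c"
  have QC: "continuous_on (?O d) (\<lambda>z. ?Q c' c (chart_inv d z))" if "c \<in> I" "c' \<in> I" "d \<in> A" for c c' d
    by (rule continuous_on_mult[OF Ck_on_continuous[OF \<rho>C[OF that(2,3), of 0]] PC[OF that(1,3)]])
  have Qint: "set_integrable lborel (?O d) (\<lambda>z. ?Q c' c (chart_inv d z) * det (g d z))"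
    if c: "c \<in> I" and c': "c' \<in> I" and d: "d = c \<or> d = c'" for c c' d
  proof -
    have dI: "d \<in> I" using c c' d by blast
    show ?thesis
    proof (rule set_integrable_supported)
      show "continuous_on (?O d) (\<lambda>z. ?Q c' c (chart_inv d z) * det (g d z))"
        by (rule continuous_on_mult[OF QC[OF c c' IA[OF dI]] metric_det_continuous[OF IA[OF dI]]])
      show "compact (snd d ` part_support d)" by (rule chart_compact_image[OF IA[OF dI] part_support(2) part_support(1)[OF dI]])
      show "snd d ` part_support d \<subseteq> ?O d" using part_support(1)[OF dI] by blast
      fix z assume z: "z \<in> ?O d" "z \<notin> snd d ` part_support d"
      then have "chart_inv d z \<notin> part_support d" using snd_chart_inv[OF IA[OF dI] z(1)] by (metis imageI)
      show "?Q c' c (chart_inv d z) * det (g d z) = 0"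
        using d
      proof
        assume "d = c"
        then have "P c (chart_inv d z) = 0" using P0[OF c] \<open>chart_inv d z \<notin> part_support d\<close> by metis
        then show ?thesis by simp
      next
        assume "d = c'"
        then have "\<rho> c' (chart_inv d z) = 0" using part_support(4) \<open>chart_inv d z \<notin> part_support d\<close> by metis
        then show ?thesis by simp
      qed
    qed
  qed
  have set_int_sum: "(LINT z:S|lborel. \<Sum>c\<in>I. f c z) = (\<Sum>c\<in>I. LINT z:S|lborel. f c z)"
    if "\<And>c. c \<in> I \<Longrightarrow> set_integrable lborel S (f c)" for S and f :: "_ \<Rightarrow> (complex, 'n) vec \<Rightarrow> complex"
    unfolding set_lebesgue_integral_def scaleR_sum_right
    by (rule Bochner_Integration.integral_sum) (use that in \<open>simp add: set_integrable_def\<close>)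
  have Leq: "Lap c' (\<lambda>z. v (chart_inv c' z)) z = (\<Sum>c\<in>I. P c (chart_inv c' z))" if c': "c' \<in> A" and z: "z \<in> ?O c'" for c' z
  proof -
    have "v x = (\<Sum>c\<in>I. w c x)" for x
      unfolding w_def sum_distrib_right[symmetric] of_real_sum[symmetric] part_facts(5) by simp
    then have "(\<lambda>z. v (chart_inv c' z)) = (\<lambda>z. \<Sum>c\<in>I. w c (chart_inv c' z))" by simp
    then have "Lap c' (\<lambda>z. v (chart_inv c' z)) z = Lap c' (\<lambda>z. \<Sum>c\<in>I. w c (chart_inv c' z)) z" by (rule arg_cong)
    also have "\<dots> = (\<Sum>c\<in>I. Lap c' (\<lambda>z. w c (chart_inv c' z)) z)"
      by (rule Lap_sum[OF chart_facts(2)[OF c'] z]) (rule wC[OF _ c'])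
    also have "\<dots> = (\<Sum>c\<in>I. P c (chart_inv c' z))"
      by (rule sum.cong[OF refl]) (rule LP[OF _ c' z])
    finally show ?thesis .
  qed
  have "(\<Sum>c'\<in>I. LINT z:?O c'|lborel. of_real (\<rho> c' (chart_inv c' z)) * Lap c' (\<lambda>z. v (chart_inv c' z)) z * det (g c' z)) =
     (\<Sum>c'\<in>I. \<Sum>c\<in>I. LINT z:?O c'|lborel. ?Q c' c (chart_inv c' z) * det (g c' z))"
  proof (rule sum.cong[OF refl])
    fix c' assume c': "c' \<in> I"
    have "(LINT z:?O c'|lborel. of_real (\<rho> c' (chart_inv c' z)) * Lap c' (\<lambda>z. v (chart_inv c' z)) z * det (g c' z)) =
       (LINT z:?O c'|lborel. \<Sum>c\<in>I. ?Q c' c (chart_inv c' z) * det (g c' z))"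
    proof (rule set_lebesgue_integral_cong)
      show "?O c' \<in> sets lborel" using chart_facts(2)[OF IA[OF c']] by simp
      show "\<forall>z. z \<in> ?O c' \<longrightarrow> of_real (\<rho> c' (chart_inv c' z)) * Lap c' (\<lambda>z. v (chart_inv c' z)) z * det (g c' z) =
         (\<Sum>c\<in>I. ?Q c' c (chart_inv c' z) * det (g c' z))"
        using Leq[OF IA[OF c']] by (simp add: sum_distrib_left sum_distrib_right)
    qed
    also have "\<dots> = (\<Sum>c\<in>I. LINT z:?O c'|lborel. ?Q c' c (chart_inv c' z) * det (g c' z))"
      by (rule set_int_sum) (rule Qint[OF _ c'], simp_all)
    finally show "(LINT z:?O c'|lborel. of_real (\<rho> c' (chart_inv c' z)) * Lap c' (\<lambda>z. v (chart_inv c' z)) z * det (g c' z)) =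
       (\<Sum>c\<in>I. LINT z:?O c'|lborel. ?Q c' c (chart_inv c' z) * det (g c' z))" .
  qed
  \<comment> \<open>The factor \<open>\<rho> c'\<close> and the function \<open>P c\<close> confine
    the integrand to the intersection of two supports, so either chart may be used.\<close>
  also have "\<dots> = (\<Sum>c'\<in>I. \<Sum>c\<in>I. LINT z:?O c|lborel. ?Q c' c (chart_inv c z) * det (g c z))"
  proof (rule sum.cong[OF refl], rule sum.cong[OF refl])
    fix c' c assume c': "c' \<in> I" and c: "c \<in> I"
    have "compact (part_support c \<inter> part_support c')" by (rule compact_Int_closed[OF part_support(2,3)])
    then show "(LINT z:?O c'|lborel. ?Q c' c (chart_inv c' z) * det (g c' z)) = (LINT z:?O c|lborel. ?Q c' c (chart_inv c z) * det (g c z))"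
    proof (rule chart_change[OF IA[OF c'] IA[OF c]])
      show "part_support c \<inter> part_support c' \<subseteq> fst c' \<inter> fst c" using part_support(1)[OF c] part_support(1)[OF c'] by blast
      show "?Q c' c x = 0" if "x \<notin> part_support c \<inter> part_support c'" for x
        using that P0[OF c, of x] part_support(4)[of x c'] by auto
    qed (rule QC[OF c c' IA[OF c]])
  qed
  also have "\<dots> = (\<Sum>c\<in>I. \<Sum>c'\<in>I. LINT z:?O c|lborel. ?Q c' c (chart_inv c z) * det (g c z))"
    by (rule sum.swap)
  also have "\<dots> = (\<Sum>c\<in>I. 0)"
  proof (rule sum.cong[OF refl])
    fix c assume c: "c \<in> I"
    note cA = IA[OF c]
    \<comment> \<open>Integration by parts needs a function that vanishes off a compact set
      everywhere, so the values of \<open>chart_inv c\<close> outside the chart are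
      discarded.\<close>
    define u where "u = (\<lambda>z. if z \<in> ?O c then w c (chart_inv c z) else 0)"
    have uC: "Ck_on 2 (?O c) u"
      using Ck_on_cong[OF chart_facts(2)[OF cA], of u "\<lambda>z. w c (chart_inv c z)" 2] wC[OF c cA] by (simp add: u_def)
    have us: "supported_in (?O c) u"
      unfolding supported_in_def
    proof (intro exI conjI allI impI)
      show "compact (snd c ` part_support c)" by (rule chart_compact_image[OF cA part_support(2) part_support(1)[OF c]])
      show "snd c ` part_support c \<subseteq> ?O c" using part_support(1)[OF c] by blast
      fix z assume z: "z \<notin> snd c ` part_support c"
      show "u z = 0"
      proof (cases "z \<in> ?O c")
        case True
        then have "chart_inv c z \<notin> part_support c" using z snd_chart_inv[OF cA True] by (metis imageI)
        then show ?thesis using w0 by (simp add: u_def)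
      qed (simp add: u_def)
    qed
    have "(\<Sum>c'\<in>I. LINT z:?O c|lborel. ?Q c' c (chart_inv c z) * det (g c z)) =
      (LINT z:?O c|lborel. \<Sum>c'\<in>I. ?Q c' c (chart_inv c z) * det (g c z))"
      by (rule set_int_sum[symmetric]) (rule Qint[OF c], simp_all)
    also have "\<dots> = (LINT z:?O c|lborel. Lap c u z * det (g c z))"
    proof (rule set_lebesgue_integral_cong)
      show "?O c \<in> sets lborel" using chart_facts(2)[OF cA] by simp
      show "\<forall>z. z \<in> ?O c \<longrightarrow> (\<Sum>c'\<in>I. ?Q c' c (chart_inv c z) * det (g c z)) = Lap c u z * det (g c z)"
      proof (intro allI impI)
        fix z assume z: "z \<in> ?O c"
        have "Lap c u z = Lap c (\<lambda>z. w c (chart_inv c z)) z"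
          by (rule Lap_cong[OF chart_facts(2)[OF cA] z]) (simp add: u_def)
        then have L: "Lap c u z = P c (chart_inv c z)" using LP[OF c cA z] by simp
        have "(\<Sum>c'\<in>I. ?Q c' c (chart_inv c z) * det (g c z)) = of_real (\<Sum>c'\<in>I. \<rho> c' (chart_inv c z)) * P c (chart_inv c z) * det (g c z)"
          by (simp add: sum_distrib_right)
        then show "(\<Sum>c'\<in>I. ?Q c' c (chart_inv c z) * det (g c z)) = Lap c u z * det (g c z)"
          unfolding part_facts(5) L by simp
      qed
    qed
    also have "\<dots> = 0" by (rule integral_Lap_compact_support[OF cA uC us])
    finally show "(\<Sum>c'\<in>I. LINT z:?O c|lborel. ?Q c' c (chart_inv c z) * det (g c z)) = 0" .
  qed
  finally show ?thesis by simp
qed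

end

end

section \<open>Hermitian holomorphic bundles\<close>

text \<open>The damping factors lie between 0 and 1 and tend to 1 wherever \<open>F\<close> is
  nonzero, so \<open>|w|\<close> dominates.\<close>

lemma tendsto_set_integral_damped:
  fixes w F :: "'a \<Rightarrow> real"
  assumes w: "set_integrable M D w"
    and wF: "\<And>m. set_integrable M D (\<lambda>z. w z * (F z / (F z + inverse (real (Suc m)))))"
    and F: "\<And>z. 0 \<le> F z" and pos: "AE z in M. z \<in> D \<longrightarrow> F z \<noteq> 0"
  shows "(\<lambda>m. LINT z:D|M. w z * (F z / (F z + inverse (real (Suc m))))) \<longlonglongrightarrow> (LINT z:D|M. w z)"
  unfolding set_lebesgue_integral_def
proof (rule integral_dominated_convergence[where w = "\<lambda>z. norm (indicator D z *\<^sub>R w z)"])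
  show "(\<lambda>z. indicator D z *\<^sub>R w z) \<in> borel_measurable M"
    using w unfolding set_integrable_def by (rule borel_measurable_integrable)
  show "integrable M (\<lambda>z. norm (indicator D z *\<^sub>R w z))"
    using w unfolding set_integrable_def by (rule integrable_norm)
  show "(\<lambda>z. indicator D z *\<^sub>R (w z * (F z / (F z + inverse (real (Suc m)))))) \<in> borel_measurable M" for m
    using wF[of m] unfolding set_integrable_def by (rule borel_measurable_integrable)
  show "AE z in M. (\<lambda>m. indicator D z *\<^sub>R (w z * (F z / (F z + inverse (real (Suc m)))))) \<longlonglongrightarrow> indicator D z *\<^sub>R w z"
    using pos
  proof (rule AE_mp, intro AE_I2 impI)
    fix z assume p: "z \<in> D \<longrightarrow> F z \<noteq> 0"
    show "(\<lambda>m. indicator D z *\<^sub>R (w z * (F z / (F z + inverse (real (Suc m)))))) \<longlonglongrightarrow> indicator D z *\<^sub>R w z"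
    proof (cases "z \<in> D")
      case True
      then have nz: "F z + 0 \<noteq> 0" using p by simp
      have "(\<lambda>m. indicator D z *\<^sub>R (w z * (F z / (F z + inverse (real (Suc m)))))) \<longlonglongrightarrow> indicator D z *\<^sub>R (w z * (F z / (F z + 0)))"
        by (intro tendsto_scaleR tendsto_mult tendsto_divide tendsto_add tendsto_const LIMSEQ_inverse_real_of_nat nz)
      then show ?thesis using nz by simp
    qed simp
  qed
  show "AE z in M. norm (indicator D z *\<^sub>R (w z * (F z / (F z + inverse (real (Suc m)))))) \<le> norm (indicator D z *\<^sub>R w z)" for m
  proof (rule AE_I2)
    fix z
    have q: "0 \<le> F z / (F z + inverse (real (Suc m)))" using F[of z] by simp
    have q': "F z / (F z + inverse (real (Suc m))) \<le> 1" using F[of z] by (simp add: divide_le_eq_1 add_nonneg_pos)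
    have "\<bar>w z\<bar> * (F z / (F z + inverse (real (Suc m)))) \<le> \<bar>w z\<bar> * 1"
      by (rule mult_left_mono[OF q']) simp
    moreover have "\<bar>F z / (F z + inverse (real (Suc m)))\<bar> = F z / (F z + inverse (real (Suc m)))"
      by (rule abs_of_nonneg[OF q])
    ultimately have "\<bar>w z * (F z / (F z + inverse (real (Suc m))))\<bar> \<le> \<bar>w z\<bar>"
      unfolding abs_mult by simp
    then show "norm (indicator D z *\<^sub>R (w z * (F z / (F z + inverse (real (Suc m)))))) \<le> norm (indicator D z *\<^sub>R w z)"
      unfolding real_scaleR_def real_norm_def abs_mult[of "indicator D z :: real"] by (rule mult_left_mono) simp
  qed
qed

locale hermitian_bundle = gauduchon_manifold A g
  for A :: "('m::t2_space, 'n::{finite,linorder}) chart set" and g :: "('m, 'n) metric_tensor" +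
  fixes E :: "('m, 'e, 'r::finite) vector_bundle"
    and h :: "'e \<Rightarrow> 'e \<Rightarrow> complex"
    and nabla :: "('m, 'n, 'e, 'r) connection"
  assumes hbundle: "holomorphic_bundle A E"
    and bmetric: "bundle_metric A E h"
    and chern: "chern_connection A E h nabla"
begin

lemmas bundle1 = conjunct1[OF hbundle[unfolded holomorphic_bundle_def]]
lemmas bundle2 = conjunct2[OF hbundle[unfolded holomorphic_bundle_def]]
lemmas bmetric1 = conjunct1[OF bmetric[unfolded bundle_metric_def]]

lemma triv_exists: "\<exists>t\<in>triv E. x \<in> fst t"
proof -
  have "x \<in> \<Union> (fst ` triv E)" unfolding conjunct1[OF bundle2] by (rule UNIV_I)
  then show ?thesis by blast
qed

lemma fibre_scale: "e \<in> fibre E x \<Longrightarrow> bscale E c e \<in> fibre E x"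
  and fibre_add: "e \<in> fibre E x \<Longrightarrow> e' \<in> fibre E x \<Longrightarrow> badd E e e' \<in> fibre E x"
  using bundle1 by blast+

lemma triv_open: "t \<in> triv E \<Longrightarrow> open (fst t)"
  and triv_bij: "t \<in> triv E \<Longrightarrow> x \<in> fst t \<Longrightarrow> bij_betw (snd t) (fibre E x) UNIV"
  and triv_scale: "t \<in> triv E \<Longrightarrow> x \<in> fst t \<Longrightarrow> e \<in> fibre E x \<Longrightarrow> snd t (bscale E c e) = c *s snd t e"
  and triv_add: "t \<in> triv E \<Longrightarrow> x \<in> fst t \<Longrightarrow> e \<in> fibre E x \<Longrightarrow> e' \<in> fibre E x \<Longrightarrow> snd t (badd E e e') = snd t e + snd t e'"
  using conjunct1[OF conjunct2[OF bundle2]] by blast+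

lemma triv_inj: "t \<in> triv E \<Longrightarrow> x \<in> fst t \<Longrightarrow> e \<in> fibre E x \<Longrightarrow> e' \<in> fibre E x \<Longrightarrow> snd t e = snd t e' \<Longrightarrow> e = e'"
  by (rule inj_onD[OF bij_betw_imp_inj_on[OF triv_bij]])

lemma triv_surj:
  assumes "t \<in> triv E" "x \<in> fst t"
  obtains e where "e \<in> fibre E x" "snd t e = v"
proof -
  have "v \<in> snd t ` fibre E x" unfolding bij_betw_imp_surj_on[OF triv_bij[OF assms]] by (rule UNIV_I)
  then show ?thesis using that by blast
qed

text \<open>\<open>bzero\<close> is the idempotent of the fibre for addition. In a trivialization
  the equation \<open>v + v = v\<close> forces \<open>v = 0\<close>.\<close>

lemma bzero_facts:
  assumes t: "t \<in> triv E" "x \<in> fst t"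
  shows "bzero E x \<in> fibre E x" "snd t (bzero E x) = 0" "badd E (bzero E x) (bzero E x) = bzero E x"
    "e \<in> fibre E x \<Longrightarrow> snd t e = 0 \<longleftrightarrow> e = bzero E x"
proof -
  obtain e0 where e0: "e0 \<in> fibre E x" "snd t e0 = 0" by (rule triv_surj[OF t])
  have a0: "badd E e0 e0 = e0"
    by (rule triv_inj[OF t fibre_add[OF e0(1) e0(1)] e0(1)]) (simp add: triv_add[OF t e0(1) e0(1)] e0(2))
  have u: "e \<in> fibre E x \<and> badd E e e = e \<longleftrightarrow> e = e0" for e
  proof
    assume e: "e \<in> fibre E x \<and> badd E e e = e"
    then have "snd t e + snd t e = snd t e" using triv_add[OF t, of e e] by metis
    then have "snd t e = 0" by simp
    then show "e = e0" using triv_inj[OF t, of e e0] e e0 by metis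
  qed (use e0 a0 in blast)
  have bz: "bzero E x = e0" unfolding bzero_def u by (rule the_eq_trivial)
  show "bzero E x \<in> fibre E x" "snd t (bzero E x) = 0" "badd E (bzero E x) (bzero E x) = bzero E x"
    unfolding bz using e0 a0 by simp_all
  show "e \<in> fibre E x \<Longrightarrow> snd t e = 0 \<longleftrightarrow> e = bzero E x"
    unfolding bz using triv_inj[OF t, of e e0] e0 by metis
qed

lemma frame_facts:
  assumes t: "t \<in> triv E" "x \<in> fst t"
  shows "frame E t \<alpha> x \<in> fibre E x" "snd t (frame E t \<alpha> x) = axis \<alpha> 1"
proof -
  obtain e where e: "e \<in> fibre E x" "snd t e = axis \<alpha> 1" by (rule triv_surj[OF t])
  have "\<exists>!e. e \<in> fibre E x \<and> snd t e = axis \<alpha> 1"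
  proof (rule ex1I)
    show "e \<in> fibre E x \<and> snd t e = axis \<alpha> 1" using e by blast
    show "e' = e" if "e' \<in> fibre E x \<and> snd t e' = axis \<alpha> 1" for e'
      using triv_inj[OF t, of e' e] e that by metis
  qed
  from theI'[OF this] show "frame E t \<alpha> x \<in> fibre E x" "snd t (frame E t \<alpha> x) = axis \<alpha> 1"
    unfolding frame_def by blast+
qed

lemma h_add: "e \<in> fibre E x \<Longrightarrow> e' \<in> fibre E x \<Longrightarrow> e'' \<in> fibre E x \<Longrightarrow> h (badd E e e') e'' = h e e'' + h e' e''"
  and h_scale: "e \<in> fibre E x \<Longrightarrow> e' \<in> fibre E x \<Longrightarrow> h (bscale E c e) e' = c * h e e'"
  and h_swap: "e \<in> fibre E x \<Longrightarrow> e' \<in> fibre E x \<Longrightarrow> h e' e = cnj (h e e')"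
  and h_pos: "e \<in> fibre E x \<Longrightarrow> e \<noteq> bzero E x \<Longrightarrow> 0 < Re (h e e)"
  using bmetric1 by blast+

lemma h_bzero: "e \<in> fibre E x \<Longrightarrow> h (bzero E x) e = 0"
proof -
  assume e: "e \<in> fibre E x"
  obtain t where t: "t \<in> triv E" "x \<in> fst t" using triv_exists[of x] by blast
  note b = bzero_facts[OF t]
  show ?thesis using h_add[OF b(1) b(1) e] unfolding b(3) by simp
qed

text \<open>\<open>h\<close> is additive and homogeneous on vectors of one fibre only, so the
  expansion in a frame is an induction over finite sets of basis vectors, with the partial sums
  realized in the fibre by surjectivity of the trivialization.\<close>

lemma h_expand_left:
  assumes t: "t \<in> triv E" "x \<in> fst t" and \<eta>: "\<eta> \<in> fibre E x" and F: "finite F"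
  shows "\<xi> \<in> fibre E x \<Longrightarrow> snd t \<xi> = (\<Sum>\<alpha>\<in>F. c \<alpha> *s axis \<alpha> 1) \<Longrightarrow> h \<xi> \<eta> = (\<Sum>\<alpha>\<in>F. c \<alpha> * h (frame E t \<alpha> x) \<eta>)"
  using F
proof (induction F arbitrary: \<xi> rule: finite_induct)
  case empty
  then have "\<xi> = bzero E x" using bzero_facts(4)[OF t empty(1)] by simp
  then show ?case by (simp add: h_bzero[OF \<eta>])
next
  case (insert a F)
  note f = frame_facts[OF t, of a]
  obtain \<xi>' where x': "\<xi>' \<in> fibre E x" "snd t \<xi>' = (\<Sum>\<alpha>\<in>F. c \<alpha> *s axis \<alpha> 1)" by (rule triv_surj[OF t])
  let ?e = "bscale E (c a) (frame E t a x)"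
  have e: "?e \<in> fibre E x" by (rule fibre_scale[OF f(1)])
  have "\<xi> = badd E ?e \<xi>'"
  proof (rule triv_inj[OF t insert.prems(1) fibre_add[OF e x'(1)]])
    show "snd t \<xi> = snd t (badd E ?e \<xi>')"
      unfolding triv_add[OF t e x'(1)] triv_scale[OF t f(1)] f(2) x'(2) insert.prems(2)
      by (rule sum.insert[OF insert.hyps])
  qed
  then show ?case
    using h_add[OF e x'(1) \<eta>] h_scale[OF f(1) \<eta>, of "c a"] insert.IH[OF x'] insert.hyps by simp
qed

lemma h_expand:
  assumes t: "t \<in> triv E" "x \<in> fst t" and \<xi>: "\<xi> \<in> fibre E x" and \<eta>: "\<eta> \<in> fibre E x"
  shows "h \<xi> \<eta> = sform (\<lambda>\<alpha> \<beta>. h (frame E t \<alpha> x) (frame E t \<beta> x)) (\<lambda>\<alpha>. snd t \<xi> $ \<alpha>) (\<lambda>\<beta>. snd t \<eta> $ \<beta>)"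
proof -
  have L: "h e e' = (\<Sum>\<alpha>\<in>UNIV. snd t e $ \<alpha> * h (frame E t \<alpha> x) e')" if "e \<in> fibre E x" "e' \<in> fibre E x" for e e'
    by (rule h_expand_left[OF t that(2) finite that(1) basis_expansion[symmetric]])
  \<comment> \<open>Antilinearity in the second argument comes from linearity in the first by
    conjugate symmetry.\<close>
  have R: "h (frame E t \<alpha> x) \<eta> = (\<Sum>\<beta>\<in>UNIV. cnj (snd t \<eta> $ \<beta>) * h (frame E t \<alpha> x) (frame E t \<beta> x))" for \<alpha>
    unfolding h_swap[OF \<eta> frame_facts(1)[OF t, of \<alpha>]] L[OF \<eta> frame_facts(1)[OF t, of \<alpha>]] cnj_sum complex_cnj_mult
    by (rule sum.cong[OF refl]) (simp only: h_swap[OF frame_facts(1)[OF t] frame_facts(1)[OF t, of \<alpha>], symmetric])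
  show ?thesis unfolding L[OF \<xi> \<eta>] R sform_def sum_distrib_left by (intro sum.cong refl) (simp only: mult_ac)
qed

lemma frame_pos_def:
  assumes t: "t \<in> triv E" "x \<in> fst t"
  shows "pos_def (\<lambda>\<alpha> \<beta>. h (frame E t \<alpha> x) (frame E t \<beta> x))"
  unfolding pos_def_def
proof (intro conjI allI impI)
  show "hermitian (\<lambda>\<alpha> \<beta>. h (frame E t \<alpha> x) (frame E t \<beta> x))"
    by (rule hermitianI) (rule h_swap[OF frame_facts(1)[OF t] frame_facts(1)[OF t], symmetric])
  fix v :: "'r \<Rightarrow> complex" assume v: "v \<noteq> (\<lambda>i. 0)"
  obtain e where e: "e \<in> fibre E x" "snd t e = (\<chi> i. v i)" by (rule triv_surj[OF t])
  have c: "(\<lambda>\<alpha>. snd t e $ \<alpha>) = v" unfolding e(2) by simp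
  have "e \<noteq> bzero E x"
  proof
    assume "e = bzero E x"
    then have "snd t e = 0" using bzero_facts(2)[OF t] by simp
    then have "v = (\<lambda>i. 0)" unfolding c[symmetric] by (auto simp: fun_eq_iff)
    with v show False by blast
  qed
  from h_pos[OF e(1) this] show "0 < Re (sform (\<lambda>\<alpha> \<beta>. h (frame E t \<alpha> x) (frame E t \<beta> x)) v v)"
    unfolding h_expand[OF t e(1) e(1)] c .
qed

lemma common_open: "c \<in> A \<Longrightarrow> t \<in> triv E \<Longrightarrow> open (common_domain c t)"
  unfolding common_domain_def by (rule chart_open_image[OF _ open_Int[OF chart_facts(1) triv_open] Int_lower1])

lemma common_mem:
  assumes "c \<in> A"
  shows "z \<in> common_domain c t \<longleftrightarrow> z \<in> snd c ` fst c \<and> chart_inv c z \<in> fst c \<inter> fst t"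
  unfolding common_domain_def by (rule chart_image_mem[OF assms Int_lower1])

lemma common_memD:
  assumes "c \<in> A" "z \<in> common_domain c t"
  shows "z \<in> snd c ` fst c" "chart_inv c z \<in> fst c" "chart_inv c z \<in> fst t"
  using common_mem[OF assms(1), of z t] assms(2) by blast+

lemma h_Ck: "c \<in> A \<Longrightarrow> t \<in> triv E \<Longrightarrow> Ck_on k (common_domain c t) (h_coeff E h c t \<alpha> \<beta>)"
  using conjunct2[OF bmetric[unfolded bundle_metric_def]] unfolding smooth_on_def by blast

definition conn :: "('m, 'n) chart \<Rightarrow> 'm set \<times> ('e \<Rightarrow> (complex, 'r) vec) \<Rightarrow> 'n \<Rightarrow> 'r \<Rightarrow> 'r \<Rightarrow> (complex, 'n) vec \<Rightarrow> complex" where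
  "conn c t i \<alpha> \<gamma> z = nabla c t \<alpha> \<gamma> z {Inl i}"

lemma conn_Ck: "c \<in> A \<Longrightarrow> t \<in> triv E \<Longrightarrow> Ck_on k (common_domain c t) (conn c t i \<alpha> \<gamma>)"
  using chern unfolding chern_connection_def smooth_on_def conn_def[abs_def] by blast

lemma chern_deg: "c \<in> A \<Longrightarrow> t \<in> triv E \<Longrightarrow> z \<in> common_domain c t \<Longrightarrow> card S \<noteq> 1 \<Longrightarrow> nabla c t \<alpha> \<beta> z S = 0"
  and chern_bar: "c \<in> A \<Longrightarrow> t \<in> triv E \<Longrightarrow> z \<in> common_domain c t \<Longrightarrow> nabla c t \<alpha> \<beta> z {Inr j} = 0"
  and chern_d: "c \<in> A \<Longrightarrow> t \<in> triv E \<Longrightarrow> z \<in> common_domain c t \<Longrightarrow>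
      ext_d (zero_form (h_coeff E h c t \<alpha> \<beta>)) z S =
              (\<Sum>\<gamma>\<in>UNIV. nabla c t \<alpha> \<gamma> z S * h_coeff E h c t \<gamma> \<beta> z)
              + (\<Sum>\<gamma>\<in>UNIV. conj_1form (nabla c t \<beta> \<gamma>) z S * h_coeff E h c t \<alpha> \<gamma> z)"
  using chern unfolding chern_connection_def by blast+

text \<open>The compatibility identity is compared on \<open>dz^i\<close> and on
  \<open>dzbar^j\<close>. The connection forms have no (0,1)-part and their conjugates no
  (1,0)-part, so one of the two sums survives in each case.\<close>

lemma dz_h: "c \<in> A \<Longrightarrow> t \<in> triv E \<Longrightarrow> z \<in> common_domain c t \<Longrightarrow>
    dz i (h_coeff E h c t \<alpha> \<beta>) z = (\<Sum>\<gamma>\<in>UNIV. conn c t i \<alpha> \<gamma> z * h_coeff E h c t \<gamma> \<beta> z)"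
  and dzbar_h: "c \<in> A \<Longrightarrow> t \<in> triv E \<Longrightarrow> z \<in> common_domain c t \<Longrightarrow>
    dzbar j (h_coeff E h c t \<alpha> \<beta>) z = (\<Sum>\<gamma>\<in>UNIV. cnj (conn c t j \<beta> \<gamma> z) * h_coeff E h c t \<alpha> \<gamma> z)"
proof -
  assume a: "c \<in> A" "t \<in> triv E" "z \<in> common_domain c t"
  have j: "conj_1form (nabla c t \<beta> \<gamma>) z {Inl i} = 0" "conj_1form (nabla c t \<beta> \<gamma>) z {Inr j} = cnj (conn c t j \<beta> \<gamma> z)" for \<gamma>
    by (simp_all add: conj_1form_def conn_def chern_bar[OF a])
  show "dz i (h_coeff E h c t \<alpha> \<beta>) z = (\<Sum>\<gamma>\<in>UNIV. conn c t i \<alpha> \<gamma> z * h_coeff E h c t \<gamma> \<beta> z)"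
    using chern_d[OF a, of \<alpha> \<beta> "{Inl i}"] by (simp only: ext_d_zero_form j conn_def mult_zero_left sum.neutral_const add_0_right)
  show "dzbar j (h_coeff E h c t \<alpha> \<beta>) z = (\<Sum>\<gamma>\<in>UNIV. cnj (conn c t j \<beta> \<gamma> z) * h_coeff E h c t \<alpha> \<gamma> z)"
    using chern_d[OF a, of \<alpha> \<beta> "{Inr j}"] by (simp only: ext_d_zero_form j chern_bar[OF a] mult_zero_left sum.neutral_const add_0)
qed

lemma h_coeff_pos_def: "c \<in> A \<Longrightarrow> t \<in> triv E \<Longrightarrow> z \<in> common_domain c t \<Longrightarrow> pos_def (\<lambda>\<alpha> \<beta>. h_coeff E h c t \<alpha> \<beta> z)"
  unfolding h_coeff_def by (rule frame_pos_def[OF _ common_memD(3)])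

lemma h_coeff_hermitian:
  assumes "c \<in> A" "t \<in> triv E" "z \<in> common_domain c t"
  shows "cnj (h_coeff E h c t \<alpha> \<beta> z) = h_coeff E h c t \<beta> \<alpha> z"
  using h_coeff_pos_def[OF assms] hermitianD[of "\<lambda>\<alpha> \<beta>. h_coeff E h c t \<alpha> \<beta> z" \<alpha> \<beta>] unfolding pos_def_def by blast

lemma mean_curv_coeff_eq:
  assumes c: "c \<in> A" and t: "t \<in> triv E" and z: "z \<in> common_domain c t"
  shows "mean_curv_coeff g E h nabla c t \<alpha> \<beta> z = (\<Sum>\<gamma>\<in>UNIV. \<Sum>i\<in>UNIV. \<Sum>j\<in>UNIV.
     h_coeff E h c t \<gamma> \<beta> z * matrix_inv (g c z) $ j $ i * - dzbar j (conn c t i \<alpha> \<gamma>) z)"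
proof -
  have "curvature (nabla c t) \<alpha> \<gamma> z {Inl i, Inr j} = - dzbar j (conn c t i \<alpha> \<gamma>) z" for \<gamma> i j
    unfolding conn_def[abs_def]
    by (rule curvature_coeff[where S = "common_domain c t"]) (assumption | rule common_open c t z chern_deg chern_bar)+
  then show ?thesis unfolding mean_curv_coeff_def by (simp only:)
qed

text \<open>\<open>mean_curvature\<close> is computed in the chart and trivialization picked by
  \<open>SOME\<close>, so the bound concerns this pair, whichever it is. The maximum of the Rayleigh
  quotient is an eigenvalue, and every eigenvalue is the quotient at its eigenvector, hence at most
  the maximum.\<close>

lemma greatest_eigenvalue_bound:
  "\<exists>c t. c \<in> A \<and> t \<in> triv E \<and> x \<in> fst c \<inter> fst t \<and> (\<forall>e\<in>fibre E x.
     Re (sform (\<lambda>\<alpha> \<beta>. mean_curv_coeff g E h nabla c t \<alpha> \<beta> (snd c x)) (\<lambda>\<alpha>. snd t e $ \<alpha>) (\<lambda>\<alpha>. snd t e $ \<alpha>))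
       \<le> greatest_eigenvalue E h (mean_curvature A g E h nabla) x * Re (h e e))"
proof -
  let ?P = "\<lambda>(c, t). c \<in> A \<and> t \<in> triv E \<and> x \<in> fst c \<inter> fst t"
  obtain c t where ct: "(SOME (c, t). c \<in> A \<and> t \<in> triv E \<and> x \<in> fst c \<inter> fst t) = (c, t)"
    by (rule prod.exhaust)
  obtain c0 where c0: "c0 \<in> A" "x \<in> fst c0" using chart_exists[of x] by blast
  obtain t0 where t0: "t0 \<in> triv E" "x \<in> fst t0" using triv_exists[of x] by blast
  have "?P (c0, t0)" using c0 t0 by simp
  then have "?P (SOME p. ?P p)" by (rule someI)
  then have "?P (c, t)" unfolding ct .
  then have c: "c \<in> A" and t: "t \<in> triv E" "x \<in> fst t" and xc: "x \<in> fst c" by simp_all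
  let ?K = "mean_curvature A g E h nabla"
  let ?Kz = "\<lambda>\<alpha> \<beta>. mean_curv_coeff g E h nabla c t \<alpha> \<beta> (snd c x)"
  let ?H = "\<lambda>\<alpha> \<beta>. h (frame E t \<alpha> x) (frame E t \<beta> x)"
  have Keq: "?K \<xi> \<eta> = sform ?Kz (\<lambda>\<alpha>. snd t \<xi> $ \<alpha>) (\<lambda>\<beta>. snd t \<eta> $ \<beta>)" if "\<xi> \<in> fibre E x" for \<xi> \<eta>
  proof -
    have b: "bproj E \<xi> = x" using that by (simp add: fibre_def)
    show ?thesis unfolding mean_curvature_def Let_def sform_def b ct prod.case by (rule refl)
  qed
  have z: "snd c x \<in> common_domain c t" unfolding common_domain_def using t(2) xc by blast
  note hx = h_expand[OF t]
  have "?Kz = (\<lambda>\<alpha> \<beta>. \<Sum>\<gamma>\<in>UNIV. \<Sum>i\<in>UNIV. \<Sum>j\<in>UNIV.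
     h_coeff E h c t \<gamma> \<beta> (snd c x) * matrix_inv (g c (snd c x)) $ j $ i * - dzbar j (conn c t i \<alpha> \<gamma>) (snd c x))"
    by (intro ext mean_curv_coeff_eq[OF c t(1) z])
  moreover have C: "hermitian (\<lambda>j i. matrix_inv (g c (snd c x)) $ j $ i)"
    by (rule matrix_inv_hermitian[OF metric_pos_def[OF c common_memD(1)[OF c z]]])
  have "hermitian (\<lambda>\<alpha> \<beta>. \<Sum>\<gamma>\<in>UNIV. \<Sum>i\<in>UNIV. \<Sum>j\<in>UNIV.
     h_coeff E h c t \<gamma> \<beta> (snd c x) * matrix_inv (g c (snd c x)) $ j $ i * - dzbar j (conn c t i \<alpha> \<gamma>) (snd c x))"
    by (rule mean_curv_hermitian[where S = "common_domain c t" and a = "conn c t" and h = "h_coeff E h c t"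
          and C = "\<lambda>j i. matrix_inv (g c (snd c x)) $ j $ i"])
       (assumption | rule common_open h_Ck conn_Ck dz_h dzbar_h h_coeff_hermitian z C c t(1))+
  ultimately have Kh: "hermitian ?Kz" by (simp only:)
  obtain M \<xi> where M: "\<xi> \<noteq> (\<lambda>i. 0)" "\<And>\<eta>. sform ?Kz \<xi> \<eta> = of_real M * sform ?H \<xi> \<eta>"
      "\<And>\<eta>. Re (sform ?Kz \<eta> \<eta>) \<le> M * Re (sform ?H \<eta> \<eta>)"
    using rayleigh_max[OF frame_pos_def[OF t] Kh] by blast
  have bound: "Re (sform ?Kz (\<lambda>\<alpha>. snd t e $ \<alpha>) (\<lambda>\<alpha>. snd t e $ \<alpha>)) \<le> M * Re (h e e)" if "e \<in> fibre E x" for e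
    unfolding hx[OF that that] by (rule M(3))
  have "greatest_eigenvalue E h ?K x = M"
    unfolding greatest_eigenvalue_def
  proof (rule Greatest_equality)
    obtain e where e: "e \<in> fibre E x" "snd t e = (\<chi> i. \<xi> i)" by (rule triv_surj[OF t])
    have co: "(\<lambda>\<alpha>. snd t e $ \<alpha>) = \<xi>" unfolding e(2) by simp
    have nz: "e \<noteq> bzero E x"
    proof
      assume "e = bzero E x"
      then have "snd t e = 0" using bzero_facts(2)[OF t] by simp
      then have "\<xi> = (\<lambda>i. 0)" unfolding co[symmetric] by (auto simp: fun_eq_iff)
      with M(1) show False by blast
    qed
    have "?K e \<eta> = of_real M * h e \<eta>" if "\<eta> \<in> fibre E x" for \<eta>
      unfolding Keq[OF e(1)] hx[OF e(1) that] co by (rule M(2))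
    then show "eigenvalue_at E h ?K x M" unfolding eigenvalue_at_def using e(1) nz by blast
  next
    fix l assume "eigenvalue_at E h ?K x l"
    then obtain e where e: "e \<in> fibre E x" "e \<noteq> bzero E x" "?K e e = of_real l * h e e"
      unfolding eigenvalue_at_def by blast
    have "l * Re (h e e) = Re (?K e e)" unfolding e(3) by simp
    also have "\<dots> \<le> M * Re (h e e)" unfolding Keq[OF e(1)] by (rule bound[OF e(1)])
    finally show "l \<le> M" using h_pos[OF e(1,2)] by (rule mult_right_le_imp_le)
  qed
  then show ?thesis using c t xc bound by blast
qed

section \<open>The squared norm of a holomorphic section\<close>

definition nrm :: "('m \<Rightarrow> 'e) \<Rightarrow> 'm \<Rightarrow> real" where
  "nrm s x = Re (h (s x) (s x))"

context
  fixes s assumes s: "holomorphic_section A E s"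
begin

lemma section_mem: "s x \<in> fibre E x"
  using s unfolding holomorphic_section_def by blast

lemma section_holo: "c \<in> A \<Longrightarrow> t \<in> triv E \<Longrightarrow> holo_on (common_domain c t) (\<lambda>z. snd t (s (chart_inv c z)) $ \<alpha>)"
  using s unfolding holomorphic_section_def mfd_holo_on_def common_domain_def by blast

lemma nrm_nonneg: "0 \<le> nrm s x" and nrm_zero_iff: "nrm s x = 0 \<longleftrightarrow> s x = bzero E x"
  unfolding nrm_def using h_pos[OF section_mem, of x] h_bzero[OF section_mem, of x]
  by (cases "s x = bzero E x"; simp)+

text \<open>The defining equation of \<open>sq_norm\<close> carries the hypotheses of its context;
  they are discharged here for the coefficients in a chart and a trivialization.\<close>

lemma sq_norm_section:
  assumes c: "c \<in> A" and t: "t \<in> triv E"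
  shows "sq_norm (h_coeff E h c t) (\<lambda>\<alpha> z. snd t (s (chart_inv c z)) $ \<alpha>) z =
    sform (\<lambda>\<alpha> \<beta>. h_coeff E h c t \<alpha> \<beta> z) (\<lambda>\<alpha>. snd t (s (chart_inv c z)) $ \<alpha>) (\<lambda>\<alpha>. snd t (s (chart_inv c z)) $ \<alpha>)"
  by (rule sq_norm_def[where S = "common_domain c t" and a = "conn c t"])
     (assumption | rule common_open h_Ck conn_Ck dz_h dzbar_h h_coeff_hermitian section_holo h_coeff_pos_def c t)+

lemma nrm_local:
  assumes "c \<in> A" "t \<in> triv E" "z \<in> common_domain c t"
  shows "nrm s (chart_inv c z) = Re (sq_norm (h_coeff E h c t) (\<lambda>\<alpha> z. snd t (s (chart_inv c z)) $ \<alpha>) z)"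
  unfolding nrm_def sq_norm_section[OF assms(1,2)] h_coeff_def h_expand[OF assms(2) common_memD(3)[OF assms(1,3)] section_mem section_mem] by (rule refl)

lemma nrm_Ck:
  assumes c: "c \<in> A"
  shows "Ck_on k (snd c ` fst c) (\<lambda>z. nrm s (chart_inv c z))"
proof (rule Ck_on_local)
  fix z assume z: "z \<in> snd c ` fst c"
  obtain t where t: "t \<in> triv E" "chart_inv c z \<in> fst t" using triv_exists by blast
  let ?U = "common_domain c t"
  let ?\<sigma> = "\<lambda>\<alpha> z. snd t (s (chart_inv c z)) $ \<alpha>"
  have U: "open ?U" by (rule common_open[OF c t(1)])
  have \<sigma>: "Ck_on k ?U (?\<sigma> \<alpha>)" for \<alpha> by (rule holo_on_Ck[OF section_holo[OF c t(1)] U])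
  have "Ck_on k ?U (\<lambda>z. Re (sq_norm (h_coeff E h c t) ?\<sigma> z))"
    unfolding sq_norm_section[OF c t(1)] sform_def
    by (intro Ck_on_Re[OF U] Ck_on_sum[OF U] Ck_on_mult[OF U] h_Ck[OF c t(1)] \<sigma> Ck_on_cnj[OF U])
  moreover have "Ck_on k ?U (\<lambda>z. nrm s (chart_inv c z)) =
      Ck_on k ?U (\<lambda>z. Re (sq_norm (h_coeff E h c t) ?\<sigma> z))"
    by (rule Ck_on_cong[OF U]) (rule nrm_local[OF c t(1)])
  moreover have "z \<in> ?U" using common_mem[OF c] z t(2) chart_inv_mem[OF c z] by blast
  ultimately show "\<exists>U. open U \<and> z \<in> U \<and> Ck_on k U (\<lambda>z. nrm s (chart_inv c z))" using U by blast
qed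

lemma log_nrm_Ck:
  assumes c: "c \<in> A" and e: "0 < \<epsilon>"
  shows "Ck_on k (snd c ` fst c) (\<lambda>z. complex_of_real (ln (nrm s (chart_inv c z) + \<epsilon>)))"
proof (rule Ck_on_of_real[OF chart_facts(2)[OF c]])
  have o: "open {0::real<..}" by simp
  show "Ck_on k (snd c ` fst c) (\<lambda>z. ln (nrm s (chart_inv c z) + \<epsilon>))"
  proof (rule Ck_on_compose[OF chart_facts(2)[OF c] o Ck_on_ln])
    show "Ck_on k (snd c ` fst c) (\<lambda>z. nrm s (chart_inv c z) + \<epsilon>)"
      by (rule Ck_on_add[OF chart_facts(2)[OF c] nrm_Ck[OF c] Ck_on_const])
    show "(\<lambda>z. nrm s (chart_inv c z) + \<epsilon>) ` (snd c ` fst c) \<subseteq> {0<..}"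
      by (intro image_subsetI) (simp add: add_nonneg_pos nrm_nonneg e)
  qed
qed

lemma bochner_local:
  assumes c: "c \<in> A" and t: "t \<in> triv E" and z: "z \<in> common_domain c t" and e: "0 < \<epsilon>"
    and K: "Re (sform (\<lambda>\<alpha> \<beta>. mean_curv_coeff g E h nabla c t \<alpha> \<beta> z)
      (\<lambda>\<alpha>. snd t (s (chart_inv c z)) $ \<alpha>) (\<lambda>\<alpha>. snd t (s (chart_inv c z)) $ \<alpha>)) \<le> C * nrm s (chart_inv c z)"
  shows "- (C * nrm s (chart_inv c z) / (nrm s (chart_inv c z) + \<epsilon>)) \<le>
    Re (Lap c (\<lambda>z. of_real (ln (nrm s (chart_inv c z) + \<epsilon>))) z)"
proof -
  let ?\<sigma> = "\<lambda>\<alpha> z. snd t (s (chart_inv c z)) $ \<alpha>"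
  let ?N = "sq_norm (h_coeff E h c t) ?\<sigma>"
  note N = nrm_local[OF c t]
  have K': "Re (sform (\<lambda>\<alpha> \<beta>. \<Sum>\<gamma>\<in>UNIV. \<Sum>i\<in>UNIV. \<Sum>j\<in>UNIV. h_coeff E h c t \<gamma> \<beta> z * matrix_inv (g c z) $ j $ i * - dzbar j (conn c t i \<alpha> \<gamma>) z)
        (\<lambda>\<alpha>. ?\<sigma> \<alpha> z) (\<lambda>\<alpha>. ?\<sigma> \<alpha> z)) \<le> C * Re (?N z)"
    using K unfolding mean_curv_coeff_eq[OF c t z] N[OF z] .
  have G: "pos_def (\<lambda>i j. g c z $ i $ j)" by (rule metric_pos_def[OF c common_memD(1)[OF c z]])
  have B: "- (C * Re (?N z) / (Re (?N z) + \<epsilon>)) \<le>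
     Re (\<Sum>i\<in>UNIV. \<Sum>j\<in>UNIV. matrix_inv (g c z) $ j $ i * dzbar j (dz i (\<lambda>z. of_real (ln (Re (?N z) + \<epsilon>)))) z)"
    by (rule bochner_log[where S = "common_domain c t" and a = "conn c t" and h = "h_coeff E h c t" and \<sigma> = ?\<sigma>])
       (assumption | rule common_open h_Ck conn_Ck dz_h dzbar_h h_coeff_hermitian section_holo h_coeff_pos_def e z G K' c t)+
  have "Lap c (\<lambda>z. of_real (ln (nrm s (chart_inv c z) + \<epsilon>))) z = Lap c (\<lambda>z. of_real (ln (Re (?N z) + \<epsilon>))) z"
    by (rule Lap_cong[OF common_open[OF c t] z]) (simp only: N)
  then show ?thesis using B unfolding N[OF z] Lap_def by (simp only:)
qed

text \<open>The Bochner bound is available in the chart supplied by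
  \<open>greatest_eigenvalue_bound\<close>. Invariance of \<open>Lap\<close> carries it to every
  chart.\<close>

lemma Lap_log_nrm_ge:
  assumes c: "c \<in> A" and z: "z \<in> snd c ` fst c" and e: "0 < \<epsilon>"
  defines "\<gamma> \<equiv> greatest_eigenvalue E h (mean_curvature A g E h nabla)"
  shows "- (\<gamma> (chart_inv c z) * nrm s (chart_inv c z) / (nrm s (chart_inv c z) + \<epsilon>)) \<le>
    Re (Lap c (\<lambda>z. of_real (ln (nrm s (chart_inv c z) + \<epsilon>))) z)"
proof -
  define x where "x = chart_inv c z"
  obtain c' t where c': "c' \<in> A" and t: "t \<in> triv E" and x: "x \<in> fst c' \<inter> fst t" and b: "\<forall>e\<in>fibre E x.
     Re (sform (\<lambda>\<alpha> \<beta>. mean_curv_coeff g E h nabla c' t \<alpha> \<beta> (snd c' x)) (\<lambda>\<alpha>. snd t e $ \<alpha>) (\<lambda>\<alpha>. snd t e $ \<alpha>))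
       \<le> \<gamma> x * Re (h e e)"
    using greatest_eigenvalue_bound[of x] unfolding \<gamma>_def by blast
  have ix: "chart_inv c' (snd c' x) = x" by (rule chart_inv_snd[OF c' IntD1[OF x]])
  have z': "snd c' x \<in> common_domain c' t" unfolding common_domain_def by (rule imageI[OF x])
  have "- (\<gamma> x * nrm s x / (nrm s x + \<epsilon>)) \<le> Re (Lap c' (\<lambda>z. of_real (ln (nrm s (chart_inv c' z) + \<epsilon>))) (snd c' x))"
    using bochner_local[OF c' t z' e, of "\<gamma> x"] bspec[OF b section_mem] unfolding ix nrm_def by blast
  also have "Lap c' (\<lambda>z. of_real (ln (nrm s (chart_inv c' z) + \<epsilon>))) (snd c' x) =
     Lap c (\<lambda>z. of_real (ln (nrm s (chart_inv c z) + \<epsilon>))) (snd c x)"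
  proof (rule Lap_invariant[where v = "\<lambda>x. of_real (ln (nrm s x + \<epsilon>))", OF c' c _ log_nrm_Ck[OF c e]])
    show "x \<in> fst c' \<inter> fst c" using x chart_inv_mem[OF c z] unfolding x_def by blast
  qed
  finally show ?thesis unfolding x_def snd_chart_inv[OF c z] .
qed

end

end

context gauduchon_manifold
begin

text \<open>Vanishing together with \<open>\<rho> c\<close> confines the integrand to a compact part
  of the chart.\<close>

lemma integrable_cutoff:
  fixes f :: "(complex, 'n) vec \<Rightarrow> 'b::{banach, second_countable_topology}"
  assumes part: "partition_of_unity A I \<rho>" and c: "c \<in> I" and f: "continuous_on (snd c ` fst c) f"
    and f0: "\<And>z. \<rho> c (chart_inv c z) = 0 \<Longrightarrow> f z = 0"
  shows "set_integrable lborel (snd c ` fst c) f"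
proof -
  have cA: "c \<in> A" using part_facts(2)[OF part] c by blast
  obtain K where K: "K \<subseteq> fst c" "compact K" "\<And>x. x \<notin> K \<Longrightarrow> \<rho> c x = 0"
    using part_support[OF part] c by metis
  show ?thesis
  proof (rule set_integrable_supported[OF f chart_compact_image[OF cA K(2,1)] image_mono[OF K(1)]])
    fix z assume z: "z \<in> snd c ` fst c" "z \<notin> snd c ` K"
    then have "chart_inv c z \<notin> K" using snd_chart_inv[OF cA z(1)] by (metis imageI)
    then show "f z = 0" by (intro f0 K(3))
  qed
qed

end

section \<open>The zero set of the section and the limit of the estimates\<close>

context hermitian_bundle
begin

context
  fixes s assumes s: "holomorphic_section A E s"
begin

lemma section_zero_iff:
  assumes "t \<in> triv E" "x \<in> fst t"
  shows "s x = bzero E x \<longleftrightarrow> (\<forall>\<alpha>. snd t (s x) $ \<alpha> = 0)"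
  using bzero_facts(4)[OF assms section_mem[OF s]] unfolding vec_eq_iff[of "snd t (s x)"] zero_index by blast

text \<open>Balls are used because the results on zeros of holomorphic functions are stated for
  convex domains.\<close>

lemma chart_ball:
  assumes c: "c \<in> A" and z: "z \<in> snd c ` fst c"
  obtains t r where "t \<in> triv E" "0 < r" "ball z r \<subseteq> common_domain c t" "ball z r \<subseteq> snd c ` fst c"
    "open (chart_inv c ` ball z r)" "\<forall>\<alpha>. holo_on (ball z r) (\<lambda>z. snd t (s (chart_inv c z)) $ \<alpha>)"
proof -
  obtain t where t: "t \<in> triv E" "chart_inv c z \<in> fst t" using triv_exists by blast
  have "z \<in> common_domain c t" using common_mem[OF c] z t(2) chart_inv_mem[OF c z] by blast
  then obtain r where r: "0 < r" "ball z r \<subseteq> common_domain c t"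
    using common_open[OF c t(1)] unfolding open_contains_ball by blast
  have sub: "ball z r \<subseteq> snd c ` fst c" using r(2) common_memD(1)[OF c] by blast
  have "\<forall>\<alpha>. holo_on (ball z r) (\<lambda>z. snd t (s (chart_inv c z)) $ \<alpha>)"
    using section_holo[OF s c t(1)] r(2) unfolding holo_on_def by blast
  then show ?thesis by (rule that[OF t(1) r sub chart_open_preimage[OF c open_ball sub]])
qed

context
  fixes x0 assumes conn: "connected (UNIV :: 'm set)" and nz: "s x0 \<noteq> bzero E x0"
begin

text \<open>Connectedness enters here. The interior of the zero set is also closed: around a limit
  point, the components of the section vanish on a nonempty open part of a ball, hence on the whole
  ball. By \<open>nz\<close> it is not the whole manifold.\<close>

lemma interior_zero_set: "interior {x. s x = bzero E x} = {}"
proof -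
  let ?Z = "{x. s x = bzero E x}"
  have "closure (interior ?Z) \<subseteq> interior ?Z"
  proof
    fix x assume x: "x \<in> closure (interior ?Z)"
    obtain c where c: "c \<in> A" "x \<in> fst c" using chart_exists[of x] by blast
    let ?z = "snd c x"
    obtain t r where t: "t \<in> triv E" and r: "0 < r" "ball ?z r \<subseteq> common_domain c t"
        and sub: "ball ?z r \<subseteq> snd c ` fst c" and V: "open (chart_inv c ` ball ?z r)"
        and holo: "\<forall>\<alpha>. holo_on (ball ?z r) (\<lambda>z. snd t (s (chart_inv c z)) $ \<alpha>)"
      by (rule chart_ball[OF c(1) imageI[OF c(2)]])
    let ?V = "chart_inv c ` ball ?z r"
    have xV: "x \<in> ?V" using chart_inv_snd[OF c] r(1) by (metis centre_in_ball imageI)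
    have "?V \<inter> closure (interior ?Z) \<noteq> {}" using x xV by blast
    then have "?V \<inter> interior ?Z \<noteq> {}" unfolding open_Int_closure_eq_empty[OF V] .
    then obtain w0 where w0: "w0 \<in> ball ?z r" "chart_inv c w0 \<in> interior ?Z" by blast
    let ?W = "ball ?z r \<inter> snd c ` (fst c \<inter> interior ?Z)"
    have W: "open ?W"
      by (rule open_Int[OF open_ball chart_open_image[OF c(1) open_Int[OF chart_facts(1)[OF c(1)] open_interior] Int_lower1]])
    have m: "w \<in> snd c ` (fst c \<inter> interior ?Z) \<longleftrightarrow> w \<in> snd c ` fst c \<and> chart_inv c w \<in> fst c \<inter> interior ?Z" for w
      by (rule chart_image_mem[OF c(1) Int_lower1])
    have w0O: "w0 \<in> snd c ` fst c" using w0(1) sub by blast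
    have "w0 \<in> ?W" unfolding Int_iff m using w0 w0O chart_inv_mem[OF c(1) w0O] by blast
    then have Wne: "?W \<noteq> {}" by blast
    have ft: "chart_inv c w \<in> fst t" if "w \<in> ball ?z r" for w
      by (rule common_memD(3)[OF c(1) subsetD[OF r(2) that]])
    have W0: "snd t (s (chart_inv c w)) $ \<alpha> = 0" if "w \<in> ?W" for w \<alpha>
    proof -
      have "w \<in> ball ?z r" "chart_inv c w \<in> interior ?Z" using that unfolding Int_iff m by blast+
      then have "s (chart_inv c w) = bzero E (chart_inv c w)" using interior_subset[of ?Z] by blast
      then show ?thesis using section_zero_iff[OF t ft[OF \<open>w \<in> ball ?z r\<close>]] by blast
    qed
    have "snd t (s (chart_inv c w)) $ \<alpha> = 0" if "w \<in> ball ?z r" for w \<alpha>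
      by (rule holo_zero_on_open_imp_zero[OF open_ball convex_ball spec[OF holo] W Wne Int_lower1 W0 that])
    then have "s y = bzero E y" if "y \<in> ?V" for y
      using that section_zero_iff[OF t ft] by blast
    then have "?V \<subseteq> ?Z" by blast
    then show "x \<in> interior ?Z" by (rule interiorI[OF V xV])
  qed
  then have "closed (interior ?Z)" unfolding closure_subset_eq .
  then have "closedin (top_of_set UNIV) (interior ?Z)" unfolding subtopology_UNIV closed_closedin[symmetric] .
  moreover have "openin (top_of_set UNIV) (interior ?Z)"
    unfolding subtopology_UNIV open_openin[symmetric] by (rule open_interior)
  ultimately have "interior ?Z = {} \<or> interior ?Z = UNIV" using conn unfolding connected_clopen by blast
  moreover have "interior ?Z \<noteq> UNIV" using nz interior_subset[of ?Z] by blast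
  ultimately show ?thesis by blast
qed

text \<open>On every coordinate ball some component of the section is nonzero somewhere, by
  \<open>interior_zero_set\<close>, and the zeros of this component are a null set. By Lindelof's
  theorem countably many such open sets suffice.\<close>

lemma zero_set_null:
  assumes c: "c \<in> A"
  shows "AE z in lborel. z \<in> snd c ` fst c \<longrightarrow> nrm s (chart_inv c z) \<noteq> 0"
proof -
  let ?O = "snd c ` fst c" and ?P = "\<lambda>z. s (chart_inv c z) = bzero E (chart_inv c z)"
  have loc: "\<exists>U. open U \<and> z \<in> U \<and> (\<exists>N\<in>null_sets lborel. {w \<in> U. ?P w} \<subseteq> N)" if z: "z \<in> ?O" for z
  proof -
    obtain t r where t: "t \<in> triv E" and r: "0 < r" "ball z r \<subseteq> common_domain c t"
        and sub: "ball z r \<subseteq> ?O" and V: "open (chart_inv c ` ball z r)"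
        and holo: "\<forall>\<alpha>. holo_on (ball z r) (\<lambda>z. snd t (s (chart_inv c z)) $ \<alpha>)"
      by (rule chart_ball[OF c z])
    have zb: "z \<in> ball z r" using r(1) by simp
    have ft: "chart_inv c w \<in> fst t" if "w \<in> ball z r" for w
      by (rule common_memD(3)[OF c subsetD[OF r(2) that]])
    have "\<not> (chart_inv c ` ball z r \<subseteq> {x. s x = bzero E x})"
    proof
      assume "chart_inv c ` ball z r \<subseteq> {x. s x = bzero E x}"
      from interiorI[OF V imageI[OF zb] this] show False unfolding interior_zero_set by blast
    qed
    then obtain q where q: "q \<in> ball z r" "\<not> ?P q" by blast
    then obtain \<alpha> where \<alpha>: "snd t (s (chart_inv c q)) $ \<alpha> \<noteq> 0" using section_zero_iff[OF t ft[OF q(1)]] by blast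
    let ?N = "{w \<in> ball z r. snd t (s (chart_inv c w)) $ \<alpha> = 0}"
    have "?N \<in> null_sets lborel" by (rule holo_zeros_null[OF open_ball convex_ball spec[OF holo] q(1) \<alpha>])
    moreover have "{w \<in> ball z r. ?P w} \<subseteq> ?N" using section_zero_iff[OF t ft] by blast
    ultimately show ?thesis using zb open_ball by blast
  qed
  let ?\<F> = "{U. open U \<and> (\<exists>N\<in>null_sets lborel. {w \<in> U. ?P w} \<subseteq> N)}"
  obtain \<F>' where F: "\<F>' \<subseteq> ?\<F>" "countable \<F>'" "\<Union>\<F>' = \<Union>?\<F>" by (rule Lindelof[of ?\<F>]) blast
  have "\<forall>U\<in>\<F>'. \<exists>N. N \<in> null_sets lborel \<and> {w \<in> U. ?P w} \<subseteq> N" using F(1) by blast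
  from bchoice[OF this] obtain N where N: "\<forall>U\<in>\<F>'. N U \<in> null_sets lborel \<and> {w \<in> U. ?P w} \<subseteq> N U" by blast
  have "(\<Union>U\<in>\<F>'. N U) \<in> null_sets lborel" by (rule null_sets_UN'[OF F(2)]) (use N in blast)
  then show ?thesis
  proof (rule AE_I')
    show "{z \<in> space lborel. \<not> (z \<in> ?O \<longrightarrow> nrm s (chart_inv c z) \<noteq> 0)} \<subseteq> (\<Union>U\<in>\<F>'. N U)"
    proof
      fix z assume "z \<in> {z \<in> space lborel. \<not> (z \<in> ?O \<longrightarrow> nrm s (chart_inv c z) \<noteq> 0)}"
      then have z: "z \<in> ?O" "?P z" using nrm_zero_iff[OF s, of "chart_inv c z"] by auto
      have "z \<in> \<Union>?\<F>" using loc[OF z(1)] by blast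
      then obtain U where "U \<in> \<F>'" "z \<in> U" unfolding F(3)[symmetric] by blast
      then show "z \<in> (\<Union>U\<in>\<F>'. N U)" using N z(2) by blast
    qed
  qed
qed

text \<open>For fixed \<open>m\<close>, integrating the lower bound on the Laplacian of
  \<open>ln (f + 1 / (m + 1))\<close> and using that its total integral is zero gives nonnegativity
  with a damping factor, which disappears as \<open>m \<rightarrow> \<infinity>\<close>.\<close>

lemma integral_greatest_eigenvalue_nonneg:
  assumes part: "partition_of_unity A I \<rho>" and \<gamma>s: "mfd_smooth A \<gamma>"
    and \<gamma>: "\<gamma> = greatest_eigenvalue E h (mean_curvature A g E h nabla)"
  shows "0 \<le> (\<Sum>c\<in>I. LINT z:snd c ` fst c|lborel. \<rho> c (chart_inv c z) * \<gamma> (chart_inv c z) * Re (det (g c z)))"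
proof -
  let ?O = "\<lambda>c. snd c ` fst c"
  let ?w = "\<lambda>c z. \<rho> c (chart_inv c z) * \<gamma> (chart_inv c z) * Re (det (g c z))"
  let ?F = "\<lambda>c z. nrm s (chart_inv c z)"
  let ?e = "\<lambda>m. inverse (real (Suc m))"
  let ?q = "\<lambda>m c z. ?F c z / (?F c z + ?e m)"
  have IA: "c \<in> A" if "c \<in> I" for c using part_facts(2)[OF part] that by blast
  have e: "0 < ?e m" for m by simp
  have c\<rho>: "continuous_on (?O c) (\<lambda>z. \<rho> c (chart_inv c z))" if "c \<in> I" for c
    by (rule Ck_on_continuous[OF mfd_smoothD[OF part_facts(3)[OF part that] IA[OF that], of 0]])
  have cw: "continuous_on (?O c) (?w c)" if "c \<in> I" for c
    by (rule continuous_on_mult[OF continuous_on_mult[OF c\<rho>[OF that] Ck_on_continuous[OF mfd_smoothD[OF \<gamma>s IA[OF that], of 0]]]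
          continuous_on_Re[OF metric_det_continuous[OF IA[OF that]]]])
  have cF: "continuous_on (?O c) (?F c)" if "c \<in> I" for c
    by (rule Ck_on_continuous[OF nrm_Ck[OF s IA[OF that], of 0]])
  have pos: "0 < nrm s x + ?e m" for x m by (rule add_nonneg_pos[OF nrm_nonneg[OF s] e])
  have cq: "continuous_on (?O c) (?q m c)" if "c \<in> I" for c m
    by (rule continuous_on_divide[OF cF[OF that] continuous_on_add[OF cF[OF that] continuous_on_const]])
       (use pos less_irrefl in metis)
  have wi: "set_integrable lborel (?O c) (?w c)" if "c \<in> I" for c
    by (rule integrable_cutoff[OF part that cw[OF that]]) simp
  have wqi: "set_integrable lborel (?O c) (\<lambda>z. ?w c z * ?q m c z)" if "c \<in> I" for c m
    by (rule integrable_cutoff[OF part that continuous_on_mult[OF cw[OF that] cq[OF that]]]) simp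
  have main: "0 \<le> (\<Sum>c\<in>I. LINT z:?O c|lborel. ?w c z * ?q m c z)" for m
  proof -
    let ?v = "\<lambda>x. complex_of_real (ln (nrm s x + ?e m))"
    have v: "mfd_smooth A ?v" by (rule mfd_smoothI) (rule log_nrm_Ck[OF s _ e])
    let ?X = "\<lambda>c z. Lap c (\<lambda>z. ?v (chart_inv c z)) z"
    let ?L = "\<lambda>c z. of_real (\<rho> c (chart_inv c z)) * ?X c z * det (g c z)"
    have cL: "continuous_on (?O c) (?L c)" if "c \<in> I" for c
      by (rule continuous_on_mult[OF continuous_on_mult[OF continuous_on_of_real[OF c\<rho>[OF that]]
          Lap_continuous[OF IA[OF that] mfd_smoothD[OF v IA[OF that]]]] metric_det_continuous[OF IA[OF that]]])
    have Li: "set_integrable lborel (?O c) (?L c)" if "c \<in> I" for c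
      by (rule integrable_cutoff[OF part that cL[OF that]]) simp
    have "0 = Re (\<Sum>c\<in>I. LINT z:?O c|lborel. ?L c z)" unfolding integral_Lap_zero[OF part v] by simp
    also have "\<dots> = (\<Sum>c\<in>I. LINT z:?O c|lborel. Re (?L c z))"
      unfolding Re_sum by (intro sum.cong refl set_integral_Re_Im(1) Li)
    finally have L0: "(\<Sum>c\<in>I. LINT z:?O c|lborel. Re (?L c z)) = 0" by (rule sym)
    have "- (LINT z:?O c|lborel. ?w c z * ?q m c z) \<le> (LINT z:?O c|lborel. Re (?L c z))" if c: "c \<in> I" for c
    proof -
      \<comment> \<open>\<open>det g\<close> is real, so it can be taken out of the real part; its
        positivity then allows multiplying the pointwise bound by it.\<close>
      have ReL: "Re (?L c z) = \<rho> c (chart_inv c z) * Re (?X c z) * Re (det (g c z))" if z: "z \<in> ?O c" for z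
        using arg_cong[OF metric_det(3)[OF IA[OF c] z], of "\<lambda>d. Re (of_real (\<rho> c (chart_inv c z)) * ?X c z * d)"] by simp
      have Ri: "set_integrable lborel (?O c) (\<lambda>z. Re (?L c z))"
        by (rule integrable_cutoff[OF part c continuous_on_Re[OF cL[OF c]]]) simp
      have ni: "set_integrable lborel (?O c) (\<lambda>z. - (?w c z * ?q m c z))"
        by (rule integrable_cutoff[OF part c continuous_on_minus[OF continuous_on_mult[OF cw[OF c] cq[OF c]]]]) simp
      have "- (LINT z:?O c|lborel. ?w c z * ?q m c z) = (LINT z:?O c|lborel. - (?w c z * ?q m c z))"
        unfolding set_lebesgue_integral_def scaleR_minus_right by (rule Bochner_Integration.integral_minus[symmetric])
      also have "\<dots> \<le> (LINT z:?O c|lborel. Re (?L c z))"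
      proof (rule set_integral_mono[OF ni Ri])
        fix z assume z: "z \<in> ?O c"
        let ?x = "chart_inv c z"
        have "- (?w c z * ?q m c z) = \<rho> c ?x * - (\<gamma> ?x * nrm s ?x / (nrm s ?x + ?e m)) * Re (det (g c z))"
          by simp
        also have "\<dots> \<le> \<rho> c ?x * Re (?X c z) * Re (det (g c z))"
          by (rule mult_right_mono[OF mult_left_mono[OF Lap_log_nrm_ge[OF s IA[OF c] z e, folded \<gamma>] part_facts(4)[OF part c]]
                less_imp_le[OF metric_det(2)[OF IA[OF c] z]]])
        finally show "- (?w c z * ?q m c z) \<le> Re (?L c z)" unfolding ReL[OF z] .
      qed
      finally show ?thesis .
    qed
    then have "(\<Sum>c\<in>I. - (LINT z:?O c|lborel. ?w c z * ?q m c z)) \<le> (\<Sum>c\<in>I. LINT z:?O c|lborel. Re (?L c z))"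
      by (rule sum_mono)
    then show ?thesis unfolding L0 sum_negf by simp
  qed
  have "(\<lambda>m. \<Sum>c\<in>I. LINT z:?O c|lborel. ?w c z * ?q m c z) \<longlonglongrightarrow> (\<Sum>c\<in>I. LINT z:?O c|lborel. ?w c z)"
    by (rule tendsto_sum, rule tendsto_set_integral_damped[OF wi wqi nrm_nonneg[OF s] zero_set_null[OF IA]])
  then show ?thesis by (rule LIMSEQ_le_const) (use main in blast)
qed

end

end

end

theorem theorem1p4:
  fixes A :: "('m::t2_space, 'n::{finite,linorder}) chart set"
    and g :: "('m, 'n) metric_tensor"
    and E :: "('m, 'e, 'r::finite) vector_bundle"
    and h :: "'e \<Rightarrow> 'e \<Rightarrow> complex"
    and nabla :: "('m, 'n, 'e, 'r) connection"
    and K :: "'e \<Rightarrow> 'e \<Rightarrow> complex"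
    and \<gamma> :: "'m \<Rightarrow> real"
  assumes "compact_connected_complex_manifold A"
    and "CARD('n) \<ge> 2"
    and "hermitian_metric A g"
    and "holomorphic_bundle A E"
    and "bundle_metric A E h"
    and "chern_connection A E h nabla"
    and "K = mean_curvature A g E h nabla"
    and "\<gamma> = greatest_eigenvalue E h K"
    and "gauduchon A g"
    and "mfd_smooth A \<gamma>"
    and "Re (form_integral A (volume_multiple g \<gamma>)) < 0"
  shows "\<not> (\<exists>s. holomorphic_section A E s \<and> (\<exists>x. s x \<noteq> bzero E x))"
proof
  assume "\<exists>s. holomorphic_section A E s \<and> (\<exists>x. s x \<noteq> bzero E x)"
  then obtain s x where s: "holomorphic_section A E s" "s x \<noteq> bzero E x" by blast
  have cm: "complex_atlas A" "compact (UNIV :: 'm set)" "connected (UNIV :: 'm set)"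
    using assms(1) unfolding compact_connected_complex_manifold_def by blast+
  interpret hermitian_bundle A g E h nabla
    by (unfold_locales; fact cm(1) cm(2) assms(3) assms(9) assms(4) assms(5) assms(6))
  \<comment> \<open>\<open>form_integral\<close> selects its partition of unity by
    \<open>SOME\<close>; the nonnegativity result is applied to this very partition.\<close>
  obtain I \<rho> where p: "(SOME (I, \<rho>). partition_of_unity A I \<rho>) = (I, \<rho>)" by (rule prod.exhaust)
  obtain I0 \<rho>0 where "partition_of_unity A I0 \<rho>0" using partition_of_unity_exists[OF cm(2)] by blast
  then have "(\<lambda>(I, \<rho>). partition_of_unity A I \<rho>) (I0, \<rho>0)" by simp
  then have "(\<lambda>(I, \<rho>). partition_of_unity A I \<rho>) (SOME (I, \<rho>). partition_of_unity A I \<rho>)" by (rule someI)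
  then have part: "partition_of_unity A I \<rho>" unfolding p prod.case .
  let ?w = "\<lambda>c z. \<rho> c (chart_inv c z) * \<gamma> (chart_inv c z) * Re (det (g c z))"
  \<comment> \<open>The positive constant from \<open>top_density_volume_multiple\<close> that
    relates the top power of the metric form to \<open>det g\<close> times Lebesgue measure.\<close>
  let ?C = "2 ^ CARD('n) * fact CARD('n) :: real"
  have c: "(LINT z:snd c ` fst c|lborel. complex_of_real (\<rho> c (chart_inv c z)) * top_density (volume_multiple g \<gamma> c) z) =
      of_real (?C * (LINT z:snd c ` fst c|lborel. ?w c z))" if "c \<in> I" for c
  proof -
    have cA: "c \<in> A" using part_facts(2)[OF part] that by blast
    have "(LINT z:snd c ` fst c|lborel. complex_of_real (\<rho> c (chart_inv c z)) * top_density (volume_multiple g \<gamma> c) z) =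
      (LINT z:snd c ` fst c|lborel. complex_of_real (?C * ?w c z))"
    proof (rule set_lebesgue_integral_cong)
      show "snd c ` fst c \<in> sets lborel" using chart_facts(2)[OF cA] by simp
      show "\<forall>z. z \<in> snd c ` fst c \<longrightarrow> complex_of_real (\<rho> c (chart_inv c z)) * top_density (volume_multiple g \<gamma> c) z = complex_of_real (?C * ?w c z)"
      proof (intro allI impI)
        fix z assume z: "z \<in> snd c ` fst c"
        obtain d where d: "det (g c z) = of_real d" using metric_det(3)[OF cA z] by blast
        show "complex_of_real (\<rho> c (chart_inv c z)) * top_density (volume_multiple g \<gamma> c) z = complex_of_real (?C * ?w c z)"
          unfolding top_density_volume_multiple d by simp
      qed
    qed
    also have "\<dots> = of_real (LINT z:snd c ` fst c|lborel. ?C * ?w c z)" by (rule set_integral_complex_of_real)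
    also have "\<dots> = of_real (?C * (LINT z:snd c ` fst c|lborel. ?w c z))" unfolding set_integral_mult_right ..
    finally show ?thesis .
  qed
  have "form_integral A (volume_multiple g \<gamma>) = (\<Sum>c\<in>I. of_real (?C * (LINT z:snd c ` fst c|lborel. ?w c z)))"
    unfolding form_integral_def p Let_def prod.case by (rule sum.cong[OF refl c])
  then have "Re (form_integral A (volume_multiple g \<gamma>)) = ?C * (\<Sum>c\<in>I. LINT z:snd c ` fst c|lborel. ?w c z)"
    unfolding of_real_sum[symmetric] Re_complex_of_real sum_distrib_left[symmetric] by simp
  moreover have "0 \<le> ?C * (\<Sum>c\<in>I. LINT z:snd c ` fst c|lborel. ?w c z)"
    by (rule mult_nonneg_nonneg)
       (simp, rule integral_greatest_eigenvalue_nonneg[OF s(1) cm(3) s(2) part assms(10) assms(8)[unfolded assms(7)]])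
  ultimately show False using assms(11) by simp
qed

end
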